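(* Let $f$ satisfy (F1)–(F3) and $G$ satisfy (G1)–(G2) (conditions stated in the context), and assume that $$\Big(L_1+\frac{L_6}{2}\Big)\vee\Big(L_2+\frac{L_7}{2}\Big)<\lambda_1 .$$ Then for any $\tau\in(0,1)$ (with $(L_1-\frac{\lambda_1}{\lambda_1+1})\tau<1$), the drift-implicit Euler scheme $$X_{m+1}=X_m+\tau A X_{m+1}+\tau F(X_{m+1})+G(X_m)\,\delta_m W,\qquad m\in\mathbb N,$$ possesses a unique invariant measure $\pi_\tau$ in $H$, and it is exponentially mixing: for any $m\in\mathbb N$, $x\in H$ and $\phi\in \mathrm{Lip}_b(H)$, $$|P_m\phi(x)-\pi_\tau(\phi)|\le \exp(-\gamma_6 t_m/2)\,|\phi|_{\mathrm{Lip}}\int_H\|x-y\|\,\pi_\tau(\mathrm dy),$$ where $\gamma_6:=\dfrac{2(\lambda_1-L_1)-L_6}{2(\lambda_1-L_1)+1}>0$.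
   Context: Setting. $\mathbb N=\{0,1,2,\dots\}$, $a\vee b=\max(a,b)$. Let $d\in\{1,2,3\}$ and let $\mathscr O\subset\mathbb R^d$ be a bounded open set with smooth boundary. $H=L^2(\mathscr O)$ with inner product $\langle\cdot,\cdot\rangle$ and norm $\|\cdot\|$. $A$ is the Dirichlet Laplacian on $\mathscr O$ and $\lambda_1>0$ is the first eigenvalue of $-A$. $\dot H^1$ is the Sobolev space of functions vanishing on $\partial\mathscr O$ with norm $\|x\|_1=\|(-A)^{1/2}x\|=\|\nabla x\|$, and $\dot H^{-1}$ is its dual; $A$ is also regarded as an operator $\dot H^1\to\dot H^{-1}$. Noise. $\mathbf Q$ is a self-adjoint, positive definite, trace-class operator on $H$ with orthonormal basis of eigenvectors $\{g_k\}$ and eigenvalues $\{q_k\}$; $W(t)=\sum_k\sqrt{q_k}\,g_k\beta_k(t)$ is an $H$-valued $\mathbf Q$-Wiener process on a filtered probability space $(\Omega,\mathscr F,(\mathscr F_t)_{t\ge0},\mathbb P)$, with $\beta_k$ independent one-dimensional Brownian motions. $H_0=\mathbf Q^{1/2}H$ with norm $\|\mathbf Q^{-1/2}\cdot\|$, and $\mathcal L_2^0$ is the space of Hilbert–Schmidt operators from $H_0$ to $H$. Drift. $f:\mathbb R\to\mathbb R$ is differentiable, and there are scalars $L_1,\dots,L_5\in\mathbb R$ and $q\ge1$ (with $q\in[1,3]$ if $d=3$) such that for all $\xi,\eta\in\mathbb R$: (F1) $(f(\xi)-f(\eta))(\xi-\eta)\le L_1(\xi-\eta)^2$; (F2) $f(\xi)\xi\le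 L_2|\xi|^2+L_3$; (F3) $|f'(\xi)|\le L_4|\xi|^{q-1}+L_5$. $F(x)(\xi)=f(x(\xi))$ is the associated Nemytskii operator, mapping $\dot H^1$ into $\dot H^{-1}$. Diffusion. $G:H\to\mathcal L_2^0$ is the Nemytskii operator $G(x)g_k(\xi)=g(x(\xi))g_k(\xi)$ associated with a function $g:\mathbb R\to\mathbb R$, and there are nonnegative constants $L_6,L_7,L_8$ such that for all $x,y\in H$: (G1) $\|G(x)-G(y)\|_{\mathcal L_2^0}^2\le L_6\|x-y\|^2$; (G2) $\|G(x)\|_{\mathcal L_2^0}^2\le L_7\|x\|^2+L_8$. Scheme. For $\tau\in(0,1)$ put $t_m=m\tau$ and $\delta_mW=W(t_{m+1})-W(t_m)$. The scheme starts from $X_0\in H$, with $X_{m+1}$ $\dot H^1$-valued and the equation holding in $\dot H^{-1}$; $X_m^x$ denotes its solution with $X_0=x$. Standing assumption (well-posedness of the scheme): $(L_1-\frac{\lambda_1}{\lambda_1+1})\tau<1$. Markov semigroup. $P_m\phi(x)=\mathbb E\,\phi(X_m^x)$. $\mathcal C_b(H)$ is the set of bounded continuous functions and $\mathrm{Lip}_b(H)$ the set of bounded Lipschitz functions $H\to\mathbb R$, with $|\phi|_{\mathrm{Lip}}=\sup_{x\ne y}|\phi(x)-\phi(y)|/\|x-y\|$. A Borel probability measure $\mu$ on $H$ is invariant if $\int_H P_m\phi\,\mathrm d\mu=\mu(\phi):=\int_H\phi\,\mathrm d\mu$ for all $\phi\in\mathcal C_b(H)$, $m\in\mathbb N$.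 *)

theory Defs
  imports "HOL-Probability.Probability"
begin

section \<open>The Hilbert space of square-integrable functions\<close>

definition sq_integrable :: "('a::euclidean_space \<Rightarrow> real) \<Rightarrow> bool" where
  "sq_integrable f \<longleftrightarrow> f \<in> borel_measurable lborel \<and> integrable lborel (\<lambda>x. (f x)\<^sup>2)"

definition l2_rel :: "('a::euclidean_space \<Rightarrow> real) \<Rightarrow> ('a \<Rightarrow> real) \<Rightarrow> bool" where
  "l2_rel f g \<longleftrightarrow> sq_integrable f \<and> sq_integrable g \<and> (AE x in lborel. f x = g x)"

lemma sq_integrable_mult:
  assumes "sq_integrable f" "sq_integrable g"
  shows "integrable lborel (\<lambda>x. f x * g x)"
proof (rule Bochner_Integration.integrable_bound)
  show "integrable lborel (\<lambda>x. (f x)\<^sup>2 + (g x)\<^sup>2)"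
    using assms by (auto simp: sq_integrable_def)
  show "(\<lambda>x. f x * g x) \<in> borel_measurable lborel"
    using assms by (auto simp: sq_integrable_def)
  show "AE x in lborel. norm (f x * g x) \<le> norm ((f x)\<^sup>2 + (g x)\<^sup>2)"
  proof (rule AE_I2)
    fix x
    have "0 \<le> (\<bar>f x\<bar> - \<bar>g x\<bar>)\<^sup>2" by simp
    then have "2 * (\<bar>f x\<bar> * \<bar>g x\<bar>) \<le> (f x)\<^sup>2 + (g x)\<^sup>2"
      by (simp add: power2_diff)
    moreover have "0 \<le> \<bar>f x\<bar> * \<bar>g x\<bar>" by simp
    ultimately have "\<bar>f x\<bar> * \<bar>g x\<bar> \<le> (f x)\<^sup>2 + (g x)\<^sup>2" by linarith
    then show "norm (f x * g x) \<le> norm ((f x)\<^sup>2 + (g x)\<^sup>2)"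
      by (simp add: abs_mult)
  qed
qed

lemma sq_integrable_add:
  assumes "sq_integrable f" "sq_integrable g"
  shows "sq_integrable (\<lambda>x. f x + g x)"
  using assms sq_integrable_mult[OF assms]
  by (auto simp: sq_integrable_def power2_sum mult.assoc)

lemma sq_integrable_scale:
  "sq_integrable f \<Longrightarrow> sq_integrable (\<lambda>x. c * f x)"
  by (auto simp: sq_integrable_def power_mult_distrib)

lemma sq_integrable_zero: "sq_integrable (\<lambda>_. 0)"
  by (auto simp: sq_integrable_def)

quotient_type (overloaded) 'a l2 = "'a::euclidean_space \<Rightarrow> real" / partial: l2_rel
proof (rule part_equivpI)
  show "\<exists>f::'a \<Rightarrow> real. l2_rel f f"
    by (rule exI[of _ "\<lambda>_. 0"]) (simp add: l2_rel_def sq_integrable_zero)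
  show "symp (l2_rel :: ('a \<Rightarrow> real) \<Rightarrow> _)"
    by (rule sympI) (auto simp: l2_rel_def elim: AE_mp)
  show "transp (l2_rel :: ('a \<Rightarrow> real) \<Rightarrow> _)"
    by (rule transpI) (auto simp: l2_rel_def elim!: AE_mp)
qed

instantiation l2 :: (euclidean_space) real_vector
begin

lift_definition zero_l2 :: "'a l2" is "\<lambda>_. 0"
  by (simp add: l2_rel_def sq_integrable_zero)

lift_definition plus_l2 :: "'a l2 \<Rightarrow> 'a l2 \<Rightarrow> 'a l2" is "\<lambda>f g x. f x + g x"
  by (auto simp: l2_rel_def sq_integrable_add elim!: AE_mp)

lift_definition scaleR_l2 :: "real \<Rightarrow> 'a l2 \<Rightarrow> 'a l2" is "\<lambda>c f x. c * f x"
  by (auto simp: l2_rel_def sq_integrable_scale elim!: AE_mp)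

definition uminus_l2 :: "'a l2 \<Rightarrow> 'a l2" where "uminus_l2 u = (-1) *\<^sub>R u"
definition minus_l2 :: "'a l2 \<Rightarrow> 'a l2 \<Rightarrow> 'a l2" where "minus_l2 u v = u + (- v)"

instance
proof
  fix u v w :: "'a l2" and a b :: real
  show "u + v + w = u + (v + w)"
    by transfer (auto simp: l2_rel_def sq_integrable_add add.assoc)
  show "u + v = v + u"
    by transfer (auto simp: l2_rel_def sq_integrable_add add.commute)
  show "0 + u = u"
    by transfer (auto simp: l2_rel_def)
  show "- u + u = 0"
    unfolding uminus_l2_def
    by transfer (auto simp: l2_rel_def sq_integrable_zero)
  show "u - v = u + - v"
    by (rule minus_l2_def)
  show "a *\<^sub>R (u + v) = a *\<^sub>R u + a *\<^sub>R v"
    by transfer (auto simp: l2_rel_def sq_integrable_add sq_integrable_scale distrib_left)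
  show "(a + b) *\<^sub>R u = a *\<^sub>R u + b *\<^sub>R u"
    by transfer (auto simp: l2_rel_def sq_integrable_add sq_integrable_scale distrib_right)
  show "a *\<^sub>R b *\<^sub>R u = (a * b) *\<^sub>R u"
    by transfer (auto simp: l2_rel_def sq_integrable_scale mult.assoc)
  show "1 *\<^sub>R u = u"
    by transfer (auto simp: l2_rel_def)
qed

end

instantiation l2 :: (euclidean_space) real_inner
begin

lift_definition inner_l2 :: "'a l2 \<Rightarrow> 'a l2 \<Rightarrow> real" is "\<lambda>f g. \<integral>x. f x * g x \<partial>lborel"
  by (rule integral_cong_AE) (auto simp: l2_rel_def sq_integrable_def elim!: AE_mp)

definition norm_l2 :: "'a l2 \<Rightarrow> real" where "norm_l2 u = sqrt (inner u u)"
definition dist_l2 :: "'a l2 \<Rightarrow> 'a l2 \<Rightarrow> real" where "dist_l2 u v = norm (u - v)"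
definition sgn_l2 :: "'a l2 \<Rightarrow> 'a l2" where "sgn_l2 u = u /\<^sub>R norm u"
definition uniformity_l2 :: "('a l2 \<times> 'a l2) filter" where
  "uniformity_l2 = (INF e\<in>{0<..}. principal {(u, v). dist u v < e})"
definition open_l2 :: "'a l2 set \<Rightarrow> bool" where
  "open_l2 U \<longleftrightarrow> (\<forall>u\<in>U. eventually (\<lambda>(u', v). u' = u \<longrightarrow> v \<in> U) uniformity)"

instance
proof
  fix u v w :: "'a l2" and a :: real and U :: "'a l2 set"
  show "sgn u = u /\<^sub>R norm u"
    by (rule sgn_l2_def)
  show "dist u v = norm (u - v)"
    by (rule dist_l2_def)
  show "uniformity = (INF e\<in>{0<..}. principal {(u, v :: 'a l2). dist u v < e})"
    by (rule uniformity_l2_def)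
  show "open U \<longleftrightarrow> (\<forall>u\<in>U. \<forall>\<^sub>F (u', v) in uniformity. u' = u \<longrightarrow> v \<in> U)"
    by (rule open_l2_def)
  show "inner u v = inner v u"
    by transfer (simp add: mult.commute)
  show "inner (u + v) w = inner u w + inner v w"
    by transfer (auto simp: l2_rel_def distrib_right sq_integrable_mult)
  show "inner (a *\<^sub>R u) v = a * inner u v"
    by transfer (simp add: mult.assoc)
  show "0 \<le> inner u u"
    by transfer simp
  show "inner u u = 0 \<longleftrightarrow> u = 0"
    by transfer (auto simp: l2_rel_def sq_integrable_zero sq_integrable_def power2_eq_square
        integral_nonneg_eq_0_iff_AE)
  show "norm u = sqrt (inner u u)"
    by (rule norm_l2_def)
qed

end

text \<open>
  Elements of \<^typ>\<open>'a l2\<close> are equivalence classes over the whole space; \<open>L\<^sup>2(\<O>)\<close> is identified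
  with the closed subspace of classes vanishing a.e. outside \<open>\<O>\<close> (extension by zero is an
  isometry). \<^const>\<open>rep_l2\<close> picks some representative; everything below depends on it only
  up to null sets.
\<close>

definition L2 :: "'a::euclidean_space set \<Rightarrow> 'a l2 set" where
  "L2 \<O> = {u. AE \<xi> in lborel. \<xi> \<notin> \<O> \<longrightarrow> rep_l2 u \<xi> = 0}"

abbreviation L2_borel :: "'a::euclidean_space set \<Rightarrow> 'a l2 measure" where
  "L2_borel \<O> \<equiv> restrict_space borel (L2 \<O>)"


section \<open>Smooth domains, Sobolev spaces and the Dirichlet Laplacian\<close>

fun Ck_on :: "nat \<Rightarrow> 'a::euclidean_space set \<Rightarrow> ('a \<Rightarrow> real) \<Rightarrow> bool" where
  "Ck_on 0 U f \<longleftrightarrow> continuous_on U f"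
| "Ck_on (Suc k) U f \<longleftrightarrow> (\<forall>x\<in>U. f differentiable (at x)) \<and>
     (\<forall>i\<in>Basis. Ck_on k U (\<lambda>x. frechet_derivative f (at x) i))"

definition smooth_on :: "'a::euclidean_space set \<Rightarrow> ('a \<Rightarrow> real) \<Rightarrow> bool" where
  "smooth_on U f \<longleftrightarrow> (\<forall>k. Ck_on k U f)"

text \<open>Near each boundary point, \<open>\<O>\<close> is the negativity set of a smooth function without
  critical points; so \<open>\<O>\<close> lies locally on one side of a smooth hypersurface.\<close>

definition smooth_boundary :: "'a::euclidean_space set \<Rightarrow> bool" where
  "smooth_boundary \<O> \<longleftrightarrow> (\<forall>p\<in>frontier \<O>. \<exists>U \<rho>. open U \<and> p \<in> U \<and> smooth_on U \<rho> \<and>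
     (\<forall>x\<in>U. frechet_derivative \<rho> (at x) \<noteq> (\<lambda>_. 0)) \<and> \<O> \<inter> U = {x\<in>U. \<rho> x < 0})"

definition test_function :: "'a::euclidean_space set \<Rightarrow> ('a \<Rightarrow> real) \<Rightarrow> bool" where
  "test_function \<O> \<phi> \<longleftrightarrow> smooth_on UNIV \<phi> \<and>
     compact (closure {x. \<phi> x \<noteq> 0}) \<and> closure {x. \<phi> x \<noteq> 0} \<subseteq> \<O>"

definition is_weak_partial :: "'a::euclidean_space set \<Rightarrow> 'a \<Rightarrow> 'a l2 \<Rightarrow> 'a l2 \<Rightarrow> bool" where
  "is_weak_partial \<O> i u w \<longleftrightarrow> w \<in> L2 \<O> \<and>
     (\<forall>\<phi>. test_function \<O> \<phi> \<longrightarrow>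
        inner u (abs_l2 (\<lambda>\<xi>. frechet_derivative \<phi> (at \<xi>) i)) = - inner w (abs_l2 \<phi>))"

definition weak_partial :: "'a::euclidean_space set \<Rightarrow> 'a \<Rightarrow> 'a l2 \<Rightarrow> 'a l2" where
  "weak_partial \<O> i u = (THE w. is_weak_partial \<O> i u w)"

definition H1 :: "'a::euclidean_space set \<Rightarrow> 'a l2 set" where
  "H1 \<O> = {u \<in> L2 \<O>. \<forall>i\<in>Basis. \<exists>w. is_weak_partial \<O> i u w}"

text \<open>The Sobolev functions vanishing on the boundary: the closure of the test functions
  in \<open>H\<^sup>1(\<O>)\<close>.\<close>

definition H10 :: "'a::euclidean_space set \<Rightarrow> 'a l2 set" where
  "H10 \<O> = {u \<in> H1 \<O>. \<exists>\<phi>. (\<forall>n. test_function \<O> (\<phi> n)) \<and> (\<lambda>n. abs_l2 (\<phi> n)) \<longlonglongrightarrow> u \<and>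
     (\<forall>i\<in>Basis. (\<lambda>n. abs_l2 (\<lambda>\<xi>. frechet_derivative (\<phi> n) (at \<xi>) i)) \<longlonglongrightarrow> weak_partial \<O> i u)}"

text \<open>Elements of the dual space \<open>H\<^sup>-\<^sup>1\<close> are represented as functionals on \<^const>\<open>H10\<close>; an
  element \<open>u\<close> of \<open>L\<^sup>2(\<O>)\<close> is embedded as \<^term>\<open>inner u\<close>.\<close>

definition dirichlet_laplacian :: "'a::euclidean_space set \<Rightarrow> 'a l2 \<Rightarrow> 'a l2 \<Rightarrow> real" where
  "dirichlet_laplacian \<O> u v = - (\<Sum>i\<in>Basis. inner (weak_partial \<O> i u) (weak_partial \<O> i v))"

text \<open>The functional \<open>F(u)\<close>. Under the growth condition on \<open>f\<close> below, the integrand is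
  integrable for \<open>u\<close>, \<open>v\<close> in \<^const>\<open>H10\<close> by the Sobolev embeddings.\<close>

definition nemytskii :: "'a::euclidean_space set \<Rightarrow> (real \<Rightarrow> real) \<Rightarrow> 'a l2 \<Rightarrow> 'a l2 \<Rightarrow> real" where
  "nemytskii \<O> f u v = (LINT \<xi>:\<O>|lborel. f (rep_l2 u \<xi>) * rep_l2 v \<xi>)"

definition minus_laplacian_eigenvalue :: "'a::euclidean_space set \<Rightarrow> real \<Rightarrow> bool" where
  "minus_laplacian_eigenvalue \<O> \<mu> \<longleftrightarrow>
     (\<exists>u\<in>H10 \<O>. u \<noteq> 0 \<and> (\<forall>v\<in>H10 \<O>. - dirichlet_laplacian \<O> u v = \<mu> * inner u v))"

definition first_eigenvalue :: "'a::euclidean_space set \<Rightarrow> real" where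
  "first_eigenvalue \<O> = (LEAST \<mu>. minus_laplacian_eigenvalue \<O> \<mu>)"


section \<open>Covariance operator and Hilbert-Schmidt operators\<close>

definition orthonormal_basis :: "'h::real_inner set \<Rightarrow> (nat \<Rightarrow> 'h) \<Rightarrow> bool" where
  "orthonormal_basis H e \<longleftrightarrow> range e \<subseteq> H \<and>
     (\<forall>j k. inner (e j) (e k) = (if j = k then 1 else 0)) \<and> closure (span (range e)) = H"

definition linear_between :: "'h::real_inner set \<Rightarrow> 'h set \<Rightarrow> ('h \<Rightarrow> 'h) \<Rightarrow> bool" where
  "linear_between U H T \<longleftrightarrow> T ` U \<subseteq> H \<and>
     (\<forall>u\<in>U. \<forall>v\<in>U. T (u + v) = T u + T v) \<and> (\<forall>c. \<forall>u\<in>U. T (c *\<^sub>R u) = c *\<^sub>R T u)"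

text \<open>For a positive operator the trace norm is the trace \<open>\<Sum>\<^sub>k \<langle>Q e\<^sub>k, e\<^sub>k\<rangle>\<close>, here the sum of the
  eigenvalues; so summability of the eigenvalues is the trace-class condition.\<close>

definition covariance_operator ::
  "'h::real_inner set \<Rightarrow> ('h \<Rightarrow> 'h) \<Rightarrow> (nat \<Rightarrow> 'h) \<Rightarrow> (nat \<Rightarrow> real) \<Rightarrow> bool" where
  "covariance_operator H Q e \<kappa> \<longleftrightarrow>
     linear_between H H Q \<and> (\<exists>C. \<forall>u\<in>H. norm (Q u) \<le> C * norm u) \<and>
     (\<forall>u\<in>H. \<forall>v\<in>H. inner (Q u) v = inner u (Q v)) \<and>
     (\<forall>u\<in>H. u \<noteq> 0 \<longrightarrow> inner (Q u) u > 0) \<and>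
     orthonormal_basis H e \<and> (\<forall>k. Q (e k) = \<kappa> k *\<^sub>R e k) \<and>
     summable (\<lambda>k. inner (Q (e k)) (e k))"

definition sqrt_Q :: "(nat \<Rightarrow> 'h::real_inner) \<Rightarrow> (nat \<Rightarrow> real) \<Rightarrow> 'h \<Rightarrow> 'h" where
  "sqrt_Q e \<kappa> u = (\<Sum>k. (sqrt (\<kappa> k) * inner u (e k)) *\<^sub>R e k)"

definition H0 :: "'h::real_inner set \<Rightarrow> (nat \<Rightarrow> 'h) \<Rightarrow> (nat \<Rightarrow> real) \<Rightarrow> 'h set" where
  "H0 H e \<kappa> = sqrt_Q e \<kappa> ` H"

definition H0_norm :: "'h::real_inner set \<Rightarrow> (nat \<Rightarrow> 'h) \<Rightarrow> (nat \<Rightarrow> real) \<Rightarrow> 'h \<Rightarrow> real" where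
  "H0_norm H e \<kappa> u = norm (inv_into H (sqrt_Q e \<kappa>) u)"

text \<open>Hilbert-Schmidt operators from \<open>H\<^sub>0\<close> to \<open>H\<close>; the vectors \<open>Q\<^sup>1\<^sup>/\<^sup>2 e\<^sub>k\<close> are an orthonormal
  basis of \<open>H\<^sub>0\<close>.\<close>

definition L20 ::
  "'h::real_inner set \<Rightarrow> (nat \<Rightarrow> 'h) \<Rightarrow> (nat \<Rightarrow> real) \<Rightarrow> ('h \<Rightarrow> 'h) set" where
  "L20 H e \<kappa> = {T. linear_between (H0 H e \<kappa>) H T \<and>
     (\<exists>C. \<forall>u\<in>H0 H e \<kappa>. norm (T u) \<le> C * H0_norm H e \<kappa> u) \<and>
     summable (\<lambda>k. (norm (T (sqrt_Q e \<kappa> (e k))))\<^sup>2)}"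

definition L20_norm :: "(nat \<Rightarrow> 'h::real_inner) \<Rightarrow> (nat \<Rightarrow> real) \<Rightarrow> ('h \<Rightarrow> 'h) \<Rightarrow> real" where
  "L20_norm e \<kappa> T = sqrt (\<Sum>k. (norm (T (sqrt_Q e \<kappa> (e k))))\<^sup>2)"


section \<open>Wiener processes\<close>

definition filtered_prob_space :: "'w measure \<Rightarrow> (real \<Rightarrow> 'w measure) \<Rightarrow> bool" where
  "filtered_prob_space P \<F> \<longleftrightarrow> prob_space P \<and> (\<forall>t\<ge>0. subalgebra P (\<F> t)) \<and>
     (\<forall>s t. 0 \<le> s \<and> s \<le> t \<longrightarrow> sets (\<F> s) \<subseteq> sets (\<F> t))"

definition brownian_motion :: "'w measure \<Rightarrow> (real \<Rightarrow> 'w \<Rightarrow> real) \<Rightarrow> bool" where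
  "brownian_motion P \<beta> \<longleftrightarrow> (\<forall>t\<ge>0. \<beta> t \<in> borel_measurable P) \<and>
     (AE \<omega> in P. \<beta> 0 \<omega> = 0) \<and> (AE \<omega> in P. continuous_on {0..} (\<lambda>t. \<beta> t \<omega>)) \<and>
     (\<forall>s t. 0 \<le> s \<and> s < t \<longrightarrow>
        distributed P lborel (\<lambda>\<omega>. \<beta> t \<omega> - \<beta> s \<omega>)
          (\<lambda>r. ennreal (normal_density 0 (sqrt (t - s)) r))) \<and>
     (\<forall>t n. 0 \<le> t 0 \<and> mono t \<longrightarrow>
        prob_space.indep_vars P (\<lambda>_. borel) (\<lambda>j \<omega>. \<beta> (t (Suc j)) \<omega> - \<beta> (t j) \<omega>) {..<n::nat})"

definition Q_wiener_process ::
  "'w measure \<Rightarrow> (real \<Rightarrow> 'w measure) \<Rightarrow> 'h::real_inner set \<Rightarrow> (nat \<Rightarrow> 'h) \<Rightarrow> (nat \<Rightarrow> real) \<Rightarrow>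
   (real \<Rightarrow> 'w \<Rightarrow> 'h) \<Rightarrow> bool" where
  "Q_wiener_process P \<F> H e \<kappa> W \<longleftrightarrow>
     (\<forall>t\<ge>0. W t \<in> \<F> t \<rightarrow>\<^sub>M restrict_space borel H) \<and>
     (AE \<omega> in P. continuous_on {0..} (\<lambda>t. W t \<omega>)) \<and>
     (\<forall>s t. 0 \<le> s \<and> s \<le> t \<longrightarrow>
        prob_space.indep_set P (sets (\<F> s))
          {(\<lambda>\<omega>. W t \<omega> - W s \<omega>) -` B \<inter> space P | B. B \<in> sets borel}) \<and>
     (\<exists>\<beta> :: nat \<Rightarrow> real \<Rightarrow> 'w \<Rightarrow> real. (\<forall>k. brownian_motion P (\<beta> k)) \<and>
        prob_space.indep_vars P (\<lambda>_. \<Pi>\<^sub>M t\<in>{0..}. borel) (\<lambda>k \<omega>. \<lambda>t\<in>{0..}. \<beta> k t \<omega>) UNIV \<and>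
        (\<forall>t\<ge>0. AE \<omega> in P. (\<lambda>k. (sqrt (\<kappa> k) * \<beta> k t \<omega>) *\<^sub>R e k) sums W t \<omega>))"


section \<open>The drift-implicit Euler scheme\<close>

text \<open>\<^term>\<open>applied_noise P H G e dW Y I\<close>: the random variable \<open>I\<close> is \<open>G(Y) \<delta>W\<close>. As \<open>\<delta>W\<close> takes values
  in \<open>H\<close> rather than in the domain \<open>H\<^sub>0\<close> of \<open>G(Y)\<close>, this is a (single-step) stochastic integral: the
  limit in \<open>L\<^sup>2(\<Omega>; H)\<close> of \<open>G(Y)\<close> applied to the partial sums
  \<open>\<Sum>\<^bsub>k<n\<^esub> \<langle>\<delta>W, e\<^sub>k\<rangle> e\<^sub>k = \<Sum>\<^bsub>k<n\<^esub> \<surd>\<kappa>\<^sub>k \<delta>\<beta>\<^sub>k e\<^sub>k\<close> of \<open>\<delta>W\<close>.\<close>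

definition applied_noise ::
  "'w measure \<Rightarrow> 'h::real_inner set \<Rightarrow> ('h \<Rightarrow> 'h \<Rightarrow> 'h) \<Rightarrow> (nat \<Rightarrow> 'h) \<Rightarrow>
   ('w \<Rightarrow> 'h) \<Rightarrow> ('w \<Rightarrow> 'h) \<Rightarrow> ('w \<Rightarrow> 'h) \<Rightarrow> bool" where
  "applied_noise P H G e dW Y I \<longleftrightarrow> I \<in> P \<rightarrow>\<^sub>M restrict_space borel H \<and>
     (\<lambda>n. \<integral>\<^sup>+\<omega>. ennreal ((norm (G (Y \<omega>) (\<Sum>k<n. inner (dW \<omega>) (e k) *\<^sub>R e k) - I \<omega>))\<^sup>2) \<partial>P)
       \<longlonglongrightarrow> 0"

definition euler_solution ::
  "'a::euclidean_space set \<Rightarrow> (real \<Rightarrow> real) \<Rightarrow> ('a l2 \<Rightarrow> 'a l2 \<Rightarrow> 'a l2) \<Rightarrow> (nat \<Rightarrow> 'a l2) \<Rightarrow>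
   'w measure \<Rightarrow> (real \<Rightarrow> 'w measure) \<Rightarrow> (real \<Rightarrow> 'w \<Rightarrow> 'a l2) \<Rightarrow> real \<Rightarrow>
   'a l2 \<Rightarrow> (nat \<Rightarrow> 'w \<Rightarrow> 'a l2) \<Rightarrow> bool" where
  "euler_solution \<O> f G e P \<F> W \<tau> x X \<longleftrightarrow>
     (\<forall>\<omega>\<in>space P. X 0 \<omega> = x) \<and>
     (\<forall>m. X m \<in> \<F> (real m * \<tau>) \<rightarrow>\<^sub>M L2_borel \<O>) \<and>
     (\<forall>m. \<exists>I. applied_noise P (L2 \<O>) G e
            (\<lambda>\<omega>. W (real (Suc m) * \<tau>) \<omega> - W (real m * \<tau>) \<omega>) (X m) I \<and>
        (AE \<omega> in P. X (Suc m) \<omega> \<in> H10 \<O> \<and>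
           (\<forall>v\<in>H10 \<O>. inner (X (Suc m) \<omega>) v =
              inner (X m \<omega>) v + \<tau> * dirichlet_laplacian \<O> (X (Suc m) \<omega>) v
              + \<tau> * nemytskii \<O> f (X (Suc m) \<omega>) v + inner (I \<omega>) v)))"

text \<open>The solution \<open>X\<^sup>x\<close> is determined only up to null sets, hence the choice operator; its law, and
  so the semigroup below, does not depend on the choice.\<close>

definition euler_process ::
  "'a::euclidean_space set \<Rightarrow> (real \<Rightarrow> real) \<Rightarrow> ('a l2 \<Rightarrow> 'a l2 \<Rightarrow> 'a l2) \<Rightarrow> (nat \<Rightarrow> 'a l2) \<Rightarrow>
   'w measure \<Rightarrow> (real \<Rightarrow> 'w measure) \<Rightarrow> (real \<Rightarrow> 'w \<Rightarrow> 'a l2) \<Rightarrow> real \<Rightarrow>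
   'a l2 \<Rightarrow> nat \<Rightarrow> 'w \<Rightarrow> 'a l2" where
  "euler_process \<O> f G e P \<F> W \<tau> x = (SOME X. euler_solution \<O> f G e P \<F> W \<tau> x X)"

definition euler_semigroup ::
  "'a::euclidean_space set \<Rightarrow> (real \<Rightarrow> real) \<Rightarrow> ('a l2 \<Rightarrow> 'a l2 \<Rightarrow> 'a l2) \<Rightarrow> (nat \<Rightarrow> 'a l2) \<Rightarrow>
   'w measure \<Rightarrow> (real \<Rightarrow> 'w measure) \<Rightarrow> (real \<Rightarrow> 'w \<Rightarrow> 'a l2) \<Rightarrow> real \<Rightarrow>
   nat \<Rightarrow> ('a l2 \<Rightarrow> real) \<Rightarrow> 'a l2 \<Rightarrow> real" where
  "euler_semigroup \<O> f G e P \<F> W \<tau> m \<phi> x =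
     (\<integral>\<omega>. \<phi> (euler_process \<O> f G e P \<F> W \<tau> x m \<omega>) \<partial>P)"


section \<open>Invariant measures\<close>

definition Cb :: "'h::real_normed_vector set \<Rightarrow> ('h \<Rightarrow> real) set" where
  "Cb H = {\<phi>. continuous_on H \<phi> \<and> bounded (\<phi> ` H)}"

definition Lipb :: "'h::real_normed_vector set \<Rightarrow> ('h \<Rightarrow> real) set" where
  "Lipb H = {\<phi>. (\<exists>C. C-lipschitz_on H \<phi>) \<and> bounded (\<phi> ` H)}"

definition Lip_seminorm :: "'h::real_normed_vector set \<Rightarrow> ('h \<Rightarrow> real) \<Rightarrow> real" where
  "Lip_seminorm H \<phi> =
     (SUP (x, y)\<in>{(x, y). x \<in> H \<and> y \<in> H \<and> x \<noteq> y}. \<bar>\<phi> x - \<phi> y\<bar> / norm (x - y))"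

definition invariant_measure ::
  "'h::real_normed_vector set \<Rightarrow> (nat \<Rightarrow> ('h \<Rightarrow> real) \<Rightarrow> 'h \<Rightarrow> real) \<Rightarrow> 'h measure \<Rightarrow> bool" where
  "invariant_measure H Pm \<mu> \<longleftrightarrow> prob_space \<mu> \<and> sets \<mu> = sets (restrict_space borel H) \<and>
     (\<forall>\<phi>\<in>Cb H. \<forall>m. (\<integral>x. Pm m \<phi> x \<partial>\<mu>) = (\<integral>x. \<phi> x \<partial>\<mu>))"


section \<open>Conditions on the coefficients\<close>

text \<open>The factor \<open>|\<xi>|\<^sup>q\<^sup>-\<^sup>1\<close> is \<open>1\<close> when \<open>q = 1\<close>, also at \<open>\<xi> = 0\<close>, where \<^term>\<open>0 powr (0::real)\<close> is \<open>0\<close>.\<close>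

definition drift_condition ::
  "(real \<Rightarrow> real) \<Rightarrow> real \<Rightarrow> real \<Rightarrow> real \<Rightarrow> real \<Rightarrow> real \<Rightarrow> real \<Rightarrow> bool" where
  "drift_condition f q L\<^sub>1 L\<^sub>2 L\<^sub>3 L\<^sub>4 L\<^sub>5 \<longleftrightarrow>
     (\<forall>\<xi>. f field_differentiable (at \<xi>)) \<and>
     (\<forall>\<xi> \<eta>. (f \<xi> - f \<eta>) * (\<xi> - \<eta>) \<le> L\<^sub>1 * (\<xi> - \<eta>)\<^sup>2) \<and>
     (\<forall>\<xi>. f \<xi> * \<xi> \<le> L\<^sub>2 * \<bar>\<xi>\<bar>\<^sup>2 + L\<^sub>3) \<and>
     (\<forall>\<xi>. \<bar>deriv f \<xi>\<bar> \<le> L\<^sub>4 * (if q = 1 then 1 else \<bar>\<xi>\<bar> powr (q - 1)) + L\<^sub>5)"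

definition diffusion_condition ::
  "'a::euclidean_space set \<Rightarrow> (nat \<Rightarrow> 'a l2) \<Rightarrow> (nat \<Rightarrow> real) \<Rightarrow> (real \<Rightarrow> real) \<Rightarrow>
   ('a l2 \<Rightarrow> 'a l2 \<Rightarrow> 'a l2) \<Rightarrow> real \<Rightarrow> real \<Rightarrow> real \<Rightarrow> bool" where
  "diffusion_condition \<O> e \<kappa> g G L\<^sub>6 L\<^sub>7 L\<^sub>8 \<longleftrightarrow> L\<^sub>6 \<ge> 0 \<and> L\<^sub>7 \<ge> 0 \<and> L\<^sub>8 \<ge> 0 \<and>
     (\<forall>x\<in>L2 \<O>. G x \<in> L20 (L2 \<O>) e \<kappa>) \<and>
     (\<forall>x\<in>L2 \<O>. \<forall>k. AE \<xi> in lborel. \<xi> \<in> \<O> \<longrightarrow>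
        rep_l2 (G x (e k)) \<xi> = g (rep_l2 x \<xi>) * rep_l2 (e k) \<xi>) \<and>
     (\<forall>x\<in>L2 \<O>. \<forall>y\<in>L2 \<O>. (L20_norm e \<kappa> (\<lambda>u. G x u - G y u))\<^sup>2 \<le> L\<^sub>6 * (norm (x - y))\<^sup>2) \<and>
     (\<forall>x\<in>L2 \<O>. (L20_norm e \<kappa> (G x))\<^sup>2 \<le> L\<^sub>7 * (norm x)\<^sup>2 + L\<^sub>8)"

end

(* One step of the scheme is X' = R(X + G(X) dW), where u = R(y) is the weak solution of
   u - tau (A u + F(u)) = y. Since -A >= lambda_1 and F is one-sided Lipschitz,
   (1 + 2 tau (lambda_1 - L_1)) |R y - R z|^2 <= |y - z|^2, and by Ito's isometry the noise multiplies
   the mean square distance by at most 1 + tau L_6. So the random map x |-> R(x + G(x) dW) contracts in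
   mean square by rho = (1 + tau L_6) / (1 + 2 tau (lambda_1 - L_1)) <= exp(- gamma_6 tau). Composing
   independent copies of it backwards gives an almost surely convergent sequence, whose limit has the
   invariant law; the contraction gives mixing and uniqueness.

   For u = R(y) no growth condition on f is used: f is regularised to Lipschitz functions, for which
   a shifted equation is a fixed point problem, and testing with the monotone part of the drift bounds
   it in L^2, which with the compactness of H_0^1 in L^2 lets one pass to the limit. Compactness also
   shows that lambda_1 is attained, hence Poincare's inequality with constant lambda_1. *)
theory Submission
  imports Defs "HOL-Library.Diagonal_Subsequence"
begin

section \<open>The space of square-integrable functions\<close>

text \<open>Three features of the statement shape the proof. The semigroup is built from a process
  picked by a choice operator, so a solution has to be constructed and every solution shown to agree
  with it almost surely. In the equation, \<open>nemytskii\<close> is a Bochner integral, which is 0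
  when the integrand is not integrable; integrability of f(u) v must therefore be proved for every
  solution before the equations of two solutions can be subtracted, and both uniqueness and the
  contraction rest on this. Finally, the increments of W lie in H and not in the domain of G(X), so
  G(X) \<delta>W is only a limit in mean square; to speak of a random map at all, a version of the
  noise is needed that is jointly measurable in the starting point and the increment. As this map
  contracts in mean square and not path by path, the almost sure statements about its iterates come
  from geometric second moment bounds.\<close>

lemma abs_l2_rep_l2 [simp]: "abs_l2 (rep_l2 u) = u"
  and l2_rel_rep_l2: "l2_rel (rep_l2 u) (rep_l2 u)"
  using Quotient3_l2 by (auto simp: Quotient3_def)

lemma sq_integrable_rep_l2 [simp]: "sq_integrable (rep_l2 u)"
  using l2_rel_rep_l2[of u] by (simp add: l2_rel_def)

lemma abs_l2_eq_iff:
  assumes "sq_integrable f" "sq_integrable g"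
  shows "abs_l2 f = abs_l2 g \<longleftrightarrow> (AE x in lborel. f x = g x)"
  using assms Quotient3_rel[OF Quotient3_l2, of f g] by (auto simp: l2_rel_def)

lemma rep_abs_l2:
  assumes "sq_integrable f"
  shows "AE x in lborel. rep_l2 (abs_l2 f) x = f x"
  using abs_l2_eq_iff[OF sq_integrable_rep_l2 assms, of "abs_l2 f"] by simp

lemma l2_eq_iff: "u = v \<longleftrightarrow> (AE x in lborel. rep_l2 u x = rep_l2 v x)"
  using abs_l2_eq_iff[of "rep_l2 u" "rep_l2 v"] by simp

lemma rep_l2_measurable [measurable]: "rep_l2 u \<in> borel_measurable borel"
  using sq_integrable_rep_l2[of u] by (simp add: sq_integrable_def)

lemma abs_l2_add:
  assumes "sq_integrable f" "sq_integrable g"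
  shows "abs_l2 f + abs_l2 g = abs_l2 (\<lambda>x. f x + g x)"
  by (rule plus_l2.abs_eq) (use assms in \<open>auto simp: l2_rel_def\<close>)

lemma abs_l2_scaleR:
  assumes "sq_integrable f"
  shows "c *\<^sub>R abs_l2 f = abs_l2 (\<lambda>x. c * f x)"
  by (rule scaleR_l2.abs_eq) (use assms in \<open>auto simp: l2_rel_def\<close>)

lemma inner_abs_l2:
  assumes "sq_integrable f" "sq_integrable g"
  shows "inner (abs_l2 f) (abs_l2 g) = (\<integral>x. f x * g x \<partial>lborel)"
  by (rule inner_l2.abs_eq) (use assms in \<open>auto simp: l2_rel_def\<close>)

lemma rep_l2_add: "AE x in lborel. rep_l2 (u + v) x = rep_l2 u x + rep_l2 v x"
  using rep_abs_l2[of "\<lambda>x. rep_l2 u x + rep_l2 v x"] abs_l2_add[of "rep_l2 u" "rep_l2 v"]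
  by (simp add: sq_integrable_add)

lemma rep_l2_scaleR: "AE x in lborel. rep_l2 (c *\<^sub>R u) x = c * rep_l2 u x"
  using rep_abs_l2[of "\<lambda>x. c * rep_l2 u x"] abs_l2_scaleR[of "rep_l2 u" c]
  by (simp add: sq_integrable_scale)

lemma rep_l2_diff: "AE x in lborel. rep_l2 (u - v) x = rep_l2 u x - rep_l2 v x"
  using rep_l2_add[of u "(-1) *\<^sub>R v"] rep_l2_scaleR[of "-1" v] by auto

lemma rep_l2_zero: "AE x in lborel. rep_l2 0 x = 0"
  using rep_l2_scaleR[of 0 0] by simp

lemma abs_l2_diff:
  assumes "sq_integrable f" "sq_integrable g"
  shows "abs_l2 f - abs_l2 g = abs_l2 (\<lambda>x. f x - g x)"
proof -
  have "abs_l2 f - abs_l2 g = abs_l2 f + (-1) *\<^sub>R abs_l2 g" by simp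
  also have "\<dots> = abs_l2 (\<lambda>x. f x - g x)"
    unfolding abs_l2_scaleR[OF assms(2)] abs_l2_add[OF assms(1) sq_integrable_scale[OF assms(2)]] by simp
  finally show ?thesis .
qed

lemma sq_integrable_diff:
  assumes "sq_integrable f" "sq_integrable g"
  shows "sq_integrable (\<lambda>x. f x - g x)"
  using sq_integrable_add[OF assms(1) sq_integrable_scale[OF assms(2), of "-1"]] by simp

lemma inner_l2_eq: "inner u v = (\<integral>x. rep_l2 u x * rep_l2 v x \<partial>lborel)"
  using inner_abs_l2[of "rep_l2 u" "rep_l2 v"] by simp

lemma integrable_rep_l2_mult [simp]: "integrable lborel (\<lambda>x. rep_l2 u x * rep_l2 v x)"
  by (rule sq_integrable_mult) simp_all

lemma inner_abs_l2_right:
  assumes "sq_integrable f"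
  shows "inner u (abs_l2 f) = (\<integral>x. rep_l2 u x * f x \<partial>lborel)"
  using inner_abs_l2[of "rep_l2 u" f] assms by simp

lemma norm_l2_sq: "(norm u)\<^sup>2 = (\<integral>x. (rep_l2 u x)\<^sup>2 \<partial>lborel)"
  unfolding power2_norm_eq_inner inner_l2_eq by (simp add: power2_eq_square)

lemma norm_abs_l2_sq:
  assumes "sq_integrable f"
  shows "(norm (abs_l2 f))\<^sup>2 = (\<integral>x. (f x)\<^sup>2 \<partial>lborel)"
  unfolding power2_norm_eq_inner inner_abs_l2[OF assms assms] by (simp add: power2_eq_square)

lemma nn_integral_rep_l2_sq: "(\<integral>\<^sup>+x. ennreal ((rep_l2 u x)\<^sup>2) \<partial>lborel) = ennreal ((norm u)\<^sup>2)"
  unfolding norm_l2_sq using sq_integrable_rep_l2[of u]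
  by (intro nn_integral_eq_integral) (auto simp: sq_integrable_def)

lemma sq_integrable_of_nn_integral:
  assumes "g \<in> borel_measurable borel" "(\<integral>\<^sup>+x. ennreal ((g x)\<^sup>2) \<partial>lborel) \<le> ennreal C"
  shows "sq_integrable g"
  unfolding sq_integrable_def
proof (intro conjI integrableI_bounded)
  show "(\<integral>\<^sup>+x. ennreal (norm ((g x)\<^sup>2)) \<partial>lborel) < \<infinity>"
    using assms(2) by (auto intro: le_less_trans)
qed (use assms in auto)

lemma norm_abs_l2_le:
  assumes "g \<in> borel_measurable borel" "(\<integral>\<^sup>+x. ennreal ((g x)\<^sup>2) \<partial>lborel) \<le> ennreal (C\<^sup>2)" "0 \<le> C"
  shows "norm (abs_l2 g) \<le> C"
proof -
  have g: "sq_integrable g" using sq_integrable_of_nn_integral assms by blast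
  have "ennreal ((norm (abs_l2 g))\<^sup>2) = (\<integral>\<^sup>+x. ennreal ((g x)\<^sup>2) \<partial>lborel)"
    unfolding norm_abs_l2_sq[OF g] using g
    by (intro nn_integral_eq_integral[symmetric]) (auto simp: sq_integrable_def)
  then have "ennreal ((norm (abs_l2 g))\<^sup>2) \<le> ennreal (C\<^sup>2)" using assms(2) by simp
  then have "(norm (abs_l2 g))\<^sup>2 \<le> C\<^sup>2" by (subst (asm) ennreal_le_iff) auto
  then show ?thesis using assms(3) by (rule power2_le_imp_le)
qed

lemma sq_integrable_bound:
  assumes "sq_integrable f" "g \<in> borel_measurable borel" "AE x in lborel. \<bar>g x\<bar> \<le> \<bar>f x\<bar>"
  shows "sq_integrable g"
  unfolding sq_integrable_def
proof
  show "integrable lborel (\<lambda>x. (g x)\<^sup>2)"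
  proof (rule Bochner_Integration.integrable_bound[of _ "\<lambda>x. (f x)\<^sup>2"])
    show "AE x in lborel. norm ((g x)\<^sup>2) \<le> norm ((f x)\<^sup>2)"
      using assms(3) by eventually_elim (simp add: abs_le_square_iff[symmetric])
  qed (use assms in \<open>auto simp: sq_integrable_def\<close>)
qed (use assms in simp)

lemma norm_abs_l2_mono:
  assumes "sq_integrable f" "g \<in> borel_measurable borel" "AE x in lborel. \<bar>g x\<bar> \<le> \<bar>f x\<bar>"
  shows "norm (abs_l2 g) \<le> norm (abs_l2 f)"
proof -
  have g: "sq_integrable g" by (rule sq_integrable_bound[OF assms])
  have "(norm (abs_l2 g))\<^sup>2 \<le> (norm (abs_l2 f))\<^sup>2"
    unfolding norm_abs_l2_sq[OF g] norm_abs_l2_sq[OF assms(1)]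
  proof (rule integral_mono_AE)
    show "AE x in lborel. (g x)\<^sup>2 \<le> (f x)\<^sup>2"
      using assms(3) by eventually_elim (simp add: abs_le_square_iff[symmetric])
  qed (use assms(1) g in \<open>auto simp: sq_integrable_def\<close>)
  then show ?thesis by (rule power2_le_imp_le) simp
qed

text \<open>A fast Cauchy sequence converges a.e.: the weights \<open>2\<^sup>n\<close> make \<open>\<Sum>\<^sub>n 2\<^sup>n |X\<^sub>n\<^sub>+\<^sub>1 - X\<^sub>n|\<^sup>2\<close> integrable,
  so that a.e. \<open>|X\<^sub>n\<^sub>+\<^sub>1 - X\<^sub>n|\<close> decays geometrically.\<close>

lemma l2_fast_Cauchy:
  fixes X :: "nat \<Rightarrow> 'a::euclidean_space l2"
  assumes fast: "\<And>n. norm (X (Suc n) - X n) \<le> (1/2)^n"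
  obtains u where "X \<longlonglongrightarrow> u" "AE x in lborel. (\<lambda>n. rep_l2 (X n) x) \<longlonglongrightarrow> rep_l2 u x"
proof -
  define d where "d n x = \<bar>rep_l2 (X (Suc n)) x - rep_l2 (X n) x\<bar>" for n x
  have [measurable]: "d n \<in> borel_measurable borel" for n
    unfolding d_def by measurable
  have d_int: "(\<integral>\<^sup>+x. ennreal ((d n x)\<^sup>2) \<partial>lborel) \<le> ennreal ((1/4)^n)" for n
  proof -
    have "(\<integral>\<^sup>+x. ennreal ((d n x)\<^sup>2) \<partial>lborel) = (\<integral>\<^sup>+x. ennreal ((rep_l2 (X (Suc n) - X n) x)\<^sup>2) \<partial>lborel)"
      by (rule nn_integral_cong_AE) (use rep_l2_diff[of "X (Suc n)" "X n"] in \<open>auto simp: d_def\<close>)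
    also have "\<dots> = ennreal ((norm (X (Suc n) - X n))\<^sup>2)" by (rule nn_integral_rep_l2_sq)
    also have "\<dots> \<le> ennreal ((1/4)^n)"
    proof (rule ennreal_leI)
      have "(norm (X (Suc n) - X n))\<^sup>2 \<le> ((1/2)^n)\<^sup>2" by (intro power_mono fast) simp
      also have "((1/2::real)^n)\<^sup>2 = ((1/2)\<^sup>2)^n" by (metis power_mult mult.commute)
      also have "\<dots> = (1/4)^n" by (simp add: power2_eq_square)
      finally show "(norm (X (Suc n) - X n))\<^sup>2 \<le> (1/4)^n" .
    qed
    finally show ?thesis .
  qed
  have "(\<integral>\<^sup>+x. (\<Sum>n. ennreal (2^n * (d n x)\<^sup>2)) \<partial>lborel) = (\<Sum>n. \<integral>\<^sup>+x. ennreal (2^n * (d n x)\<^sup>2) \<partial>lborel)"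
    by (rule nn_integral_suminf) measurable
  also have "\<dots> = (\<Sum>n. ennreal (2^n) * (\<integral>\<^sup>+x. ennreal ((d n x)\<^sup>2) \<partial>lborel))"
    by (simp add: ennreal_mult nn_integral_cmult)
  also have "\<dots> \<le> (\<Sum>n. ennreal ((1/2)^n))"
  proof (intro suminf_le allI)
    fix n
    have "ennreal (2^n) * (\<integral>\<^sup>+x. ennreal ((d n x)\<^sup>2) \<partial>lborel) \<le> ennreal (2^n) * ennreal ((1/4)^n)"
      by (intro mult_left_mono d_int) simp
    also have "\<dots> = ennreal (2^n * (1/4)^n)" by (rule ennreal_mult[symmetric]) auto
    also have "(2::real)^n * (1/4)^n = (2 * (1/4))^n" by (rule power_mult_distrib[symmetric])
    also have "2 * (1/4::real) = 1/2" by simp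
    finally show "ennreal (2^n) * (\<integral>\<^sup>+x. ennreal ((d n x)\<^sup>2) \<partial>lborel) \<le> ennreal ((1/2)^n)" .
  qed simp_all
  also have "\<dots> = ennreal (\<Sum>n. (1/2)^n)"
    by (rule suminf_ennreal2) (auto intro: summable_geometric)
  also have "\<dots> < \<infinity>" by simp
  finally have "AE x in lborel. (\<Sum>n. ennreal (2^n * (d n x)\<^sup>2)) \<noteq> \<infinity>"
    by (intro nn_integral_PInf_AE) auto
  then have conv: "AE x in lborel. convergent (\<lambda>n. rep_l2 (X n) x)"
  proof eventually_elim
    case (elim x)
    then have sm: "summable (\<lambda>n. 2^n * (d n x)\<^sup>2)"
      by (intro summable_suminf_not_top) auto
    have "\<forall>\<^sub>F n in sequentially. 2^n * (d n x)\<^sup>2 < 1"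
      using summable_LIMSEQ_zero[OF sm] by (rule order_tendstoD) simp
    then have "\<forall>\<^sub>F n in sequentially. norm (rep_l2 (X (Suc n)) x - rep_l2 (X n) x) \<le> (sqrt (1/2))^n"
    proof eventually_elim
      case (elim n)
      have "((sqrt (1/2::real))^n)\<^sup>2 = ((sqrt (1/2))\<^sup>2)^n"
        by (metis power_mult mult.commute)
      also have "\<dots> = 1 / 2^n" by (simp add: power_one_over)
      finally have "(d n x)\<^sup>2 \<le> ((sqrt (1/2))^n)\<^sup>2"
        using elim by (simp add: pos_le_divide_eq mult.commute)
      then have "d n x \<le> (sqrt (1/2))^n" by (rule power2_le_imp_le) simp
      then show ?case by (simp add: d_def)
    qed
    then have "summable (\<lambda>n. rep_l2 (X (Suc n)) x - rep_l2 (X n) x)"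
      by (rule summable_comparison_test_ev) (auto intro!: summable_geometric)
    then have "convergent (\<lambda>n. \<Sum>i<n. rep_l2 (X (Suc i)) x - rep_l2 (X i) x)"
      by (simp add: summable_iff_convergent)
    then have "convergent (\<lambda>n. rep_l2 (X n) x - rep_l2 (X 0) x)"
      by (simp only: sum_lessThan_telescope[of "\<lambda>n. rep_l2 (X n) x"])
    then show ?case by (simp add: convergent_diff_const_right_iff)
  qed
  define g where "g x = lim (\<lambda>n. rep_l2 (X n) x)" for x
  have [measurable]: "g \<in> borel_measurable borel" unfolding g_def by measurable
  have lim: "AE x in lborel. (\<lambda>n. rep_l2 (X n) x) \<longlonglongrightarrow> g x"
    using conv unfolding g_def by eventually_elim (simp add: convergent_LIMSEQ_iff)
  have tail: "norm (X (n + k) - X n) \<le> 2 * (1/2)^n" for n k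
  proof -
    have "X (n + k) - X n = (\<Sum>i<k. X (Suc (n + i)) - X (n + i))"
      using sum_lessThan_telescope[of "\<lambda>i. X (n + i)" k] by simp
    also have "norm \<dots> \<le> (\<Sum>i<k. (1/2)^n * (1/2)^i)"
      by (rule sum_norm_le) (use fast in \<open>simp add: power_add[symmetric]\<close>)
    also have "\<dots> = (1/2)^n * (\<Sum>i<k. (1/2)^i)" by (simp add: sum_distrib_left)
    also have "\<dots> \<le> (1/2)^n * 2"
      by (intro mult_left_mono) (simp_all add: sum_gp_strict)
    finally show ?thesis by simp
  qed
  \<comment> \<open>Fatou's lemma carries the geometric tail bound to the pointwise limit. For n = 0
    it makes g square integrable, for general n it gives the rate of convergence in norm.\<close>
  have bound: "(\<integral>\<^sup>+x. ennreal ((g x - rep_l2 (X n) x)\<^sup>2) \<partial>lborel) \<le> ennreal ((2 * (1/2)^n)\<^sup>2)" for n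
  proof -
    have "(\<integral>\<^sup>+x. ennreal ((g x - rep_l2 (X n) x)\<^sup>2) \<partial>lborel)
       = (\<integral>\<^sup>+x. liminf (\<lambda>k. ennreal ((rep_l2 (X (k + n)) x - rep_l2 (X n) x)\<^sup>2)) \<partial>lborel)"
    proof (rule nn_integral_cong_AE, use lim in eventually_elim)
      case (elim x)
      have "(\<lambda>k. ennreal ((rep_l2 (X (k + n)) x - rep_l2 (X n) x)\<^sup>2)) \<longlonglongrightarrow> ennreal ((g x - rep_l2 (X n) x)\<^sup>2)"
        using LIMSEQ_ignore_initial_segment[OF elim, of n]
        by (intro tendsto_intros tendsto_ennrealI) auto
      then show ?case by (metis lim_imp_Liminf sequentially_bot)
    qed
    also have "\<dots> \<le> liminf (\<lambda>k. \<integral>\<^sup>+x. ennreal ((rep_l2 (X (k + n)) x - rep_l2 (X n) x)\<^sup>2) \<partial>lborel)"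
      by (rule nn_integral_liminf) measurable
    also have "\<dots> \<le> ennreal ((2 * (1/2)^n)\<^sup>2)"
    proof (rule order_trans[OF Liminf_mono[of _ "\<lambda>_. ennreal ((2 * (1/2)^n)\<^sup>2)"]])
      have "(\<integral>\<^sup>+x. ennreal ((rep_l2 (X (k + n)) x - rep_l2 (X n) x)\<^sup>2) \<partial>lborel) \<le> ennreal ((2 * (1/2)^n)\<^sup>2)" for k
      proof -
        have "(\<integral>\<^sup>+x. ennreal ((rep_l2 (X (k + n)) x - rep_l2 (X n) x)\<^sup>2) \<partial>lborel)
          = (\<integral>\<^sup>+x. ennreal ((rep_l2 (X (n + k) - X n) x)\<^sup>2) \<partial>lborel)"
          by (rule nn_integral_cong_AE) (use rep_l2_diff[of "X (n + k)" "X n"] in \<open>auto simp: add.commute\<close>)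
        also have "\<dots> \<le> ennreal ((2 * (1/2)^n)\<^sup>2)"
          unfolding nn_integral_rep_l2_sq by (intro ennreal_leI power_mono tail) simp
        finally show ?thesis .
      qed
      then show "\<forall>\<^sub>F k in sequentially. (\<integral>\<^sup>+x. ennreal ((rep_l2 (X (k + n)) x - rep_l2 (X n) x)\<^sup>2) \<partial>lborel)
        \<le> ennreal ((2 * (1/2)^n)\<^sup>2)" by simp
    qed (simp add: Liminf_const)
    finally show ?thesis .
  qed
  have g: "sq_integrable g"
  proof -
    have "sq_integrable (\<lambda>x. g x - rep_l2 (X 0) x)"
      by (rule sq_integrable_of_nn_integral[OF _ bound[of 0]]) measurable
    from sq_integrable_add[OF this sq_integrable_rep_l2[of "X 0"]] show ?thesis by simp
  qed
  have "norm (abs_l2 g - X n) \<le> 2 * (1/2)^n" for n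
  proof -
    have "abs_l2 g - X n = abs_l2 (\<lambda>x. g x - rep_l2 (X n) x)"
      using abs_l2_diff[OF g, of "rep_l2 (X n)"] by simp
    moreover have "norm (abs_l2 (\<lambda>x. g x - rep_l2 (X n) x)) \<le> 2 * (1/2)^n"
      by (rule norm_abs_l2_le[OF _ bound]) auto
    ultimately show ?thesis by (simp only:)
  qed
  then have "X \<longlonglongrightarrow> abs_l2 g"
  proof -
    assume a: "\<And>n. norm (abs_l2 g - X n) \<le> 2 * (1/2)^n"
    have "(\<lambda>n. 2 * (1/2::real)^n) \<longlonglongrightarrow> 2 * 0"
      by (intro tendsto_mult tendsto_const LIMSEQ_realpow_zero) auto
    then have z: "(\<lambda>n. 2 * (1/2::real)^n) \<longlonglongrightarrow> 0" by (simp only: mult_zero_right)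
    have "norm (X n - abs_l2 g) \<le> 2 * (1/2)^n" for n
      by (subst norm_minus_commute) (rule a)
    then have "(\<lambda>n. X n - abs_l2 g) \<longlonglongrightarrow> 0"
      by (intro Lim_null_comparison[OF _ z] always_eventually allI)
    then show "X \<longlonglongrightarrow> abs_l2 g" by (simp add: LIM_zero_iff)
  qed
  moreover have "AE x in lborel. (\<lambda>n. rep_l2 (X n) x) \<longlonglongrightarrow> rep_l2 (abs_l2 g) x"
    using lim rep_abs_l2[OF g] by eventually_elim simp
  ultimately show ?thesis by (rule that)
qed

text \<open>Indices chosen so fast that consecutive terms differ by at most 2^-k make
  \<open>l2_fast_Cauchy\<close> applicable; its limit is u by uniqueness of limits.\<close>

lemma l2_tendsto_AE_subseq:
  fixes X :: "nat \<Rightarrow> 'a::euclidean_space l2"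
  assumes "X \<longlonglongrightarrow> u"
  obtains r where "strict_mono (r :: nat \<Rightarrow> nat)" "AE x in lborel. (\<lambda>n. rep_l2 (X (r n)) x) \<longlonglongrightarrow> rep_l2 u x"
proof -
  have "\<exists>N. \<forall>n\<ge>N. norm (X n - u) \<le> (1/2)^k / 2" for k
    using LIMSEQ_D[OF assms, of "(1/2)^k/2"] by (auto intro: less_imp_le)
  then obtain N where N: "\<And>k n. n \<ge> N k \<Longrightarrow> norm (X n - u) \<le> (1/2)^k / 2" by metis
  \<comment> \<open>The sum dominates \<open>N k\<close>, and the added k makes the sequence
    strictly increasing.\<close>
  define r where "r k = (\<Sum>j\<le>k. N j) + k" for k
  have r: "strict_mono r" unfolding strict_mono_Suc_iff r_def by auto
  have rN: "r k \<ge> N k" for k unfolding r_def using member_le_sum[of k "{..k}" N] by simp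
  have "norm (X (r (Suc k)) - X (r k)) \<le> (1/2)^k" for k
  proof -
    have "norm (X (r (Suc k)) - X (r k)) \<le> norm (X (r (Suc k)) - u) + norm (X (r k) - u)"
      using norm_triangle_ineq4[of "X (r (Suc k)) - u" "X (r k) - u"] by simp
    also have "\<dots> \<le> (1/2)^k / 2 + (1/2)^k / 2"
      using N[OF rN[of "Suc k"]] N[OF rN[of k]] zero_le_power[of "1/2::real" k] by (intro add_mono) (auto simp: field_simps)
    finally show ?thesis by simp
  qed
  then obtain v where v: "(\<lambda>k. X (r k)) \<longlonglongrightarrow> v" "AE x in lborel. (\<lambda>k. rep_l2 (X (r k)) x) \<longlonglongrightarrow> rep_l2 v x"
    by (rule l2_fast_Cauchy[of "\<lambda>k. X (r k)"]) auto
  have "v = u" using LIMSEQ_unique[OF v(1) LIMSEQ_subseq_LIMSEQ[OF assms r, unfolded comp_def]] .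
  then show ?thesis using that r v(2) by simp
qed

text \<open>Riesz-Fischer: a fast subsequence converges, and a Cauchy sequence with a convergent
  subsequence converges. Completeness is used for the fixed point argument and for the completeness
  of \<open>H10\<close>.\<close>

instance l2 :: (euclidean_space) banach
proof
  fix X :: "nat \<Rightarrow> 'a l2"
  assume X: "Cauchy X"
  have "\<exists>N. \<forall>m\<ge>N. \<forall>n\<ge>N. norm (X m - X n) \<le> (1/2)^k" for k
    using CauchyD[OF X, of "(1/2)^k"] by (auto intro: less_imp_le)
  then obtain N where N: "\<And>k m n. m \<ge> N k \<Longrightarrow> n \<ge> N k \<Longrightarrow> norm (X m - X n) \<le> (1/2)^k" by metis
  define r where "r k = (\<Sum>j\<le>k. N j) + k" for k
  have r: "strict_mono r" unfolding strict_mono_Suc_iff r_def by auto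
  have rN: "r k \<ge> N k" for k unfolding r_def using member_le_sum[of k "{..k}" N] by simp
  have "norm (X (r (Suc k)) - X (r k)) \<le> (1/2)^k" for k
    using rN[of k] strict_monoD[OF r, of k "Suc k"] by (intro N) linarith+
  then obtain v where v: "(\<lambda>k. X (r k)) \<longlonglongrightarrow> v"
    by (rule l2_fast_Cauchy[of "\<lambda>k. X (r k)"]) auto
  then show "convergent X"
    using Cauchy_converges_subseq[OF X r] by (auto simp: convergent_def comp_def)
qed

section \<open>Square-integrable functions vanishing outside the domain\<close>

lemma L2_zero [simp]: "0 \<in> L2 \<O>"
  using rep_l2_zero by (auto simp: L2_def)

lemma L2_add [intro]: "u \<in> L2 \<O> \<Longrightarrow> v \<in> L2 \<O> \<Longrightarrow> u + v \<in> L2 \<O>"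
  unfolding L2_def using rep_l2_add[of u v] by auto

lemma L2_scaleR [intro]: "u \<in> L2 \<O> \<Longrightarrow> c *\<^sub>R u \<in> L2 \<O>"
  unfolding L2_def using rep_l2_scaleR[of c u] by auto

lemma L2_diff [intro]: "u \<in> L2 \<O> \<Longrightarrow> v \<in> L2 \<O> \<Longrightarrow> u - v \<in> L2 \<O>"
  using L2_add[of u \<O> "(-1) *\<^sub>R v"] L2_scaleR[of v \<O> "-1"] by simp

lemma abs_l2_in_L2:
  assumes "sq_integrable f" "AE x in lborel. x \<notin> \<O> \<longrightarrow> f x = 0"
  shows "abs_l2 f \<in> L2 \<O>"
  unfolding L2_def using assms(2) rep_abs_l2[OF assms(1)] by auto

lemma L2_rep_zero: "u \<in> L2 \<O> \<Longrightarrow> AE x in lborel. x \<notin> \<O> \<longrightarrow> rep_l2 u x = 0"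
  by (simp add: L2_def)

text \<open>Vanishing outside the domain is a pointwise condition, so it is passed to the limit
  along a subsequence converging almost everywhere.\<close>

lemma L2_limit:
  assumes "\<And>n. X n \<in> L2 \<O>" "X \<longlonglongrightarrow> u"
  shows "u \<in> L2 \<O>"
proof -
  obtain r where r: "AE x in lborel. (\<lambda>n. rep_l2 (X (r n)) x) \<longlonglongrightarrow> rep_l2 u x"
    by (rule l2_tendsto_AE_subseq[OF assms(2)])
  have "AE x in lborel. \<forall>n. x \<notin> \<O> \<longrightarrow> rep_l2 (X (r n)) x = 0"
    unfolding AE_all_countable using assms(1) by (auto simp: L2_def)
  with r have "AE x in lborel. x \<notin> \<O> \<longrightarrow> rep_l2 u x = 0"
  proof eventually_elim
    case (elim x)
    then show ?case using LIMSEQ_unique[OF elim(1), of 0] by auto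
  qed
  then show ?thesis by (simp add: L2_def)
qed

section \<open>Smooth functions and test functions\<close>

abbreviation partial :: "'a::euclidean_space \<Rightarrow> ('a \<Rightarrow> real) \<Rightarrow> 'a \<Rightarrow> real" where
  "partial i f \<equiv> \<lambda>x. frechet_derivative f (at x) i"

text \<open>Smoothness on the line as a whole tower D of derivatives: closure properties are shown
  by exhibiting the tower, without induction on the order. \<open>smooth1_iff_smooth_on\<close>
  identifies it with \<open>smooth_on UNIV\<close>.\<close>

definition smooth1 :: "(real \<Rightarrow> real) \<Rightarrow> bool" where
  "smooth1 h \<longleftrightarrow> (\<exists>D. D 0 = h \<and> (\<forall>k x. (D k has_real_derivative D (Suc k) x) (at x)))"

lemma smooth1_deriv:
  assumes "smooth1 h"
  obtains h' where "smooth1 h'" "\<And>x. (h has_real_derivative h' x) (at x)"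
proof -
  obtain D where D: "D 0 = h" "\<And>k x. (D k has_real_derivative D (Suc k) x) (at x)"
    using assms unfolding smooth1_def by blast
  have "smooth1 (D 1)"
    unfolding smooth1_def by (rule exI[of _ "\<lambda>k. D (Suc k)"]) (use D in auto)
  with D show ?thesis by (metis One_nat_def that)
qed

lemma smooth1_continuous: "smooth1 h \<Longrightarrow> continuous_on A h"
  by (rule smooth1_deriv) (auto intro!: continuous_at_imp_continuous_on DERIV_isCont)

lemma smooth1_affine:
  assumes "smooth1 h"
  shows "smooth1 (\<lambda>x. h (c * x + d))"
proof -
  obtain D where D: "D 0 = h" "\<And>k x. (D k has_real_derivative D (Suc k) x) (at x)"
    using assms unfolding smooth1_def by blast
  have "((\<lambda>x. c^k * D k (c * x + d)) has_real_derivative c^Suc k * D (Suc k) (c * x + d)) (at x)" for k x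
    by (auto intro!: derivative_eq_intros DERIV_chain2[OF D(2)])
  then show ?thesis unfolding smooth1_def using D(1)
    by (intro exI[of _ "\<lambda>k x. c^k * D k (c * x + d)"]) auto
qed

lemma smooth1_scale:
  assumes "smooth1 h"
  shows "smooth1 (\<lambda>x. c * h x)"
proof -
  obtain D where D: "D 0 = h" "\<And>k x. (D k has_real_derivative D (Suc k) x) (at x)"
    using assms unfolding smooth1_def by blast
  then show ?thesis unfolding smooth1_def
    by (intro exI[of _ "\<lambda>k x. c * D k x"]) (auto intro!: DERIV_cmult)
qed

lemma smooth1_add:
  assumes "smooth1 h" "smooth1 g"
  shows "smooth1 (\<lambda>x. h x + g x)"
proof -
  obtain D where D: "D 0 = h" "\<And>k x. (D k has_real_derivative D (Suc k) x) (at x)"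
    using assms unfolding smooth1_def by blast
  obtain E where E: "E 0 = g" "\<And>k x. (E k has_real_derivative E (Suc k) x) (at x)"
    using assms unfolding smooth1_def by blast
  from D E show ?thesis unfolding smooth1_def
    by (intro exI[of _ "\<lambda>k x. D k x + E k x"]) (auto intro!: DERIV_add)
qed

lemma smooth1_zero: "smooth1 (\<lambda>_. 0)"
  unfolding smooth1_def by (rule exI[of _ "\<lambda>_ _. 0"]) auto

text \<open>The classical flat function: smooth, zero on the left half-line, positive on the right.
  It supplies the test functions, the smooth steps of \<open>stair\<close> and the windows of
  \<open>smooth_lip_window\<close>.\<close>

definition psi :: "real \<Rightarrow> real" where
  "psi x = (if x > 0 then exp (- (1 / x)) else 0)"

lemma poly_exp_tendsto_0: "((\<lambda>t. poly p t * exp (- t)) \<longlongrightarrow> (0::real)) at_top"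
proof -
  have "((\<lambda>t. \<Sum>i\<le>degree p. coeff p i * (t ^ i / exp t)) \<longlongrightarrow> (\<Sum>i\<le>degree p. coeff p i * 0)) at_top"
    by (intro tendsto_sum tendsto_mult tendsto_const tendsto_power_div_exp_0)
  moreover have "(\<Sum>i\<le>degree p. coeff p i * (t ^ i / exp t)) = poly p t * exp (- t)" for t :: real
    unfolding poly_altdef sum_distrib_right by (rule sum.cong) (auto simp: exp_minus field_simps)
  ultimately show ?thesis by simp
qed

text \<open>For x > 0 the k-th derivative is p_k(1/x) exp(-1/x), and one more differentiation gives
  p_{k+1}(t) = t^2 (p_k(t) - p_k'(t)). At 0 the right difference quotient is, in t = 1/x, a
  polynomial times exp(-t), so all derivatives extend by zero.\<close>

lemma smooth1_psi: "smooth1 psi"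
proof -
  define p :: "nat \<Rightarrow> real poly" where "p = rec_nat 1 (\<lambda>_ r. [:0, 0, 1:] * (r - pderiv r))"
  have p0: "p 0 = 1" and pS: "p (Suc k) = [:0, 0, 1:] * (p k - pderiv (p k))" for k
    by (auto simp: p_def)
  define D where "D k x = (if x > 0 then poly (p k) (1 / x) * exp (- (1 / x)) else 0)" for k and x :: real
  have "(D k has_real_derivative D (Suc k) x) (at x)" for k x
  proof -
    consider "x > 0" | "x < 0" | "x = 0" by linarith
    then show ?thesis
    proof cases
      case 1
      have "((\<lambda>x. poly (p k) (1 / x) * exp (- (1 / x))) has_real_derivative
        poly (p (Suc k)) (1 / x) * exp (- (1 / x))) (at x)"
        using 1 by (auto intro!: derivative_eq_intros DERIV_chain2[OF poly_DERIV]
          simp: pS field_simps power2_eq_square)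
      then have "(D k has_real_derivative poly (p (Suc k)) (1 / x) * exp (- (1 / x))) (at x)"
        by (rule has_field_derivative_transform_within_open[where S = "{0<..}"])
           (use 1 in \<open>auto simp: D_def\<close>)
      then show ?thesis using 1 by (simp add: D_def)
    next
      case 2
      have "(D k has_real_derivative 0) (at x)"
        by (rule has_field_derivative_transform_within_open[where S = "{..<0}" and f = "\<lambda>_. 0"])
           (use 2 in \<open>auto simp: D_def\<close>)
      then show ?thesis using 2 by (simp add: D_def)
    next
      case 3
      have "((\<lambda>y. D k y / y) \<longlongrightarrow> 0) (at_left 0)"
        by (rule tendsto_eventually) (auto simp: D_def eventually_at_left_field intro!: exI[of _ "-1"])
      moreover have "((\<lambda>y. D k y / y) \<longlongrightarrow> 0) (at_right 0)"
        unfolding filterlim_at_right_to_top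
      proof (rule Lim_transform_eventually[OF poly_exp_tendsto_0[of "[:0, 1:] * p k"]])
        show "\<forall>\<^sub>F t in at_top. poly ([:0, 1:] * p k) t * exp (- t) = D k (inverse t) / inverse t"
          using eventually_gt_at_top[of 0] by eventually_elim (auto simp: D_def field_simps)
      qed
      ultimately have "((\<lambda>y. D k y / y) \<longlongrightarrow> 0) (at 0)"
        by (simp add: filterlim_at_split)
      then show ?thesis using 3 by (simp add: has_field_derivative_iff D_def)
    qed
  qed
  moreover have "D 0 = psi" by (auto simp: D_def psi_def p0 fun_eq_iff)
  ultimately show ?thesis unfolding smooth1_def by blast
qed

lemma psi_nonneg: "0 \<le> psi x" and psi_le_1: "psi x \<le> 1" and psi_pos: "0 < psi x \<longleftrightarrow> 0 < x"
  and psi_nonpos: "x \<le> 0 \<Longrightarrow> psi x = 0"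
  by (auto simp: psi_def)

lemma psi_mono: "x \<le> y \<Longrightarrow> psi x \<le> psi y"
  by (auto simp: psi_def frac_le)

lemma psi_scaled_tendsto: "(\<lambda>n. psi (real n * y)) \<longlonglongrightarrow> (if y > 0 then 1 else 0)"
proof (cases "y > 0")
  case True
  have "(\<lambda>n. exp (- (inverse (real n) / y))) \<longlonglongrightarrow> exp (- (0 / y))"
    using True by (intro tendsto_intros lim_inverse_n) auto
  moreover have "\<forall>\<^sub>F n in sequentially. exp (- (inverse (real n) / y)) = psi (real n * y)"
    using eventually_gt_at_top[of 0] by eventually_elim (use True in \<open>auto simp: psi_def field_simps\<close>)
  ultimately show ?thesis using True by (simp add: Lim_transform_eventually)
next
  case False
  then have "psi (real n * y) = 0" for n by (intro psi_nonpos) (simp add: mult_nonneg_nonpos)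
  then show ?thesis using False by simp
qed

section \<open>Calculus of C^k functions\<close>

lemma Ck_on_UNIV_Suc_iff:
  "Ck_on (Suc k) UNIV f \<longleftrightarrow> (\<forall>x. f differentiable (at x)) \<and> (\<forall>i\<in>Basis. Ck_on k UNIV (partial i f))"
  by simp

declare Ck_on.simps(2) [simp del]

text \<open>\<open>Ck_on (Suc k)\<close> mentions only the existence of the derivative and the
  regularity of the partials; continuity of the function itself enters through differentiability at
  the bottom of the recursion.\<close>

lemma Ck_on_Suc_imp: "Ck_on (Suc k) UNIV f \<Longrightarrow> Ck_on k UNIV f"
proof (induction k arbitrary: f)
  case 0
  then show ?case
    by (auto simp: Ck_on_UNIV_Suc_iff intro!: continuous_at_imp_continuous_on differentiable_imp_continuous_within)
next
  case (Suc k)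
  from Suc.prems show ?case
    using Suc.IH by (subst Ck_on_UNIV_Suc_iff) (auto simp: Ck_on_UNIV_Suc_iff[of "Suc k"])
qed

lemma partial_works:
  assumes "f differentiable (at x)"
  shows "(f has_derivative (\<lambda>z. frechet_derivative f (at x) z)) (at x)"
  using assms by (simp add: frechet_derivative_works[symmetric])

lemma partial_add:
  assumes "f differentiable (at x)" "g differentiable (at x)"
  shows "partial i (\<lambda>x. f x + g x) x = partial i f x + partial i g x"
  using frechet_derivative_at[OF has_derivative_add[OF partial_works[OF assms(1)] partial_works[OF assms(2)]]]
  by (metis (no_types, lifting))

lemma partial_mult:
  fixes f g :: "'a::euclidean_space \<Rightarrow> real"
  assumes "f differentiable (at x)" "g differentiable (at x)"
  shows "partial i (\<lambda>x. f x * g x) x = f x * partial i g x + partial i f x * g x"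
  using fun_cong[OF frechet_derivative_at[OF has_derivative_mult[OF partial_works[OF assms(1)] partial_works[OF assms(2)]]], of i]
  by simp

lemma partial_compose:
  assumes "f differentiable (at x)" "(h has_real_derivative h') (at (f x))"
  shows "partial i (\<lambda>x. h (f x)) x = h' * partial i f x"
proof -
  have "((\<lambda>x. h (f x)) has_derivative (\<lambda>z. h' * frechet_derivative f (at x) z)) (at x)"
    using has_derivative_compose[OF partial_works[OF assms(1)] assms(2)[unfolded has_field_derivative_def]]
    by simp
  from fun_cong[OF frechet_derivative_at[OF this], of i] show ?thesis by simp
qed

lemma Ck_on_add:
  "Ck_on k UNIV f \<Longrightarrow> Ck_on k UNIV g \<Longrightarrow> Ck_on k UNIV (\<lambda>x. f x + g x)"
proof (induction k arbitrary: f g)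
  case (Suc k)
  have "partial i (\<lambda>x. f x + g x) = (\<lambda>x. partial i f x + partial i g x)" for i
    using Suc.prems by (intro ext partial_add) (auto simp: Ck_on_UNIV_Suc_iff)
  then show ?case using Suc by (auto simp: Ck_on_UNIV_Suc_iff)
qed (auto intro: continuous_intros)

lemma Ck_on_mult:
  "Ck_on k UNIV f \<Longrightarrow> Ck_on k UNIV g \<Longrightarrow> Ck_on k UNIV (\<lambda>x. f x * g x)"
proof (induction k arbitrary: f g)
  case (Suc k)
  have "partial i (\<lambda>x. f x * g x) = (\<lambda>x. f x * partial i g x + partial i f x * g x)" for i
    using Suc.prems by (intro ext partial_mult) (auto simp: Ck_on_UNIV_Suc_iff)
  moreover have "Ck_on k UNIV f" "Ck_on k UNIV g" using Suc.prems by (auto intro: Ck_on_Suc_imp)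
  ultimately show ?case using Suc.prems
    by (auto simp: Ck_on_UNIV_Suc_iff intro!: Ck_on_add Suc.IH)
qed (auto intro: continuous_intros)

lemma Ck_on_const: "Ck_on k UNIV (\<lambda>_. c)"
  by (induction k arbitrary: c) (auto simp: Ck_on_UNIV_Suc_iff)

lemma Ck_on_inner: "Ck_on k UNIV (\<lambda>x. x \<bullet> a)"
proof (cases k)
  case (Suc n)
  have "((\<lambda>x. x \<bullet> a) has_derivative (\<lambda>z. z \<bullet> a)) (at x)" for x
    by (auto intro!: derivative_eq_intros)
  then have "frechet_derivative (\<lambda>x. x \<bullet> a) (at x) = (\<lambda>z. z \<bullet> a)" "(\<lambda>x. x \<bullet> a) differentiable (at x)" for x
    by (auto intro: frechet_derivative_at[symmetric] differentiableI)
  then show ?thesis using Suc by (auto simp: Ck_on_UNIV_Suc_iff Ck_on_const)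
qed (auto intro: continuous_intros)

lemma Ck_on_compose:
  "Ck_on k UNIV f \<Longrightarrow> smooth1 h \<Longrightarrow> Ck_on k UNIV (\<lambda>x. h (f x))"
proof (induction k arbitrary: h)
  case 0
  then show ?case using continuous_on_compose2[OF smooth1_continuous[of h UNIV]] by auto
next
  case (Suc k)
  obtain h' where h': "smooth1 h'" "\<And>x. (h has_real_derivative h' x) (at x)"
    by (rule smooth1_deriv[OF Suc.prems(2)]) blast
  have diff: "f differentiable (at x)" for x using Suc.prems(1) by (auto simp: Ck_on_UNIV_Suc_iff)
  have "(\<lambda>x. h (f x)) differentiable (at x)" for x
    using has_derivative_compose[OF partial_works[OF diff] h'(2)[unfolded has_field_derivative_def]]
    unfolding differentiable_def by blast
  moreover have "partial i (\<lambda>x. h (f x)) = (\<lambda>x. h' (f x) * partial i f x)" for i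
    using partial_compose[OF diff h'(2)] by auto
  moreover have "Ck_on k UNIV (\<lambda>x. h' (f x))"
    by (rule Suc.IH[OF Ck_on_Suc_imp[OF Suc.prems(1)] h'(1)])
  ultimately show ?case using Suc.prems(1)
    by (auto simp: Ck_on_UNIV_Suc_iff intro!: Ck_on_mult)
qed

lemma Ck_on_prod:
  "(\<And>j. j \<in> J \<Longrightarrow> Ck_on k UNIV (f j)) \<Longrightarrow> Ck_on k UNIV (\<lambda>x. \<Prod>j\<in>J. f j x)"
  by (induction J rule: infinite_finite_induct) (auto intro: Ck_on_const Ck_on_mult)

subsection \<open>Test functions\<close>

lemma test_function_smooth:
  assumes "test_function \<O> \<phi>"
  shows "\<phi> differentiable (at x)" "i \<in> Basis \<Longrightarrow> smooth_on UNIV (partial i \<phi>)" "continuous_on A \<phi>"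
proof -
  have "Ck_on (Suc k) UNIV \<phi>" for k using assms by (auto simp: test_function_def smooth_on_def)
  then show "\<phi> differentiable (at x)" "i \<in> Basis \<Longrightarrow> smooth_on UNIV (partial i \<phi>)"
    by (auto simp: Ck_on_UNIV_Suc_iff smooth_on_def)
  have "continuous_on UNIV \<phi>" using assms by (auto simp: test_function_def smooth_on_def intro: Ck_on.simps(1)[THEN iffD1])
  then show "continuous_on A \<phi>" by (rule continuous_on_subset) simp
qed

lemma test_function_outside: "test_function \<O> \<phi> \<Longrightarrow> x \<notin> \<O> \<Longrightarrow> \<phi> x = 0"
  using closure_subset[of "{x. \<phi> x \<noteq> 0}"] by (auto simp: test_function_def)

lemma zero_outside_support: "x \<notin> closure {x. \<phi> x \<noteq> 0} \<Longrightarrow> \<phi> x = 0"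
  using closure_subset[of "{x. \<phi> x \<noteq> 0}"] by blast

lemma partial_zero_outside:
  assumes "x \<notin> closure {x. \<phi> x \<noteq> 0}"
  shows "partial i \<phi> x = 0"
proof -
  have "(\<phi> has_derivative (\<lambda>_. 0)) (at x)"
    by (rule has_derivative_transform_within_open[of "\<lambda>_. 0" "\<lambda>_. 0" x UNIV "- closure {x. \<phi> x \<noteq> 0}"])
       (use assms closure_subset[of "{x. \<phi> x \<noteq> 0}"] in auto)
  from fun_cong[OF frechet_derivative_at[OF this]] show ?thesis by simp
qed

lemma test_functionI:
  assumes "smooth_on UNIV \<phi>" "compact K" "K \<subseteq> \<O>" "\<And>x. x \<notin> K \<Longrightarrow> \<phi> x = 0"
  shows "test_function \<O> \<phi>"
proof -
  have "closure {x. \<phi> x \<noteq> 0} \<subseteq> K"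
    using assms by (intro closure_minimal) (auto simp: compact_imp_closed)
  moreover from this have "compact (closure {x. \<phi> x \<noteq> 0})"
    using compact_Int_closed[OF assms(2), of "closure {x. \<phi> x \<noteq> 0}"] by (simp add: Int_absorb1)
  ultimately show ?thesis using assms by (auto simp: test_function_def)
qed

lemma test_function_partial:
  assumes "test_function \<O> \<phi>" "i \<in> Basis"
  shows "test_function \<O> (partial i \<phi>)"
  by (rule test_functionI[of _ "closure {x. \<phi> x \<noteq> 0}"])
     (use assms test_function_smooth(2)[OF assms] partial_zero_outside[of _ \<phi> i] in \<open>auto simp: test_function_def\<close>)

lemma test_function_compose:
  assumes "test_function \<O> \<phi>" "smooth1 h" "h 0 = 0"
  shows "test_function \<O> (\<lambda>x. h (\<phi> x))"
proof (rule test_functionI[of _ "closure {x. \<phi> x \<noteq> 0}"])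
  show "smooth_on UNIV (\<lambda>x. h (\<phi> x))"
    using assms by (auto simp: test_function_def smooth_on_def intro: Ck_on_compose)
  show "h (\<phi> x) = 0" if "x \<notin> closure {x. \<phi> x \<noteq> 0}" for x
    using zero_outside_support[OF that] assms by simp
qed (use assms in \<open>simp_all add: test_function_def del: compact_closure\<close>)

lemma test_function_add:
  assumes "test_function \<O> \<phi>" "test_function \<O> \<eta>"
  shows "test_function \<O> (\<lambda>x. \<phi> x + \<eta> x)"
proof (rule test_functionI[of _ "closure {x. \<phi> x \<noteq> 0} \<union> closure {x. \<eta> x \<noteq> 0}"])
  show "smooth_on UNIV (\<lambda>x. \<phi> x + \<eta> x)"
    using assms by (auto simp: test_function_def smooth_on_def intro: Ck_on_add)
  show "\<phi> x + \<eta> x = 0" if "x \<notin> closure {x. \<phi> x \<noteq> 0} \<union> closure {x. \<eta> x \<noteq> 0}" for x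
    using zero_outside_support[of x \<phi>] zero_outside_support[of x \<eta>] that by auto
qed (use assms in \<open>simp_all add: test_function_def compact_Un del: compact_closure\<close>)

lemma test_function_mult:
  assumes "test_function \<O> \<phi>" "test_function \<O> \<eta>"
  shows "test_function \<O> (\<lambda>x. \<phi> x * \<eta> x)"
proof (rule test_functionI[of _ "closure {x. \<phi> x \<noteq> 0}"])
  show "smooth_on UNIV (\<lambda>x. \<phi> x * \<eta> x)"
    using assms by (auto simp: test_function_def smooth_on_def intro: Ck_on_mult)
  show "\<phi> x * \<eta> x = 0" if "x \<notin> closure {x. \<phi> x \<noteq> 0}" for x
    using zero_outside_support[OF that] assms by simp
qed (use assms in \<open>simp_all add: test_function_def del: compact_closure\<close>)

lemma test_function_scale:
  assumes "test_function \<O> \<phi>"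
  shows "test_function \<O> (\<lambda>x. c * \<phi> x)"
proof (rule test_function_compose[OF assms])
  show "smooth1 (\<lambda>x. c * x)"
    unfolding smooth1_def
    by (rule exI[of _ "\<lambda>k x. if k = 0 then c * x else if k = 1 then c else 0"]) (auto intro!: derivative_eq_intros)
qed simp

lemma test_function_measurable: "test_function \<O> \<phi> \<Longrightarrow> \<phi> \<in> borel_measurable borel"
  by (rule borel_measurable_continuous_onI) (rule test_function_smooth(3))

lemma test_function_integrable:
  assumes "test_function \<O> \<phi>"
  shows "integrable lborel \<phi>"
proof -
  let ?K = "closure {x. \<phi> x \<noteq> 0}"
  have "integrable lborel (\<lambda>x. indicator ?K x *\<^sub>R \<phi> x)"
    using assms by (intro borel_integrable_compact test_function_smooth(3)) (auto simp: test_function_def)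
  moreover have "(\<lambda>x. indicator ?K x *\<^sub>R \<phi> x) = \<phi>"
  proof
    fix x show "indicator ?K x *\<^sub>R \<phi> x = \<phi> x"
      using zero_outside_support[of x \<phi>] by (cases "x \<in> ?K") simp_all
  qed
  ultimately show ?thesis by (simp only:)
qed

lemma test_function_sq_integrable:
  assumes "test_function \<O> \<phi>"
  shows "sq_integrable \<phi>"
  using test_function_measurable[OF assms] test_function_integrable[OF test_function_mult[OF assms assms]]
  by (simp add: sq_integrable_def power2_eq_square)

lemma test_function_in_L2: "test_function \<O> \<phi> \<Longrightarrow> abs_l2 \<phi> \<in> L2 \<O>"
  by (rule abs_l2_in_L2) (auto simp: test_function_sq_integrable test_function_outside)

lemma test_function_bounded:
  assumes "test_function \<O> \<phi>"
  obtains M where "M \<ge> 0" "\<And>x. \<bar>\<phi> x\<bar> \<le> M"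
proof -
  let ?K = "closure {x. \<phi> x \<noteq> 0}"
  have "bounded (\<phi> ` ?K)"
    using assms by (intro compact_imp_bounded compact_continuous_image test_function_smooth(3)[OF assms])
      (auto simp: test_function_def)
  then obtain M where M: "\<And>x. x \<in> ?K \<Longrightarrow> \<bar>\<phi> x\<bar> \<le> M" by (auto simp: bounded_iff)
  have "\<bar>\<phi> x\<bar> \<le> max M 0" for x
    using M[of x] closure_subset[of "{x. \<phi> x \<noteq> 0}"] by (cases "\<phi> x = 0") (auto simp: max_def)
  then show ?thesis by (intro that[of "max M 0"]) auto
qed

section \<open>Integration by parts for test functions\<close>

lemma directional_derivative:
  assumes "test_function \<O> \<phi>"
  shows "((\<lambda>s. \<phi> (x + s *\<^sub>R z)) has_real_derivative frechet_derivative \<phi> (at (x + t *\<^sub>R z)) z) (at t)"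
proof -
  have l: "((\<lambda>s. x + s *\<^sub>R z) has_derivative (\<lambda>s. s *\<^sub>R z)) (at t)"
    by (auto intro!: derivative_eq_intros)
  have p: "(\<phi> has_derivative frechet_derivative \<phi> (at (x + t *\<^sub>R z))) (at (x + t *\<^sub>R z))"
    using partial_works[OF test_function_smooth(1)[OF assms]] .
  have "((\<lambda>s. \<phi> (x + s *\<^sub>R z)) has_derivative (\<lambda>s. frechet_derivative \<phi> (at (x + t *\<^sub>R z)) (s *\<^sub>R z))) (at t)"
    using has_derivative_compose[OF l p] .
  moreover have "frechet_derivative \<phi> (at (x + t *\<^sub>R z)) (s *\<^sub>R z) = frechet_derivative \<phi> (at (x + t *\<^sub>R z)) z * s" for s
    using linear_scale[OF has_derivative_linear[OF p]] by (simp add: mult.commute)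
  ultimately show ?thesis unfolding has_field_derivative_def by simp
qed

lemma lborel_integral_translate:
  fixes f :: "'a::euclidean_space \<Rightarrow> real"
  assumes "f \<in> borel_measurable borel"
  shows "(\<integral>x. f (x + z) \<partial>lborel) = (\<integral>x. f x \<partial>lborel)"
proof -
  have "(\<integral>x. f x \<partial>lborel) = (\<integral>x. f x \<partial>distr lborel borel ((+) z))" by (simp add: lborel_distr_plus)
  also have "\<dots> = (\<integral>x. f (z + x) \<partial>lborel)" using assms by (intro integral_distr) auto
  finally show ?thesis by (simp add: add.commute)
qed

text \<open>Each difference quotient has integral 0 because Lebesgue measure is translation
  invariant; dominated convergence passes to the derivative.\<close>

lemma test_function_integral_partial:
  assumes \<phi>: "test_function \<O> \<phi>" and i: "i \<in> Basis"
  shows "(\<integral>x. partial i \<phi> x \<partial>lborel) = 0"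
proof -
  obtain M where M: "M \<ge> 0" "\<And>x. \<bar>partial i \<phi> x\<bar> \<le> M"
    by (rule test_function_bounded[OF test_function_partial[OF \<phi> i]]) blast
  have "bounded {x. \<phi> x \<noteq> 0}"
    using \<phi> by (auto simp: test_function_def)
  then obtain R where R: "R > 0" "\<And>x. \<phi> x \<noteq> 0 \<Longrightarrow> norm x \<le> R"
    by (auto simp: bounded_pos)
  define d where "d n x = (\<phi> (x + inverse (real (Suc n)) *\<^sub>R i) - \<phi> x) / inverse (real (Suc n))" for n x
  have [measurable]: "\<phi> \<in> borel_measurable borel" by (rule test_function_measurable[OF \<phi>])
  \<comment> \<open>The steps have length at most 1, so the quotients vanish outside the ball of
    radius R + 1; inside, the mean value theorem bounds them by M.\<close>
  have "(\<lambda>n. \<integral>x. d n x \<partial>lborel) \<longlonglongrightarrow> (\<integral>x. partial i \<phi> x \<partial>lborel)"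
  proof (rule integral_dominated_convergence[where w = "\<lambda>x. M * indicator (cball 0 (R + 1)) x"])
    show "partial i \<phi> \<in> borel_measurable lborel"
      using test_function_measurable[OF test_function_partial[OF \<phi> i]] by simp
    show "d n \<in> borel_measurable lborel" for n unfolding d_def by measurable
    show "integrable lborel (\<lambda>x. M * indicator (cball 0 (R + 1)) x)"
      by (intro integrable_mult_right integrable_real_indicator) (auto intro: emeasure_lborel_cball_finite[unfolded infinity_ennreal_def])
    show "AE x in lborel. (\<lambda>n. d n x) \<longlonglongrightarrow> partial i \<phi> x"
    proof (rule AE_I2)
      fix x
      have "((\<lambda>h. (\<phi> (x + h *\<^sub>R i) - \<phi> x) / h) \<longlongrightarrow> partial i \<phi> x) (at 0)"
        using directional_derivative[OF \<phi>, of x i 0] by (simp add: has_field_derivative_iff)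
      moreover have "filterlim (\<lambda>n. inverse (real (Suc n))) (at 0) sequentially"
        using LIMSEQ_inverse_real_of_nat by (auto simp: filterlim_at)
      ultimately show "(\<lambda>n. d n x) \<longlonglongrightarrow> partial i \<phi> x"
        unfolding d_def by (rule filterlim_compose)
    qed
    show "AE x in lborel. norm (d n x) \<le> M * indicator (cball 0 (R + 1)) x" for n
    proof (rule AE_I2)
      fix x
      let ?h = "inverse (real (Suc n))"
      have h: "0 < ?h" "?h \<le> 1" by (auto simp: field_simps)
      show "norm (d n x) \<le> M * indicator (cball 0 (R + 1)) x"
      proof (cases "x \<in> cball 0 (R + 1)")
        case True
        obtain s where "0 < s" "s < ?h" "\<phi> (x + ?h *\<^sub>R i) - \<phi> (x + 0 *\<^sub>R i) = (?h - 0) * partial i \<phi> (x + s *\<^sub>R i)"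
          using MVT2[OF h(1), of "\<lambda>s. \<phi> (x + s *\<^sub>R i)" "\<lambda>s. partial i \<phi> (x + s *\<^sub>R i)"] directional_derivative[OF \<phi>]
          by blast
        then have "d n x = partial i \<phi> (x + s *\<^sub>R i)" using h(1) by (simp add: d_def)
        then show ?thesis using True M(2) by (simp add: indicator_def)
      next
        case False
        then have n: "norm x > R + 1" by simp
        have "norm (?h *\<^sub>R i) \<le> 1" using h i by simp
        then have "norm (x + ?h *\<^sub>R i) > R"
          using n norm_triangle_ineq2[of x "- (?h *\<^sub>R i)"] by simp
        then have "\<phi> (x + ?h *\<^sub>R i) = 0" "\<phi> x = 0" using R(2) n by force+
        then show ?thesis using False by (simp add: d_def)
      qed
    qed
  qed
  moreover have "(\<integral>x. d n x \<partial>lborel) = 0" for n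
  proof -
    have "integrable lborel (\<lambda>x. \<phi> (x + z))" for z
      using lborel_integrable_real_affine test_function_integrable[OF \<phi>]
        integrable_distr[of "(+) z" lborel borel \<phi>] by (simp add: lborel_distr_plus add.commute)
    then show ?thesis unfolding d_def
      using test_function_integrable[OF \<phi>] by (simp add: lborel_integral_translate)
  qed
  ultimately show ?thesis by (simp add: LIMSEQ_const_iff)
qed

lemma integration_by_parts:
  assumes "test_function \<O> \<phi>" "test_function \<O> \<eta>" "i \<in> Basis"
  shows "(\<integral>x. \<phi> x * partial i \<eta> x \<partial>lborel) = - (\<integral>x. partial i \<phi> x * \<eta> x \<partial>lborel)"
proof -
  have "partial i (\<lambda>x. \<phi> x * \<eta> x) = (\<lambda>x. \<phi> x * partial i \<eta> x + partial i \<phi> x * \<eta> x)"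
    by (intro ext partial_mult test_function_smooth(1)[OF assms(1)] test_function_smooth(1)[OF assms(2)])
  then have "(\<integral>x. \<phi> x * partial i \<eta> x + partial i \<phi> x * \<eta> x \<partial>lborel) = 0"
    using test_function_integral_partial[OF test_function_mult[OF assms(1,2)] assms(3)] by simp
  moreover have "integrable lborel (\<lambda>x. \<phi> x * partial i \<eta> x)" "integrable lborel (\<lambda>x. partial i \<phi> x * \<eta> x)"
    using assms by (auto intro!: test_function_integrable test_function_mult test_function_partial)
  ultimately show ?thesis by simp
qed

section \<open>Bump functions and the fundamental lemma of the calculus of variations\<close>

definition bump :: "nat \<Rightarrow> 'a::euclidean_space \<Rightarrow> 'a \<Rightarrow> 'a \<Rightarrow> real" where
  "bump n a b x = (\<Prod>i\<in>Basis. psi (real n * (x \<bullet> i - a \<bullet> i)) * psi (real n * (b \<bullet> i - x \<bullet> i)))"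

lemma bump_bounds: "0 \<le> bump n a b x" "bump n a b x \<le> 1"
  unfolding bump_def by (auto intro!: prod_nonneg prod_le_1 mult_le_one simp: psi_nonneg psi_le_1)

lemma bump_outside: "x \<notin> box a b \<Longrightarrow> bump n a b x = 0"
proof -
  assume "x \<notin> box a b"
  then obtain i where i: "i \<in> Basis" "x \<bullet> i \<le> a \<bullet> i \<or> b \<bullet> i \<le> x \<bullet> i" by (auto simp: mem_box not_less)
  then have "psi (real n * (x \<bullet> i - a \<bullet> i)) * psi (real n * (b \<bullet> i - x \<bullet> i)) = 0"
    by (auto intro!: psi_nonpos simp: mult_nonneg_nonpos)
  then show ?thesis unfolding bump_def using i(1) by (intro prod_zero) auto
qed

lemma bump_test_function:
  assumes "cbox a b \<subseteq> \<O>"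
  shows "test_function \<O> (bump n a b)"
proof (rule test_functionI[of _ "cbox a b"])
  have "Ck_on k UNIV (bump n a b)" for k
    unfolding bump_def
  proof (intro Ck_on_prod Ck_on_mult)
    fix i :: 'a
    have "Ck_on k UNIV (\<lambda>x. psi (real n * (x \<bullet> i) + (- real n * (a \<bullet> i))))"
      "Ck_on k UNIV (\<lambda>x. psi ((- real n) * (x \<bullet> i) + real n * (b \<bullet> i)))"
      by (rule Ck_on_compose[OF Ck_on_inner smooth1_affine[OF smooth1_psi]])+
    then show "Ck_on k UNIV (\<lambda>x. psi (real n * (x \<bullet> i - a \<bullet> i)))"
      "Ck_on k UNIV (\<lambda>x. psi (real n * (b \<bullet> i - x \<bullet> i)))"
      by (simp_all add: algebra_simps)
  qed
  then show "smooth_on UNIV (bump n a b)" by (simp add: smooth_on_def)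
qed (use assms box_subset_cbox in \<open>auto intro!: bump_outside\<close>)

lemma bump_tendsto: "(\<lambda>n. bump n a b x) \<longlonglongrightarrow> indicator (box a b) x"
proof -
  have "(\<lambda>n. bump n a b x) \<longlonglongrightarrow>
    (\<Prod>i\<in>Basis. (if x \<bullet> i - a \<bullet> i > 0 then 1 else 0) * (if b \<bullet> i - x \<bullet> i > 0 then 1 else 0))"
    unfolding bump_def by (intro tendsto_prod tendsto_mult psi_scaled_tendsto)
  moreover have "(\<Prod>i\<in>Basis. (if x \<bullet> i - a \<bullet> i > 0 then 1 else 0) * (if b \<bullet> i - x \<bullet> i > 0 then 1 else 0)) =
      (indicator (box a b) x :: real)"
  proof (cases "x \<in> box a b")
    case True
    then show ?thesis by (auto simp: mem_box intro!: prod.neutral)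
  next
    case False
    then show ?thesis by (auto simp: mem_box intro!: prod_zero)
  qed
  ultimately show ?thesis by simp
qed

lemma sq_integrable_indicator:
  assumes "A \<in> sets borel" "emeasure lborel A < \<infinity>"
  shows "sq_integrable (indicator A)"
proof -
  have "(\<lambda>x. (indicator A x :: real)\<^sup>2) = indicator A" by (auto simp: indicator_def)
  then show ?thesis unfolding sq_integrable_def using assms by auto
qed

lemma integrable_rep_l2_indicator:
  assumes "A \<in> sets borel" "emeasure lborel A < \<infinity>"
  shows "integrable lborel (\<lambda>x. rep_l2 w x * indicator A x)"
  by (rule sq_integrable_mult[OF sq_integrable_rep_l2 sq_integrable_indicator[OF assms]])

lemma lborel_box_finite: "emeasure lborel (box a b) < \<infinity>"
  by (simp add: emeasure_lborel_box_eq)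

text \<open>The bumps are dominated by the indicator of the box and converge to it, so dominated
  convergence turns orthogonality to test functions into vanishing integrals over boxes.\<close>

lemma integral_box_zero_if_orth:
  assumes orth: "\<And>\<phi>. test_function \<O> \<phi> \<Longrightarrow> inner w (abs_l2 \<phi>) = 0" and ab: "cbox a b \<subseteq> \<O>"
  shows "(\<integral>x. rep_l2 w x * indicator (box a b) x \<partial>lborel) = 0"
proof -
  have "(\<lambda>n. \<integral>x. rep_l2 w x * bump n a b x \<partial>lborel) \<longlonglongrightarrow> (\<integral>x. rep_l2 w x * indicator (box a b) x \<partial>lborel)"
  proof (rule integral_dominated_convergence[where w = "\<lambda>x. \<bar>rep_l2 w x * indicator (box a b) x\<bar>"])
    show "integrable lborel (\<lambda>x. \<bar>rep_l2 w x * indicator (box a b) x\<bar>)"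
      by (intro integrable_abs integrable_rep_l2_indicator lborel_box_finite) auto
    show "AE x in lborel. (\<lambda>n. rep_l2 w x * bump n a b x) \<longlonglongrightarrow> rep_l2 w x * indicator (box a b) x"
      by (intro AE_I2 tendsto_mult tendsto_const bump_tendsto)
    show "(\<lambda>x. rep_l2 w x * bump n a b x) \<in> borel_measurable lborel" for n
      using test_function_measurable[OF bump_test_function[OF ab]] by auto
    show "AE x in lborel. norm (rep_l2 w x * bump n a b x) \<le> \<bar>rep_l2 w x * indicator (box a b) x\<bar>" for n
    proof (rule AE_I2)
      fix x show "norm (rep_l2 w x * bump n a b x) \<le> \<bar>rep_l2 w x * indicator (box a b) x\<bar>"
        using bump_bounds[of n a b x] by (cases "x \<in> box a b") (auto simp: abs_mult bump_outside mult_left_le)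
    qed
  qed auto
  moreover have "(\<integral>x. rep_l2 w x * bump n a b x \<partial>lborel) = 0" for n
    using orth[OF bump_test_function[OF ab], of n]
    by (simp add: inner_abs_l2_right test_function_sq_integrable[OF bump_test_function[OF ab]])
  ultimately show ?thesis by (simp add: LIMSEQ_const_iff)
qed

text \<open>The positive and the negative part of g are densities of measures that agree on the
  intersection-stable family of boxes and are finite there; hence the measures agree, and densities
  are unique almost everywhere.\<close>

lemma AE_zero_if_integral_boxes_zero:
  fixes g :: "'a::euclidean_space \<Rightarrow> real"
  assumes g: "integrable lborel g" and z: "\<And>c d. (\<integral>x. g x * indicator (box c d) x \<partial>lborel) = 0"
  shows "AE x in lborel. g x = 0"
proof -
  have [measurable]: "g \<in> borel_measurable borel" using g by auto
  let ?M = "density lborel (\<lambda>x. ennreal (g x))" and ?N = "density lborel (\<lambda>x. ennreal (- g x))"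
  let ?E = "range (\<lambda>(a, b). box a b) :: 'a set set"
  have box: "emeasure ?M (box c d) = emeasure ?N (box c d) \<and> emeasure ?M (box c d) \<noteq> \<infinity>" for c d
  proof -
    let ?h = "\<lambda>x. g x * indicator (box c d) x"
    have h: "integrable lborel ?h" using g by (intro integrable_real_mult_indicator) auto
    have p: "integrable lborel (\<lambda>x. max 0 (?h x))" "integrable lborel (\<lambda>x. max 0 (- ?h x))"
      using h by (auto intro!: integrable_max)
    have "(\<integral>x. max 0 (?h x) - max 0 (- ?h x) \<partial>lborel) = (\<integral>x. ?h x \<partial>lborel)"
      by (rule Bochner_Integration.integral_cong) (auto simp: max_def)
    then have eq: "(\<integral>x. max 0 (?h x) \<partial>lborel) = (\<integral>x. max 0 (- ?h x) \<partial>lborel)"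
      using p z[of c d] by simp
    have "emeasure ?M (box c d) = (\<integral>\<^sup>+x. ennreal (max 0 (?h x)) \<partial>lborel)"
      by (subst emeasure_density) (auto intro!: nn_integral_cong simp: indicator_def ennreal_neg max_def)
    also have "\<dots> = ennreal (\<integral>x. max 0 (?h x) \<partial>lborel)"
      by (rule nn_integral_eq_integral[OF p(1)]) auto
    finally have 1: "emeasure ?M (box c d) = ennreal (\<integral>x. max 0 (?h x) \<partial>lborel)" .
    have "emeasure ?N (box c d) = (\<integral>\<^sup>+x. ennreal (max 0 (- ?h x)) \<partial>lborel)"
      by (subst emeasure_density) (auto intro!: nn_integral_cong simp: indicator_def ennreal_neg max_def)
    also have "\<dots> = ennreal (\<integral>x. max 0 (- ?h x) \<partial>lborel)"
      by (rule nn_integral_eq_integral[OF p(2)]) auto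
    finally show ?thesis using 1 eq by simp
  qed
  have "?M = ?N"
  proof (rule measure_eqI_generator_eq[of ?E UNIV _ _ "\<lambda>n. box (- real n *\<^sub>R One) (real n *\<^sub>R One)"])
    show "Int_stable ?E" by (auto simp: Int_stable_def box_Int_box)
    show "sets ?M = sigma_sets UNIV ?E" "sets ?N = sigma_sets UNIV ?E"
      by (simp_all add: borel_eq_box)
    show "(\<Union>n. box (- real n *\<^sub>R One) (real n *\<^sub>R One)) = (UNIV :: 'a set)"
      using UN_box_eq_UNIV by simp
    show "emeasure ?M (box (- real n *\<^sub>R One) (real n *\<^sub>R One)) \<noteq> \<infinity>" for n
      using box by blast
    show "emeasure ?M X = emeasure ?N X" if "X \<in> ?E" for X
      using box that by auto
  qed auto
  \<comment> \<open>\<open>ennreal\<close> truncates negative values, so this equates the positive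
    and the negative part of g, which forces both to vanish.\<close>
  then have "AE x in lborel. ennreal (g x) = ennreal (- g x)"
    by (subst (asm) sigma_finite_measure.density_unique_iff[OF sigma_finite_lborel]) auto
  then show ?thesis
  proof eventually_elim
    case (elim x)
    then show ?case by (cases "g x \<ge> 0"; cases "g x \<le> 0") (auto simp: ennreal_neg dest: sym)
  qed
qed

text \<open>The function is first shown to vanish on every box whose closure lies in the domain;
  countably many such boxes cover the domain, so the exceptional null sets can be united.\<close>

lemma L2_zero_if_orth_test:
  fixes w :: "'a::euclidean_space l2"
  assumes "open \<O>" "w \<in> L2 \<O>" and orth: "\<And>\<phi>. test_function \<O> \<phi> \<Longrightarrow> inner w (abs_l2 \<phi>) = 0"
  shows "w = 0"
proof -
  have box: "AE x in lborel. x \<in> box a b \<longrightarrow> rep_l2 w x = 0" if ab: "cbox a b \<subseteq> \<O>" for a b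
  proof -
    have "AE x in lborel. rep_l2 w x * indicator (box a b) x = 0"
    proof (rule AE_zero_if_integral_boxes_zero)
      show "integrable lborel (\<lambda>x. rep_l2 w x * indicator (box a b) x)"
        by (intro integrable_rep_l2_indicator lborel_box_finite) auto
      fix c d
      \<comment> \<open>The corners of the intersection of the two boxes. Its closed box stays
        inside \<open>cbox a b\<close>, hence inside the domain, whatever c and d are.\<close>
      define p q where "p = (\<Sum>i\<in>Basis. max (a \<bullet> i) (c \<bullet> i) *\<^sub>R i)" and "q = (\<Sum>i\<in>Basis. min (b \<bullet> i) (d \<bullet> i) *\<^sub>R i)"
      have "cbox p q \<subseteq> cbox a b" by (auto simp: p_def q_def mem_box)
      then have "(\<integral>x. rep_l2 w x * indicator (box p q) x \<partial>lborel) = 0"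
        using ab by (intro integral_box_zero_if_orth[where \<O> = \<O>] orth) auto
      moreover have "indicator (box p q) x = (indicator (box a b) x * indicator (box c d) x :: real)" for x
        unfolding p_def q_def box_Int_box[symmetric] by (simp add: indicator_inter_arith)
      ultimately show "(\<integral>x. rep_l2 w x * indicator (box a b) x * indicator (box c d) x \<partial>lborel) = 0"
        by (simp add: mult.assoc)
    qed
    then show ?thesis by eventually_elim (auto simp: indicator_def)
  qed
  define F where "F = {box a b | a b. cbox a b \<subseteq> \<O>}"
  obtain F' where F': "F' \<subseteq> F" "countable F'" "\<Union>F' = \<Union>F"
    by (rule Lindelof[of F]) (auto simp: F_def open_box)
  have "\<O> \<subseteq> \<Union>F"
  proof
    fix x assume "x \<in> \<O>"
    then obtain e where e: "e > 0" "cball x e \<subseteq> \<O>" using \<open>open \<O>\<close> open_contains_cball by blast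
    obtain a b where ab: "x \<in> box a b" "box a b \<subseteq> ball x e"
      using rational_boxes[OF e(1), of x] by blast
    then have "cbox a b = closure (box a b)" by (subst closure_box) auto
    also have "\<dots> \<subseteq> cball x e" using ab(2) by (intro closure_minimal) auto
    finally show "x \<in> \<Union>F" using e ab unfolding F_def by blast
  qed
  moreover have "AE x in lborel. \<forall>X\<in>F'. x \<in> X \<longrightarrow> rep_l2 w x = 0"
    using F'(1) box by (subst AE_ball_countable[OF F'(2)]) (auto simp: F_def)
  ultimately have "AE x in lborel. x \<in> \<O> \<longrightarrow> rep_l2 w x = 0"
    using F'(3) by (auto elim!: eventually_mono)
  then have "AE x in lborel. rep_l2 w x = rep_l2 0 x"
    using L2_rep_zero[OF assms(2)] rep_l2_zero by eventually_elim auto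
  then show ?thesis by (simp add: l2_eq_iff)
qed

section \<open>The Sobolev space of functions vanishing on the boundary\<close>

lemma is_weak_partialD:
  assumes "is_weak_partial \<O> i u w"
  shows "w \<in> L2 \<O>"
    "test_function \<O> \<phi> \<Longrightarrow> inner u (abs_l2 (partial i \<phi>)) = - inner w (abs_l2 \<phi>)"
  using assms unfolding is_weak_partial_def by blast+

text \<open>This gives the definite description in \<open>weak_partial\<close> its meaning: the
  difference of two candidates is orthogonal to every test function.\<close>

lemma is_weak_partial_unique:
  assumes "open \<O>" "is_weak_partial \<O> i u w" "is_weak_partial \<O> i u w'"
  shows "w = w'"
proof -
  have "w - w' = 0"
  proof (rule L2_zero_if_orth_test[OF assms(1)])
    show "w - w' \<in> L2 \<O>" by (intro L2_diff is_weak_partialD(1)[OF assms(2)] is_weak_partialD(1)[OF assms(3)])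
    fix \<phi> assume "test_function \<O> \<phi>"
    then show "inner (w - w') (abs_l2 \<phi>) = 0"
      using is_weak_partialD(2)[OF assms(2), of \<phi>] is_weak_partialD(2)[OF assms(3), of \<phi>]
      by (simp add: inner_diff_left)
  qed
  then show ?thesis by simp
qed

lemma weak_partial_eq:
  assumes "open \<O>" "is_weak_partial \<O> i u w"
  shows "weak_partial \<O> i u = w"
  unfolding weak_partial_def
  by (rule the_equality[of "is_weak_partial \<O> i u", OF assms(2)])
    (rule is_weak_partial_unique[OF assms(1) _ assms(2)])

lemma is_weak_partial_test:
  assumes "test_function \<O> \<phi>" "i \<in> Basis"
  shows "is_weak_partial \<O> i (abs_l2 \<phi>) (abs_l2 (partial i \<phi>))"
  unfolding is_weak_partial_def
proof (intro conjI allI impI)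
  show "abs_l2 (partial i \<phi>) \<in> L2 \<O>" by (intro test_function_in_L2 test_function_partial assms)
  fix \<eta> assume \<eta>: "test_function \<O> \<eta>"
  note sq = test_function_sq_integrable
  show "inner (abs_l2 \<phi>) (abs_l2 (partial i \<eta>)) = - inner (abs_l2 (partial i \<phi>)) (abs_l2 \<eta>)"
    unfolding inner_abs_l2[OF sq[OF assms(1)] sq[OF test_function_partial[OF \<eta> assms(2)]]]
      inner_abs_l2[OF sq[OF test_function_partial[OF assms]] sq[OF \<eta>]]
    by (rule integration_by_parts[OF assms(1) \<eta> assms(2)])
qed

text \<open>Both sides of the defining identity are continuous in L^2, so weak differentiation is a
  closed operator.\<close>

lemma is_weak_partial_limit:
  assumes "\<And>n. is_weak_partial \<O> i (X n) (Y n)" "X \<longlonglongrightarrow> u" "Y \<longlonglongrightarrow> w"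
  shows "is_weak_partial \<O> i u w"
  unfolding is_weak_partial_def
proof (intro conjI allI impI)
  show "w \<in> L2 \<O>" by (rule L2_limit[OF is_weak_partialD(1)[OF assms(1)] assms(3)])
  fix \<phi> assume \<phi>: "test_function \<O> \<phi>"
  have "(\<lambda>n. inner (X n) (abs_l2 (partial i \<phi>))) \<longlonglongrightarrow> inner u (abs_l2 (partial i \<phi>))"
    by (intro tendsto_inner assms tendsto_const)
  moreover have "(\<lambda>n. inner (X n) (abs_l2 (partial i \<phi>))) \<longlonglongrightarrow> - inner w (abs_l2 \<phi>)"
  proof -
    have "inner (X n) (abs_l2 (partial i \<phi>)) = - inner (Y n) (abs_l2 \<phi>)" for n
      by (rule is_weak_partialD(2)[OF assms(1) \<phi>])
    then show ?thesis by (simp only:) (intro tendsto_minus tendsto_inner assms tendsto_const)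
  qed
  ultimately show "inner u (abs_l2 (partial i \<phi>)) = - inner w (abs_l2 \<phi>)"
    by (rule LIMSEQ_unique)
qed

text \<open>The limit of the classical partials is automatically the weak partial of the limit, so
  membership in \<open>H10\<close> follows from convergence alone.\<close>

lemma H10I:
  assumes \<O>: "open \<O>" and \<phi>: "\<And>n. test_function \<O> (\<phi> n)" and u: "(\<lambda>n. abs_l2 (\<phi> n)) \<longlonglongrightarrow> u"
    and w: "\<And>i. i \<in> Basis \<Longrightarrow> (\<lambda>n. abs_l2 (partial i (\<phi> n))) \<longlonglongrightarrow> w i"
  shows "u \<in> H10 \<O>" "\<And>i. i \<in> Basis \<Longrightarrow> weak_partial \<O> i u = w i"
proof -
  have wp: "is_weak_partial \<O> i u (w i)" if "i \<in> Basis" for i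
    by (rule is_weak_partial_limit[OF is_weak_partial_test[OF \<phi> that] u w[OF that]])
  then show eq: "\<And>i. i \<in> Basis \<Longrightarrow> weak_partial \<O> i u = w i"
    by (auto intro: weak_partial_eq[OF \<O>])
  have "u \<in> L2 \<O>" by (rule L2_limit[OF test_function_in_L2[OF \<phi>] u])
  then show "u \<in> H10 \<O>"
    unfolding H10_def H1_def using wp \<phi> u w eq by (auto intro!: exI[of _ \<phi>])
qed

lemma H10_approx:
  assumes "u \<in> H10 \<O>"
  obtains \<phi> where "\<And>n. test_function \<O> (\<phi> n)" "(\<lambda>n. abs_l2 (\<phi> n)) \<longlonglongrightarrow> u"
    "\<And>i. i \<in> Basis \<Longrightarrow> (\<lambda>n. abs_l2 (partial i (\<phi> n))) \<longlonglongrightarrow> weak_partial \<O> i u"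
  using assms unfolding H10_def by blast

lemma H10_subset_L2: "u \<in> H10 \<O> \<Longrightarrow> u \<in> L2 \<O>"
  by (simp add: H10_def H1_def)

lemma test_function_H10:
  assumes "open \<O>" "test_function \<O> \<phi>"
  shows "abs_l2 \<phi> \<in> H10 \<O>" "i \<in> Basis \<Longrightarrow> weak_partial \<O> i (abs_l2 \<phi>) = abs_l2 (partial i \<phi>)"
  using H10I[of \<O> "\<lambda>_. \<phi>", OF assms tendsto_const tendsto_const] by auto

lemma H10_add:
  assumes "open \<O>" "u \<in> H10 \<O>" "v \<in> H10 \<O>"
  shows "u + v \<in> H10 \<O>" "i \<in> Basis \<Longrightarrow> weak_partial \<O> i (u + v) = weak_partial \<O> i u + weak_partial \<O> i v"
proof -
  obtain \<phi> where \<phi>: "\<And>n. test_function \<O> (\<phi> n)" "(\<lambda>n. abs_l2 (\<phi> n)) \<longlonglongrightarrow> u"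
    "\<And>i. i \<in> Basis \<Longrightarrow> (\<lambda>n. abs_l2 (partial i (\<phi> n))) \<longlonglongrightarrow> weak_partial \<O> i u"
    by (rule H10_approx[OF assms(2)]) blast
  obtain \<eta> where \<eta>: "\<And>n. test_function \<O> (\<eta> n)" "(\<lambda>n. abs_l2 (\<eta> n)) \<longlonglongrightarrow> v"
    "\<And>i. i \<in> Basis \<Longrightarrow> (\<lambda>n. abs_l2 (partial i (\<eta> n))) \<longlonglongrightarrow> weak_partial \<O> i v"
    by (rule H10_approx[OF assms(3)]) blast
  have 1: "test_function \<O> (\<lambda>x. \<phi> n x + \<eta> n x)" for n by (rule test_function_add[OF \<phi>(1) \<eta>(1)])
  have 2: "(\<lambda>n. abs_l2 (\<lambda>x. \<phi> n x + \<eta> n x)) \<longlonglongrightarrow> u + v"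
    using tendsto_add[OF \<phi>(2) \<eta>(2)] by (simp add: abs_l2_add test_function_sq_integrable[OF \<phi>(1)] test_function_sq_integrable[OF \<eta>(1)])
  have 3: "(\<lambda>n. abs_l2 (partial i (\<lambda>x. \<phi> n x + \<eta> n x))) \<longlonglongrightarrow> weak_partial \<O> i u + weak_partial \<O> i v"
    if "i \<in> Basis" for i
  proof -
    have "partial i (\<lambda>x. \<phi> n x + \<eta> n x) = (\<lambda>x. partial i (\<phi> n) x + partial i (\<eta> n) x)" for n
      by (intro ext partial_add test_function_smooth(1)[OF \<phi>(1)] test_function_smooth(1)[OF \<eta>(1)])
    then show ?thesis
      using tendsto_add[OF \<phi>(3)[OF that] \<eta>(3)[OF that]]
      by (simp add: abs_l2_add test_function_sq_integrable[OF test_function_partial[OF \<phi>(1) that]]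
         test_function_sq_integrable[OF test_function_partial[OF \<eta>(1) that]])
  qed
  show "u + v \<in> H10 \<O>" "i \<in> Basis \<Longrightarrow> weak_partial \<O> i (u + v) = weak_partial \<O> i u + weak_partial \<O> i v"
    using H10I[OF assms(1) 1 2 3] by auto
qed

lemma H10_scaleR:
  assumes "open \<O>" "u \<in> H10 \<O>"
  shows "c *\<^sub>R u \<in> H10 \<O>" "i \<in> Basis \<Longrightarrow> weak_partial \<O> i (c *\<^sub>R u) = c *\<^sub>R weak_partial \<O> i u"
proof -
  obtain \<phi> where \<phi>: "\<And>n. test_function \<O> (\<phi> n)" "(\<lambda>n. abs_l2 (\<phi> n)) \<longlonglongrightarrow> u"
    "\<And>i. i \<in> Basis \<Longrightarrow> (\<lambda>n. abs_l2 (partial i (\<phi> n))) \<longlonglongrightarrow> weak_partial \<O> i u"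
    by (rule H10_approx[OF assms(2)]) blast
  have 1: "test_function \<O> (\<lambda>x. c * \<phi> n x)" for n by (rule test_function_scale[OF \<phi>(1)])
  have 2: "(\<lambda>n. abs_l2 (\<lambda>x. c * \<phi> n x)) \<longlonglongrightarrow> c *\<^sub>R u"
    using tendsto_scaleR[OF tendsto_const \<phi>(2), of c] by (simp add: abs_l2_scaleR test_function_sq_integrable[OF \<phi>(1)])
  have 3: "(\<lambda>n. abs_l2 (partial i (\<lambda>x. c * \<phi> n x))) \<longlonglongrightarrow> c *\<^sub>R weak_partial \<O> i u"
    if "i \<in> Basis" for i
  proof -
    have "partial i (\<lambda>x. c * \<phi> n x) = (\<lambda>x. c * partial i (\<phi> n) x)" for n
      by (rule ext, rule partial_compose[OF test_function_smooth(1)[OF \<phi>(1)], where h = "\<lambda>x. c * x"])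
        (auto intro!: derivative_eq_intros)
    then show ?thesis
      using tendsto_scaleR[OF tendsto_const \<phi>(3)[OF that], of c]
      by (simp add: abs_l2_scaleR test_function_sq_integrable[OF test_function_partial[OF \<phi>(1) that]])
  qed
  show "c *\<^sub>R u \<in> H10 \<O>" "i \<in> Basis \<Longrightarrow> weak_partial \<O> i (c *\<^sub>R u) = c *\<^sub>R weak_partial \<O> i u"
    using H10I[OF assms(1) 1 2 3] by auto
qed

lemma H10_diff:
  assumes "open \<O>" "u \<in> H10 \<O>" "v \<in> H10 \<O>"
  shows "u - v \<in> H10 \<O>" "i \<in> Basis \<Longrightarrow> weak_partial \<O> i (u - v) = weak_partial \<O> i u - weak_partial \<O> i v"
  using H10_add[OF assms(1,2) H10_scaleR(1)[OF assms(1,3), of "-1"]] H10_scaleR(2)[OF assms(1,3), of i "-1"]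
  by auto

lemma H10_zero:
  assumes "open \<O>"
  shows "0 \<in> H10 \<O>"
proof -
  have "test_function \<O> (\<lambda>_. 0)"
    by (rule test_functionI[of _ "{}"]) (auto simp: smooth_on_def Ck_on_const)
  then show ?thesis using H10_scaleR(1)[OF assms test_function_H10(1)[OF assms], of _ 0] by simp
qed

section \<open>The Dirichlet form and the completeness of \<open>H10\<close>\<close>

definition dirform :: "'a::euclidean_space set \<Rightarrow> 'a l2 \<Rightarrow> 'a l2 \<Rightarrow> real" where
  "dirform \<O> u v = (\<Sum>i\<in>Basis. inner (weak_partial \<O> i u) (weak_partial \<O> i v))"

lemma dirichlet_laplacian_dirform: "dirichlet_laplacian \<O> u v = - dirform \<O> u v"
  by (simp add: dirichlet_laplacian_def dirform_def)

lemma dirform_commute: "dirform \<O> u v = dirform \<O> v u"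
  unfolding dirform_def by (simp add: inner_commute)

lemma dirform_nonneg: "0 \<le> dirform \<O> u u"
  unfolding dirform_def by (intro sum_nonneg) simp

lemma dirform_add_left:
  assumes "open \<O>" "u \<in> H10 \<O>" "v \<in> H10 \<O>"
  shows "dirform \<O> (u + v) w = dirform \<O> u w + dirform \<O> v w"
  unfolding dirform_def sum.distrib[symmetric]
  by (rule sum.cong) (simp_all add: H10_add(2)[OF assms] inner_add_left)

lemma dirform_diff_left:
  assumes "open \<O>" "u \<in> H10 \<O>" "v \<in> H10 \<O>"
  shows "dirform \<O> (u - v) w = dirform \<O> u w - dirform \<O> v w"
  unfolding dirform_def sum_subtractf[symmetric]
  by (rule sum.cong) (simp_all add: H10_diff(2)[OF assms] inner_diff_left)

lemma dirform_scaleR_left: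
  assumes "open \<O>" "u \<in> H10 \<O>"
  shows "dirform \<O> (c *\<^sub>R u) w = c * dirform \<O> u w"
  unfolding dirform_def sum_distrib_left
  by (rule sum.cong) (simp_all add: H10_scaleR(2)[OF assms])

lemma dirform_add_right:
  assumes "open \<O>" "u \<in> H10 \<O>" "v \<in> H10 \<O>"
  shows "dirform \<O> w (u + v) = dirform \<O> w u + dirform \<O> w v"
  using dirform_add_left[OF assms] by (simp add: dirform_commute[of _ w])

lemma dirform_diff_right:
  assumes "open \<O>" "u \<in> H10 \<O>" "v \<in> H10 \<O>"
  shows "dirform \<O> w (u - v) = dirform \<O> w u - dirform \<O> w v"
  using dirform_diff_left[OF assms] by (simp add: dirform_commute[of _ w])

lemma dirform_scaleR_right:
  assumes "open \<O>" "u \<in> H10 \<O>"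
  shows "dirform \<O> w (c *\<^sub>R u) = c * dirform \<O> w u"
  using dirform_scaleR_left[OF assms] by (simp add: dirform_commute[of _ w])

lemma norm_weak_partial_le_dirform:
  assumes "i \<in> Basis"
  shows "(norm (weak_partial \<O> i u))\<^sup>2 \<le> dirform \<O> u u"
  unfolding dirform_def power2_norm_eq_inner
  by (rule member_le_sum) (use assms in auto)

text \<open>A diagonal choice: each term is replaced by a test function that is within 1/(n+1) of it
  together with all partials.\<close>

lemma H10_closed:
  assumes \<O>: "open \<O>" and X: "\<And>n. X n \<in> H10 \<O>" and u: "X \<longlonglongrightarrow> u"
    and w: "\<And>i. i \<in> Basis \<Longrightarrow> (\<lambda>n. weak_partial \<O> i (X n)) \<longlonglongrightarrow> w i"
  shows "u \<in> H10 \<O>" "\<And>i. i \<in> Basis \<Longrightarrow> weak_partial \<O> i u = w i"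
proof -
  have "\<exists>\<phi>. test_function \<O> \<phi> \<and> norm (abs_l2 \<phi> - X n) < inverse (real (Suc n)) \<and>
      (\<forall>i\<in>Basis. norm (abs_l2 (partial i \<phi>) - weak_partial \<O> i (X n)) < inverse (real (Suc n)))" for n
  proof -
    obtain \<phi> where \<phi>: "\<And>n. test_function \<O> (\<phi> n)" "(\<lambda>n. abs_l2 (\<phi> n)) \<longlonglongrightarrow> X n"
      "\<And>i. i \<in> Basis \<Longrightarrow> (\<lambda>n. abs_l2 (partial i (\<phi> n))) \<longlonglongrightarrow> weak_partial \<O> i (X n)"
      by (rule H10_approx[OF X[of n]]) blast
    have e: "inverse (real (Suc n)) > 0" by simp
    have "\<forall>\<^sub>F k in sequentially. norm (abs_l2 (\<phi> k) - X n) < inverse (real (Suc n))"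
      using tendstoD[OF \<phi>(2) e] by (simp add: dist_norm)
    moreover have "\<forall>\<^sub>F k in sequentially. \<forall>i\<in>Basis. norm (abs_l2 (partial i (\<phi> k)) - weak_partial \<O> i (X n)) < inverse (real (Suc n))"
      using tendstoD[OF \<phi>(3) e] by (intro eventually_ball_finite) (auto simp: dist_norm)
    ultimately have "\<forall>\<^sub>F k in sequentially. norm (abs_l2 (\<phi> k) - X n) < inverse (real (Suc n)) \<and>
      (\<forall>i\<in>Basis. norm (abs_l2 (partial i (\<phi> k)) - weak_partial \<O> i (X n)) < inverse (real (Suc n)))"
      by (rule eventually_conj)
    then obtain k where "norm (abs_l2 (\<phi> k) - X n) < inverse (real (Suc n)) \<and>
      (\<forall>i\<in>Basis. norm (abs_l2 (partial i (\<phi> k)) - weak_partial \<O> i (X n)) < inverse (real (Suc n)))"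
      using eventually_happens'[OF sequentially_bot] by blast
    with \<phi>(1) show ?thesis by blast
  qed
  then obtain \<phi> where \<phi>: "\<And>n. test_function \<O> (\<phi> n)"
    "\<And>n. norm (abs_l2 (\<phi> n) - X n) < inverse (real (Suc n))"
    "\<And>n i. i \<in> Basis \<Longrightarrow> norm (abs_l2 (partial i (\<phi> n)) - weak_partial \<O> i (X n)) < inverse (real (Suc n))"
    by metis
  have "(\<lambda>n. abs_l2 (\<phi> n) - X n) \<longlonglongrightarrow> 0"
    by (rule Lim_null_comparison[OF always_eventually LIMSEQ_inverse_real_of_nat]) (use \<phi>(2) in \<open>auto intro: less_imp_le\<close>)
  from tendsto_add[OF this u] have 1: "(\<lambda>n. abs_l2 (\<phi> n)) \<longlonglongrightarrow> u" by simp
  have 2: "(\<lambda>n. abs_l2 (partial i (\<phi> n))) \<longlonglongrightarrow> w i" if i: "i \<in> Basis" for i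
  proof -
    have "(\<lambda>n. abs_l2 (partial i (\<phi> n)) - weak_partial \<O> i (X n)) \<longlonglongrightarrow> 0"
      by (rule Lim_null_comparison[OF always_eventually LIMSEQ_inverse_real_of_nat]) (use \<phi>(3)[OF i] in \<open>auto intro: less_imp_le\<close>)
    from tendsto_add[OF this w[OF i]] show ?thesis by simp
  qed
  show "u \<in> H10 \<O>" "\<And>i. i \<in> Basis \<Longrightarrow> weak_partial \<O> i u = w i"
    using H10I[OF \<O> \<phi>(1) 1 2] by auto
qed

lemma Cauchy_if_norm_sq_le:
  fixes X :: "nat \<Rightarrow> 'a::real_normed_vector"
  assumes "\<And>e. e > 0 \<Longrightarrow> \<exists>N. \<forall>m\<ge>N. \<forall>n\<ge>N. (norm (X m - X n))\<^sup>2 < e"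
  shows "Cauchy X"
proof (rule CauchyI)
  fix e :: real assume "e > 0"
  then obtain N where N: "\<forall>m\<ge>N. \<forall>n\<ge>N. (norm (X m - X n))\<^sup>2 < e\<^sup>2" using assms[of "e\<^sup>2"] by auto
  then have "\<forall>m\<ge>N. \<forall>n\<ge>N. norm (X m - X n) < e" using \<open>e > 0\<close> power2_less_imp_less by fastforce
  then show "\<exists>M. \<forall>m\<ge>M. \<forall>n\<ge>M. norm (X m - X n) < e" by blast
qed

text \<open>Cauchy estimates arise in exactly this squared energy norm: for the minimising sequences
  of the first eigenvalue and of \<open>lax_milgram\<close>, and for the approximate solutions in
  \<open>solve_monotone\<close>.\<close>

lemma H10_complete:
  assumes \<O>: "open \<O>" and X: "\<And>n. X n \<in> H10 \<O>"
    and C: "\<And>e. e > 0 \<Longrightarrow> \<exists>N. \<forall>m\<ge>N. \<forall>n\<ge>N. (norm (X m - X n))\<^sup>2 + dirform \<O> (X m - X n) (X m - X n) < e"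
  obtains u where "u \<in> H10 \<O>" "X \<longlonglongrightarrow> u" "\<And>i. i \<in> Basis \<Longrightarrow> (\<lambda>n. weak_partial \<O> i (X n)) \<longlonglongrightarrow> weak_partial \<O> i u"
proof -
  have "Cauchy X"
  proof (rule Cauchy_if_norm_sq_le)
    fix e :: real assume "e > 0"
    from C[OF this] obtain N where N: "\<forall>m\<ge>N. \<forall>n\<ge>N. (norm (X m - X n))\<^sup>2 + dirform \<O> (X m - X n) (X m - X n) < e" by blast
    have "(norm (X m - X n))\<^sup>2 < e" if "m \<ge> N" "n \<ge> N" for m n
    proof -
      have "(norm (X m - X n))\<^sup>2 \<le> (norm (X m - X n))\<^sup>2 + dirform \<O> (X m - X n) (X m - X n)"
        by (simp add: dirform_nonneg)
      also have "\<dots> < e" using N that by blast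
      finally show ?thesis .
    qed
    then show "\<exists>N. \<forall>m\<ge>N. \<forall>n\<ge>N. (norm (X m - X n))\<^sup>2 < e" by blast
  qed
  then obtain u where u: "X \<longlonglongrightarrow> u" using Cauchy_convergent_iff convergent_def by blast
  have "\<exists>w. (\<lambda>n. weak_partial \<O> i (X n)) \<longlonglongrightarrow> w" if i: "i \<in> Basis" for i
  proof -
    have "Cauchy (\<lambda>n. weak_partial \<O> i (X n))"
    proof (rule Cauchy_if_norm_sq_le)
      fix e :: real assume "e > 0"
      from C[OF this] obtain N where N: "\<forall>m\<ge>N. \<forall>n\<ge>N. (norm (X m - X n))\<^sup>2 + dirform \<O> (X m - X n) (X m - X n) < e" by blast
      have "(norm (weak_partial \<O> i (X m) - weak_partial \<O> i (X n)))\<^sup>2 < e" if "m \<ge> N" "n \<ge> N" for m n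
      proof -
        have "(norm (weak_partial \<O> i (X m) - weak_partial \<O> i (X n)))\<^sup>2 \<le> dirform \<O> (X m - X n) (X m - X n)"
          using norm_weak_partial_le_dirform[OF i, of \<O> "X m - X n"] H10_diff(2)[OF \<O> X X i] by simp
        also have "\<dots> \<le> (norm (X m - X n))\<^sup>2 + dirform \<O> (X m - X n) (X m - X n)" by simp
        also have "\<dots> < e" using N that by blast
        finally show ?thesis .
      qed
      then show "\<exists>N. \<forall>m\<ge>N. \<forall>n\<ge>N. (norm (weak_partial \<O> i (X m) - weak_partial \<O> i (X n)))\<^sup>2 < e" by blast
    qed
    then show ?thesis using Cauchy_convergent_iff convergent_def by blast
  qed
  then obtain w where w: "\<And>i. i \<in> Basis \<Longrightarrow> (\<lambda>n. weak_partial \<O> i (X n)) \<longlonglongrightarrow> w i" by metis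
  show ?thesis using H10_closed[OF \<O> X u w] w u by (intro that[of u]) auto
qed

lemma dirform_tendsto:
  assumes "\<And>i. i \<in> Basis \<Longrightarrow> (\<lambda>n. weak_partial \<O> i (X n)) \<longlonglongrightarrow> weak_partial \<O> i u"
    and "\<And>i. i \<in> Basis \<Longrightarrow> (\<lambda>n. weak_partial \<O> i (Y n)) \<longlonglongrightarrow> weak_partial \<O> i v"
  shows "(\<lambda>n. dirform \<O> (X n) (Y n)) \<longlonglongrightarrow> dirform \<O> u v"
  unfolding dirform_def by (intro tendsto_sum tendsto_inner assms)

subsection \<open>Superposition operators\<close>

definition comp_l2 :: "(real \<Rightarrow> real) \<Rightarrow> 'a::euclidean_space l2 \<Rightarrow> 'a l2" where
  "comp_l2 h u = abs_l2 (\<lambda>x. h (rep_l2 u x))"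

lemma sq_integrable_comp:
  assumes "h \<in> borel_measurable borel" "\<And>s. \<bar>h s\<bar> \<le> M * \<bar>s\<bar>" "sq_integrable f"
  shows "sq_integrable (\<lambda>x. h (f x))"
proof (rule sq_integrable_bound[OF sq_integrable_scale[OF assms(3), of M]])
  show "(\<lambda>x. h (f x)) \<in> borel_measurable borel"
    using assms(1,3) by (auto simp: sq_integrable_def)
  show "AE x in lborel. \<bar>h (f x)\<bar> \<le> \<bar>M * f x\<bar>"
  proof (rule AE_I2)
    fix x
    have "\<bar>h (f x)\<bar> \<le> M * \<bar>f x\<bar>" by (rule assms(2))
    also have "\<dots> \<le> \<bar>M * f x\<bar>" by (simp add: abs_mult mult_right_mono)
    finally show "\<bar>h (f x)\<bar> \<le> \<bar>M * f x\<bar>" .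
  qed
qed

lemma norm_abs_l2_comp_diff:
  assumes h: "h \<in> borel_measurable borel" "\<And>s t. \<bar>h s - h t\<bar> \<le> M * \<bar>s - t\<bar>" "h 0 = 0"
    and fg: "sq_integrable f" "sq_integrable g"
  shows "norm (abs_l2 (\<lambda>x. h (f x)) - abs_l2 (\<lambda>x. h (g x))) \<le> M * norm (abs_l2 f - abs_l2 g)"
proof -
  have M: "M \<ge> 0" using h(2)[of 1 0] by auto
  have b: "\<bar>h s\<bar> \<le> M * \<bar>s\<bar>" for s using h(2)[of s 0] h(3) by simp
  have [simp]: "sq_integrable (\<lambda>x. h (f x))" "sq_integrable (\<lambda>x. h (g x))"
    using sq_integrable_comp[OF h(1) b] fg by auto
  have "norm (abs_l2 (\<lambda>x. h (f x) - h (g x))) \<le> norm (abs_l2 (\<lambda>x. M * (f x - g x)))"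
  proof (rule norm_abs_l2_mono)
    show "sq_integrable (\<lambda>x. M * (f x - g x))" by (intro sq_integrable_scale sq_integrable_diff fg)
    show "(\<lambda>x. h (f x) - h (g x)) \<in> borel_measurable borel"
      using h(1) fg by (auto simp: sq_integrable_def)
    show "AE x in lborel. \<bar>h (f x) - h (g x)\<bar> \<le> \<bar>M * (f x - g x)\<bar>"
      using h(2) M by (auto simp: abs_mult)
  qed
  also have "abs_l2 (\<lambda>x. M * (f x - g x)) = M *\<^sub>R (abs_l2 f - abs_l2 g)"
    by (simp add: abs_l2_diff fg abs_l2_scaleR sq_integrable_diff)
  finally show ?thesis using M by (simp add: abs_l2_diff)
qed

lemma comp_l2_lipschitz:
  assumes "h \<in> borel_measurable borel" "\<And>s t. \<bar>h s - h t\<bar> \<le> M * \<bar>s - t\<bar>" "h 0 = 0"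
  shows "norm (comp_l2 h u - comp_l2 h v) \<le> M * norm (u - v)"
  unfolding comp_l2_def using norm_abs_l2_comp_diff[OF assms, of "rep_l2 u" "rep_l2 v"] by simp

lemma norm_abs_l2_tendsto_0:
  fixes g :: "nat \<Rightarrow> 'a::euclidean_space \<Rightarrow> real"
  assumes [measurable]: "\<And>n. g n \<in> borel_measurable borel" and w: "sq_integrable w"
    and "\<And>n. AE x in lborel. \<bar>g n x\<bar> \<le> \<bar>w x\<bar>" "AE x in lborel. (\<lambda>n. g n x) \<longlonglongrightarrow> 0"
  shows "(\<lambda>n. norm (abs_l2 (g n))) \<longlonglongrightarrow> 0"
proof -
  have g: "sq_integrable (g n)" for n by (rule sq_integrable_bound[OF w]) (use assms in auto)
  have "(\<lambda>n. \<integral>x. (g n x)\<^sup>2 \<partial>lborel) \<longlonglongrightarrow> (\<integral>x. 0 \<partial>(lborel :: 'a measure))"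
  proof (rule integral_dominated_convergence[where w = "\<lambda>x. (w x)\<^sup>2"])
    show "integrable lborel (\<lambda>x. (w x)\<^sup>2)" using w by (simp add: sq_integrable_def)
    show "AE x in lborel. (\<lambda>n. (g n x)\<^sup>2) \<longlonglongrightarrow> 0"
      using assms(4) by eventually_elim (auto intro: tendsto_eq_intros)
    show "AE x in lborel. norm ((g n x)\<^sup>2) \<le> (w x)\<^sup>2" for n
      using assms(3)[of n] by eventually_elim (simp add: abs_le_square_iff[symmetric])
  qed auto
  then have "(\<lambda>n. (norm (abs_l2 (g n)))\<^sup>2) \<longlonglongrightarrow> 0" by (simp add: norm_abs_l2_sq[OF g])
  from tendsto_real_sqrt[OF this] show ?thesis by simp
qed

text \<open>Composing the approximating test functions with h gives test functions again, since h 0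
  = 0 keeps the support. Their partials are products of h'(\<phi>), bounded and convergent almost
  everywhere, with the partials of \<phi>, convergent in L^2.\<close>

lemma H10_chain_rule:
  assumes \<O>: "open \<O>" and u: "u \<in> H10 \<O>" and h: "smooth1 h" "h 0 = 0"
    and h': "\<And>x. (h has_real_derivative h' x) (at x)" "\<And>x. \<bar>h' x\<bar> \<le> M"
  shows "comp_l2 h u \<in> H10 \<O>"
    "i \<in> Basis \<Longrightarrow> weak_partial \<O> i (comp_l2 h u) = abs_l2 (\<lambda>x. h' (rep_l2 u x) * rep_l2 (weak_partial \<O> i u) x)"
proof -
  have cont_h': "continuous_on UNIV h'"
  proof -
    obtain k where k: "smooth1 k" "\<And>x. (h has_real_derivative k x) (at x)"
      by (rule smooth1_deriv[OF h(1)]) blast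
    have "h' = k" using DERIV_unique[OF h'(1) k(2)] by auto
    then show ?thesis using smooth1_continuous[OF k(1)] by simp
  qed
  have mh [measurable]: "h \<in> borel_measurable borel" "h' \<in> borel_measurable borel"
    using smooth1_continuous[OF h(1), of UNIV] cont_h' by (auto intro: borel_measurable_continuous_onI)
  have lip: "\<bar>h s - h t\<bar> \<le> M * \<bar>s - t\<bar>" for s t
    using field_differentiable_bound[of UNIV h h' M s t] h' by auto
  have M: "M \<ge> 0" using h'(2)[of 0] by auto
  obtain \<phi> where \<phi>: "\<And>n. test_function \<O> (\<phi> n)" "(\<lambda>n. abs_l2 (\<phi> n)) \<longlonglongrightarrow> u"
    "\<And>i. i \<in> Basis \<Longrightarrow> (\<lambda>n. abs_l2 (partial i (\<phi> n))) \<longlonglongrightarrow> weak_partial \<O> i u"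
    by (rule H10_approx[OF u]) blast
  \<comment> \<open>The argument of h' converges pointwise only along a subsequence.\<close>
  obtain r :: "nat \<Rightarrow> nat" where r: "strict_mono r"
    "AE x in lborel. (\<lambda>n. rep_l2 (abs_l2 (\<phi> (r n))) x) \<longlonglongrightarrow> rep_l2 u x"
    by (rule l2_tendsto_AE_subseq[OF \<phi>(2)])
  have "AE x in lborel. \<forall>n. rep_l2 (abs_l2 (\<phi> n)) x = \<phi> n x"
    unfolding AE_all_countable by (intro allI rep_abs_l2 test_function_sq_integrable[OF \<phi>(1)])
  with r(2) have ae: "AE x in lborel. (\<lambda>n. \<phi> (r n) x) \<longlonglongrightarrow> rep_l2 u x"
    by eventually_elim simp
  have sqi [simp]: "sq_integrable (\<phi> n)" for n
    by (rule test_function_sq_integrable[OF \<phi>(1)])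
  have sqp [simp]: "sq_integrable (partial i (\<phi> n))" if "i \<in> Basis" for n i
    by (rule test_function_sq_integrable[OF test_function_partial[OF \<phi>(1) that]])
  have ms [measurable]: "\<phi> n \<in> borel_measurable borel" for n by (rule test_function_measurable[OF \<phi>(1)])
  define \<eta> where "\<eta> n x = h (\<phi> (r n) x)" for n x
  have 1: "test_function \<O> (\<eta> n)" for n unfolding \<eta>_def by (rule test_function_compose[OF \<phi>(1) h])
  have 2: "(\<lambda>n. abs_l2 (\<eta> n)) \<longlonglongrightarrow> comp_l2 h u"
  proof (rule LIM_zero_cancel, rule Lim_null_comparison[OF always_eventually])
    show "\<forall>n. norm (abs_l2 (\<eta> n) - comp_l2 h u) \<le> M * norm (abs_l2 (\<phi> (r n)) - u)"
      unfolding \<eta>_def comp_l2_def using norm_abs_l2_comp_diff[OF mh(1) lip h(2), of _ "rep_l2 u"] by auto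
    have "(\<lambda>n. M * norm (abs_l2 (\<phi> (r n)) - u)) \<longlonglongrightarrow> M * norm (u - u)"
      using LIMSEQ_subseq_LIMSEQ[OF \<phi>(2) r(1)] by (intro tendsto_intros) (simp add: comp_def)
    then show "(\<lambda>n. M * norm (abs_l2 (\<phi> (r n)) - u)) \<longlonglongrightarrow> 0" by simp
  qed
  have 3: "(\<lambda>n. abs_l2 (partial i (\<eta> n))) \<longlonglongrightarrow> abs_l2 (\<lambda>x. h' (rep_l2 u x) * rep_l2 (weak_partial \<O> i u) x)"
    if i: "i \<in> Basis" for i
  proof -
    let ?w = "rep_l2 (weak_partial \<O> i u)"
    have mp [measurable]: "partial i (\<phi> n) \<in> borel_measurable borel" for n
      by (rule test_function_measurable[OF test_function_partial[OF \<phi>(1) i]])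
    have p: "partial i (\<eta> n) = (\<lambda>x. h' (\<phi> (r n) x) * partial i (\<phi> (r n)) x)" for n
      unfolding \<eta>_def by (intro ext partial_compose test_function_smooth(1)[OF \<phi>(1)] h'(1))
    have sq1: "sq_integrable (\<lambda>x. h' (k x) * l x)" if [measurable]: "k \<in> borel_measurable borel" and l: "sq_integrable l" for k l
    proof (rule sq_integrable_bound[OF sq_integrable_scale[OF l, of M]])
      show "(\<lambda>x. h' (k x) * l x) \<in> borel_measurable borel" using l by (auto simp: sq_integrable_def)
      show "AE x in lborel. \<bar>h' (k x) * l x\<bar> \<le> \<bar>M * l x\<bar>"
        using h'(2) M by (auto simp: abs_mult intro!: mult_right_mono)
    qed
    \<comment> \<open>The bounded factor h' is carried along while the partials converge in
      L^2.\<close>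
    have d1: "(\<lambda>n. norm (abs_l2 (\<lambda>x. h' (\<phi> (r n) x) * (partial i (\<phi> (r n)) x - ?w x)))) \<longlonglongrightarrow> 0"
    proof (rule tendsto_sandwich[OF always_eventually always_eventually tendsto_const])
      show "\<forall>n. norm (abs_l2 (\<lambda>x. h' (\<phi> (r n) x) * (partial i (\<phi> (r n)) x - ?w x))) \<le> M * norm (abs_l2 (partial i (\<phi> (r n))) - weak_partial \<O> i u)"
      proof
        fix n
        have "norm (abs_l2 (\<lambda>x. h' (\<phi> (r n) x) * (partial i (\<phi> (r n)) x - ?w x))) \<le> norm (abs_l2 (\<lambda>x. M * (partial i (\<phi> (r n)) x - ?w x)))"
        proof (rule norm_abs_l2_mono)
          show "AE x in lborel. \<bar>h' (\<phi> (r n) x) * (partial i (\<phi> (r n)) x - ?w x)\<bar> \<le> \<bar>M * (partial i (\<phi> (r n)) x - ?w x)\<bar>"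
            using h'(2) M by (auto simp: abs_mult intro!: mult_right_mono)
          show "sq_integrable (\<lambda>x. M * (partial i (\<phi> (r n)) x - ?w x))"
            using i by (intro sq_integrable_scale sq_integrable_diff) auto
        qed measurable
        also have "abs_l2 (\<lambda>x. M * (partial i (\<phi> (r n)) x - ?w x)) = M *\<^sub>R (abs_l2 (partial i (\<phi> (r n))) - abs_l2 ?w)"
          using i by (subst abs_l2_diff) (auto simp: abs_l2_scaleR sq_integrable_diff)
        finally show "norm (abs_l2 (\<lambda>x. h' (\<phi> (r n) x) * (partial i (\<phi> (r n)) x - ?w x))) \<le> M * norm (abs_l2 (partial i (\<phi> (r n))) - weak_partial \<O> i u)"
          using M by simp
      qed
      have "(\<lambda>n. M * norm (abs_l2 (partial i (\<phi> (r n))) - weak_partial \<O> i u)) \<longlonglongrightarrow> M * norm (weak_partial \<O> i u - weak_partial \<O> i u)"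
        using LIMSEQ_subseq_LIMSEQ[OF \<phi>(3)[OF i] r(1)] by (intro tendsto_intros) (simp add: comp_def)
      then show "(\<lambda>n. M * norm (abs_l2 (partial i (\<phi> (r n))) - weak_partial \<O> i u)) \<longlonglongrightarrow> 0" by simp
    qed simp
    \<comment> \<open>Here the partial is frozen at its limit; the factor in front tends to 0 almost
      everywhere by continuity of h', and 2 M times the partial dominates.\<close>
    have d2: "(\<lambda>n. norm (abs_l2 (\<lambda>x. (h' (\<phi> (r n) x) - h' (rep_l2 u x)) * ?w x))) \<longlonglongrightarrow> 0"
    proof (rule norm_abs_l2_tendsto_0)
      show "sq_integrable (\<lambda>x. (2 * M) * ?w x)" by (intro sq_integrable_scale) simp
      show "AE x in lborel. \<bar>(h' (\<phi> (r n) x) - h' (rep_l2 u x)) * ?w x\<bar> \<le> \<bar>2 * M * ?w x\<bar>" for n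
      proof (rule AE_I2)
        fix x
        have "\<bar>h' (\<phi> (r n) x) - h' (rep_l2 u x)\<bar> \<le> 2 * M"
          using h'(2)[of "\<phi> (r n) x"] h'(2)[of "rep_l2 u x"] by linarith
        then show "\<bar>(h' (\<phi> (r n) x) - h' (rep_l2 u x)) * ?w x\<bar> \<le> \<bar>2 * M * ?w x\<bar>"
          using M by (simp add: abs_mult mult_right_mono)
      qed
      show "AE x in lborel. (\<lambda>n. (h' (\<phi> (r n) x) - h' (rep_l2 u x)) * ?w x) \<longlonglongrightarrow> 0"
        using ae
      proof eventually_elim
        case (elim x)
        have "(\<lambda>n. h' (\<phi> (r n) x)) \<longlonglongrightarrow> h' (rep_l2 u x)"
          using continuous_on_tendsto_compose[OF cont_h' elim] by simp
        from tendsto_mult_right[OF tendsto_diff[OF this tendsto_const[of "h' (rep_l2 u x)"]], of "?w x"] show ?case by simp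
      qed
    qed measurable
    have sum_eq: "abs_l2 (partial i (\<eta> n)) - abs_l2 (\<lambda>x. h' (rep_l2 u x) * ?w x) =
       abs_l2 (\<lambda>x. h' (\<phi> (r n) x) * (partial i (\<phi> (r n)) x - ?w x)) + abs_l2 (\<lambda>x. (h' (\<phi> (r n) x) - h' (rep_l2 u x)) * ?w x)" for n
    proof -
      have s: "sq_integrable (\<lambda>x. h' (\<phi> (r n) x) * partial i (\<phi> (r n)) x)" "sq_integrable (\<lambda>x. h' (rep_l2 u x) * ?w x)"
         "sq_integrable (\<lambda>x. h' (\<phi> (r n) x) * ?w x)" "sq_integrable (\<lambda>x. h' (\<phi> (r n) x) * (partial i (\<phi> (r n)) x - ?w x))"
        using i by (auto intro!: sq1 sq_integrable_diff)
      have s5: "sq_integrable (\<lambda>x. (h' (\<phi> (r n) x) - h' (rep_l2 u x)) * ?w x)"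
        using sq_integrable_diff[OF s(3,2)] by (simp add: left_diff_distrib)
      show ?thesis unfolding p abs_l2_diff[OF s(1,2)] abs_l2_add[OF s(4) s5] by (simp add: algebra_simps)
    qed
    have lim0: "(\<lambda>n. abs_l2 (\<lambda>x. h' (\<phi> (r n) x) * (partial i (\<phi> (r n)) x - ?w x)) + abs_l2 (\<lambda>x. (h' (\<phi> (r n) x) - h' (rep_l2 u x)) * ?w x)) \<longlonglongrightarrow> 0 + 0"
      using d1 d2 by (intro tendsto_add) (auto simp only: tendsto_norm_zero_iff)
    have eq: "(\<lambda>n. abs_l2 (partial i (\<eta> n)) - abs_l2 (\<lambda>x. h' (rep_l2 u x) * ?w x)) =
       (\<lambda>n. abs_l2 (\<lambda>x. h' (\<phi> (r n) x) * (partial i (\<phi> (r n)) x - ?w x)) + abs_l2 (\<lambda>x. (h' (\<phi> (r n) x) - h' (rep_l2 u x)) * ?w x))"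
      by (rule ext) (rule sum_eq)
    show ?thesis by (rule LIM_zero_cancel, unfold eq, rule lim0[unfolded add_0_left])
  qed
  show "comp_l2 h u \<in> H10 \<O>"
    "i \<in> Basis \<Longrightarrow> weak_partial \<O> i (comp_l2 h u) = abs_l2 (\<lambda>x. h' (rep_l2 u x) * rep_l2 (weak_partial \<O> i u) x)"
    using H10I[OF \<O> 1 2 3] by auto
qed

subsection \<open>Compactness of the embedding into the square-integrable functions\<close>

lemma nn_integral_translate:
  fixes f :: "'a::euclidean_space \<Rightarrow> ennreal"
  assumes "f \<in> borel_measurable borel"
  shows "(\<integral>\<^sup>+x. f (x + z) \<partial>lborel) = (\<integral>\<^sup>+x. f x \<partial>lborel)"
proof -
  have "(\<integral>\<^sup>+x. f x \<partial>lborel) = (\<integral>\<^sup>+x. f x \<partial>distr lborel borel ((+) z))" by (simp add: lborel_distr_plus)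
  also have "\<dots> = (\<integral>\<^sup>+x. f (z + x) \<partial>lborel)" using assms by (intro nn_integral_distr) auto
  finally show ?thesis by (simp add: add.commute)
qed

lemma sq_integrable_translate:
  fixes f :: "'a::euclidean_space \<Rightarrow> real"
  assumes "sq_integrable f"
  shows "sq_integrable (\<lambda>x. f (x + z))"
proof -
  have "(\<integral>\<^sup>+x. ennreal ((f (x + z))\<^sup>2) \<partial>lborel) = (\<integral>\<^sup>+x. ennreal ((f x)\<^sup>2) \<partial>lborel)"
    using assms by (intro nn_integral_translate[of "\<lambda>x. ennreal ((f x)\<^sup>2)"]) (auto simp: sq_integrable_def)
  also have "\<dots> = ennreal (\<integral>x. (f x)\<^sup>2 \<partial>lborel)"
    using assms by (intro nn_integral_eq_integral) (auto simp: sq_integrable_def)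
  finally show ?thesis
    using assms by (intro sq_integrable_of_nn_integral) (auto simp: sq_integrable_def)
qed

lemma norm_abs_l2_translate:
  fixes f :: "'a::euclidean_space \<Rightarrow> real"
  assumes "sq_integrable f"
  shows "norm (abs_l2 (\<lambda>x. f (x + z))) = norm (abs_l2 f)"
proof -
  have "(norm (abs_l2 (\<lambda>x. f (x + z))))\<^sup>2 = (norm (abs_l2 f))\<^sup>2"
    unfolding norm_abs_l2_sq[OF sq_integrable_translate[OF assms]] norm_abs_l2_sq[OF assms]
    using assms by (intro lborel_integral_translate[of "\<lambda>x. (f x)\<^sup>2"]) (auto simp: sq_integrable_def)
  then show ?thesis by simp
qed

lemma directional_eq_sum:
  assumes "test_function \<O> \<phi>"
  shows "frechet_derivative \<phi> (at x) z = (\<Sum>i\<in>Basis. (z \<bullet> i) * partial i \<phi> x)"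
proof -
  have lin: "linear (frechet_derivative \<phi> (at x))"
    using partial_works[OF test_function_smooth(1)[OF assms]] by (rule has_derivative_linear)
  have "frechet_derivative \<phi> (at x) z = frechet_derivative \<phi> (at x) (\<Sum>i\<in>Basis. (z \<bullet> i) *\<^sub>R i)"
    by (simp add: euclidean_representation)
  also have "\<dots> = (\<Sum>i\<in>Basis. (z \<bullet> i) * partial i \<phi> x)"
    by (simp add: linear_sum[OF lin] linear_scale[OF lin])
  finally show ?thesis .
qed

lemma directional_test_function:
  assumes "test_function \<O> \<phi>"
  shows "test_function \<O> (\<lambda>x. frechet_derivative \<phi> (at x) z)"
proof -
  have "test_function \<O> (\<lambda>x. \<Sum>i\<in>B. (z \<bullet> i) * partial i \<phi> x)" if "finite B" "B \<subseteq> Basis" for B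
    using that
  proof (induction B rule: finite_induct)
    case empty
    then show ?case using test_function_scale[OF assms, of 0] by simp
  next
    case (insert i B)
    have i: "i \<in> Basis" using insert by blast
    have "test_function \<O> (\<lambda>x. (z \<bullet> i) * partial i \<phi> x + (\<Sum>i\<in>B. (z \<bullet> i) * partial i \<phi> x))"
      using insert by (intro test_function_add test_function_scale test_function_partial assms i) auto
    then show ?case using insert by simp
  qed
  then have "test_function \<O> (\<lambda>x. \<Sum>i\<in>Basis. (z \<bullet> i) * partial i \<phi> x)" by simp
  moreover have "(\<lambda>x. frechet_derivative \<phi> (at x) z) = (\<lambda>x. \<Sum>i\<in>Basis. (z \<bullet> i) * partial i \<phi> x)"
    by (rule ext) (rule directional_eq_sum[OF assms])
  ultimately show ?thesis by (simp only:)
qed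

lemma norm_directional_le:
  assumes \<O>: "open \<O>" and \<phi>: "test_function \<O> \<phi>"
  shows "(norm (abs_l2 (\<lambda>x. frechet_derivative \<phi> (at x) z)))\<^sup>2 \<le> (norm z)\<^sup>2 * dirform \<O> (abs_l2 \<phi>) (abs_l2 \<phi>)"
proof -
  have int: "integrable lborel (\<lambda>x. (partial i \<phi> x)\<^sup>2)" if "i \<in> Basis" for i
    using test_function_sq_integrable[OF test_function_partial[OF \<phi> that]] by (simp add: sq_integrable_def)
  have "(norm (abs_l2 (\<lambda>x. frechet_derivative \<phi> (at x) z)))\<^sup>2 = (\<integral>x. (frechet_derivative \<phi> (at x) z)\<^sup>2 \<partial>lborel)"
    by (rule norm_abs_l2_sq[OF test_function_sq_integrable[OF directional_test_function[OF \<phi>]]])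
  also have "\<dots> \<le> (\<integral>x. (norm z)\<^sup>2 * (\<Sum>i\<in>Basis. (partial i \<phi> x)\<^sup>2) \<partial>lborel)"
  proof (rule integral_mono)
    show "integrable lborel (\<lambda>x. (frechet_derivative \<phi> (at x) z)\<^sup>2)"
      using test_function_sq_integrable[OF directional_test_function[OF \<phi>, of z]] by (simp add: sq_integrable_def)
    show "integrable lborel (\<lambda>x. (norm z)\<^sup>2 * (\<Sum>i\<in>Basis. (partial i \<phi> x)\<^sup>2))"
      by (intro integrable_mult_right Bochner_Integration.integrable_sum int)
    fix x
    have "(\<Sum>i\<in>Basis. (z \<bullet> i) * partial i \<phi> x)\<^sup>2 \<le> (\<Sum>i\<in>Basis. (z \<bullet> i)\<^sup>2) * (\<Sum>i\<in>Basis. (partial i \<phi> x)\<^sup>2)"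
      by (rule Cauchy_Schwarz_ineq_sum)
    also have "(\<Sum>i\<in>Basis. (z \<bullet> i)\<^sup>2) = (norm z)\<^sup>2"
      unfolding power2_norm_eq_inner euclidean_inner[of z z] by (simp add: power2_eq_square)
    finally show "(frechet_derivative \<phi> (at x) z)\<^sup>2 \<le> (norm z)\<^sup>2 * (\<Sum>i\<in>Basis. (partial i \<phi> x)\<^sup>2)"
      using directional_eq_sum[OF \<phi>, of x z] by (simp only:)
  qed
  also have "\<dots> = (norm z)\<^sup>2 * (\<Sum>i\<in>Basis. \<integral>x. (partial i \<phi> x)\<^sup>2 \<partial>lborel)"
    using int by (simp add: Bochner_Integration.integral_sum)
  also have "(\<Sum>i\<in>Basis. \<integral>x. (partial i \<phi> x)\<^sup>2 \<partial>lborel) = dirform \<O> (abs_l2 \<phi>) (abs_l2 \<phi>)"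
    unfolding dirform_def
  proof (rule sum.cong[OF refl])
    fix i :: 'a assume i: "i \<in> Basis"
    show "(\<integral>x. (partial i \<phi> x)\<^sup>2 \<partial>lborel) = inner (weak_partial \<O> i (abs_l2 \<phi>)) (weak_partial \<O> i (abs_l2 \<phi>))"
      unfolding test_function_H10(2)[OF \<O> \<phi> i] power2_norm_eq_inner[symmetric]
      by (rule norm_abs_l2_sq[symmetric, OF test_function_sq_integrable[OF test_function_partial[OF \<phi> i]]])
  qed
  finally show ?thesis .
qed

text \<open>The difference quotients \<open>N (\<phi>(x + z/N) - \<phi>(x))\<close> converge in \<open>L\<^sup>2\<close> to the directional
  derivative, and the triangle inequality bounds the norm of \<open>\<phi>(x + z) - \<phi>(x)\<close> by each of theirs.\<close>

lemma translation_estimate: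
  assumes \<O>: "open \<O>" and \<phi>: "test_function \<O> \<phi>"
  shows "(norm (abs_l2 (\<lambda>x. \<phi> (x + z) - \<phi> x)))\<^sup>2 \<le> (norm z)\<^sup>2 * dirform \<O> (abs_l2 \<phi>) (abs_l2 \<phi>)"
proof -
  let ?D = "\<lambda>x. frechet_derivative \<phi> (at x) z"
  have sq: "sq_integrable \<phi>" by (rule test_function_sq_integrable[OF \<phi>])
  have tD: "test_function \<O> ?D" by (rule directional_test_function[OF \<phi>])
  have [measurable]: "\<phi> \<in> borel_measurable borel" "?D \<in> borel_measurable borel"
    using test_function_measurable \<phi> tD by auto
  have sqd: "sq_integrable (\<lambda>x. \<phi> (x + w) - \<phi> (x + v))" for w v
    by (intro sq_integrable_diff sq_integrable_translate sq)
  obtain M where M: "M \<ge> 0" "\<And>x. \<bar>?D x\<bar> \<le> M" by (rule test_function_bounded[OF tD]) blast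
  have "bounded {x. \<phi> x \<noteq> 0}"
    using \<phi> by (auto simp: test_function_def)
  then obtain R where R: "R > 0" "\<And>x. \<phi> x \<noteq> 0 \<Longrightarrow> norm x \<le> R"
    by (auto simp: bounded_pos)
  define d where "d n x = (\<phi> (x + inverse (real (Suc n)) *\<^sub>R z) - \<phi> x) / inverse (real (Suc n))" for n x
  have [measurable]: "d n \<in> borel_measurable borel" for n unfolding d_def by measurable
  have sq_d: "sq_integrable (d n)" for n
    using sq_integrable_scale[OF sqd[of "inverse (real (Suc n)) *\<^sub>R z" 0], of "real (Suc n)"]
    by (simp add: d_def[abs_def] field_simps)
  have "(\<lambda>n. norm (abs_l2 (\<lambda>x. d n x - ?D x))) \<longlonglongrightarrow> 0"
  proof (rule norm_abs_l2_tendsto_0)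
    show "sq_integrable (\<lambda>x. (2 * M) * indicator (cball 0 (R + norm z)) x)"
      by (intro sq_integrable_scale sq_integrable_indicator emeasure_lborel_cball_finite) auto
    show "AE x in lborel. \<bar>d n x - ?D x\<bar> \<le> \<bar>2 * M * indicator (cball 0 (R + norm z)) x\<bar>" for n
    proof (rule AE_I2)
      fix x
      let ?h = "inverse (real (Suc n))"
      have h: "0 < ?h" "?h \<le> 1" by (auto simp: field_simps)
      show "\<bar>d n x - ?D x\<bar> \<le> \<bar>2 * M * indicator (cball 0 (R + norm z)) x\<bar>"
      proof (cases "x \<in> cball 0 (R + norm z)")
        case True
        obtain s where "\<phi> (x + ?h *\<^sub>R z) - \<phi> (x + 0 *\<^sub>R z) = (?h - 0) * frechet_derivative \<phi> (at (x + s *\<^sub>R z)) z"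
          using MVT2[OF h(1), of "\<lambda>s. \<phi> (x + s *\<^sub>R z)" "\<lambda>s. frechet_derivative \<phi> (at (x + s *\<^sub>R z)) z"]
            directional_derivative[OF \<phi>] by blast
        then have "d n x = ?D (x + s *\<^sub>R z)" using h(1) by (simp add: d_def)
        then have "\<bar>d n x - ?D x\<bar> \<le> 2 * M" using M(2)[of x] M(2)[of "x + s *\<^sub>R z"] by linarith
        then show ?thesis using True M(1) by simp
      next
        case False
        then have n: "norm x > R + norm z" by simp
        have "norm (?h *\<^sub>R z) \<le> 1 * norm z" using h by (simp only: norm_scaleR) (intro mult_right_mono; simp)
        then have "norm (x + ?h *\<^sub>R z) > R"
          using n norm_triangle_ineq2[of x "- (?h *\<^sub>R z)"] by simp
        then have "\<phi> (x + ?h *\<^sub>R z) = 0" "\<phi> x = 0" using R(2)[of "x + ?h *\<^sub>R z"] R(2)[of x] n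
          by (fastforce, smt (verit) norm_ge_zero)
        moreover have "x \<notin> closure {x. \<phi> x \<noteq> 0}"
        proof -
          have "closure {x. \<phi> x \<noteq> 0} \<subseteq> cball 0 R" using R(2) by (intro closure_minimal) auto
          moreover have "x \<notin> cball 0 R" using n norm_ge_zero[of z] by (auto simp: mem_cball simp del: norm_ge_zero)
          ultimately show ?thesis by blast
        qed
        then have "?D x = 0" using partial_zero_outside[of x \<phi>] by blast
        ultimately show ?thesis using False by (simp add: d_def)
      qed
    qed
    show "AE x in lborel. (\<lambda>n. d n x - ?D x) \<longlonglongrightarrow> 0"
    proof (rule AE_I2)
      fix x
      have "((\<lambda>h. (\<phi> (x + h *\<^sub>R z) - \<phi> x) / h) \<longlongrightarrow> ?D x) (at 0)"
        using directional_derivative[OF \<phi>, of x z 0] by (simp add: has_field_derivative_iff)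
      moreover have "filterlim (\<lambda>n. inverse (real (Suc n))) (at 0) sequentially"
        using LIMSEQ_inverse_real_of_nat by (auto simp: filterlim_at)
      ultimately have "(\<lambda>n. d n x) \<longlonglongrightarrow> ?D x"
        unfolding d_def by (rule filterlim_compose)
      then show "(\<lambda>n. d n x - ?D x) \<longlonglongrightarrow> 0" by (rule LIM_zero)
    qed
  qed measurable
  then have "(\<lambda>n. abs_l2 (d n) - abs_l2 ?D) \<longlonglongrightarrow> 0"
    unfolding abs_l2_diff[OF sq_d test_function_sq_integrable[OF tD]] by (rule tendsto_norm_zero_cancel)
  then have lim: "(\<lambda>n. norm (abs_l2 (d n))) \<longlonglongrightarrow> norm (abs_l2 ?D)"
    by (intro tendsto_norm) (rule LIM_zero_cancel)
  have "norm (abs_l2 (\<lambda>x. \<phi> (x + z) - \<phi> x)) \<le> norm (abs_l2 (d n))" for n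
  proof -
    let ?h = "inverse (real (Suc n))"
    have step: "norm (abs_l2 (\<lambda>x. \<phi> (x + real (Suc k) *\<^sub>R (?h *\<^sub>R z)) - \<phi> (x + real k *\<^sub>R (?h *\<^sub>R z)))) = ?h * norm (abs_l2 (d n))" for k
    proof -
      have "norm (abs_l2 (\<lambda>x. \<phi> (x + real (Suc k) *\<^sub>R (?h *\<^sub>R z)) - \<phi> (x + real k *\<^sub>R (?h *\<^sub>R z))))
         = norm (abs_l2 (\<lambda>x. (\<lambda>y. \<phi> (y + ?h *\<^sub>R z) - \<phi> y) (x + real k *\<^sub>R (?h *\<^sub>R z))))"
        by (simp add: algebra_simps)
      also have "\<dots> = norm (abs_l2 (\<lambda>y. \<phi> (y + ?h *\<^sub>R z) - \<phi> y))"
        using sqd[of _ 0] by (intro norm_abs_l2_translate) simp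
      also have "(\<lambda>y. \<phi> (y + ?h *\<^sub>R z) - \<phi> y) = (\<lambda>y. ?h * d n y)" by (simp add: d_def)
      also have "norm (abs_l2 \<dots>) = ?h * norm (abs_l2 (d n))"
        by (simp add: abs_l2_scaleR[OF sq_d, symmetric])
      finally show ?thesis .
    qed
    \<comment> \<open>For k = n + 1 the total displacement is z and the factor in front of the
      quotient becomes 1.\<close>
    have "norm (abs_l2 (\<lambda>x. \<phi> (x + real k *\<^sub>R (?h *\<^sub>R z)) - \<phi> x)) \<le> real k * (?h * norm (abs_l2 (d n)))" for k
    proof (induction k)
      case 0
      have "abs_l2 (\<lambda>x. 0 :: real) = (0 :: 'a l2)" by (simp add: zero_l2_def)
      then show ?case by simp
    next
      case (Suc k)
      have "abs_l2 (\<lambda>x. \<phi> (x + real (Suc k) *\<^sub>R (?h *\<^sub>R z)) - \<phi> x) =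
         abs_l2 (\<lambda>x. \<phi> (x + real (Suc k) *\<^sub>R (?h *\<^sub>R z)) - \<phi> (x + real k *\<^sub>R (?h *\<^sub>R z))) + abs_l2 (\<lambda>x. \<phi> (x + real k *\<^sub>R (?h *\<^sub>R z)) - \<phi> x)"
        using sqd[of _ 0] sqd by (subst abs_l2_add) auto
      then have "norm (abs_l2 (\<lambda>x. \<phi> (x + real (Suc k) *\<^sub>R (?h *\<^sub>R z)) - \<phi> x)) \<le>
        ?h * norm (abs_l2 (d n)) + norm (abs_l2 (\<lambda>x. \<phi> (x + real k *\<^sub>R (?h *\<^sub>R z)) - \<phi> x))"
        by (simp only:) (rule order_trans[OF norm_triangle_ineq], unfold step, rule order_refl)
      also have "\<dots> \<le> ?h * norm (abs_l2 (d n)) + real k * (?h * norm (abs_l2 (d n)))"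
        using Suc.IH by simp
      finally show ?case by (simp add: algebra_simps)
    qed
    moreover have "real (Suc n) *\<^sub>R (?h *\<^sub>R z) = z" "real (Suc n) * (?h * c) = c" for c by auto
    ultimately show ?thesis by metis
  qed
  then have "norm (abs_l2 (\<lambda>x. \<phi> (x + z) - \<phi> x)) \<le> norm (abs_l2 ?D)"
    by (intro LIMSEQ_le_const[OF lim]) auto
  then have "(norm (abs_l2 (\<lambda>x. \<phi> (x + z) - \<phi> x)))\<^sup>2 \<le> (norm (abs_l2 ?D))\<^sup>2"
    by (rule power_mono) simp
  also have "\<dots> \<le> (norm z)\<^sup>2 * dirform \<O> (abs_l2 \<phi>) (abs_l2 \<phi>)" by (rule norm_directional_le[OF \<O> \<phi>])
  finally show ?thesis .
qed

text \<open>A half-open cube of side h, indexed by a vector of the space itself of which only the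
  integer parts of the coordinates matter. Indices with integer coordinates are determined by any
  point of their cell (\<open>cell_unique\<close>).\<close>

definition cell :: "real \<Rightarrow> 'a::euclidean_space \<Rightarrow> 'a set" where
  "cell h p = {x. \<forall>i\<in>Basis. \<lfloor>x \<bullet> i / h\<rfloor> = \<lfloor>p \<bullet> i\<rfloor>}"

lemma cell_bounds:
  assumes "h > 0"
  shows "x \<in> cell h p \<longleftrightarrow> (\<forall>i\<in>Basis. h * \<lfloor>p \<bullet> i\<rfloor> \<le> x \<bullet> i \<and> x \<bullet> i < h * (\<lfloor>p \<bullet> i\<rfloor> + 1))"
  using assms by (simp add: cell_def floor_eq_iff field_simps)

lemma cell_measurable [measurable]: "cell h p \<in> sets borel"
  unfolding cell_def by measurable

lemma emeasure_cell:
  fixes p :: "'a::euclidean_space"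
  assumes h: "h > 0"
  shows "emeasure lborel (cell h p) = ennreal (h ^ DIM('a))"
proof -
  define a b :: 'a where "a = (\<Sum>i\<in>Basis. (h * \<lfloor>p \<bullet> i\<rfloor>) *\<^sub>R i)" and "b = (\<Sum>i\<in>Basis. (h * (\<lfloor>p \<bullet> i\<rfloor> + 1)) *\<^sub>R i)"
  have ab: "a \<bullet> i = h * \<lfloor>p \<bullet> i\<rfloor>" "b \<bullet> i = h * (\<lfloor>p \<bullet> i\<rfloor> + 1)" if "i \<in> Basis" for i
    using that by (auto simp: a_def b_def)
  have le: "a \<bullet> i \<le> b \<bullet> i" if "i \<in> Basis" for i using h ab[OF that] by (simp add: algebra_simps)
  have "(\<Prod>i\<in>Basis. (b - a) \<bullet> i) = (\<Prod>i\<in>(Basis :: 'a set). h)"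
    by (rule prod.cong) (auto simp: ab inner_diff_left algebra_simps)
  then have pr: "(\<Prod>i\<in>Basis. (b - a) \<bullet> i) = h ^ DIM('a)" by simp
  have "box a b \<subseteq> cell h p" "cell h p \<subseteq> cbox a b"
    by (auto simp: cell_bounds[OF h] mem_box ab less_imp_le)
  then have "emeasure lborel (box a b) \<le> emeasure lborel (cell h p)" "emeasure lborel (cell h p) \<le> emeasure lborel (cbox a b)"
    by (auto intro!: emeasure_mono)
  moreover have "emeasure lborel (box a b) = ennreal (h ^ DIM('a))" "emeasure lborel (cbox a b) = ennreal (h ^ DIM('a))"
    using le pr by (auto simp: emeasure_lborel_box_eq emeasure_lborel_cbox_eq)
  ultimately show ?thesis by (auto intro: antisym)
qed

lemma finite_cells:
  fixes \<O> :: "'a::euclidean_space set"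
  assumes "bounded \<O>" "h > 0"
  obtains S where "finite S" "\<And>x. x \<in> \<O> \<Longrightarrow> \<exists>p\<in>S. x \<in> cell h p"
    "\<And>p i. p \<in> S \<Longrightarrow> i \<in> Basis \<Longrightarrow> p \<bullet> i \<in> \<int>"
proof -
  obtain B where B: "\<And>x. x \<in> \<O> \<Longrightarrow> norm x \<le> B" using assms(1) by (auto simp: bounded_iff)
  define K where "K = (Basis :: 'a set) \<rightarrow>\<^sub>E {\<lfloor>- B / h\<rfloor>..\<lfloor>B / h\<rfloor>}"
  define v where "v k = (\<Sum>i\<in>Basis. of_int (k i) *\<^sub>R i)" for k :: "'a \<Rightarrow> int"
  have v: "v k \<bullet> i = of_int (k i)" if "i \<in> Basis" for k i using that by (simp add: v_def)
  show ?thesis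
  proof (rule that[of "v ` K"])
    show "finite (v ` K)" unfolding K_def by (intro finite_imageI finite_PiE) auto
    fix x assume x: "x \<in> \<O>"
    define k where "k = (\<lambda>i\<in>Basis. \<lfloor>x \<bullet> i / h\<rfloor>)"
    have "k \<in> K"
      unfolding K_def k_def
    proof (rule restrict_PiE_iff[THEN iffD2], rule ballI)
      fix i :: 'a assume "i \<in> Basis"
      then have "\<bar>x \<bullet> i\<bar> \<le> B" using B[OF x] Basis_le_norm[of i x] by linarith
      then have "- B / h \<le> x \<bullet> i / h" "x \<bullet> i / h \<le> B / h"
        using assms(2) by (intro divide_right_mono; linarith)+
      then show "\<lfloor>x \<bullet> i / h\<rfloor> \<in> {\<lfloor>- B / h\<rfloor>..\<lfloor>B / h\<rfloor>}"
        by (simp only: atLeastAtMost_iff floor_mono simp_thms)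
    qed
    moreover have "x \<in> cell h (v k)" by (auto simp: cell_def v k_def)
    ultimately show "\<exists>p\<in>v ` K. x \<in> cell h p" by blast
  qed (auto simp: v)
qed

lemma cell_unique:
  assumes "x \<in> cell h p" "x \<in> cell h p'" "\<And>i. i \<in> Basis \<Longrightarrow> p \<bullet> i \<in> \<int>" "\<And>i. i \<in> Basis \<Longrightarrow> p' \<bullet> i \<in> \<int>"
  shows "p = p'"
proof (rule euclidean_eqI)
  fix i :: 'a assume i: "i \<in> Basis"
  then have "\<lfloor>p \<bullet> i\<rfloor> = \<lfloor>p' \<bullet> i\<rfloor>" using assms(1,2) by (simp add: cell_def)
  moreover have "of_int \<lfloor>p \<bullet> i\<rfloor> = p \<bullet> i" "of_int \<lfloor>p' \<bullet> i\<rfloor> = p' \<bullet> i"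
    using assms(3)[OF i] assms(4)[OF i] by (auto elim!: Ints_cases)
  ultimately show "p \<bullet> i = p' \<bullet> i" by metis
qed

text \<open>Expanding the square expresses the variance on A as a double integral of differences, to
  which translation estimates can be applied.\<close>

lemma nn_integral_cell_variance:
  fixes \<phi> :: "'a::euclidean_space \<Rightarrow> real"
  assumes \<phi>: "sq_integrable \<phi>" and A [measurable]: "A \<in> sets borel" and m: "emeasure lborel A = ennreal m" "m \<ge> 0"
  shows "(\<integral>\<^sup>+x. \<integral>\<^sup>+y. ennreal (indicator A x * indicator A y * (\<phi> x - \<phi> y)\<^sup>2) \<partial>lborel \<partial>lborel)
    = ennreal (2 * m * (\<integral>x. indicator A x * (\<phi> x)\<^sup>2 \<partial>lborel) - 2 * (\<integral>x. indicator A x * \<phi> x \<partial>lborel)\<^sup>2)"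
proof -
  define I where "I = (\<integral>x. indicator A x * \<phi> x \<partial>lborel)"
  define J where "J = (\<integral>x. indicator A x * (\<phi> x)\<^sup>2 \<partial>lborel)"
  have [measurable]: "\<phi> \<in> borel_measurable borel" using \<phi> by (simp add: sq_integrable_def)
  have fin: "emeasure lborel A < \<infinity>" using m by simp
  have i0: "integrable lborel (\<lambda>x. indicator A x :: real)" using fin by auto
  have i1: "integrable lborel (\<lambda>x. indicator A x * \<phi> x)"
    by (rule sq_integrable_mult[OF sq_integrable_indicator[OF A fin] \<phi>])
  have i2: "integrable lborel (\<lambda>x. indicator A x * (\<phi> x)\<^sup>2)"
    using integrable_real_mult_indicator[of A lborel "\<lambda>x. (\<phi> x)\<^sup>2"] \<phi> by (simp add: sq_integrable_def mult.commute)
  have mA: "(\<integral>x. indicator A x \<partial>lborel) = m" using m by (simp add: measure_def)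
  have inner: "(\<integral>\<^sup>+y. ennreal (indicator A x * indicator A y * (\<phi> x - \<phi> y)\<^sup>2) \<partial>lborel) =
     ennreal (m * (indicator A x * (\<phi> x)\<^sup>2) - 2 * I * (indicator A x * \<phi> x) + J * indicator A x)" for x
  proof -
    have e: "indicator A x * indicator A y * (\<phi> x - \<phi> y)\<^sup>2 = (indicator A x * (\<phi> x)\<^sup>2) * indicator A y
       - (2 * indicator A x * \<phi> x) * (indicator A y * \<phi> y) + indicator A x * (indicator A y * (\<phi> y)\<^sup>2)" for y
      by (simp add: power2_diff algebra_simps)
    have "(\<integral>\<^sup>+y. ennreal (indicator A x * indicator A y * (\<phi> x - \<phi> y)\<^sup>2) \<partial>lborel) =
      ennreal (\<integral>y. indicator A x * indicator A y * (\<phi> x - \<phi> y)\<^sup>2 \<partial>lborel)"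
    proof (rule nn_integral_eq_integral)
      show "integrable lborel (\<lambda>y. indicator A x * indicator A y * (\<phi> x - \<phi> y)\<^sup>2)"
        unfolding e by (intro Bochner_Integration.integrable_add Bochner_Integration.integrable_diff integrable_mult_right i0 i1 i2)
    qed auto
    also have "(\<integral>y. indicator A x * indicator A y * (\<phi> x - \<phi> y)\<^sup>2 \<partial>lborel) =
       (indicator A x * (\<phi> x)\<^sup>2) * m - (2 * indicator A x * \<phi> x) * I + indicator A x * J"
      unfolding e I_def J_def mA[symmetric] using i0 i1 i2 by simp
    finally show ?thesis by (simp add: algebra_simps)
  qed
  have "(\<integral>\<^sup>+x. ennreal (m * (indicator A x * (\<phi> x)\<^sup>2) - 2 * I * (indicator A x * \<phi> x) + J * indicator A x) \<partial>lborel)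
    = ennreal (\<integral>x. m * (indicator A x * (\<phi> x)\<^sup>2) - 2 * I * (indicator A x * \<phi> x) + J * indicator A x \<partial>lborel)"
  proof (rule nn_integral_eq_integral)
    show "integrable lborel (\<lambda>x. m * (indicator A x * (\<phi> x)\<^sup>2) - 2 * I * (indicator A x * \<phi> x) + J * indicator A x)"
      by (intro Bochner_Integration.integrable_add Bochner_Integration.integrable_diff integrable_mult_right i0 i1 i2)
    \<comment> \<open>For x in A this integrand is itself an integral over y of a square, which
      gives its sign.\<close>
    have "0 \<le> m * (indicator A x * (\<phi> x)\<^sup>2) - 2 * I * (indicator A x * \<phi> x) + J * indicator A x" for x
    proof (cases "x \<in> A")
      case True
      have "0 \<le> (\<integral>y. indicator A y * (\<phi> x - \<phi> y)\<^sup>2 \<partial>lborel)" by simp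
      also have "\<dots> = (\<integral>y. (\<phi> x)\<^sup>2 * indicator A y - (2 * \<phi> x) * (indicator A y * \<phi> y) + indicator A y * (\<phi> y)\<^sup>2 \<partial>lborel)"
        by (simp add: power2_diff algebra_simps)
      also have "\<dots> = (\<phi> x)\<^sup>2 * m - (2 * \<phi> x) * I + J"
        unfolding I_def J_def mA[symmetric] using i0 i1 i2 by simp
      finally show ?thesis using True by (simp add: algebra_simps)
    qed simp
    then show "AE x in lborel. 0 \<le> m * (indicator A x * (\<phi> x)\<^sup>2) - 2 * I * (indicator A x * \<phi> x) + J * indicator A x" by simp
  qed
  also have "(\<integral>x. m * (indicator A x * (\<phi> x)\<^sup>2) - 2 * I * (indicator A x * \<phi> x) + J * indicator A x \<partial>lborel) = m * J - 2 * I * I + J * m"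
    using i0 i1 i2 unfolding I_def[symmetric] J_def[symmetric] mA[symmetric] by (simp add: I_def J_def)
  finally show ?thesis unfolding inner I_def[symmetric] J_def[symmetric] by (simp add: power2_eq_square algebra_simps)
qed

text \<open>Poincare's inequality on each cell of a fine grid: up to a small multiple of the Dirichlet form,
  the norm is controlled by finitely many functionals, the averages over the cells.\<close>

lemma cell_poincare_test:
  fixes \<O> :: "'a::euclidean_space set" and h :: real
  assumes \<O>: "open \<O>" and h: "h > 0" and S: "finite S" "\<And>x. x \<in> \<O> \<Longrightarrow> \<exists>p\<in>S. x \<in> cell h p"
    "\<And>p i. p \<in> S \<Longrightarrow> i \<in> Basis \<Longrightarrow> p \<bullet> i \<in> \<int>" and \<phi>: "test_function \<O> \<phi>"
  shows "(norm (abs_l2 \<phi>))\<^sup>2 \<le> (\<Sum>p\<in>S. (inner (abs_l2 \<phi>) (abs_l2 (indicator (cell h p))))\<^sup>2 / h ^ DIM('a))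
    + 2 ^ DIM('a) * (real DIM('a) * h)\<^sup>2 * dirform \<O> (abs_l2 \<phi>) (abs_l2 \<phi>)"
proof -
  define m where "m = h ^ DIM('a)"
  define D where "D = dirform \<O> (abs_l2 \<phi>) (abs_l2 \<phi>)"
  define C :: "'a set" where "C = cbox (- h *\<^sub>R One) (h *\<^sub>R One)"
  have m: "m > 0" using h by (simp add: m_def)
  have D: "D \<ge> 0" by (simp add: D_def dirform_nonneg)
  have sq: "sq_integrable \<phi>" by (rule test_function_sq_integrable[OF \<phi>])
  have [measurable]: "\<phi> \<in> borel_measurable borel" by (rule test_function_measurable[OF \<phi>])
  have [measurable]: "C \<in> sets borel" by (simp add: C_def)
  have fin: "emeasure lborel (cell h p) < \<infinity>" for p :: 'a using emeasure_cell[OF h, of p] by simp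
  define I where "I p = (\<integral>x. indicator (cell h p) x * \<phi> x \<partial>lborel)" for p
  define J where "J p = (\<integral>x. indicator (cell h p) x * (\<phi> x)\<^sup>2 \<partial>lborel)" for p
  have I: "inner (abs_l2 \<phi>) (abs_l2 (indicator (cell h p))) = I p" for p
    unfolding I_def using inner_abs_l2[OF sq sq_integrable_indicator[OF cell_measurable fin]] by (simp add: mult.commute)
  have IJ: "0 \<le> 2 * m * J p - 2 * (I p)\<^sup>2" for p
  proof -
    have "0 \<le> (\<integral>x. indicator (cell h p) x * (m * \<phi> x - I p)\<^sup>2 \<partial>lborel)" by simp
    also have "\<dots> = (\<integral>x. m\<^sup>2 * (indicator (cell h p) x * (\<phi> x)\<^sup>2) - (2 * m * I p) * (indicator (cell h p) x * \<phi> x) + (I p)\<^sup>2 * indicator (cell h p) x \<partial>lborel)"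
      by (simp add: power2_diff power_mult_distrib algebra_simps)
    also have "\<dots> = m\<^sup>2 * J p - 2 * m * I p * I p + (I p)\<^sup>2 * m"
    proof -
      have "integrable lborel (\<lambda>x. indicator (cell h p) x * (\<phi> x)\<^sup>2)"
        using integrable_real_mult_indicator[of "cell h p" lborel "\<lambda>x. (\<phi> x)\<^sup>2"] sq by (simp add: sq_integrable_def mult.commute)
      moreover have "integrable lborel (\<lambda>x. indicator (cell h p) x * \<phi> x)"
        by (rule sq_integrable_mult[OF sq_integrable_indicator[OF cell_measurable fin] sq])
      moreover have "integrable lborel (\<lambda>x. indicator (cell h p) x :: real)" using fin by auto
      moreover have "(\<integral>x. indicator (cell h p) x \<partial>lborel) = m"
        using emeasure_cell[OF h, of p] m by (simp add: measure_def m_def)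
      ultimately show ?thesis by (simp add: I_def J_def)
    qed
    finally have "0 \<le> m * (m * J p - (I p)\<^sup>2)" by (simp add: power2_eq_square algebra_simps)
    then show ?thesis using m by (simp add: zero_le_mult_iff)
  qed
  \<comment> \<open>Cells with distinct integer indices are disjoint, so at most one term is 1; and
    two points of one cell differ by a vector of the cube C of side 2 h.\<close>
  have overlap: "(\<Sum>p\<in>S. indicator (cell h p) x * indicator (cell h p) y) \<le> (indicator C (y - x) :: real)" for x y
  proof (cases "\<exists>p\<in>S. x \<in> cell h p \<and> y \<in> cell h p")
    case True
    then obtain p where p: "p \<in> S" "x \<in> cell h p" "y \<in> cell h p" by blast
    have "(\<Sum>p'\<in>S. indicator (cell h p') x * indicator (cell h p') y) = (\<Sum>p'\<in>{p}. indicator (cell h p') x * indicator (cell h p') y :: real)"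
    proof (rule sum.mono_neutral_right[OF S(1)])
      show "\<forall>p'\<in>S - {p}. indicator (cell h p') x * indicator (cell h p') y = (0::real)"
      proof
        fix p' assume p': "p' \<in> S - {p}"
        have "x \<notin> cell h p'"
        proof
          assume "x \<in> cell h p'"
          then have "p = p'" using p' p by (intro cell_unique[OF p(2) _ S(3) S(3)]) auto
          then show False using p' by blast
        qed
        then show "indicator (cell h p') x * indicator (cell h p') y = (0::real)" by simp
      qed
    qed (use p in auto)
    also have "\<dots> = 1" using p by simp
    also have "y - x \<in> C"
      using p(2,3) unfolding C_def cell_bounds[OF h] mem_box
      by (force simp: inner_diff_left algebra_simps)
    then have "1 = (indicator C (y - x) :: real)" by simp
    finally show ?thesis by simp
  next
    case False
    then have "(\<Sum>p\<in>S. indicator (cell h p) x * indicator (cell h p) y) = (0::real)"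
      by (intro sum.neutral) (auto simp: indicator_def)
    then show ?thesis by simp
  qed
  have "ennreal (\<Sum>p\<in>S. 2 * m * J p - 2 * (I p)\<^sup>2) = (\<Sum>p\<in>S. ennreal (2 * m * J p - 2 * (I p)\<^sup>2))"
    using IJ by (intro sum_ennreal[symmetric])
  also have "\<dots> = (\<Sum>p\<in>S. \<integral>\<^sup>+x. \<integral>\<^sup>+y. ennreal (indicator (cell h p) x * indicator (cell h p) y * (\<phi> x - \<phi> y)\<^sup>2) \<partial>lborel \<partial>lborel)"
    unfolding I_def J_def
    by (rule sum.cong[OF refl], rule nn_integral_cell_variance[symmetric, OF sq]) (use emeasure_cell[OF h] m in \<open>auto simp: m_def\<close>)
  also have "\<dots> = (\<integral>\<^sup>+x. \<integral>\<^sup>+y. (\<Sum>p\<in>S. ennreal (indicator (cell h p) x * indicator (cell h p) y * (\<phi> x - \<phi> y)\<^sup>2)) \<partial>lborel \<partial>lborel)"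
  proof -
    have "(\<integral>\<^sup>+x. \<integral>\<^sup>+y. (\<Sum>p\<in>S. ennreal (indicator (cell h p) x * indicator (cell h p) y * (\<phi> x - \<phi> y)\<^sup>2)) \<partial>lborel \<partial>lborel)
      = (\<integral>\<^sup>+x. (\<Sum>p\<in>S. \<integral>\<^sup>+y. ennreal (indicator (cell h p) x * indicator (cell h p) y * (\<phi> x - \<phi> y)\<^sup>2) \<partial>lborel) \<partial>lborel)"
      by (intro nn_integral_cong nn_integral_sum) measurable
    also have "\<dots> = (\<Sum>p\<in>S. \<integral>\<^sup>+x. \<integral>\<^sup>+y. ennreal (indicator (cell h p) x * indicator (cell h p) y * (\<phi> x - \<phi> y)\<^sup>2) \<partial>lborel \<partial>lborel)"
      by (rule nn_integral_sum) measurable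
    finally show ?thesis by (rule sym)
  qed
  also have "\<dots> \<le> (\<integral>\<^sup>+x. \<integral>\<^sup>+y. ennreal (indicator C (y - x) * (\<phi> y - \<phi> x)\<^sup>2) \<partial>lborel \<partial>lborel)"
  proof (intro nn_integral_mono)
    fix x y
    have "(\<Sum>p\<in>S. ennreal (indicator (cell h p) x * indicator (cell h p) y * (\<phi> x - \<phi> y)\<^sup>2)) =
       ennreal ((\<Sum>p\<in>S. indicator (cell h p) x * indicator (cell h p) y) * (\<phi> x - \<phi> y)\<^sup>2)"
      by (subst sum_ennreal) (auto simp: sum_distrib_right)
    also have "\<dots> \<le> ennreal (indicator C (y - x) * (\<phi> x - \<phi> y)\<^sup>2)"
      by (intro ennreal_leI mult_right_mono overlap) simp
    finally show "(\<Sum>p\<in>S. ennreal (indicator (cell h p) x * indicator (cell h p) y * (\<phi> x - \<phi> y)\<^sup>2)) \<le> ennreal (indicator C (y - x) * (\<phi> y - \<phi> x)\<^sup>2)"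
      by (simp add: power2_commute)
  qed
  \<comment> \<open>Substituting z = y - x and exchanging the integrals leaves, for each fixed z in
    C, the norm of \<phi>(x + z) - \<phi>(x), where the length of z is at most the dimension times
    h.\<close>
  also have "\<dots> = (\<integral>\<^sup>+x. \<integral>\<^sup>+z. ennreal (indicator C z * (\<phi> (x + z) - \<phi> x)\<^sup>2) \<partial>lborel \<partial>lborel)"
  proof (rule nn_integral_cong)
    fix x
    show "(\<integral>\<^sup>+y. ennreal (indicator C (y - x) * (\<phi> y - \<phi> x)\<^sup>2) \<partial>lborel) = (\<integral>\<^sup>+z. ennreal (indicator C z * (\<phi> (x + z) - \<phi> x)\<^sup>2) \<partial>lborel)"
      using nn_integral_translate[of "\<lambda>y. ennreal (indicator C (y - x) * (\<phi> y - \<phi> x)\<^sup>2)" x] by (simp add: add.commute)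
  qed
  also have "\<dots> = (\<integral>\<^sup>+z. \<integral>\<^sup>+x. ennreal (indicator C z * (\<phi> (x + z) - \<phi> x)\<^sup>2) \<partial>lborel \<partial>lborel)"
    by (rule lborel_pair.Fubini') measurable
  also have "\<dots> \<le> (\<integral>\<^sup>+z. ennreal ((real DIM('a) * h)\<^sup>2 * D) * indicator C z \<partial>lborel)"
  proof (rule nn_integral_mono)
    fix z
    show "(\<integral>\<^sup>+x. ennreal (indicator C z * (\<phi> (x + z) - \<phi> x)\<^sup>2) \<partial>lborel) \<le> ennreal ((real DIM('a) * h)\<^sup>2 * D) * indicator C z"
    proof (cases "z \<in> C")
      case True
      have s: "sq_integrable (\<lambda>x. \<phi> (x + z) - \<phi> x)" by (intro sq_integrable_diff sq_integrable_translate sq)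
      have "\<bar>z \<bullet> i\<bar> \<le> h" if "i \<in> Basis" for i
        using True that unfolding C_def mem_box by force
      then have "norm z \<le> real DIM('a) * h"
        using norm_le_l1[of z] sum_bounded_above[of "Basis" "\<lambda>i. \<bar>z \<bullet> i\<bar>" h] by simp
      then have nz: "(norm z)\<^sup>2 \<le> (real DIM('a) * h)\<^sup>2" by (intro power_mono) auto
      have "(\<integral>\<^sup>+x. ennreal ((\<phi> (x + z) - \<phi> x)\<^sup>2) \<partial>lborel) = ennreal ((norm (abs_l2 (\<lambda>x. \<phi> (x + z) - \<phi> x)))\<^sup>2)"
        unfolding norm_abs_l2_sq[OF s] using s by (intro nn_integral_eq_integral) (auto simp: sq_integrable_def)
      also have "\<dots> \<le> ennreal ((real DIM('a) * h)\<^sup>2 * D)"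
        using translation_estimate[OF \<O> \<phi>, of z] mult_right_mono[OF nz D]
        by (intro ennreal_leI) (simp add: D_def)
      finally show ?thesis using True by simp
    qed simp
  qed
  also have "\<dots> = ennreal ((real DIM('a) * h)\<^sup>2 * D) * emeasure lborel C"
    by (rule nn_integral_cmult_indicator) simp
  \<comment> \<open>The cube C has volume (2 h)^d; this is the source of the factor 2^d in the
    estimate.\<close>
  also have "emeasure lborel C = ennreal (2 ^ DIM('a) * m)"
  proof -
    have "emeasure lborel C = ennreal (\<Prod>i\<in>(Basis :: 'a set). 2 * h)"
    proof -
      have "(\<Prod>i\<in>(Basis :: 'a set). (h *\<^sub>R One - (- h) *\<^sub>R One) \<bullet> i) = (\<Prod>i\<in>(Basis :: 'a set). 2 * h)"
        by (rule prod.cong) (auto simp: inner_diff_left inner_add_left inner_sum_left inner_Basis)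
      then show ?thesis unfolding C_def using h by (subst emeasure_lborel_cbox_eq) auto
    qed
    then show ?thesis by (simp add: m_def power_mult_distrib)
  qed
  also have "ennreal ((real DIM('a) * h)\<^sup>2 * D) * ennreal (2 ^ DIM('a) * m) = ennreal (((real DIM('a) * h)\<^sup>2 * D) * (2 ^ DIM('a) * m))"
    using D m by (intro ennreal_mult[symmetric]) auto
  finally have le: "(\<Sum>p\<in>S. 2 * m * J p - 2 * (I p)\<^sup>2) \<le> ((real DIM('a) * h)\<^sup>2 * D) * (2 ^ DIM('a) * m)"
    using D m by (subst (asm) ennreal_le_iff) auto
  have "(norm (abs_l2 \<phi>))\<^sup>2 = (\<integral>x. (\<phi> x)\<^sup>2 \<partial>lborel)" by (rule norm_abs_l2_sq[OF sq])
  also have "\<dots> \<le> (\<integral>x. (\<Sum>p\<in>S. indicator (cell h p) x * (\<phi> x)\<^sup>2) \<partial>lborel)"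
  proof (rule integral_mono)
    have i: "integrable lborel (\<lambda>x. indicator (cell h p) x * (\<phi> x)\<^sup>2)" for p
      using integrable_real_mult_indicator[of "cell h p" lborel "\<lambda>x. (\<phi> x)\<^sup>2"] sq by (simp add: sq_integrable_def mult.commute)
    then show "integrable lborel (\<lambda>x. \<Sum>p\<in>S. indicator (cell h p) x * (\<phi> x)\<^sup>2)" by simp
    show "integrable lborel (\<lambda>x. (\<phi> x)\<^sup>2)" using sq by (simp add: sq_integrable_def)
    fix x
    show "(\<phi> x)\<^sup>2 \<le> (\<Sum>p\<in>S. indicator (cell h p) x * (\<phi> x)\<^sup>2)"
    proof (cases "x \<in> \<O>")
      case True
      then obtain p where p: "p \<in> S" "x \<in> cell h p" using S(2) by blast
      then have "(\<phi> x)\<^sup>2 = indicator (cell h p) x * (\<phi> x)\<^sup>2" by simp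
      also have "\<dots> \<le> (\<Sum>p\<in>S. indicator (cell h p) x * (\<phi> x)\<^sup>2)" using p S(1) by (intro member_le_sum) auto
      finally show ?thesis .
    next
      case False
      then show ?thesis using test_function_outside[OF \<phi>] by simp
    qed
  qed
  also have "\<dots> = (\<Sum>p\<in>S. J p)"
    unfolding J_def
  proof (rule Bochner_Integration.integral_sum)
    show "integrable lborel (\<lambda>x. indicator (cell h p) x * (\<phi> x)\<^sup>2)" for p
      using integrable_real_mult_indicator[of "cell h p" lborel "\<lambda>x. (\<phi> x)\<^sup>2"] sq by (simp add: sq_integrable_def mult.commute)
  qed
  finally have "m * (norm (abs_l2 \<phi>))\<^sup>2 \<le> m * (\<Sum>p\<in>S. J p)" using m by simp
  \<comment> \<open>The double integral carries a factor 2 on the left; it is given away, because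
    the bound on the right is nonnegative.\<close>
  also have "\<dots> \<le> (\<Sum>p\<in>S. (I p)\<^sup>2) + ((real DIM('a) * h)\<^sup>2 * D) * (2 ^ DIM('a) * m)"
  proof -
    have "0 \<le> ((real DIM('a) * h)\<^sup>2 * D) * (2 ^ DIM('a) * m)" using m D by simp
    then show ?thesis using le unfolding sum_subtractf sum_distrib_left[symmetric] mult.assoc by linarith
  qed
  also have "\<dots> = m * ((\<Sum>p\<in>S. (I p)\<^sup>2 / m) + 2 ^ DIM('a) * (real DIM('a) * h)\<^sup>2 * D)"
    using m by (simp add: sum_divide_distrib[symmetric] algebra_simps)
  finally have "(norm (abs_l2 \<phi>))\<^sup>2 \<le> (\<Sum>p\<in>S. (I p)\<^sup>2 / m) + 2 ^ DIM('a) * (real DIM('a) * h)\<^sup>2 * D"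
    using m by simp
  then show ?thesis unfolding I m_def D_def .
qed

lemma cell_poincare:
  fixes \<O> :: "'a::euclidean_space set"
  assumes \<O>: "open \<O>" "bounded \<O>" and e: "e > 0"
  obtains C where "finite C" "\<And>u. u \<in> H10 \<O> \<Longrightarrow> (norm u)\<^sup>2 \<le> (\<Sum>c\<in>C. (inner u c)\<^sup>2) + e * dirform \<O> u u"
proof -
  define K where "K = 2 ^ DIM('a) * (real DIM('a))\<^sup>2"
  have K: "K > 0" by (simp add: K_def)
  \<comment> \<open>The side is chosen so that the factor of the Dirichlet form becomes exactly
    e.\<close>
  define h where "h = sqrt (e / K)"
  have h: "h > 0" using e K by (simp add: h_def)
  have hK: "2 ^ DIM('a) * (real DIM('a) * h)\<^sup>2 = e"
    using e K by (simp add: h_def power_mult_distrib) (simp add: K_def)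
  obtain S :: "'a set" where S: "finite S" "\<And>x. x \<in> \<O> \<Longrightarrow> \<exists>p\<in>S. x \<in> cell h p"
    "\<And>p i. p \<in> S \<Longrightarrow> i \<in> Basis \<Longrightarrow> p \<bullet> i \<in> \<int>"
    by (rule finite_cells[OF \<O>(2) h]) blast
  define c where "c p = (1 / sqrt (h ^ DIM('a))) *\<^sub>R abs_l2 (indicator (cell h p))" for p :: 'a
  have c: "(inner u (c p))\<^sup>2 = (inner u (abs_l2 (indicator (cell h p))))\<^sup>2 / h ^ DIM('a)" for u p
    using h by (simp add: c_def power_divide)
  have le: "(norm u)\<^sup>2 \<le> (\<Sum>p\<in>S. (inner u (c p))\<^sup>2) + e * dirform \<O> u u" if u: "u \<in> H10 \<O>" for u
  proof -
    obtain \<phi> where \<phi>: "\<And>n. test_function \<O> (\<phi> n)" "(\<lambda>n. abs_l2 (\<phi> n)) \<longlonglongrightarrow> u"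
      "\<And>i. i \<in> Basis \<Longrightarrow> (\<lambda>n. abs_l2 (partial i (\<phi> n))) \<longlonglongrightarrow> weak_partial \<O> i u"
      by (rule H10_approx[OF u]) blast
    have wp: "(\<lambda>n. weak_partial \<O> i (abs_l2 (\<phi> n))) \<longlonglongrightarrow> weak_partial \<O> i u" if "i \<in> Basis" for i
      unfolding test_function_H10(2)[OF \<O>(1) \<phi>(1) that] by (rule \<phi>(3)[OF that])
    have l1: "(\<lambda>n. (norm (abs_l2 (\<phi> n)))\<^sup>2) \<longlonglongrightarrow> (norm u)\<^sup>2"
      by (intro tendsto_intros \<phi>(2))
    have l2: "(\<lambda>n. (\<Sum>p\<in>S. (inner (abs_l2 (\<phi> n)) (c p))\<^sup>2) + e * dirform \<O> (abs_l2 (\<phi> n)) (abs_l2 (\<phi> n)))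
        \<longlonglongrightarrow> (\<Sum>p\<in>S. (inner u (c p))\<^sup>2) + e * dirform \<O> u u"
      by (intro tendsto_intros \<phi>(2) dirform_tendsto wp)
    have "(norm (abs_l2 (\<phi> n)))\<^sup>2 \<le> (\<Sum>p\<in>S. (inner (abs_l2 (\<phi> n)) (c p))\<^sup>2) + e * dirform \<O> (abs_l2 (\<phi> n)) (abs_l2 (\<phi> n))" for n
      using cell_poincare_test[OF \<O>(1) h S \<phi>(1)] unfolding c hK .
    then show ?thesis by (intro LIMSEQ_le[OF l1 l2]) auto
  qed
  show ?thesis
  proof (rule that[of "c ` S"])
    show "finite (c ` S)" using S(1) by simp
    fix u assume u: "u \<in> H10 \<O>"
    \<comment> \<open>The conclusion sums over a set of vectors, so distinct cells must give
      distinct vectors: disjoint cells of positive measure have different indicators.\<close>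
    have "inj_on c S"
    proof (rule inj_onI)
      fix p p' assume p: "p \<in> S" "p' \<in> S" "c p = c p'"
      have fin: "emeasure lborel (cell h q) < \<infinity>" for q :: 'a using emeasure_cell[OF h, of q] by simp
      have "abs_l2 (indicator (cell h p)) = (abs_l2 (indicator (cell h p')) :: 'a l2)"
        using p(3) h by (simp add: c_def)
      then have ae: "AE x in lborel. indicator (cell h p) x = (indicator (cell h p') x :: real)"
        using fin by (subst (asm) abs_l2_eq_iff) (auto intro!: sq_integrable_indicator)
      show "p = p'"
      proof (rule ccontr)
        assume ne: "p \<noteq> p'"
        have "AE x in lborel. x \<notin> cell h p"
          using ae
        proof eventually_elim
          case (elim x)
          then show ?case using cell_unique[of x h p p'] S(3) p ne by (auto simp: indicator_def split: if_splits)
        qed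
        then have "emeasure lborel (cell h p) = 0" by (intro AE_iff_null_sets[THEN iffD2, THEN null_setsD1]) auto
        then show False using emeasure_cell[OF h, of p] h by simp
      qed
    qed
    then show "(norm u)\<^sup>2 \<le> (\<Sum>c\<in>c ` S. (inner u c)\<^sup>2) + e * dirform \<O> u u"
      using le[OF u] by (simp add: sum.reindex)
  qed
qed

text \<open>Rellich's theorem. \<open>cell_poincare\<close> with e = 1/(k+1) bounds the norm of a
  difference by finitely many functionals, up to a small multiple of the Dirichlet form; along a
  diagonal subsequence all of these countably many functionals converge.\<close>

lemma H10_compact:
  fixes X :: "nat \<Rightarrow> 'a::euclidean_space l2"
  assumes \<O>: "open \<O>" "bounded \<O>" and X: "\<And>n. X n \<in> H10 \<O>"
    and K: "\<And>n. (norm (X n))\<^sup>2 \<le> K" "\<And>n. dirform \<O> (X n) (X n) \<le> K"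
  obtains r u where "strict_mono (r :: nat \<Rightarrow> nat)" "(\<lambda>n. X (r n)) \<longlonglongrightarrow> u"
proof -
  have "\<exists>C. finite C \<and> (\<forall>u\<in>H10 \<O>. (norm u)\<^sup>2 \<le> (\<Sum>c\<in>C. (inner u c)\<^sup>2) + inverse (real (Suc k)) * dirform \<O> u u)" for k
    by (rule cell_poincare[OF \<O>, of "inverse (real (Suc k))"]) auto
  then obtain C where C: "\<And>k. finite (C k)"
    "\<And>k u. u \<in> H10 \<O> \<Longrightarrow> (norm u)\<^sup>2 \<le> (\<Sum>c\<in>C k. (inner u c)\<^sup>2) + inverse (real (Suc k)) * dirform \<O> u u" by metis
  \<comment> \<open>Adding 0 makes the countable set nonempty, hence the range of a
    sequence.\<close>
  define S where "S = insert 0 (\<Union>k. C k)"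
  have "countable S" unfolding S_def using C(1) by (auto intro: countable_finite)
  then have "range (from_nat_into S) = S" by (intro range_from_nat_into) (auto simp: S_def)
  then obtain c :: "nat \<Rightarrow> 'a l2" where c: "S = range c" by blast
  have K0: "K \<ge> 0" using order_trans[OF _ K(1)[of 0]] by simp
  interpret D: subseqs "\<lambda>i s. convergent (\<lambda>n. inner (X (s n)) (c i))"
  proof
    fix i and s :: "nat \<Rightarrow> nat"
    have "norm (inner (X (s n)) (c i)) \<le> sqrt K * norm (c i)" for n
    proof -
      have "norm (X (s n)) \<le> sqrt K" using K(1)[of "s n"] by (simp add: real_le_rsqrt)
      then have "norm (X (s n)) * norm (c i) \<le> sqrt K * norm (c i)" by (intro mult_right_mono) auto
      then show ?thesis using Cauchy_Schwarz_ineq2[of "X (s n)" "c i"] by simp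
    qed
    then have "bounded (range (\<lambda>n. inner (X (s n)) (c i)))" by (auto simp: bounded_iff)
    from bounded_imp_convergent_subsequence[OF this] obtain l r where "strict_mono r" "((\<lambda>n. inner (X (s n)) (c i)) \<circ> r) \<longlonglongrightarrow> l" by blast
    then show "\<exists>r'. strict_mono r' \<and> convergent (\<lambda>n. inner (X ((s \<circ> r') n)) (c i))"
      by (auto simp: convergent_def comp_def)
  qed
  define r where "r = D.diagseq"
  have r: "strict_mono r" unfolding r_def by (rule D.subseq_diagseq)
  have conv: "convergent (\<lambda>n. inner (X (r n)) (c i))" for i
  proof -
    \<comment> \<open>The diagonal sequence inherits the i-th property only after its first i + 1
      terms, which do not affect convergence.\<close>
    have "convergent (\<lambda>n. inner (X ((D.diagseq \<circ> ((+) (Suc i))) n)) (c i))"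
    proof (rule D.diagseq_holds)
      fix r s :: "nat \<Rightarrow> nat" and n
      assume "strict_mono r" "convergent (\<lambda>m. inner (X (s m)) (c n))"
      then show "convergent (\<lambda>m. inner (X ((s \<circ> r) m)) (c n))"
        using convergent_subseq_convergent[of "\<lambda>m. inner (X (s m)) (c n)" r] by (simp add: comp_def)
    qed
    then have "convergent (\<lambda>n. inner (X (r (n + Suc i))) (c i))" by (simp add: r_def comp_def add.commute)
    then show ?thesis by (subst (asm) convergent_ignore_initial_segment)
  qed
  have "Cauchy (\<lambda>n. X (r n))"
  proof (rule Cauchy_if_norm_sq_le)
    fix e :: real assume e: "e > 0"
    \<comment> \<open>By the parallelogram identity the differences have Dirichlet form at most 4 K,
      so this k makes the remainder smaller than e / 2.\<close>
    define k where "k = nat \<lceil>8 * (K + 1) / e\<rceil>"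
    have k: "inverse (real (Suc k)) * (4 * K) < e / 2"
    proof -
      have "8 * (K + 1) / e < real (Suc k)" unfolding k_def using e K0 by linarith
      then have "8 * (K + 1) < e * real (Suc k)" using e by (simp add: field_simps)
      moreover have "8 * K < 8 * (K + 1)" by simp
      ultimately have "8 * K < e * real (Suc k)" by (rule less_trans[rotated])
      then show ?thesis by (simp add: field_simps)
    qed
    have "\<forall>c'\<in>C k. \<exists>N. \<forall>m\<ge>N. \<forall>n\<ge>N. (inner (X (r m)) c' - inner (X (r n)) c')\<^sup>2 \<le> e / (2 * (real (card (C k)) + 1))"
    proof
      fix c' assume "c' \<in> C k"
      then obtain i where i: "c' = c i" using c unfolding S_def by blast
      have "Cauchy (\<lambda>n. inner (X (r n)) c')" using conv[of i] i by (simp add: Cauchy_convergent_iff)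
      moreover have "sqrt (e / (2 * (real (card (C k)) + 1))) > 0" using e by simp
      ultimately obtain N where N: "\<forall>m\<ge>N. \<forall>n\<ge>N. norm (inner (X (r m)) c' - inner (X (r n)) c') < sqrt (e / (2 * (real (card (C k)) + 1)))"
        using CauchyD by blast
      have "(inner (X (r m)) c' - inner (X (r n)) c')\<^sup>2 \<le> e / (2 * (real (card (C k)) + 1))" if "m \<ge> N" "n \<ge> N" for m n
      proof -
        have "\<bar>inner (X (r m)) c' - inner (X (r n)) c'\<bar>\<^sup>2 \<le> (sqrt (e / (2 * (real (card (C k)) + 1))))\<^sup>2"
          using N that by (intro power_mono) (auto intro: less_imp_le)
        then show ?thesis using e by (simp del: power2_less_eq_zero_iff)
      qed
      then show "\<exists>N. \<forall>m\<ge>N. \<forall>n\<ge>N. (inner (X (r m)) c' - inner (X (r n)) c')\<^sup>2 \<le> e / (2 * (real (card (C k)) + 1))" by blast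
    qed
    then obtain N where N: "\<And>c' m n. c' \<in> C k \<Longrightarrow> m \<ge> N c' \<Longrightarrow> n \<ge> N c' \<Longrightarrow>
      (inner (X (r m)) c' - inner (X (r n)) c')\<^sup>2 \<le> e / (2 * (real (card (C k)) + 1))" by metis
    define N0 where "N0 = (\<Sum>c'\<in>C k. N c')"
    have N0: "N c' \<le> N0" if "c' \<in> C k" for c' unfolding N0_def using that C(1) by (intro member_le_sum) auto
    have "(norm (X (r m) - X (r n)))\<^sup>2 < e" if mn: "m \<ge> N0" "n \<ge> N0" for m n
    proof -
      have d: "X (r m) - X (r n) \<in> H10 \<O>" by (rule H10_diff(1)[OF \<O>(1) X X])
      have "dirform \<O> (X (r m) - X (r n)) (X (r m) - X (r n)) + dirform \<O> (X (r m) + X (r n)) (X (r m) + X (r n))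
         = 2 * dirform \<O> (X (r m)) (X (r m)) + 2 * dirform \<O> (X (r n)) (X (r n))"
        by (simp add: dirform_diff_left dirform_diff_right dirform_add_left dirform_add_right \<O> X H10_diff H10_add dirform_commute[of \<O> "X (r n)" "X (r m)"])
      then have dd: "dirform \<O> (X (r m) - X (r n)) (X (r m) - X (r n)) \<le> 4 * K"
        using K(2)[of "r m"] K(2)[of "r n"] dirform_nonneg[of \<O> "X (r m) + X (r n)"] by linarith
      have "(norm (X (r m) - X (r n)))\<^sup>2 \<le> (\<Sum>c'\<in>C k. (inner (X (r m) - X (r n)) c')\<^sup>2) + inverse (real (Suc k)) * dirform \<O> (X (r m) - X (r n)) (X (r m) - X (r n))"
        by (rule C(2)[OF d])
      also have "(\<Sum>c'\<in>C k. (inner (X (r m) - X (r n)) c')\<^sup>2) \<le> (\<Sum>c'\<in>C k. e / (2 * (real (card (C k)) + 1)))"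
        unfolding inner_diff_left
      proof (rule sum_mono)
        fix c' assume c': "c' \<in> C k"
        then have "m \<ge> N c'" "n \<ge> N c'" using N0[OF c'] mn by auto
        from N[OF c' this] show "(inner (X (r m)) c' - inner (X (r n)) c')\<^sup>2 \<le> e / (2 * (real (card (C k)) + 1))" .
      qed
      also have "\<dots> = real (card (C k)) * (e / (2 * (real (card (C k)) + 1)))" by simp
      also have "\<dots> \<le> e / 2" using e by (simp add: field_simps)
      also have "inverse (real (Suc k)) * dirform \<O> (X (r m) - X (r n)) (X (r m) - X (r n)) \<le> inverse (real (Suc k)) * (4 * K)"
        by (intro mult_left_mono dd) simp
      finally show ?thesis using k by linarith
    qed
    then show "\<exists>N. \<forall>m\<ge>N. \<forall>n\<ge>N. (norm (X (r m) - X (r n)))\<^sup>2 < e" by blast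
  qed
  then obtain u where "(\<lambda>n. X (r n)) \<longlonglongrightarrow> u" using Cauchy_convergent_iff convergent_def by blast
  with r show ?thesis by (rule that)
qed

subsection \<open>The first eigenvalue\<close>

text \<open>A normalised bump inside the domain; it makes the set of Rayleigh quotients
  nonempty.\<close>

lemma H10_nontrivial:
  fixes \<O> :: "'a::euclidean_space set"
  assumes "open \<O>" "\<O> \<noteq> {}"
  obtains u where "u \<in> H10 \<O>" "norm u = 1"
proof -
  obtain x e where e: "e > 0" "cball x e \<subseteq> \<O>" using assms open_contains_cball by blast
  obtain a b where ab: "x \<in> box a b" "box a b \<subseteq> ball x e"
    using rational_boxes[OF e(1), of x] by blast
  have "cbox a b = closure (box a b)" using ab by (subst closure_box) auto
  also have "\<dots> \<subseteq> cball x e" using ab(2) by (intro closure_minimal) auto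
  finally have sub: "cbox a b \<subseteq> \<O>" using e by blast
  define v where "v = abs_l2 (bump 1 a b)"
  have t: "test_function \<O> (bump 1 a b)" by (rule bump_test_function[OF sub])
  have v: "v \<in> H10 \<O>" unfolding v_def by (rule test_function_H10(1)[OF assms(1) t])
  have "v \<noteq> 0"
  proof
    assume "v = 0"
    then have "AE x in lborel. rep_l2 (abs_l2 (bump 1 a b)) x = 0" using rep_l2_zero by (simp add: v_def)
    then have "AE x in lborel. bump 1 a b x = 0"
      using rep_abs_l2[OF test_function_sq_integrable[OF t]] by eventually_elim simp
    then have "AE x in lborel. x \<notin> box a b"
    proof eventually_elim
      case (elim x)
      show ?case
      proof
        assume "x \<in> box a b"
        then have "bump 1 a b x > 0" unfolding bump_def by (intro prod_pos) (auto simp: mem_box psi_pos)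
        then show False using elim by simp
      qed
    qed
    then have "emeasure lborel (box a b) = 0" by (intro AE_iff_null_sets[THEN iffD2, THEN null_setsD1]) auto
    moreover have "emeasure lborel (box a b) = ennreal (\<Prod>i\<in>Basis. (b - a) \<bullet> i)"
    proof -
      have "a \<bullet> i \<le> b \<bullet> i" if "i \<in> Basis" for i using ab(1) that by (force simp: mem_box)
      then show ?thesis by (simp add: emeasure_lborel_box_eq)
    qed
    moreover have "(\<Prod>i\<in>Basis. (b - a) \<bullet> i) > 0"
      (is "?P > 0")
    proof (rule prod_pos)
      fix i :: 'a assume "i \<in> Basis"
      then show "0 < (b - a) \<bullet> i" using ab(1) by (force simp: mem_box inner_diff_left)
    qed
    ultimately have "ennreal ?P = 0" "?P > 0" by (simp_all only:)
    then show False by (simp only: ennreal_eq_0_iff)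
  qed
  then show ?thesis using H10_scaleR(1)[OF assms(1) v, of "1 / norm v"]
    by (intro that[of "(1 / norm v) *\<^sub>R v"]) auto
qed

text \<open>The first-order condition at a minimum, b being half the derivative at t = 0. It turns
  minimality into the eigenvalue equation and into the equation of
  \<open>lax_milgram\<close>.\<close>

lemma quadratic_nonneg_imp_zero:
  fixes b c :: real
  assumes "\<And>t. 0 \<le> 2 * t * b + t\<^sup>2 * c"
  shows "b = 0"
proof (rule ccontr)
  assume b: "b \<noteq> 0"
  define s where "s = \<bar>c\<bar> + 1"
  have s: "s > 0" "c < s" by (auto simp: s_def)
  have "0 \<le> 2 * (- b / s) * b + (- b / s)\<^sup>2 * c" by (rule assms)
  also have "\<dots> = (b\<^sup>2 / s) * (c / s - 2)" using s by (simp add: field_simps power2_eq_square)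
  finally have "0 \<le> (b\<^sup>2 / s) * (c / s - 2)" .
  moreover have "c / s < 2" "b\<^sup>2 / s > 0" using s b by (auto simp: field_simps)
  ultimately show False using mult_pos_neg[of "b\<^sup>2 / s" "c / s - 2"] by linarith
qed

text \<open>The minimum of the Rayleigh quotient is attained by compactness, and it is the least eigenvalue.\<close>

lemma first_eigenvalue_poincare:
  fixes \<O> :: "'a::euclidean_space set"
  assumes \<O>: "open \<O>" "bounded \<O>" "\<O> \<noteq> {}" and v: "v \<in> H10 \<O>"
  shows "first_eigenvalue \<O> * (norm v)\<^sup>2 \<le> dirform \<O> v v"
proof -
  define R where "R = {dirform \<O> u u | u. u \<in> H10 \<O> \<and> norm u = 1}"
  define l where "l = Inf R"
  obtain u0 where u0: "u0 \<in> H10 \<O>" "norm u0 = 1" by (rule H10_nontrivial[OF \<O>(1,3)])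
  have ne: "R \<noteq> {}" using u0 by (auto simp: R_def)
  have bdd: "bdd_below R" by (rule bdd_belowI[of _ 0]) (auto simp: R_def dirform_nonneg)
  have ray: "l * (norm u)\<^sup>2 \<le> dirform \<O> u u" if u: "u \<in> H10 \<O>" for u
  proof (cases "u = 0")
    case True
    then show ?thesis by (simp add: dirform_nonneg)
  next
    case False
    let ?w = "(1 / norm u) *\<^sub>R u"
    have w: "?w \<in> H10 \<O>" "norm ?w = 1" using H10_scaleR(1)[OF \<O>(1) u] False by auto
    then have "l \<le> dirform \<O> ?w ?w" unfolding l_def by (intro cInf_lower bdd) (auto simp: R_def)
    also have "\<dots> = dirform \<O> u u / (norm u)\<^sup>2"
      by (simp add: dirform_scaleR_left dirform_scaleR_right \<O> u power2_eq_square)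
    finally show ?thesis using False by (simp add: field_simps)
  qed
  have "\<exists>u. u \<in> H10 \<O> \<and> norm u = 1 \<and> dirform \<O> u u < l + inverse (real (Suc n))" for n
    using cInf_lessD[OF ne, of "l + inverse (real (Suc n))"] unfolding l_def[symmetric] by (auto simp: R_def)
  then obtain X where X: "\<And>n. X n \<in> H10 \<O>" "\<And>n. norm (X n) = 1" "\<And>n. dirform \<O> (X n) (X n) < l + inverse (real (Suc n))"
    by metis
  have l0: "l \<ge> 0" unfolding l_def using ne by (intro cInf_greatest) (auto simp: R_def dirform_nonneg)
  have bd: "dirform \<O> (X n) (X n) \<le> l + 1" for n
  proof -
    have "inverse (real (Suc n)) \<le> 1" by (simp add: field_simps)
    then show ?thesis using X(3)[of n] by linarith
  qed
  obtain r u where r: "strict_mono (r :: nat \<Rightarrow> nat)" "(\<lambda>n. X (r n)) \<longlonglongrightarrow> u"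
    by (rule H10_compact[OF \<O>(1,2), where X = X and K = "l + 1"]) (use X(1,2) l0 bd in auto)
  define Y where "Y n = X (r n)" for n
  have Y: "Y n \<in> H10 \<O>" "norm (Y n) = 1" "dirform \<O> (Y n) (Y n) \<le> l + inverse (real (Suc n))" for n
  proof -
    have "real n \<le> real (r n)" using seq_suble[OF r(1)] by simp
    then have "inverse (real (Suc (r n))) \<le> inverse (real (Suc n))" by (intro le_imp_inverse_le) auto
    then show "dirform \<O> (Y n) (Y n) \<le> l + inverse (real (Suc n))" using X(3)[of "r n"] unfolding Y_def by linarith
  qed (auto simp: Y_def X)
  have Yu: "Y \<longlonglongrightarrow> u" using r(2) by (simp add: Y_def[abs_def])
  \<comment> \<open>The parallelogram identity, with the Rayleigh bound applied to the sum: a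
    normalised minimising sequence that converges in L^2 is also Cauchy in the energy norm.\<close>
  have pm: "dirform \<O> (Y m - Y n) (Y m - Y n) \<le> 2 * inverse (real (Suc m)) + 2 * inverse (real (Suc n)) + l * (norm (Y m - Y n))\<^sup>2" for m n
  proof -
    have "dirform \<O> (Y m - Y n) (Y m - Y n) + dirform \<O> (Y m + Y n) (Y m + Y n)
         = 2 * dirform \<O> (Y m) (Y m) + 2 * dirform \<O> (Y n) (Y n)"
      by (simp add: dirform_diff_left dirform_diff_right dirform_add_left dirform_add_right \<O> Y H10_diff H10_add dirform_commute[of \<O> "Y n" "Y m"])
    moreover have "l * (norm (Y m + Y n))\<^sup>2 \<le> dirform \<O> (Y m + Y n) (Y m + Y n)"
      by (intro ray H10_add(1) \<O> Y)
    moreover have "(norm (Y m - Y n))\<^sup>2 + (norm (Y m + Y n))\<^sup>2 = 4"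
      using Y(2)[of m] Y(2)[of n] unfolding power2_norm_eq_inner
      by (simp add: inner_diff_left inner_diff_right inner_add_left inner_add_right norm_eq_1 inner_commute)
    then have "l * (norm (Y m + Y n))\<^sup>2 = l * 4 - l * (norm (Y m - Y n))\<^sup>2"
      by (simp add: right_diff_distrib[symmetric])
    ultimately show ?thesis using Y(3)[of m] Y(3)[of n] by linarith
  qed
  have CY: "Cauchy Y" using Yu by (rule LIMSEQ_imp_Cauchy)
  have "\<exists>N. \<forall>m\<ge>N. \<forall>n\<ge>N. (norm (Y m - Y n))\<^sup>2 + dirform \<O> (Y m - Y n) (Y m - Y n) < e" if e: "e > 0" for e
  proof -
    have "sqrt (e / (2 * (l + 1))) > 0" using e l0 by simp
    then obtain N1 where N1: "\<forall>m\<ge>N1. \<forall>n\<ge>N1. norm (Y m - Y n) < sqrt (e / (2 * (l + 1)))"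
      using CauchyD[OF CY] by blast
    obtain N2 where N2: "inverse (real (Suc N2)) < e / 8" using reals_Archimedean[of "e / 8"] e by auto
    have "(norm (Y m - Y n))\<^sup>2 + dirform \<O> (Y m - Y n) (Y m - Y n) < e" if mn: "m \<ge> max N1 N2" "n \<ge> max N1 N2" for m n
    proof -
      have "norm (Y m - Y n) < sqrt (e / (2 * (l + 1)))" using N1 mn by simp
      then have "(norm (Y m - Y n))\<^sup>2 < (sqrt (e / (2 * (l + 1))))\<^sup>2" by (intro power_strict_mono) auto
      then have "(norm (Y m - Y n))\<^sup>2 < e / (2 * (l + 1))" using e l0 by simp
      then have "(l + 1) * (norm (Y m - Y n))\<^sup>2 < e / 2" using l0 by (simp add: field_simps)
      moreover have "inverse (real (Suc m)) \<le> inverse (real (Suc N2))" "inverse (real (Suc n)) \<le> inverse (real (Suc N2))"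
        using mn by (auto intro!: le_imp_inverse_le)
      moreover have "(l + 1) * (norm (Y m - Y n))\<^sup>2 = l * (norm (Y m - Y n))\<^sup>2 + (norm (Y m - Y n))\<^sup>2"
        by (simp add: algebra_simps)
      ultimately show ?thesis using pm[of m n] N2 by linarith
    qed
    then show ?thesis by blast
  qed
  then obtain w where w: "w \<in> H10 \<O>" "Y \<longlonglongrightarrow> w" "\<And>i. i \<in> Basis \<Longrightarrow> (\<lambda>n. weak_partial \<O> i (Y n)) \<longlonglongrightarrow> weak_partial \<O> i w"
    by (rule H10_complete[OF \<O>(1) Y(1)]) blast+
  have nw: "norm w = 1"
    using tendsto_norm[OF w(2)] by (simp add: Y(2) LIMSEQ_const_iff)
  have "(\<lambda>n. l + inverse (real (Suc n))) \<longlonglongrightarrow> l + 0"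
    by (intro tendsto_add tendsto_const LIMSEQ_inverse_real_of_nat)
  from LIMSEQ_le[OF dirform_tendsto[OF w(3) w(3)] this] have "dirform \<O> w w \<le> l" using Y(3) by auto
  then have dw: "dirform \<O> w w = l" using ray[OF w(1)] nw by simp
  \<comment> \<open>The quadratic polynomial in t is the difference of the two sides of the Rayleigh
    bound at w + t z; it vanishes at t = 0.\<close>
  have eig: "dirform \<O> w z = l * inner w z" if z: "z \<in> H10 \<O>" for z
  proof -
    have "0 \<le> 2 * t * (dirform \<O> w z - l * inner w z) + t\<^sup>2 * (dirform \<O> z z - l * inner z z)" for t
    proof -
      have tz: "t *\<^sub>R z \<in> H10 \<O>" by (rule H10_scaleR(1)[OF \<O>(1) z])
      have "l * (norm (w + t *\<^sub>R z))\<^sup>2 \<le> dirform \<O> (w + t *\<^sub>R z) (w + t *\<^sub>R z)"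
        by (intro ray H10_add(1) \<O>(1) w(1) tz)
      moreover have "dirform \<O> (w + t *\<^sub>R z) (w + t *\<^sub>R z) = l + 2 * t * dirform \<O> w z + t\<^sup>2 * dirform \<O> z z"
        by (simp add: dirform_add_left dirform_add_right dirform_scaleR_left dirform_scaleR_right \<O> w(1) z tz H10_add dw
          dirform_commute[of \<O> z w] power2_eq_square algebra_simps)
      moreover have "(norm (w + t *\<^sub>R z))\<^sup>2 = 1 + 2 * t * inner w z + t\<^sup>2 * inner z z"
        using nw unfolding power2_norm_eq_inner inner_add_left inner_add_right
        by (simp add: norm_eq_1 inner_commute[of z w] power2_eq_square algebra_simps)
      ultimately show ?thesis by (simp add: algebra_simps)
    qed
    from quadratic_nonneg_imp_zero[OF this] show ?thesis by simp
  qed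
  have "minus_laplacian_eigenvalue \<O> l"
    unfolding minus_laplacian_eigenvalue_def dirichlet_laplacian_dirform
    using eig w(1) nw by (intro bexI[of _ w]) auto
  moreover have "l \<le> \<mu>" if "minus_laplacian_eigenvalue \<O> \<mu>" for \<mu>
  proof -
    obtain z where z: "z \<in> H10 \<O>" "z \<noteq> 0" "dirform \<O> z z = \<mu> * inner z z"
      using \<open>minus_laplacian_eigenvalue \<O> \<mu>\<close> unfolding minus_laplacian_eigenvalue_def dirichlet_laplacian_dirform by auto
    then show ?thesis using ray[OF z(1)] by (simp add: power2_norm_eq_inner)
  qed
  ultimately have "first_eigenvalue \<O> = l"
    unfolding first_eigenvalue_def by (intro Least_equality)
  then show ?thesis using ray[OF v] by simp
qed

section \<open>The resolvent of the drift\<close>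

text \<open>The form is symmetric, so the solution is the minimiser of the energy E(u) = q(u, u)/2 -
  <y, u>. Coercivity bounds E from below and, by the parallelogram identity, makes minimising
  sequences Cauchy.\<close>

lemma lax_milgram:
  fixes \<O> :: "'a::euclidean_space set"
  assumes \<O>: "open \<O>" and c: "c > 0"
    and coer: "\<And>u. u \<in> H10 \<O> \<Longrightarrow> c * ((norm u)\<^sup>2 + dirform \<O> u u) \<le> k * (norm u)\<^sup>2 + t * dirform \<O> u u"
  obtains u where "u \<in> H10 \<O>" "\<And>v. v \<in> H10 \<O> \<Longrightarrow> k * inner u v + t * dirform \<O> u v = inner y v"
proof -
  define q where "q u v = k * inner u v + t * dirform \<O> u v" for u v
  define E where "E u = q u u / 2 - inner y u" for u
  note lin = dirform_diff_left dirform_diff_right dirform_add_left dirform_add_right dirform_scaleR_left dirform_scaleR_right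
    inner_diff_left inner_diff_right inner_add_left inner_add_right
  have coer': "c * ((norm u)\<^sup>2 + dirform \<O> u u) \<le> q u u" if "u \<in> H10 \<O>" for u
    using coer[OF that] by (simp add: q_def power2_norm_eq_inner)
  have lower: "- ((norm y)\<^sup>2 / (2 * c)) \<le> E u" if u: "u \<in> H10 \<O>" for u
  proof -
    have "0 \<le> (c * norm u - norm y)\<^sup>2 / (2 * c)" using c by simp
    also have "\<dots> = c * (norm u)\<^sup>2 / 2 - norm y * norm u + (norm y)\<^sup>2 / (2 * c)"
      using c by (simp add: power2_diff power_mult_distrib field_simps power2_eq_square)
    finally have "norm y * norm u - (norm y)\<^sup>2 / (2 * c) \<le> c * (norm u)\<^sup>2 / 2" by linarith
    moreover have "c * (norm u)\<^sup>2 \<le> q u u"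
      using coer'[OF u] mult_nonneg_nonneg[OF less_imp_le[OF c] dirform_nonneg[of \<O> u]] unfolding distrib_left by linarith
    moreover have "inner y u \<le> norm y * norm u" by (rule norm_cauchy_schwarz)
    ultimately show ?thesis unfolding E_def by linarith
  qed
  define m where "m = Inf (E ` H10 \<O>)"
  have bdd: "bdd_below (E ` H10 \<O>)" by (rule bdd_belowI[of _ "- ((norm y)\<^sup>2 / (2 * c))"]) (use lower in auto)
  have ne: "E ` H10 \<O> \<noteq> {}" using H10_zero[OF \<O>] by auto
  have mE: "m \<le> E u" if "u \<in> H10 \<O>" for u unfolding m_def using that bdd by (intro cInf_lower) auto
  have "\<exists>u\<in>H10 \<O>. E u < m + inverse (real (Suc n))" for n
    using cInf_lessD[OF ne, of "m + inverse (real (Suc n))"] unfolding m_def[symmetric] by auto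
  then obtain X where X: "\<And>n. X n \<in> H10 \<O>" "\<And>n. E (X n) < m + inverse (real (Suc n))" by metis
  have par: "c * ((norm (X i - X j))\<^sup>2 + dirform \<O> (X i - X j) (X i - X j)) \<le> 4 * inverse (real (Suc i)) + 4 * inverse (real (Suc j))" for i j
  proof -
    define w where "w = X i + X j"
    let ?h = "(1/2) *\<^sub>R w"
    have s: "w \<in> H10 \<O>" "X i - X j \<in> H10 \<O>" unfolding w_def by (intro H10_add H10_diff \<O> X)+
    have "q ?h ?h = q w w / 4"
      unfolding q_def dirform_scaleR_left[OF \<O> s(1)] dirform_scaleR_right[OF \<O> s(1)] by (simp add: field_simps)
    moreover have "inner y ?h = inner y w / 2" by simp
    ultimately have "8 * E ?h = q w w - 4 * inner y w"
      unfolding E_def by simp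
    moreover have "q (X i - X j) (X i - X j) = 2 * q (X i) (X i) + 2 * q (X j) (X j) - q w w"
      unfolding q_def w_def
      by (simp add: lin \<O> X s[unfolded w_def] dirform_commute[of \<O> "X j" "X i"] inner_commute[of "X j" "X i"])
        (simp add: algebra_simps)
    moreover have "4 * inner y w = 4 * inner y (X i) + 4 * inner y (X j)" by (simp add: w_def inner_add_right)
    moreover have "4 * E (X i) = 2 * q (X i) (X i) - 4 * inner y (X i)" "4 * E (X j) = 2 * q (X j) (X j) - 4 * inner y (X j)"
      by (simp_all add: E_def)
    \<comment> \<open>The half sum has energy at least m, which turns this identity into the Cauchy
      estimate.\<close>
    ultimately have "q (X i - X j) (X i - X j) = 4 * E (X i) + 4 * E (X j) - 8 * E ?h"
      by simp
    moreover have "m \<le> E ?h" by (intro mE H10_scaleR(1) \<O> s)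
    ultimately have "q (X i - X j) (X i - X j) \<le> 4 * inverse (real (Suc i)) + 4 * inverse (real (Suc j))"
      using X(2)[of i] X(2)[of j] by linarith
    then show ?thesis using coer'[OF s(2)] by linarith
  qed
  have "\<exists>N. \<forall>m\<ge>N. \<forall>n\<ge>N. (norm (X m - X n))\<^sup>2 + dirform \<O> (X m - X n) (X m - X n) < e" if e: "e > 0" for e
  proof -
    obtain N where N: "inverse (real (Suc N)) < c * e / 8" using reals_Archimedean[of "c * e / 8"] e c by auto
    have "(norm (X m - X n))\<^sup>2 + dirform \<O> (X m - X n) (X m - X n) < e" if "m \<ge> N" "n \<ge> N" for m n
    proof -
      have "inverse (real (Suc m)) \<le> inverse (real (Suc N))" "inverse (real (Suc n)) \<le> inverse (real (Suc N))"
        using that by (auto intro!: le_imp_inverse_le)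
      then have "c * ((norm (X m - X n))\<^sup>2 + dirform \<O> (X m - X n) (X m - X n)) < c * e"
        using par[of m n] N by linarith
      then show ?thesis using c by simp
    qed
    then show ?thesis by blast
  qed
  then obtain u where u: "u \<in> H10 \<O>" "X \<longlonglongrightarrow> u" "\<And>i. i \<in> Basis \<Longrightarrow> (\<lambda>n. weak_partial \<O> i (X n)) \<longlonglongrightarrow> weak_partial \<O> i u"
    by (rule H10_complete[OF \<O> X(1)]) blast+
  have "(\<lambda>n. E (X n)) \<longlonglongrightarrow> E u"
    unfolding E_def q_def by (intro tendsto_intros dirform_tendsto u) auto
  moreover have "(\<lambda>n. m + inverse (real (Suc n))) \<longlonglongrightarrow> m + 0"
    by (intro tendsto_add tendsto_const LIMSEQ_inverse_real_of_nat)
  ultimately have "E u \<le> m + 0" by (rule LIMSEQ_le) (use X(2) in \<open>auto intro: less_imp_le\<close>)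
  then have Eu: "E u = m" using mE[OF u(1)] by simp
  have "q u v = inner y v" if v: "v \<in> H10 \<O>" for v
  proof -
    have "0 \<le> 2 * r * (q u v - inner y v) + r\<^sup>2 * q v v" for r
    proof -
      have rv: "r *\<^sub>R v \<in> H10 \<O>" "u + r *\<^sub>R v \<in> H10 \<O>" by (intro H10_scaleR(1) H10_add(1) \<O> v u(1))+
      have "E u \<le> E (u + r *\<^sub>R v)" unfolding Eu by (rule mE[OF rv(2)])
      moreover have "2 * E (u + r *\<^sub>R v) - 2 * E u = 2 * r * (q u v - inner y v) + r\<^sup>2 * q v v"
        unfolding E_def q_def
        by (simp add: lin \<O> v u(1) rv dirform_commute[of \<O> v u] inner_commute[of v u] algebra_simps power2_eq_square)
      ultimately show ?thesis by linarith
    qed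
    from quadratic_nonneg_imp_zero[OF this] show ?thesis by simp
  qed
  then show ?thesis using u(1) by (intro that[of u]) (auto simp: q_def)
qed

section \<open>The linear part of one step and its Lipschitz perturbations\<close>

locale drift_step =
  fixes \<O> :: "'a::euclidean_space set" and f :: "real \<Rightarrow> real" and L \<tau> :: real
  assumes open_dom: "open \<O>" and bounded_dom: "bounded \<O>" and dom_nonempty: "\<O> \<noteq> {}"
    and cont_f: "continuous_on UNIV f"
    and one_sided: "\<And>s t. (f s - f t) * (s - t) \<le> L * (s - t)\<^sup>2"
    and \<tau>_pos: "0 < \<tau>" and L_less: "L < first_eigenvalue \<O>"
begin

abbreviation "lam \<equiv> first_eigenvalue \<O>"

text \<open>The modulus of strong monotonicity of u - \<tau> (A u + F(u)): Poincare's inequality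
  contributes \<tau> lam, the one-sided Lipschitz bound costs \<tau> L.\<close>

definition \<alpha> :: real where "\<alpha> = 1 + \<tau> * (lam - L)"

lemma \<alpha>_pos: "\<alpha> > 0"
  unfolding \<alpha>_def using \<tau>_pos L_less by (simp add: add_pos_pos)

text \<open>The linear part of the step after the term - \<tau> L u has been added to it, so that
  the remaining nonlinearity L s - f(s) is nondecreasing.\<close>

definition bform :: "'a l2 \<Rightarrow> 'a l2 \<Rightarrow> real" where
  "bform u v = (1 - \<tau> * L) * inner u v + \<tau> * dirform \<O> u v"

lemma bform_lower: "u \<in> H10 \<O> \<Longrightarrow> \<alpha> * (norm u)\<^sup>2 \<le> bform u u"
  using mult_left_mono[OF first_eigenvalue_poincare[OF open_dom bounded_dom dom_nonempty, of u] less_imp_le[OF \<tau>_pos]]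
  by (simp add: bform_def \<alpha>_def power2_norm_eq_inner algebra_simps)

text \<open>The coefficient 1 - \<tau> L may be negative, so the Dirichlet form does two jobs: a
  fraction \<theta> of it is kept, and the rest is converted into norm by Poincare's
  inequality.\<close>

lemma bform_coercive:
  obtains c where "c > 0" "\<And>u. u \<in> H10 \<O> \<Longrightarrow> c * ((norm u)\<^sup>2 + dirform \<O> u u) \<le> bform u u"
proof -
  \<comment> \<open>The second entry keeps the loss \<theta> \<tau> lam at most half of
    \<alpha>.\<close>
  define \<theta> where "\<theta> = min (1/2) (\<alpha> / (2 * (\<tau> * \<bar>lam\<bar> + 1)))"
  have p: "\<tau> * \<bar>lam\<bar> + 1 > 0" using \<tau>_pos by (simp add: add_nonneg_pos)
  have \<theta>: "\<theta> > 0" "\<theta> < 1" using \<alpha>_pos p by (auto simp: \<theta>_def)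
  have "\<theta> * (\<tau> * \<bar>lam\<bar> + 1) \<le> \<alpha> / (2 * (\<tau> * \<bar>lam\<bar> + 1)) * (\<tau> * \<bar>lam\<bar> + 1)"
    using p by (intro mult_right_mono) (auto simp: \<theta>_def)
  also have "\<dots> = \<alpha> / 2" using p by (simp add: field_simps)
  finally have h: "\<theta> * (\<tau> * \<bar>lam\<bar> + 1) \<le> \<alpha> / 2" .
  have "\<theta> * (\<tau> * lam) \<le> \<theta> * (\<tau> * \<bar>lam\<bar>)" using \<theta> \<tau>_pos by (intro mult_left_mono) auto
  then have "\<theta> * (\<tau> * lam) \<le> \<alpha> / 2" using h \<theta> by (simp add: algebra_simps)
  define c where "c = min (\<alpha> / 2) (\<tau> * \<theta>)"
  have c: "c > 0" "c \<le> \<alpha> / 2" "c \<le> \<tau> * \<theta>" using \<alpha>_pos \<theta> \<tau>_pos by (auto simp: c_def)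
  have "c * ((norm u)\<^sup>2 + dirform \<O> u u) \<le> bform u u" if u: "u \<in> H10 \<O>" for u
  proof -
    have "lam * (norm u)\<^sup>2 \<le> dirform \<O> u u" by (rule first_eigenvalue_poincare[OF open_dom bounded_dom dom_nonempty u])
    then have "(\<tau> * (1 - \<theta>)) * (lam * (norm u)\<^sup>2) \<le> (\<tau> * (1 - \<theta>)) * dirform \<O> u u"
      using \<theta> \<tau>_pos by (intro mult_left_mono) auto
    moreover have "c * (norm u)\<^sup>2 \<le> (\<alpha> - \<theta> * (\<tau> * lam)) * (norm u)\<^sup>2"
      using c \<open>\<theta> * (\<tau> * lam) \<le> \<alpha> / 2\<close> by (intro mult_right_mono) auto
    moreover have "c * dirform \<O> u u \<le> \<tau> * \<theta> * dirform \<O> u u"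
      using c by (intro mult_right_mono dirform_nonneg) auto
    ultimately show ?thesis
      by (simp add: bform_def \<alpha>_def power2_norm_eq_inner algebra_simps)
  qed
  then show ?thesis using c(1) by (intro that) auto
qed

lemma bform_diff_left: "u \<in> H10 \<O> \<Longrightarrow> v \<in> H10 \<O> \<Longrightarrow> bform (u - v) w = bform u w - bform v w"
  by (simp add: bform_def dirform_diff_left open_dom inner_diff_left algebra_simps)

text \<open>With \<open>g(s) = M s - \<eta>(s)\<close>, the equation becomes a fixed point problem for
  \<open>u \<mapsto> (bform + \<tau> M)\<^sup>-\<^sup>1 (y + \<tau> g(u))\<close>, a contraction since \<open>g\<close> is \<open>M\<close>-Lipschitz.\<close>

lemma solve_lipschitz:
  assumes mono: "mono \<eta>" and lip: "\<And>s t. \<bar>\<eta> s - \<eta> t\<bar> \<le> M * \<bar>s - t\<bar>" and zero: "\<eta> 0 = 0"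
  obtains u where "u \<in> H10 \<O>" "\<And>v. v \<in> H10 \<O> \<Longrightarrow> bform u v + \<tau> * inner (comp_l2 \<eta> u) v = inner y v"
proof -
  have M: "M \<ge> 0" using lip[of 1 0] by auto
  have [measurable]: "\<eta> \<in> borel_measurable borel" by (rule borel_measurable_mono[OF mono])
  have sq: "sq_integrable (\<lambda>x. \<eta> (rep_l2 u x))" for u :: "'a l2"
    by (rule sq_integrable_comp[of _ M]) (use lip[of _ 0] zero in auto)
  define g where "g s = M * s - \<eta> s" for s
  \<comment> \<open>The slopes of \<eta> lie between 0 and M, hence so do those of g; monotonicity
    keeps the Lipschitz constant at M instead of 2 M.\<close>
  have g_lip: "\<bar>g s - g t\<bar> \<le> M * \<bar>s - t\<bar>" for s t
  proof -
    have "\<bar>M * (s - t) - (\<eta> s - \<eta> t)\<bar> \<le> M * \<bar>s - t\<bar>"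
    proof (cases "s \<ge> t")
      case True
      then have "\<eta> t \<le> \<eta> s" using mono by (simp add: monoD)
      then show ?thesis using lip[of s t] True M by (simp add: abs_le_iff)
    next
      case False
      then have "\<eta> s \<le> \<eta> t" using mono by (simp add: monoD)
      then show ?thesis using lip[of s t] False M by (simp add: abs_le_iff algebra_simps)
    qed
    then show ?thesis by (simp add: g_def algebra_simps)
  qed
  have g0: "g 0 = 0" and gm: "g \<in> borel_measurable borel" using zero by (auto simp: g_def[abs_def])
  have comp_g: "comp_l2 g u = M *\<^sub>R u - comp_l2 \<eta> u" for u :: "'a l2"
  proof -
    have "comp_l2 g u = abs_l2 (\<lambda>x. M * rep_l2 u x) - abs_l2 (\<lambda>x. \<eta> (rep_l2 u x))"
      unfolding comp_l2_def g_def by (rule abs_l2_diff[symmetric]) (auto intro: sq_integrable_scale sq)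
    also have "abs_l2 (\<lambda>x. M * rep_l2 u x) = M *\<^sub>R u" using abs_l2_scaleR[of "rep_l2 u" M] by simp
    finally show ?thesis by (simp add: comp_l2_def)
  qed
  have "\<exists>u\<in>H10 \<O>. \<forall>v\<in>H10 \<O>. bform u v + \<tau> * M * inner u v = inner z v" for z
  proof -
    obtain c where c: "c > 0" "\<And>u. u \<in> H10 \<O> \<Longrightarrow> c * ((norm u)\<^sup>2 + dirform \<O> u u) \<le> bform u u"
      by (rule bform_coercive) blast
    have "c * ((norm u)\<^sup>2 + dirform \<O> u u) \<le> (1 - \<tau> * L + \<tau> * M) * (norm u)\<^sup>2 + \<tau> * dirform \<O> u u" if u: "u \<in> H10 \<O>" for u
    proof -
      have "0 \<le> \<tau> * M * (norm u)\<^sup>2" using M \<tau>_pos by simp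
      then show ?thesis using c(2)[OF u] unfolding bform_def power2_norm_eq_inner by (simp add: algebra_simps)
    qed
    then obtain u where "u \<in> H10 \<O>" "\<And>v. v \<in> H10 \<O> \<Longrightarrow> (1 - \<tau> * L + \<tau> * M) * inner u v + \<tau> * dirform \<O> u v = inner z v"
      by (rule lax_milgram[OF open_dom c(1)]) blast+
    then show ?thesis by (intro bexI[of _ u]) (auto simp: bform_def algebra_simps)
  qed
  then obtain S where S: "\<And>z. S z \<in> H10 \<O>" "\<And>z v. v \<in> H10 \<O> \<Longrightarrow> bform (S z) v + \<tau> * M * inner (S z) v = inner z v"
    by metis
  have S_lip: "(\<alpha> + \<tau> * M) * norm (S z - S z') \<le> norm (z - z')" for z z'
  proof (cases "S z = S z'")
    case False
    let ?w = "S z - S z'"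
    have w: "?w \<in> H10 \<O>" by (intro H10_diff open_dom S)
    have "bform ?w ?w + \<tau> * M * inner ?w ?w = inner (z - z') ?w"
      using S(2)[OF w, of z] S(2)[OF w, of z'] by (simp add: bform_diff_left S inner_diff_left algebra_simps)
    then have "(\<alpha> + \<tau> * M) * (norm ?w)\<^sup>2 \<le> inner (z - z') ?w"
      using bform_lower[OF w] by (simp add: power2_norm_eq_inner algebra_simps)
    also have "\<dots> \<le> norm (z - z') * norm ?w" by (rule norm_cauchy_schwarz)
    finally have "((\<alpha> + \<tau> * M) * norm ?w) * norm ?w \<le> norm (z - z') * norm ?w" by (simp add: power2_eq_square mult.assoc)
    then show ?thesis using False by (simp add: mult_le_cancel_right)
  qed simp
  define T where "T u = S (y + \<tau> *\<^sub>R comp_l2 g u)" for u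
  have p: "\<alpha> + \<tau> * M > 0" using \<alpha>_pos M \<tau>_pos by (simp add: add_pos_nonneg)
  \<comment> \<open>The inverse gains \<alpha> + \<tau> M and g costs \<tau> M; the quotient is
    below 1 because \<alpha> is positive.\<close>
  have "\<exists>!u. T u = u"
  proof (rule banach_fix_type[where c = "\<tau> * M / (\<alpha> + \<tau> * M)"], goal_cases)
    case 1
    show ?case using p M \<tau>_pos \<alpha>_pos by auto
  next
    case 2
    show ?case using p M \<tau>_pos \<alpha>_pos by auto
  next
    case 3
    show ?case
    proof (intro allI)
    fix u v :: "'a l2"
    have "(\<alpha> + \<tau> * M) * norm (T u - T v) \<le> norm (\<tau> *\<^sub>R (comp_l2 g u - comp_l2 g v))"
      using S_lip[of "y + \<tau> *\<^sub>R comp_l2 g u" "y + \<tau> *\<^sub>R comp_l2 g v"] by (simp add: T_def scaleR_diff_right)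
    also have "\<dots> \<le> \<tau> * (M * norm (u - v))"
      using comp_l2_lipschitz[OF gm g_lip g0, of u v] \<tau>_pos by simp
    finally show "dist (T u) (T v) \<le> \<tau> * M / (\<alpha> + \<tau> * M) * dist u v"
      using p by (simp add: dist_norm field_simps)
    qed
  qed
  then obtain u where u: "T u = u" by blast
  have uH: "u \<in> H10 \<O>" using S(1) u unfolding T_def by metis
  have "bform u v + \<tau> * inner (comp_l2 \<eta> u) v = inner y v" if v: "v \<in> H10 \<O>" for v
    using S(2)[OF v, of "y + \<tau> *\<^sub>R comp_l2 g u"] u
    by (simp add: T_def comp_g inner_add_left inner_diff_left algebra_simps)
  with uH show ?thesis by (rule that)
qed

end

subsection \<open>Smooth monotone approximations\<close>

definition smooth_lip :: "(real \<Rightarrow> real) \<Rightarrow> bool" where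
  "smooth_lip h \<longleftrightarrow> smooth1 h \<and> (\<exists>M. \<forall>s t. \<bar>h s - h t\<bar> \<le> M * \<bar>s - t\<bar>)"

text \<open>For x > 0 the derivative is t^2 exp(-t) with t = 1/x, at most 2 because exp(t) is at
  least t^2/2. An interval reaching from the left half-line to t > 0 is handled by
  \<open>psi t\<close> \<le> t.\<close>

lemma psi_lipschitz: "\<bar>psi s - psi t\<bar> \<le> 2 * \<bar>s - t\<bar>"
proof -
  have sq: "(1 / x)\<^sup>2 * exp (- (1 / x)) \<le> 2" if "x > 0" for x :: real
  proof -
    have "(1 / x)\<^sup>2 / 2 \<le> exp (1 / x)"
    proof -
      have "1 + 1 / x + (1 / x)\<^sup>2 / 2 \<le> exp (1 / x)" using that by (intro exp_lower_Taylor_quadratic) simp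
      moreover have "0 \<le> 1 / x" using that by simp
      ultimately show ?thesis by linarith
    qed
    then have "(1 / x)\<^sup>2 * exp (- (1 / x)) \<le> (2 * exp (1 / x)) * exp (- (1 / x))"
      by (intro mult_right_mono) auto
    also have "\<dots> = 2" by (simp add: exp_minus)
    finally show ?thesis .
  qed
  have le: "psi t - psi s \<le> 2 * (t - s)" if st: "s < t" for s t
  proof (cases "s > 0")
    case True
    have d: "((\<lambda>x. exp (- (1 / x))) has_real_derivative (1 / x)\<^sup>2 * exp (- (1 / x))) (at x)" if "x > 0" for x :: real
      using that by (auto intro!: derivative_eq_intros simp: power2_eq_square)
    obtain z where z: "s < z" "z < t" "exp (- (1 / t)) - exp (- (1 / s)) = (t - s) * ((1 / z)\<^sup>2 * exp (- (1 / z)))"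
      using MVT2[OF st, of "\<lambda>x. exp (- (1 / x))" "\<lambda>x. (1 / x)\<^sup>2 * exp (- (1 / x))"] d True by fastforce
    have "(t - s) * ((1 / z)\<^sup>2 * exp (- (1 / z))) \<le> (t - s) * 2"
      using sq[of z] z True st by (intro mult_left_mono) auto
    then show ?thesis using z True st by (simp add: psi_def)
  next
    case False
    then have 0: "psi s = 0" by (simp add: psi_nonpos)
    show ?thesis
    proof (cases "t > 0")
      case True
      have "1 / t \<le> exp (1 / t)" using exp_ge_add_one_self[of "1 / t"] by linarith
      then have "exp (- (1 / t)) \<le> t" using True by (simp add: exp_minus field_simps)
      then show ?thesis using True False 0 by (simp add: psi_def)
    next
      case False
      then show ?thesis using 0 st by (simp add: psi_nonpos)
    qed
  qed
  show ?thesis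
  proof (cases s t rule: linorder_cases)
    case less
    then show ?thesis using le[OF less] psi_mono[of s t] by simp
  next
    case greater
    then show ?thesis using le[OF greater] psi_mono[of t s] by simp
  qed simp
qed

lemma smooth_lip_psi: "smooth_lip psi"
  unfolding smooth_lip_def using smooth1_psi psi_lipschitz by blast

lemma smooth_lip_scale:
  assumes "smooth_lip h"
  shows "smooth_lip (\<lambda>s. c * h s)"
proof -
  obtain M where M: "\<And>s t. \<bar>h s - h t\<bar> \<le> M * \<bar>s - t\<bar>" using assms by (auto simp: smooth_lip_def)
  have "\<bar>c * h s - c * h t\<bar> \<le> (\<bar>c\<bar> * M) * \<bar>s - t\<bar>" for s t
    using mult_left_mono[OF M[of s t], of "\<bar>c\<bar>"] by (simp add: right_diff_distrib[symmetric] abs_mult mult.assoc)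
  then show ?thesis using assms smooth1_scale by (auto simp: smooth_lip_def)
qed

lemma smooth_lip_affine:
  assumes "smooth_lip h"
  shows "smooth_lip (\<lambda>s. h (c * s + d))"
proof -
  obtain M where M: "\<And>s t. \<bar>h s - h t\<bar> \<le> M * \<bar>s - t\<bar>" using assms by (auto simp: smooth_lip_def)
  have "\<bar>h (c * s + d) - h (c * t + d)\<bar> \<le> (M * \<bar>c\<bar>) * \<bar>s - t\<bar>" for s t
    using M[of "c * s + d" "c * t + d"] by (simp add: right_diff_distrib[symmetric] abs_mult mult.assoc)
  then show ?thesis using assms smooth1_affine by (auto simp: smooth_lip_def)
qed

lemma smooth_lip_add:
  assumes "smooth_lip h" "smooth_lip g"
  shows "smooth_lip (\<lambda>s. h s + g s)"
proof -
  obtain M N where "\<And>s t. \<bar>h s - h t\<bar> \<le> M * \<bar>s - t\<bar>" "\<And>s t. \<bar>g s - g t\<bar> \<le> N * \<bar>s - t\<bar>"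
    using assms by (auto simp: smooth_lip_def)
  then have "\<bar>h s - h t\<bar> \<le> M * \<bar>s - t\<bar>" "\<bar>g s - g t\<bar> \<le> N * \<bar>s - t\<bar>" for s t by blast+
  then have "\<bar>h s - h t\<bar> + \<bar>g s - g t\<bar> \<le> M * \<bar>s - t\<bar> + N * \<bar>s - t\<bar>" for s t by (intro add_mono)
  moreover have "\<bar>h s + g s - (h t + g t)\<bar> \<le> \<bar>h s - h t\<bar> + \<bar>g s - g t\<bar>" for s t by linarith
  ultimately have "\<bar>h s + g s - (h t + g t)\<bar> \<le> (M + N) * \<bar>s - t\<bar>" for s t
    unfolding distrib_right using order_trans by blast
  then show ?thesis using assms smooth1_add by (auto simp: smooth_lip_def)
qed

lemma smooth_lip_sum:
  assumes "\<And>j. j \<in> J \<Longrightarrow> smooth_lip (h j)"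
  shows "smooth_lip (\<lambda>s. \<Sum>j\<in>J. h j s)"
proof -
  have "smooth_lip (\<lambda>_. 0)" unfolding smooth_lip_def using smooth1_zero by (auto intro: exI[of _ 0])
  then show ?thesis using assms
    by (induction J rule: infinite_finite_induct) (auto intro: smooth_lip_add)
qed

lemma derivative_le_lipschitz:
  assumes "(h has_real_derivative d) (at x)" "\<And>s t. \<bar>h s - h t\<bar> \<le> M * \<bar>s - t\<bar>"
  shows "\<bar>d\<bar> \<le> M"
proof -
  have "((\<lambda>y. \<bar>(h y - h x) / (y - x)\<bar>) \<longlongrightarrow> \<bar>d\<bar>) (at x)"
    using assms(1) unfolding has_field_derivative_iff by (rule tendsto_rabs)
  moreover have "\<forall>\<^sub>F y in at x. \<bar>(h y - h x) / (y - x)\<bar> \<le> M"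
    using eventually_at_ball'[of 1 x UNIV]
  proof (rule eventually_mono)
    show "0 < (1::real)" by simp
    fix y assume "y \<in> ball x 1 \<and> y \<noteq> x \<and> y \<in> UNIV"
    then show "\<bar>(h y - h x) / (y - x)\<bar> \<le> M"
      using assms(2)[of y x] by (simp add: abs_divide pos_divide_le_eq)
  qed
  ultimately show ?thesis by (rule tendsto_upperbound) simp
qed

text \<open>A smooth staircase for a nondecreasing b on [0, n] with mesh 1/n. The rise of b over the
  j-th interval is switched on by psi(n^2 (s - (j+1)/n)): only after the right end of the interval,
  and almost completely within a further 1/n.\<close>

definition stair :: "(real \<Rightarrow> real) \<Rightarrow> nat \<Rightarrow> real \<Rightarrow> real" where
  "stair b n s = (\<Sum>j<n\<^sup>2. (b (real (Suc j) / n) - b (real j / n)) * psi ((real n)\<^sup>2 * s - real n * real (Suc j)))"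

lemma smooth_lip_stair: "smooth_lip (stair b n)"
proof -
  have "smooth_lip (\<lambda>s. \<Sum>j<n\<^sup>2. (b (real (Suc j) / n) - b (real j / n)) * psi ((real n)\<^sup>2 * s + - (real n * real (Suc j))))"
    by (intro smooth_lip_sum smooth_lip_scale smooth_lip_affine smooth_lip_psi)
  then show ?thesis by (simp add: stair_def[abs_def])
qed

lemma mono_stair:
  assumes "mono b"
  shows "mono (stair b n)"
  unfolding stair_def
  by (rule monoI, rule sum_mono, rule mult_left_mono, rule psi_mono)
     (auto intro!: mult_left_mono monoD[OF assms] divide_right_mono)

lemma stair_nonpos: "s \<le> 0 \<Longrightarrow> stair b n s = 0"
  unfolding stair_def by (intro sum.neutral ballI) (auto intro!: psi_nonpos simp: mult_nonneg_nonpos order_trans[of _ 0])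

text \<open>A step contributes only once its interval lies to the left of s, and then at most the
  rise of b there; the rises telescope.\<close>

lemma stair_upper:
  assumes b: "mono b" and n: "n > 0"
  shows "stair b n s \<le> b (min s n) - b (min s 0)"
proof -
  have "stair b n s \<le> (\<Sum>j<n\<^sup>2. b (min s (real (Suc j) / n)) - b (min s (real j / n)))"
    unfolding stair_def
  proof (rule sum_mono)
    fix j
    let ?d = "b (real (Suc j) / n) - b (real j / n)"
    have d: "?d \<ge> 0" using monoD[OF b, of "real j / n" "real (Suc j) / n"] by (simp add: divide_right_mono)
    show "?d * psi ((real n)\<^sup>2 * s - real n * real (Suc j)) \<le> b (min s (real (Suc j) / n)) - b (min s (real j / n))"
    proof (cases "real (Suc j) / n < s")
      case True
      have "real j / n \<le> real (Suc j) / n" by (intro divide_right_mono) auto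
      then have "min s (real (Suc j) / n) = real (Suc j) / n" "min s (real j / n) = real j / n" using True by auto
      then show ?thesis using mult_left_mono[OF psi_le_1 d] by simp
    next
      case False
      then have "n * s \<le> real (Suc j)" using n by (simp add: field_simps)
      then have "real n * (n * s) \<le> real n * real (Suc j)" by (intro mult_left_mono) auto
      then have "psi ((real n)\<^sup>2 * s - real n * real (Suc j)) = 0" by (intro psi_nonpos) (simp add: power2_eq_square mult.assoc)
      moreover have "b (min s (real j / n)) \<le> b (min s (real (Suc j) / n))"
        by (intro monoD[OF b] min.mono divide_right_mono) auto
      ultimately show ?thesis by simp
    qed
  qed
  also have "\<dots> = b (min s (real (n\<^sup>2) / n)) - b (min s (real 0 / n))"
    by (rule sum_lessThan_telescope[of "\<lambda>j. b (min s (real j / n))"])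
  finally show ?thesis using n by (simp add: power2_eq_square)
qed

text \<open>Intervals ending before s - 1/n are switched on at least up to exp(-1/n), the value of
  psi at n. Together with the width 1/n of an interval this makes the lag 2/n.\<close>

lemma stair_lower:
  assumes b: "mono b" and n: "n > 0"
  shows "exp (- (1 / n)) * (b (min (s - 2 / n) n) - b (min (s - 2 / n) 0)) \<le> stair b n s"
proof -
  let ?\<sigma> = "s - 2 / real n"
  have "exp (- (1 / n)) * (\<Sum>j<n\<^sup>2. b (min ?\<sigma> (real (Suc j) / n)) - b (min ?\<sigma> (real j / n))) \<le> stair b n s"
    unfolding stair_def sum_distrib_left
  proof (rule sum_mono)
    fix j
    let ?d = "b (real (Suc j) / n) - b (real j / n)"
    have d: "?d \<ge> 0" using monoD[OF b, of "real j / n" "real (Suc j) / n"] by (simp add: divide_right_mono)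
    show "exp (- (1 / n)) * (b (min ?\<sigma> (real (Suc j) / n)) - b (min ?\<sigma> (real j / n))) \<le> ?d * psi ((real n)\<^sup>2 * s - real n * real (Suc j))"
    proof (cases "real (Suc j) / n \<le> s - 1 / n")
      case True
      then have "real n * (real (Suc j) / n) \<le> real n * (s - 1 / n)" by (intro mult_left_mono) auto
      then have "real (Suc j) \<le> n * s - 1" using n by (simp add: right_diff_distrib)
      then have "real n * real (Suc j) \<le> real n * (n * s - 1)" by (intro mult_left_mono) auto
      then have "real n \<le> (real n)\<^sup>2 * s - real n * real (Suc j)" by (simp add: power2_eq_square algebra_simps)
      then have "psi (real n) \<le> psi ((real n)\<^sup>2 * s - real n * real (Suc j))" by (rule psi_mono)
      then have p: "exp (- (1 / n)) \<le> psi ((real n)\<^sup>2 * s - real n * real (Suc j))" using n by (simp add: psi_def)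
      have "b (min ?\<sigma> (real (Suc j) / n)) - b (min ?\<sigma> (real j / n)) \<le> ?d"
      proof (cases "?\<sigma> \<le> real j / n")
        case True
        moreover have "real j / n \<le> real (Suc j) / n" by (intro divide_right_mono) auto
        ultimately have "min ?\<sigma> (real (Suc j) / n) = ?\<sigma>" "min ?\<sigma> (real j / n) = ?\<sigma>" by auto
        then show ?thesis using d by simp
      next
        case False
        then have "b (min ?\<sigma> (real (Suc j) / n)) \<le> b (real (Suc j) / n)" "min ?\<sigma> (real j / n) = real j / n"
          by (auto intro!: monoD[OF b])
        then show ?thesis by simp
      qed
      then have "exp (- (1 / n)) * (b (min ?\<sigma> (real (Suc j) / n)) - b (min ?\<sigma> (real j / n))) \<le> exp (- (1 / n)) * ?d"
        by (intro mult_left_mono) auto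
      also have "\<dots> \<le> psi ((real n)\<^sup>2 * s - real n * real (Suc j)) * ?d" using p d by (intro mult_right_mono)
      finally show ?thesis by (simp add: mult.commute)
    next
      case False
      then have "?\<sigma> \<le> real j / n" using n by (simp add: field_simps)
      moreover have "real j / n \<le> real (Suc j) / n" by (intro divide_right_mono) auto
      ultimately have "min ?\<sigma> (real (Suc j) / n) = ?\<sigma>" "min ?\<sigma> (real j / n) = ?\<sigma>" by auto
      then show ?thesis using d psi_nonneg[of "(real n)\<^sup>2 * s - real n * real (Suc j)"] by simp
    qed
  qed
  also have "(\<Sum>j<n\<^sup>2. b (min ?\<sigma> (real (Suc j) / n)) - b (min ?\<sigma> (real j / n))) = b (min ?\<sigma> (real (n\<^sup>2) / n)) - b (min ?\<sigma> (real 0 / n))"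
    by (rule sum_lessThan_telescope[of "\<lambda>j. b (min ?\<sigma> (real j / n))"])
  finally show ?thesis using n by (simp add: power2_eq_square)
qed

text \<open>The two bounds of \<open>stair\<close> squeeze it, and by continuity of b they converge
  even when the argument varies with n. The limit is b - b 0 on the positive half-line and 0 on the
  negative one.\<close>

lemma stair_tendsto:
  assumes b: "mono b" "continuous_on UNIV b" and r: "strict_mono r" and s: "s \<longlonglongrightarrow> s0"
  shows "(\<lambda>n. stair b (r n) (s n)) \<longlonglongrightarrow> b s0 - b (min s0 0)"
proof -
  have r_top: "filterlim (\<lambda>n. real (r n)) at_top sequentially"
    by (rule filterlim_compose[OF filterlim_real_sequentially filterlim_subseq[OF r]])
  have inv: "(\<lambda>n. c / real (r n)) \<longlonglongrightarrow> 0" for c :: real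
    by (rule tendsto_divide_0[OF tendsto_const filterlim_at_top_imp_at_infinity[OF r_top]])
  have shift: "(\<lambda>n. s n - 2 / real (r n)) \<longlonglongrightarrow> s0" using tendsto_diff[OF s inv[of 2]] by simp
  have min_lim: "(\<lambda>n. min (t n) (real (r n))) \<longlonglongrightarrow> s0" if t: "t \<longlonglongrightarrow> s0" for t :: "nat \<Rightarrow> real"
  proof (rule Lim_transform_eventually[OF t])
    have "\<forall>\<^sub>F n in sequentially. t n < s0 + 1" using t by (rule order_tendstoD) simp
    moreover have "\<forall>\<^sub>F n in sequentially. s0 + 1 \<le> real (r n)" using r_top by (simp add: filterlim_at_top)
    ultimately show "\<forall>\<^sub>F n in sequentially. t n = min (t n) (real (r n))"
      by eventually_elim auto
  qed
  have bl: "(\<lambda>n. b (t n)) \<longlonglongrightarrow> b l" if "t \<longlonglongrightarrow> l" for t l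
    using continuous_on_tendsto_compose[OF b(2) that] by simp
  have up: "(\<lambda>n. b (min (s n) (real (r n))) - b (min (s n) 0)) \<longlonglongrightarrow> b s0 - b (min s0 0)"
    by (intro tendsto_diff bl min_lim s tendsto_min tendsto_const)
  have "(\<lambda>n. exp (- (1 / real (r n))) * (b (min (s n - 2 / real (r n)) (real (r n))) - b (min (s n - 2 / real (r n)) 0)))
      \<longlonglongrightarrow> exp (- 0) * (b s0 - b (min s0 0))"
    by (intro tendsto_diff tendsto_mult tendsto_exp tendsto_minus bl min_lim shift inv tendsto_min tendsto_const)
  then have low: "(\<lambda>n. exp (- (1 / real (r n))) * (b (min (s n - 2 / real (r n)) (real (r n))) - b (min (s n - 2 / real (r n)) 0)))
      \<longlonglongrightarrow> b s0 - b (min s0 0)" by simp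
  have pos: "\<forall>\<^sub>F n in sequentially. r n > 0"
    using eventually_gt_at_top[of 0] by eventually_elim (use seq_suble[OF r] in \<open>auto intro: less_le_trans\<close>)
  show ?thesis
  proof (rule tendsto_sandwich[OF _ _ low up])
    show "\<forall>\<^sub>F n in sequentially. exp (- (1 / real (r n))) * (b (min (s n - 2 / real (r n)) (real (r n))) - b (min (s n - 2 / real (r n)) 0)) \<le> stair b (r n) (s n)"
      using pos by eventually_elim (rule stair_lower[OF b(1)])
    show "\<forall>\<^sub>F n in sequentially. stair b (r n) (s n) \<le> b (min (s n) (real (r n))) - b (min (s n) 0)"
      using pos by eventually_elim (rule stair_upper[OF b(1)])
  qed
qed

text \<open>Convergence along varying arguments is what the limit in \<open>solve_monotone\<close>
  requires, since there the argument of the n-th function is the n-th approximate solution at a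
  point.\<close>

lemma monotone_approximation:
  fixes b :: "real \<Rightarrow> real"
  assumes b: "mono b" "continuous_on UNIV b" "b 0 = 0"
  obtains h where "\<And>n. mono (h n)" "\<And>n. smooth_lip (h n)" "\<And>n. h n 0 = 0"
    "\<And>r s s0. strict_mono (r :: nat \<Rightarrow> nat) \<Longrightarrow> s \<longlonglongrightarrow> s0 \<Longrightarrow> (\<lambda>n. h (r n) (s n)) \<longlonglongrightarrow> b s0"
proof -
  \<comment> \<open>Reflection supplies the part of b on the negative half-line.\<close>
  define b' where "b' s = - b (- s)" for s
  have b': "mono b'" "continuous_on UNIV b'" "b' 0 = 0"
    using b(1,3) by (auto simp: b'_def mono_def intro!: continuous_intros continuous_on_compose2[OF b(2)])
  define h where "h n s = stair b n s - stair b' n (- s)" for n s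
  show ?thesis
  proof (rule that[of h])
    show "mono (h n)" for n
      using monoD[OF mono_stair[OF b(1), of n]] monoD[OF mono_stair[OF b'(1), of n]]
      unfolding h_def by (intro monoI diff_mono) auto
    have "smooth_lip (\<lambda>s. stair b n s + (-1) * stair b' n ((-1) * s + 0))" for n
      by (intro smooth_lip_add smooth_lip_scale smooth_lip_affine smooth_lip_stair)
    then show "smooth_lip (h n)" for n by (simp add: h_def[abs_def])
    show "h n 0 = 0" for n by (simp add: h_def stair_nonpos)
    fix r :: "nat \<Rightarrow> nat" and s :: "nat \<Rightarrow> real" and s0
    assume r: "strict_mono r" "s \<longlonglongrightarrow> s0"
    have "(\<lambda>n. h (r n) (s n)) \<longlonglongrightarrow> (b s0 - b (min s0 0)) - (b' (- s0) - b' (min (- s0) 0))"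
      unfolding h_def by (intro tendsto_diff stair_tendsto b b' r tendsto_minus)
    also have "(b s0 - b (min s0 0)) - (b' (- s0) - b' (min (- s0) 0)) = b s0"
      using b(3) by (auto simp: b'_def min_def)
    finally show "(\<lambda>n. h (r n) (s n)) \<longlonglongrightarrow> b s0" .
  qed
qed

text \<open>Off the set where \<open>|g\<^sub>m - g| \<le> |v|\<close> for all \<open>m \<ge> k\<close>, \<open>v\<close> has small norm; on it, dominated
  convergence applies.\<close>

lemma bounded_AE_convergent_imp_weak:
  fixes g :: "nat \<Rightarrow> 'a::euclidean_space l2"
  assumes bdd: "\<And>n. norm (g n) \<le> K" and lim: "AE x in lborel. (\<lambda>n. rep_l2 (g n) x) \<longlonglongrightarrow> k x"
    and [measurable]: "k \<in> borel_measurable borel"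
  shows "sq_integrable k" "(\<lambda>n. inner (g n) v) \<longlonglongrightarrow> inner (abs_l2 k) v"
proof -
  have K: "K \<ge> 0" using order_trans[OF norm_ge_zero bdd] .
  have "(\<integral>\<^sup>+x. ennreal ((k x)\<^sup>2) \<partial>lborel) = (\<integral>\<^sup>+x. liminf (\<lambda>n. ennreal ((rep_l2 (g n) x)\<^sup>2)) \<partial>lborel)"
  proof (rule nn_integral_cong_AE, use lim in eventually_elim)
    case (elim x)
    then have "(\<lambda>n. ennreal ((rep_l2 (g n) x)\<^sup>2)) \<longlonglongrightarrow> ennreal ((k x)\<^sup>2)"
      by (intro tendsto_intros tendsto_ennrealI) auto
    then show ?case by (metis lim_imp_Liminf sequentially_bot)
  qed
  also have "\<dots> \<le> liminf (\<lambda>n. \<integral>\<^sup>+x. ennreal ((rep_l2 (g n) x)\<^sup>2) \<partial>lborel)"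
    by (rule nn_integral_liminf) measurable
  also have "\<dots> \<le> liminf (\<lambda>n. ennreal (K\<^sup>2))"
    unfolding nn_integral_rep_l2_sq by (intro Liminf_mono always_eventually allI ennreal_leI power_mono bdd) simp
  also have "\<dots> = ennreal (K\<^sup>2)" by (simp add: Liminf_const)
  finally have ki: "(\<integral>\<^sup>+x. ennreal ((k x)\<^sup>2) \<partial>lborel) \<le> ennreal (K\<^sup>2)" .
  show k: "sq_integrable k" by (rule sq_integrable_of_nn_integral[OF _ ki]) simp
  have nk: "norm (abs_l2 k) \<le> K" by (rule norm_abs_l2_le[OF _ ki K]) simp
  define d where "d n x = rep_l2 (g n) x - k x" for n x
  have [measurable]: "d n \<in> borel_measurable borel" for n unfolding d_def by measurable
  have sqd: "sq_integrable (d n)" for n unfolding d_def by (intro sq_integrable_diff k) simp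
  have absd: "abs_l2 (d n) = g n - abs_l2 k" for n
    unfolding d_def using abs_l2_diff[OF _ k, of "rep_l2 (g n)"] by simp
  have nd: "norm (abs_l2 (d n)) \<le> 2 * K" for n
    unfolding absd using norm_triangle_ineq4[of "g n" "abs_l2 k"] bdd[of n] nk by linarith
  define E where "E j = {x. \<forall>m\<ge>j. \<bar>d m x\<bar> \<le> \<bar>rep_l2 v x\<bar>}" for j
  have [measurable]: "E j \<in> sets borel" for j unfolding E_def by measurable
  define vE where "vE j x = rep_l2 v x * indicator (E j) x" for j x
  define vF where "vF j x = rep_l2 v x * indicator (- E j) x" for j x
  have [measurable]: "vE j \<in> borel_measurable borel" "vF j \<in> borel_measurable borel" for j
    unfolding vE_def vF_def by measurable
  have sqE: "sq_integrable (vE j)" "sq_integrable (vF j)" for j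
    by (rule sq_integrable_bound[OF sq_integrable_rep_l2[of v]]; auto simp: vE_def vF_def indicator_def)+
  have "(\<lambda>j. norm (abs_l2 (vF j))) \<longlonglongrightarrow> 0"
  proof (rule norm_abs_l2_tendsto_0)
    show "sq_integrable (rep_l2 v)" by simp
    show "AE x in lborel. \<bar>vF j x\<bar> \<le> \<bar>rep_l2 v x\<bar>" for j by (auto simp: vF_def indicator_def)
    show "AE x in lborel. (\<lambda>j. vF j x) \<longlonglongrightarrow> 0"
      using lim
    proof eventually_elim
      case (elim x)
      show ?case
      proof (cases "rep_l2 v x = 0")
        case False
        have "(\<lambda>n. d n x) \<longlonglongrightarrow> 0" unfolding d_def by (rule LIM_zero[OF elim])
        then obtain N where "\<forall>n\<ge>N. norm (d n x) < \<bar>rep_l2 v x\<bar>" using LIMSEQ_D[of _ 0 "\<bar>rep_l2 v x\<bar>"] False by fastforce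
        then have "\<forall>j\<ge>N. x \<in> E j" by (auto simp: E_def intro: less_imp_le)
        then have "\<forall>j\<ge>N. vF j x = 0" by (simp add: vF_def)
        then have "\<forall>\<^sub>F j in sequentially. vF j x = 0" unfolding eventually_sequentially by blast
        then show ?thesis by (rule tendsto_eventually)
      qed (simp add: vF_def)
    qed
  qed simp
  note vF_lim = this
  have "(\<lambda>n. inner (abs_l2 (d n)) v) \<longlonglongrightarrow> 0"
  proof (rule LIMSEQ_I)
    fix e :: real assume e: "e > 0"
    \<comment> \<open>First j is fixed to make the part of v outside \<open>E j\<close> small
      against the norm bound 2 K; only then does n grow.\<close>
    have "e / (2 * (2 * K + 1)) > 0" using e K by simp
    then obtain j where j: "norm (abs_l2 (vF j)) < e / (2 * (2 * K + 1))"
      using LIMSEQ_D[OF vF_lim] by fastforce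
    have "(\<lambda>n. \<integral>x. d (n + j) x * vE j x \<partial>lborel) \<longlonglongrightarrow> (\<integral>x. 0 \<partial>(lborel :: 'a measure))"
    proof (rule integral_dominated_convergence[where w = "\<lambda>x. (rep_l2 v x)\<^sup>2", rotated 2])
      show "integrable lborel (\<lambda>x. (rep_l2 v x)\<^sup>2)" using sq_integrable_rep_l2[of v] by (simp add: sq_integrable_def)
    next
      show "AE x in lborel. (\<lambda>n. d (n + j) x * vE j x) \<longlonglongrightarrow> 0"
        using lim
      proof eventually_elim
        case (elim x)
        have "(\<lambda>n. d n x) \<longlonglongrightarrow> 0" unfolding d_def by (rule LIM_zero[OF elim])
        from tendsto_mult_right[OF LIMSEQ_ignore_initial_segment[OF this, of j], of "vE j x"] show ?case by simp
      qed
    next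
      fix n
      show "AE x in lborel. norm (d (n + j) x * vE j x) \<le> (rep_l2 v x)\<^sup>2"
      proof (rule AE_I2)
        fix x
        show "norm (d (n + j) x * vE j x) \<le> (rep_l2 v x)\<^sup>2"
        proof (cases "x \<in> E j")
          case True
          then have "\<bar>d (n + j) x\<bar> * \<bar>rep_l2 v x\<bar> \<le> \<bar>rep_l2 v x\<bar> * \<bar>rep_l2 v x\<bar>"
            by (intro mult_right_mono) (auto simp: E_def)
          then show ?thesis using True by (simp add: vE_def abs_mult power2_eq_square)
        qed (simp add: vE_def)
      qed
    qed auto
    then have "(\<lambda>n. \<integral>x. d n x * vE j x \<partial>lborel) \<longlonglongrightarrow> 0" by (simp add: LIMSEQ_offset)
    then obtain N where N: "\<And>n. n \<ge> N \<Longrightarrow> \<bar>\<integral>x. d n x * vE j x \<partial>lborel\<bar> < e / 2"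
      using LIMSEQ_D[of _ 0 "e / 2"] e by fastforce
    have "norm (inner (abs_l2 (d n)) v - 0) < e" if "n \<ge> N" for n
    proof -
      have "inner (abs_l2 (d n)) v = (\<integral>x. d n x * rep_l2 v x \<partial>lborel)"
        using inner_abs_l2[OF sqd, of "rep_l2 v"] by simp
      also have "\<dots> = (\<integral>x. d n x * vE j x + d n x * vF j x \<partial>lborel)"
        by (rule Bochner_Integration.integral_cong) (auto simp: vE_def vF_def indicator_def)
      also have "\<dots> = (\<integral>x. d n x * vE j x \<partial>lborel) + (\<integral>x. d n x * vF j x \<partial>lborel)"
        by (intro Bochner_Integration.integral_add sq_integrable_mult sqd sqE)
      also have "(\<integral>x. d n x * vF j x \<partial>lborel) = inner (abs_l2 (d n)) (abs_l2 (vF j))"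
        by (rule inner_abs_l2[symmetric, OF sqd sqE(2)])
      finally have eq: "inner (abs_l2 (d n)) v = (\<integral>x. d n x * vE j x \<partial>lborel) + inner (abs_l2 (d n)) (abs_l2 (vF j))" .
      have "\<bar>inner (abs_l2 (d n)) (abs_l2 (vF j))\<bar> \<le> norm (abs_l2 (d n)) * norm (abs_l2 (vF j))"
        by (rule Cauchy_Schwarz_ineq2)
      also have "\<dots> \<le> (2 * K + 1) * norm (abs_l2 (vF j))" using nd[of n] by (intro mult_right_mono) auto
      also have "\<dots> \<le> (2 * K + 1) * (e / (2 * (2 * K + 1)))" using j K by (intro mult_left_mono) auto
      also have "\<dots> = e / 2" using K by (simp add: field_simps)
      finally show ?thesis using eq N[OF that] by (simp add: abs_le_iff)
    qed
    then show "\<exists>N. \<forall>n\<ge>N. norm (inner (abs_l2 (d n)) v - 0) < e" by blast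
  qed
  then show "(\<lambda>n. inner (g n) v) \<longlonglongrightarrow> inner (abs_l2 k) v"
    unfolding absd inner_diff_left by (rule LIM_zero_cancel)
qed

section \<open>The nonlinear equation with a continuous monotone drift\<close>

context drift_step
begin

text \<open>The nondecreasing remainder L s - f(s), normalised to vanish at 0 so that composition
  with it preserves vanishing outside the domain; the constant f 0 reappears on the right-hand side
  in \<open>solves_exists\<close>.\<close>

definition shifted :: "real \<Rightarrow> real" where
  "shifted s = L * s - f s + f 0"

lemma shifted_0: "shifted 0 = 0" by (simp add: shifted_def)

lemma shifted_continuous: "continuous_on UNIV shifted"
  unfolding shifted_def by (intro continuous_intros continuous_on_compose2[OF cont_f]) auto

lemma shifted_mono: "mono shifted"
proof (rule monoI)
  fix s t :: real assume "s \<le> t"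
  show "shifted s \<le> shifted t"
  proof (cases "s = t")
    case False
    with \<open>s \<le> t\<close> have st: "t - s > 0" by simp
    have "(f t - f s) * (t - s) \<le> (L * (t - s)) * (t - s)"
      using one_sided[of t s] by (simp add: power2_eq_square mult.assoc)
    then have "f t - f s \<le> L * (t - s)" using st by (simp add: mult_le_cancel_right)
    then show ?thesis by (simp add: shifted_def algebra_simps)
  qed simp
qed

lemma f_measurable [measurable]: "f \<in> borel_measurable borel"
  by (rule borel_measurable_continuous_onI[OF cont_f])

lemma shifted_measurable [measurable]: "shifted \<in> borel_measurable borel"
  by (rule borel_measurable_continuous_onI[OF shifted_continuous])

lemma dom_finite: "emeasure lborel \<O> < \<infinity>"
  using emeasure_bounded_finite[OF bounded_dom] by simp

lemma dom_measurable [measurable]: "\<O> \<in> sets borel"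
  using open_dom by simp

text \<open>Testing with \<open>h(u)\<close> bounds the monotone part in \<open>L\<^sup>2\<close>, because
  \<open>\<langle>\<nabla>u, \<nabla>h(u)\<rangle> = \<integral> h'(u) |\<nabla>u|\<^sup>2 \<ge> 0\<close>.\<close>

lemma dirform_comp_nonneg:
  assumes u: "u \<in> H10 \<O>" and h: "smooth_lip h" "mono h" "h 0 = 0"
  shows "comp_l2 h u \<in> H10 \<O>" "0 \<le> dirform \<O> u (comp_l2 h u)"
proof -
  obtain M where M: "\<And>s t. \<bar>h s - h t\<bar> \<le> M * \<bar>s - t\<bar>" using h(1) unfolding smooth_lip_def by blast
  have sm: "smooth1 h" using h(1) by (simp add: smooth_lip_def)
  obtain h' where h': "smooth1 h'" "\<And>x. (h has_real_derivative h' x) (at x)"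
    by (rule smooth1_deriv[OF sm]) blast
  have bd: "\<bar>h' x\<bar> \<le> M" for x by (rule derivative_le_lipschitz[OF h'(2) M])
  have pos: "0 \<le> h' x" for x
    by (rule mono_on_imp_deriv_nonneg[OF h(2) h'(2)]) simp
  note ch = H10_chain_rule[OF open_dom u sm h(3) h'(2) bd]
  show "comp_l2 h u \<in> H10 \<O>" by (rule ch(1))
  have [measurable]: "h' \<in> borel_measurable borel"
    by (rule borel_measurable_continuous_onI[OF smooth1_continuous[OF h'(1)]])
  have "0 \<le> inner (weak_partial \<O> i u) (weak_partial \<O> i (comp_l2 h u))" if i: "i \<in> Basis" for i
  proof -
    let ?w = "rep_l2 (weak_partial \<O> i u)"
    have M0: "M \<ge> 0" using bd[of 0] by linarith
    have "sq_integrable (\<lambda>x. h' (rep_l2 u x) * ?w x)"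
    proof (rule sq_integrable_bound[OF sq_integrable_scale[OF sq_integrable_rep_l2, of M]])
      show "AE x in lborel. \<bar>h' (rep_l2 u x) * ?w x\<bar> \<le> \<bar>M * ?w x\<bar>"
        using bd M0 by (auto simp: abs_mult intro!: mult_right_mono)
    qed measurable
    then have "inner (weak_partial \<O> i u) (weak_partial \<O> i (comp_l2 h u)) = (\<integral>x. ?w x * (h' (rep_l2 u x) * ?w x) \<partial>lborel)"
      unfolding ch(2)[OF i] by (rule inner_abs_l2_right)
    also have "\<dots> \<ge> 0" using pos by (intro integral_nonneg_AE) (auto simp: mult.left_commute)
    finally show ?thesis .
  qed
  then show "0 \<le> dirform \<O> u (comp_l2 h u)" unfolding dirform_def by (rule sum_nonneg)
qed

lemma comp_sq_integrable:
  assumes "smooth_lip h" "h 0 = 0"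
  shows "sq_integrable (\<lambda>x. h (rep_l2 u x))"
proof -
  obtain M where M: "\<And>s t. \<bar>h s - h t\<bar> \<le> M * \<bar>s - t\<bar>" using assms(1) unfolding smooth_lip_def by blast
  have m: "h \<in> borel_measurable borel"
    using assms(1) smooth1_continuous by (auto simp: smooth_lip_def intro: borel_measurable_continuous_onI)
  show ?thesis by (rule sq_integrable_comp[OF m, of M]) (use M[of _ 0] assms(2) in auto)
qed

text \<open>The first two bounds come from testing with u, the third from testing with h(u). None
  involves the Lipschitz constant of h, so they are uniform over the approximations in
  \<open>solve_monotone\<close>.\<close>

lemma solve_approximation_bounds:
  assumes c: "c > 0" "\<And>u. u \<in> H10 \<O> \<Longrightarrow> c * ((norm u)\<^sup>2 + dirform \<O> u u) \<le> bform u u"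
    and h: "smooth_lip h" "mono h" "h 0 = 0"
    and u: "u \<in> H10 \<O>" "\<And>v. v \<in> H10 \<O> \<Longrightarrow> bform u v + \<tau> * inner (comp_l2 h u) v = inner z v"
  shows "norm u \<le> norm z / c" "dirform \<O> u u \<le> (norm z / c)\<^sup>2"
    "norm (comp_l2 h u) \<le> (norm z + \<bar>1 - \<tau> * L\<bar> * (norm z / c)) / \<tau>"
proof -
  have "0 \<le> (\<integral>x. h (rep_l2 u x) * rep_l2 u x \<partial>lborel)"
  proof (rule integral_nonneg_AE, rule AE_I2)
    fix x show "0 \<le> h (rep_l2 u x) * rep_l2 u x"
      using monoD[OF h(2), of 0 "rep_l2 u x"] monoD[OF h(2), of "rep_l2 u x" 0] h(3)
      by (cases "rep_l2 u x \<ge> 0") (auto intro: mult_nonneg_nonneg mult_nonpos_nonpos)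
  qed
  then have "0 \<le> inner (comp_l2 h u) u"
    unfolding comp_l2_def using inner_abs_l2[OF comp_sq_integrable[OF h(1,3)] sq_integrable_rep_l2, of u u] by simp
  then have "0 \<le> \<tau> * inner (comp_l2 h u) u" using \<tau>_pos by simp
  then have "bform u u \<le> inner z u" using u(2)[OF u(1)] by linarith
  also have "\<dots> \<le> norm z * norm u" by (rule norm_cauchy_schwarz)
  finally have e: "c * ((norm u)\<^sup>2 + dirform \<O> u u) \<le> norm z * norm u" using c(2)[OF u(1)] by linarith
  have "(c * norm u) * norm u \<le> norm z * norm u"
    using e mult_nonneg_nonneg[OF less_imp_le[OF c(1)] dirform_nonneg[of \<O> u]]
    by (simp add: distrib_left power2_eq_square mult.assoc)
  then have "c * norm u \<le> norm z" by (cases "norm u = 0") auto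
  then show nu: "norm u \<le> norm z / c" using c(1) by (simp add: field_simps)
  have "c * dirform \<O> u u \<le> norm z * norm u"
    using e mult_nonneg_nonneg[OF less_imp_le[OF c(1)] zero_le_power2[of "norm u"]] by (simp add: distrib_left)
  also have "\<dots> \<le> norm z * (norm z / c)" by (intro mult_left_mono nu) simp
  finally show "dirform \<O> u u \<le> (norm z / c)\<^sup>2" using c(1) by (simp add: field_simps power2_eq_square)
  let ?w = "comp_l2 h u"
  have w: "?w \<in> H10 \<O>" "0 \<le> dirform \<O> u ?w" by (rule dirform_comp_nonneg[OF u(1) h])+
  have "\<tau> * (norm ?w)\<^sup>2 = inner z ?w - (1 - \<tau> * L) * inner u ?w - \<tau> * dirform \<O> u ?w"
    using u(2)[OF w(1)] by (simp add: bform_def power2_norm_eq_inner)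
  also have "\<dots> \<le> inner z ?w - (1 - \<tau> * L) * inner u ?w" using w(2) \<tau>_pos by simp
  also have "\<dots> = inner (z - (1 - \<tau> * L) *\<^sub>R u) ?w" by (simp add: inner_diff_left)
  also have "\<dots> \<le> norm (z - (1 - \<tau> * L) *\<^sub>R u) * norm ?w" by (rule norm_cauchy_schwarz)
  finally have a: "\<tau> * (norm ?w)\<^sup>2 \<le> norm (z - (1 - \<tau> * L) *\<^sub>R u) * norm ?w" .
  have "norm (z - (1 - \<tau> * L) *\<^sub>R u) \<le> norm z + \<bar>1 - \<tau> * L\<bar> * norm u"
    using norm_triangle_ineq4[of z "(1 - \<tau> * L) *\<^sub>R u"] by simp
  also have "norm z + \<bar>1 - \<tau> * L\<bar> * norm u \<le> norm z + \<bar>1 - \<tau> * L\<bar> * (norm z / c)"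
    by (intro add_left_mono mult_left_mono nu) simp
  finally have k: "norm (z - (1 - \<tau> * L) *\<^sub>R u) \<le> norm z + \<bar>1 - \<tau> * L\<bar> * (norm z / c)" .
  have "(\<tau> * norm ?w) * norm ?w \<le> norm (z - (1 - \<tau> * L) *\<^sub>R u) * norm ?w"
    using a by (simp only: power2_eq_square mult.assoc)
  then have "\<tau> * norm ?w \<le> norm (z - (1 - \<tau> * L) *\<^sub>R u)" by (cases "norm ?w = 0") auto
  then have "\<tau> * norm ?w \<le> norm z + \<bar>1 - \<tau> * L\<bar> * (norm z / c)" using k by linarith
  then show "norm ?w \<le> (norm z + \<bar>1 - \<tau> * L\<bar> * (norm z / c)) / \<tau>" using \<tau>_pos by (simp add: pos_le_divide_eq mult.commute)
qed

text \<open>The approximate problems are solved by \<open>solve_lipschitz\<close>. Compactness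
  provides an L^2 limit of their solutions, and the convergence of the approximations along varying
  arguments the pointwise limit of the nonlinear terms.\<close>

lemma solve_monotone:
  obtains u where "u \<in> H10 \<O>" "sq_integrable (\<lambda>x. shifted (rep_l2 u x))"
    "\<And>v. v \<in> H10 \<O> \<Longrightarrow> bform u v + \<tau> * inner (comp_l2 shifted u) v = inner z v"
proof -
  obtain h where h: "\<And>n. mono (h n)" "\<And>n. smooth_lip (h n)" "\<And>n. h n 0 = 0"
    "\<And>r s s0. strict_mono (r :: nat \<Rightarrow> nat) \<Longrightarrow> s \<longlonglongrightarrow> s0 \<Longrightarrow> (\<lambda>n. h (r n) (s n)) \<longlonglongrightarrow> shifted s0"
    by (rule monotone_approximation[OF shifted_mono shifted_continuous shifted_0]) blast
  obtain c where c: "c > 0" "\<And>u. u \<in> H10 \<O> \<Longrightarrow> c * ((norm u)\<^sup>2 + dirform \<O> u u) \<le> bform u u"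
    by (rule bform_coercive) blast
  have "\<exists>u. u \<in> H10 \<O> \<and> (\<forall>v\<in>H10 \<O>. bform u v + \<tau> * inner (comp_l2 (h n) u) v = inner z v)" for n
  proof -
    obtain M where M: "\<And>s t. \<bar>h n s - h n t\<bar> \<le> M * \<bar>s - t\<bar>" using h(2)[of n] unfolding smooth_lip_def by blast
    obtain u where "u \<in> H10 \<O>" "\<And>v. v \<in> H10 \<O> \<Longrightarrow> bform u v + \<tau> * inner (comp_l2 (h n) u) v = inner z v"
      by (rule solve_lipschitz[OF h(1) M h(3)]) blast
    then show ?thesis by blast
  qed
  then obtain U where U: "\<And>n. U n \<in> H10 \<O>"
    "\<And>n v. v \<in> H10 \<O> \<Longrightarrow> bform (U n) v + \<tau> * inner (comp_l2 (h n) (U n)) v = inner z v" by metis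
  define K where "K = (norm z + \<bar>1 - \<tau> * L\<bar> * (norm z / c)) / \<tau>"
  have bd: "norm (U n) \<le> norm z / c" "dirform \<O> (U n) (U n) \<le> (norm z / c)\<^sup>2" "norm (comp_l2 (h n) (U n)) \<le> K" for n
    using solve_approximation_bounds[OF c h(2)[of n] h(1)[of n] h(3)[of n] U(1)[of n] U(2)[of _ n]]
    unfolding K_def by blast+
  have "(norm (U n))\<^sup>2 \<le> (norm z / c)\<^sup>2" for n by (intro power_mono bd(1)) simp
  then obtain r w where r: "strict_mono (r :: nat \<Rightarrow> nat)" "(\<lambda>n. U (r n)) \<longlonglongrightarrow> w"
    using H10_compact[OF open_dom bounded_dom, where X = U and K = "(norm z / c)\<^sup>2"] U(1) bd(2) by blast
  have K0: "K \<ge> 0" using order_trans[OF norm_ge_zero bd(3)] .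
  \<comment> \<open>The difference of two equations is tested with the difference of the solutions:
    as the nonlinear terms are bounded in L^2, convergence in L^2 improves to convergence in the
    energy norm.\<close>
  have diff: "c * ((norm (U m - U n))\<^sup>2 + dirform \<O> (U m - U n) (U m - U n)) \<le> 2 * \<tau> * K * norm (U m - U n)" for m n
  proof -
    let ?d = "U m - U n" and ?e = "comp_l2 (h m) (U m) - comp_l2 (h n) (U n)"
    have d: "?d \<in> H10 \<O>" by (intro H10_diff open_dom U)
    have "bform ?d ?d = \<tau> * (- inner ?e ?d)"
      using U(2)[OF d, of m] U(2)[OF d, of n] by (simp add: bform_diff_left U inner_diff_left algebra_simps)
    also have "\<dots> \<le> \<tau> * (norm ?e * norm ?d)"
      using \<tau>_pos Cauchy_Schwarz_ineq2[of ?e ?d] by (intro mult_left_mono) auto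
    also have "\<dots> \<le> \<tau> * ((2 * K) * norm ?d)"
    proof (intro mult_left_mono mult_right_mono)
      show "norm ?e \<le> 2 * K"
        using norm_triangle_ineq4[of "comp_l2 (h m) (U m)" "comp_l2 (h n) (U n)"] bd(3)[of m] bd(3)[of n] by linarith
    qed (use \<tau>_pos in auto)
    finally show ?thesis using c(2)[OF d] by simp
  qed
  have CU: "Cauchy (\<lambda>n. U (r n))" using r(2) by (rule LIMSEQ_imp_Cauchy)
  have "\<exists>N. \<forall>m\<ge>N. \<forall>n\<ge>N. (norm (U (r m) - U (r n)))\<^sup>2 + dirform \<O> (U (r m) - U (r n)) (U (r m) - U (r n)) < e" if e: "e > 0" for e
  proof -
    have p: "2 * \<tau> * K + 1 > 0" using K0 \<tau>_pos by (simp add: add_nonneg_pos)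
    then have "c * e / (2 * \<tau> * K + 1) > 0" using e c by simp
    then obtain N where N: "\<forall>m\<ge>N. \<forall>n\<ge>N. norm (U (r m) - U (r n)) < c * e / (2 * \<tau> * K + 1)"
      using CauchyD[OF CU] by blast
    have "(norm (U (r m) - U (r n)))\<^sup>2 + dirform \<O> (U (r m) - U (r n)) (U (r m) - U (r n)) < e" if "m \<ge> N" "n \<ge> N" for m n
    proof -
      have "norm (U (r m) - U (r n)) < c * e / (2 * \<tau> * K + 1)" using N that by blast
      then have "norm (U (r m) - U (r n)) * (2 * \<tau> * K + 1) < c * e" using p by (simp only: pos_less_divide_eq)
      then have "2 * \<tau> * K * norm (U (r m) - U (r n)) + norm (U (r m) - U (r n)) < c * e"
        by (simp only: distrib_left mult_1_right mult.commute)
      then have "2 * \<tau> * K * norm (U (r m) - U (r n)) < c * e"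
        using norm_ge_zero[of "U (r m) - U (r n)"] by linarith
      then have "c * ((norm (U (r m) - U (r n)))\<^sup>2 + dirform \<O> (U (r m) - U (r n)) (U (r m) - U (r n))) < c * e"
        using diff[of "r m" "r n"] by linarith
      then show ?thesis using c(1) by simp
    qed
    then show ?thesis by blast
  qed
  then obtain u where u: "u \<in> H10 \<O>" "(\<lambda>n. U (r n)) \<longlonglongrightarrow> u"
    "\<And>i. i \<in> Basis \<Longrightarrow> (\<lambda>n. weak_partial \<O> i (U (r n))) \<longlonglongrightarrow> weak_partial \<O> i u"
    by (rule H10_complete[OF open_dom, of "\<lambda>n. U (r n)", OF U(1)]) blast+
  \<comment> \<open>A further subsequence converges almost everywhere, as the pointwise limit of the
    nonlinear terms requires.\<close>
  obtain r' :: "nat \<Rightarrow> nat" where r': "strict_mono r'" "AE x in lborel. (\<lambda>n. rep_l2 (U (r (r' n))) x) \<longlonglongrightarrow> rep_l2 u x"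
    by (rule l2_tendsto_AE_subseq[OF u(2)])
  define R where "R n = r (r' n)" for n
  have R: "strict_mono R" unfolding R_def using strict_mono_o[OF r(1) r'(1)] by (simp add: comp_def)
  define g where "g n = comp_l2 (h (R n)) (U (R n))" for n
  have "AE x in lborel. \<forall>n. rep_l2 (g n) x = h (R n) (rep_l2 (U (R n)) x)"
    unfolding AE_all_countable g_def comp_l2_def
    by (intro allI rep_abs_l2 comp_sq_integrable h)
  with r'(2) have g_lim: "AE x in lborel. (\<lambda>n. rep_l2 (g n) x) \<longlonglongrightarrow> shifted (rep_l2 u x)"
  proof eventually_elim
    case (elim x)
    show ?case using h(4)[OF R elim(1)[folded R_def]] elim(2) by simp
  qed
  have gK: "norm (g n) \<le> K" for n unfolding g_def by (rule bd(3))
  have sm: "(\<lambda>x. shifted (rep_l2 u x)) \<in> borel_measurable borel" by measurable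
  \<comment> \<open>The nonlinear terms are only bounded in norm and pointwise convergent; weak
    convergence suffices, because they are tested with a fixed v.\<close>
  note weak = bounded_AE_convergent_imp_weak[OF gK g_lim sm]
  have "bform u v + \<tau> * inner (comp_l2 shifted u) v = inner z v" if v: "v \<in> H10 \<O>" for v
  proof -
    have uR: "(\<lambda>n. U (R n)) \<longlonglongrightarrow> u" unfolding R_def using LIMSEQ_subseq_LIMSEQ[OF u(2) r'(1)] by (simp add: comp_def)
    have wR: "(\<lambda>n. weak_partial \<O> i (U (R n))) \<longlonglongrightarrow> weak_partial \<O> i u" if "i \<in> Basis" for i
      unfolding R_def using LIMSEQ_subseq_LIMSEQ[OF u(3)[OF that] r'(1)] by (simp add: comp_def)
    have "(\<lambda>n. bform (U (R n)) v + \<tau> * inner (g n) v) \<longlonglongrightarrow> bform u v + \<tau> * inner (abs_l2 (\<lambda>x. shifted (rep_l2 u x))) v"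
      unfolding bform_def by (intro tendsto_add tendsto_mult tendsto_const tendsto_inner dirform_tendsto weak(2) uR wR)
    moreover have "bform (U (R n)) v + \<tau> * inner (g n) v = inner z v" for n unfolding g_def by (rule U(2)[OF v])
    ultimately show ?thesis unfolding comp_l2_def by (simp add: LIMSEQ_const_iff)
  qed
  with u(1) weak(1) show ?thesis by (rule that)
qed

end

text \<open>The tower of \<open>smooth1\<close> is unwieldy for products; this gives access to
  \<open>Ck_on_mult\<close>.\<close>

lemma smooth1_iff_smooth_on: "smooth1 h \<longleftrightarrow> smooth_on UNIV h"
proof
  assume h: "smooth1 h"
  have "Ck_on k UNIV (\<lambda>x::real. x)" for k using Ck_on_inner[of k "1::real"] by simp
  from Ck_on_compose[OF this h] show "smooth_on UNIV h" by (simp add: smooth_on_def)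
next
  assume h: "smooth_on UNIV h"
  define D where "D k = ((partial 1) ^^ k) h" for k
  have D_Suc: "D (Suc k) = partial 1 (D k)" for k by (simp add: D_def)
  have Ck: "Ck_on j UNIV (D k)" for k j
  proof (induction k arbitrary: j)
    case 0
    then show ?case using h by (simp add: D_def smooth_on_def)
  next
    case (Suc k)
    have "Ck_on (Suc j) UNIV (D k)" by (rule Suc.IH)
    then show ?case unfolding D_Suc by (simp add: Ck_on_UNIV_Suc_iff)
  qed
  have "(D k has_real_derivative D (Suc k) x) (at x)" for k x
  proof -
    have "D k differentiable (at x)" using Ck[of "Suc 0" k] by (simp add: Ck_on_UNIV_Suc_iff)
    then have p: "(D k has_derivative frechet_derivative (D k) (at x)) (at x)" by (rule partial_works)
    have "frechet_derivative (D k) (at x) z = frechet_derivative (D k) (at x) 1 * z" for z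
      using linear_scale[OF has_derivative_linear[OF p], of z 1] by simp
    then have "frechet_derivative (D k) (at x) = (*) (D (Suc k) x)" unfolding D_Suc by (rule ext)
    with p show ?thesis unfolding has_field_derivative_def by (simp only:)
  qed
  moreover have "D 0 = h" by (simp add: D_def)
  ultimately show "smooth1 h" unfolding smooth1_def by blast
qed

text \<open>A smooth window, positive exactly on the interval from a to b; when 0 lies outside that
  interval, its composition with a solution may be used as a test function in the equation. The
  constant 4 adds up the constants 2 of the two factors.\<close>

lemma smooth_lip_window: "smooth_lip (\<lambda>s. psi (s - a) * psi (b - s))"
proof -
  have "smooth1 (\<lambda>s. psi (1 * s + - a))" "smooth1 (\<lambda>s. psi ((-1) * s + b))"
    by (rule smooth1_affine[OF smooth1_psi])+
  then have s: "smooth1 (\<lambda>s. psi (s - a))" "smooth1 (\<lambda>s. psi (b - s))" by simp_all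
  then have "smooth1 (\<lambda>s. psi (s - a) * psi (b - s))"
    unfolding smooth1_iff_smooth_on smooth_on_def by (intro allI Ck_on_mult) blast+
  moreover have "\<bar>psi (s - a) * psi (b - s) - psi (t - a) * psi (b - t)\<bar> \<le> 4 * \<bar>s - t\<bar>" for s t
  proof -
    have "psi (s - a) * psi (b - s) - psi (t - a) * psi (b - t) =
       (psi (s - a) - psi (t - a)) * psi (b - s) + psi (t - a) * (psi (b - s) - psi (b - t))" by (simp add: algebra_simps)
    also have "\<bar>\<dots>\<bar> \<le> \<bar>psi (s - a) - psi (t - a)\<bar> * \<bar>psi (b - s)\<bar> + \<bar>psi (t - a)\<bar> * \<bar>psi (b - s) - psi (b - t)\<bar>"
      by (metis abs_mult abs_triangle_ineq)
    also have "\<dots> \<le> (2 * \<bar>s - t\<bar>) * 1 + 1 * (2 * \<bar>s - t\<bar>)"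
      using psi_lipschitz[of "s - a" "t - a"] psi_lipschitz[of "b - s" "b - t"] psi_nonneg psi_le_1
      by (intro add_mono mult_mono) (auto simp: abs_minus_commute)
    finally show ?thesis by simp
  qed
  ultimately show ?thesis unfolding smooth_lip_def by blast
qed

section \<open>Solutions of one implicit step and their stability\<close>

context drift_step
begin

lemma comp_in_H10:
  assumes u: "u \<in> H10 \<O>" and h: "smooth_lip h" "h 0 = 0"
  shows "comp_l2 h u \<in> H10 \<O>"
proof -
  obtain M where M: "\<And>s t. \<bar>h s - h t\<bar> \<le> M * \<bar>s - t\<bar>" using h(1) unfolding smooth_lip_def by blast
  have sm: "smooth1 h" using h(1) by (simp add: smooth_lip_def)
  obtain h' where h': "smooth1 h'" "\<And>x. (h has_real_derivative h' x) (at x)"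
    by (rule smooth1_deriv[OF sm]) blast
  show ?thesis by (rule H10_chain_rule(1)[OF open_dom u sm h(2) h'(2) derivative_le_lipschitz[OF h'(2) M]])
qed

text \<open>The equation of the scheme for one step, with y the sum of the previous value and the
  noise. The integral in \<open>nemytskii\<close> is taken as it stands, including its default value
  for integrands that are not integrable.\<close>

definition solves :: "'a l2 \<Rightarrow> 'a l2 \<Rightarrow> bool" where
  "solves y u \<longleftrightarrow> u \<in> H10 \<O> \<and> (\<forall>v\<in>H10 \<O>. inner u v = inner y v
     + \<tau> * dirichlet_laplacian \<O> u v + \<tau> * nemytskii \<O> f u v)"

definition nem_integrable :: "'a l2 \<Rightarrow> 'a l2 \<Rightarrow> bool" where
  "nem_integrable u v \<longleftrightarrow> integrable lborel (\<lambda>x. indicator \<O> x * (f (rep_l2 u x) * rep_l2 v x))"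

lemma nemytskii_eq: "nemytskii \<O> f u v = (\<integral>x. indicator \<O> x * (f (rep_l2 u x) * rep_l2 v x) \<partial>lborel)"
  by (simp add: nemytskii_def set_lebesgue_integral_def)

lemma nem_diff:
  assumes "nem_integrable u v" "nem_integrable u w"
  shows "nem_integrable u (v - w)" "nemytskii \<O> f u (v - w) = nemytskii \<O> f u v - nemytskii \<O> f u w"
proof -
  let ?g = "\<lambda>v x. indicator \<O> x * (f (rep_l2 u x) * rep_l2 v x)"
  have i: "integrable lborel (?g v)" "integrable lborel (?g w)" using assms by (simp_all add: nem_integrable_def)
  have ae: "AE x in lborel. ?g v x - ?g w x = ?g (v - w) x"
    using rep_l2_diff[of v w]
  proof eventually_elim
    case (elim x)
    show ?case unfolding elim by (simp add: algebra_simps)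
  qed
  have "integrable lborel (\<lambda>x. ?g v x - ?g w x)" using i by simp
  then show "nem_integrable u (v - w)" unfolding nem_integrable_def
    by (rule integrable_cong_AE_imp[OF _ _ ae]) measurable
  have "nemytskii \<O> f u (v - w) = (\<integral>x. ?g v x - ?g w x \<partial>lborel)"
    unfolding nemytskii_eq by (rule integral_cong_AE[symmetric, OF _ _ ae]) measurable
  also have "\<dots> = nemytskii \<O> f u v - nemytskii \<O> f u w" unfolding nemytskii_eq using i by simp
  finally show "nemytskii \<O> f u (v - w) = nemytskii \<O> f u v - nemytskii \<O> f u w" .
qed

text \<open>If \<open>f(u) v\<^sub>0\<close> were not integrable, the integrals for \<open>v\<^sub>0\<close> and \<open>v\<^sub>0 + w\<close> would both take the
  default value \<open>0\<close>, so that by linearity of the other terms of the equation \<open>\<integral> f(u) w = 0\<close> for every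
  admissible \<open>w\<close>. Taking \<open>w\<close> a bump function of \<open>u\<close>, this makes \<open>f(u)\<close> bounded, a contradiction.\<close>

lemma solution_nem_integrable:
  assumes s: "solves y u" and v0: "v0 \<in> H10 \<O>"
  shows "nem_integrable u v0"
proof (rule ccontr)
  assume bad: "\<not> nem_integrable u v0"
  have u: "u \<in> H10 \<O>" using s by (simp add: solves_def)
  have eq: "\<tau> * nemytskii \<O> f u v = inner u v - inner y v + \<tau> * dirform \<O> u v" if "v \<in> H10 \<O>" for v
    using s that unfolding solves_def dirichlet_laplacian_dirform by (simp add: algebra_simps)
  have zero: "nemytskii \<O> f u w = 0" if w: "w \<in> H10 \<O>" "nem_integrable u w" for w
  proof -
    have "\<not> nem_integrable u (v0 + w)" using nem_diff(1)[of u "v0 + w" w] w(2) bad by auto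
    then have "nemytskii \<O> f u (v0 + w) = 0" "nemytskii \<O> f u v0 = 0"
      using bad by (auto simp: nemytskii_eq nem_integrable_def not_integrable_integral_eq)
    moreover have "\<tau> * nemytskii \<O> f u (v0 + w) = \<tau> * nemytskii \<O> f u v0 + \<tau> * nemytskii \<O> f u w"
      using eq[OF v0] eq[OF w(1)] eq[OF H10_add(1)[OF open_dom v0 w(1)]]
      by (simp add: dirform_add_right open_dom v0 w inner_add_right algebra_simps)
    ultimately show ?thesis using \<tau>_pos by simp
  qed
  \<comment> \<open>On an interval where f keeps one sign, f(u) h(u) is bounded and of that sign for
    a window h, so its vanishing integral shows that u avoids the interval. The interval must not
    contain 0, so that h(0) = 0 and h(u) belongs to \<open>H10\<close>.\<close>
  have avoid: "AE x in lborel. x \<in> \<O> \<longrightarrow> rep_l2 u x \<notin> {a<..<b}"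
    if n0: "0 \<notin> {a<..<b}" and \<sigma>: "\<And>t. t \<in> {a..b} \<Longrightarrow> 0 < \<sigma> * f t" for a b \<sigma>
  proof -
    define h where "h t = psi (t - a) * psi (b - t)" for t
    have h: "smooth_lip h" unfolding h_def by (rule smooth_lip_window)
    have h_out: "h t = 0" if "t \<notin> {a<..<b}" for t using that by (auto simp: h_def psi_nonpos)
    have h_in: "h t > 0" if "t \<in> {a<..<b}" for t using that by (auto simp: h_def psi_pos)
    have h01: "0 \<le> h t" "h t \<le> 1" for t by (auto simp: h_def psi_nonneg psi_le_1 mult_le_one)
    have [measurable]: "h \<in> borel_measurable borel"
      using h smooth1_continuous by (auto simp: smooth_lip_def intro: borel_measurable_continuous_onI)
    have h0: "h 0 = 0" by (rule h_out[OF n0])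
    have w: "comp_l2 h u \<in> H10 \<O>" by (rule comp_in_H10[OF u h h0])
    have rw: "AE x in lborel. rep_l2 (comp_l2 h u) x = h (rep_l2 u x)"
      unfolding comp_l2_def by (rule rep_abs_l2[OF comp_sq_integrable[OF h h0]])
    have "compact (f ` {a..b})" using cont_f by (intro compact_continuous_image) (auto intro: continuous_on_subset)
    then obtain M where M: "\<And>t. t \<in> {a..b} \<Longrightarrow> \<bar>f t\<bar> \<le> M" using compact_imp_bounded by (fastforce simp: bounded_iff)
    have fh: "\<bar>f t * h t\<bar> \<le> \<bar>M\<bar>" for t
    proof (cases "t \<in> {a<..<b}")
      case True
      then have "\<bar>f t\<bar> * \<bar>h t\<bar> \<le> M * 1" using M[of t] h01[of t] by (intro mult_mono) auto
      then show ?thesis by (simp add: abs_mult)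
    qed (simp add: h_out)
    have int: "integrable lborel (\<lambda>x. indicator \<O> x * (f (rep_l2 u x) * h (rep_l2 u x)))"
    proof (rule Bochner_Integration.integrable_bound[of _ "\<lambda>x. \<bar>M\<bar> * indicator \<O> x"])
      show "integrable lborel (\<lambda>x. \<bar>M\<bar> * indicator \<O> x)" using dom_finite by auto
      show "AE x in lborel. norm (indicator \<O> x * (f (rep_l2 u x) * h (rep_l2 u x))) \<le> norm (\<bar>M\<bar> * indicator \<O> x)"
        using fh by (intro AE_I2) (auto simp: indicator_def)
    qed measurable
    have ae: "AE x in lborel. indicator \<O> x * (f (rep_l2 u x) * h (rep_l2 u x)) = indicator \<O> x * (f (rep_l2 u x) * rep_l2 (comp_l2 h u) x)"
      using rw by eventually_elim simp
    have "nem_integrable u (comp_l2 h u)" unfolding nem_integrable_def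
      by (rule integrable_cong_AE_imp[OF int _ ae]) measurable
    from zero[OF w this] have "(\<integral>x. indicator \<O> x * (f (rep_l2 u x) * h (rep_l2 u x)) \<partial>lborel) = 0"
      unfolding nemytskii_eq by (subst integral_cong_AE[OF _ _ ae]) auto
    then have "(\<integral>x. \<sigma> * (indicator \<O> x * (f (rep_l2 u x) * h (rep_l2 u x))) \<partial>lborel) = 0" by simp
    moreover have pos: "0 \<le> \<sigma> * (indicator \<O> x * (f (rep_l2 u x) * h (rep_l2 u x)))" for x
    proof (cases "rep_l2 u x \<in> {a<..<b}")
      case True
      then have "0 < \<sigma> * f (rep_l2 u x)" using \<sigma>[of "rep_l2 u x"] by auto
      from mult_nonneg_nonneg[OF less_imp_le[OF this] h01(1)]
      have "0 \<le> (\<sigma> * f (rep_l2 u x)) * h (rep_l2 u x)" .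
      then show ?thesis by (simp add: indicator_def mult.assoc)
    qed (simp add: h_out)
    ultimately have "AE x in lborel. \<sigma> * (indicator \<O> x * (f (rep_l2 u x) * h (rep_l2 u x))) = 0"
      using int by (subst (asm) integral_nonneg_eq_0_iff_AE) auto
    then show ?thesis
    proof eventually_elim
      case (elim x)
      show ?case
      proof (intro impI notI)
        assume x: "x \<in> \<O>" "rep_l2 u x \<in> {a<..<b}"
        then have "0 < \<sigma> * f (rep_l2 u x)" using \<sigma>[of "rep_l2 u x"] by auto
        from mult_pos_pos[OF this h_in[OF x(2)]] have "(\<sigma> * f (rep_l2 u x)) * h (rep_l2 u x) > 0" .
        moreover have "(\<sigma> * f (rep_l2 u x)) * h (rep_l2 u x) = \<sigma> * (indicator \<O> x * (f (rep_l2 u x) * h (rep_l2 u x)))"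
          using x(1) by (simp add: mult.assoc)
        ultimately show False using elim by linarith
      qed
    qed
  qed
  \<comment> \<open>Rational endpoints leave countably many intervals; by continuity of f they still
    cover all nonzero points where f does not vanish.\<close>
  define F where "F = {(a, b) \<in> \<rat> \<times> \<rat>. 0 \<notin> {a<..<b} \<and> (\<exists>\<sigma>::real. \<forall>t\<in>{a..b}. 0 < \<sigma> * f t)}"
  have "countable F" unfolding F_def by (rule countable_subset[of _ "\<rat> \<times> \<rat>"]) (auto intro: countable_SIGMA countable_rat)
  moreover have "\<forall>p\<in>F. AE x in lborel. x \<in> \<O> \<longrightarrow> rep_l2 u x \<notin> {fst p<..<snd p}"
  proof
    fix p assume "p \<in> F"
    then obtain \<sigma> where "0 \<notin> {fst p<..<snd p}" "\<And>t. t \<in> {fst p..snd p} \<Longrightarrow> 0 < \<sigma> * f t"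
      unfolding F_def mem_Collect_eq case_prod_beta by blast
    then show "AE x in lborel. x \<in> \<O> \<longrightarrow> rep_l2 u x \<notin> {fst p<..<snd p}" by (rule avoid)
  qed
  ultimately have "AE x in lborel. \<forall>p\<in>F. x \<in> \<O> \<longrightarrow> rep_l2 u x \<notin> {fst p<..<snd p}"
    by (subst AE_ball_countable)
  then have ae: "AE x in lborel. x \<in> \<O> \<longrightarrow> rep_l2 u x = 0 \<or> f (rep_l2 u x) = 0"
  proof eventually_elim
    case (elim x)
    show ?case
    proof (rule impI, rule ccontr)
      let ?s = "rep_l2 u x"
      assume x: "x \<in> \<O>" and "\<not> (?s = 0 \<or> f ?s = 0)"
      then have s: "?s \<noteq> 0" "f ?s \<noteq> 0" by auto
      define \<sigma> where "\<sigma> = sgn (f ?s)"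
      have "(f \<longlongrightarrow> f ?s) (at ?s)" using cont_f by (simp add: continuous_on_eq_continuous_at continuous_at)
      then have "\<forall>\<^sub>F t in at ?s. dist (f t) (f ?s) < \<bar>f ?s\<bar>" using s by (intro tendstoD) auto
      then obtain \<delta> where \<delta>: "\<delta> > 0" "\<And>t. t \<noteq> ?s \<Longrightarrow> dist t ?s < \<delta> \<Longrightarrow> dist (f t) (f ?s) < \<bar>f ?s\<bar>"
        unfolding eventually_at by auto
      have sg: "0 < \<sigma> * f t" if "\<bar>t - ?s\<bar> < \<delta>" for t
      proof (cases "t = ?s")
        case False
        then have "\<bar>f t - f ?s\<bar> < \<bar>f ?s\<bar>" using \<delta>(2)[of t] that by (simp add: dist_real_def)
        then show ?thesis unfolding \<sigma>_def by (cases "f ?s > 0") (auto simp: sgn_if abs_if split: if_splits)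
      qed (use s in \<open>simp add: \<sigma>_def sgn_if\<close>)
      define e where "e = min \<delta> \<bar>?s\<bar>"
      have e: "e > 0" using \<delta> s by (simp add: e_def)
      obtain a where a: "a \<in> \<rat>" "?s - e < a" "a < ?s" using Rats_dense_in_real[of "?s - e" ?s] e by auto
      obtain b where b: "b \<in> \<rat>" "?s < b" "b < ?s + e" using Rats_dense_in_real[of ?s "?s + e"] e by auto
      have "0 \<notin> {a<..<b}" using a b e_def by (auto simp: abs_if split: if_splits)
      moreover have "0 < \<sigma> * f t" if "t \<in> {a..b}" for t using that a b by (intro sg) (auto simp: e_def abs_if)
      ultimately have "(a, b) \<in> F" using a(1) b(1) unfolding F_def mem_Collect_eq case_prod_conv by blast
      then have "?s \<notin> {fst (a, b)<..<snd (a, b)}" using elim x(1) by blast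
      then show False using a b by simp
    qed
  qed
  \<comment> \<open>On the domain f(u) now takes almost everywhere only the values 0 and f 0, so the
    integrand is dominated by a multiple of v0 there.\<close>
  have "nem_integrable u v0"
    unfolding nem_integrable_def
  proof (rule Bochner_Integration.integrable_bound[of _ "\<lambda>x. f 0 * (rep_l2 v0 x * indicator \<O> x)"])
    show "integrable lborel (\<lambda>x. f 0 * (rep_l2 v0 x * indicator \<O> x))"
      by (intro integrable_mult_right integrable_rep_l2_indicator dom_measurable dom_finite)
    show "AE x in lborel. norm (indicator \<O> x * (f (rep_l2 u x) * rep_l2 v0 x)) \<le> norm (f 0 * (rep_l2 v0 x * indicator \<O> x))"
      using ae
    proof eventually_elim
      case (elim x)
      then show ?case by (cases "x \<in> \<O>") (auto simp: abs_mult)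
    qed
  qed measurable
  with bad show False by simp
qed

lemma solves_exists: "\<exists>u. solves y u"
proof -
  define one where "one = abs_l2 (indicator \<O> :: 'a \<Rightarrow> real)"
  have sq1: "sq_integrable (indicator \<O> :: 'a \<Rightarrow> real)" by (rule sq_integrable_indicator[OF dom_measurable dom_finite])
  \<comment> \<open>The term \<tau> f(0) on the domain compensates the constant in
    \<open>shifted\<close>.\<close>
  obtain u where u: "u \<in> H10 \<O>" "sq_integrable (\<lambda>x. shifted (rep_l2 u x))"
    "\<And>v. v \<in> H10 \<O> \<Longrightarrow> bform u v + \<tau> * inner (comp_l2 shifted u) v = inner (y + (\<tau> * f 0) *\<^sub>R one) v"
    by (rule solve_monotone[of "y + (\<tau> * f 0) *\<^sub>R one"]) blast
  have "inner u v = inner y v + \<tau> * dirichlet_laplacian \<O> u v + \<tau> * nemytskii \<O> f u v" if v: "v \<in> H10 \<O>" for v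
  proof -
    have i1: "inner one v = (\<integral>x. indicator \<O> x * rep_l2 v x \<partial>lborel)"
      unfolding one_def using inner_abs_l2[OF sq1 sq_integrable_rep_l2, of v] by simp
    have i2: "inner (comp_l2 shifted u) v = (\<integral>x. shifted (rep_l2 u x) * rep_l2 v x \<partial>lborel)"
      unfolding comp_l2_def using inner_abs_l2[OF u(2) sq_integrable_rep_l2, of v] by simp
    have "nemytskii \<O> f u v = (\<integral>x. L * (rep_l2 u x * rep_l2 v x) + f 0 * (indicator \<O> x * rep_l2 v x) - shifted (rep_l2 u x) * rep_l2 v x \<partial>lborel)"
      unfolding nemytskii_eq
    proof (rule integral_cong_AE)
      show "AE x in lborel. indicator \<O> x * (f (rep_l2 u x) * rep_l2 v x) =
        L * (rep_l2 u x * rep_l2 v x) + f 0 * (indicator \<O> x * rep_l2 v x) - shifted (rep_l2 u x) * rep_l2 v x"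
        using L2_rep_zero[OF H10_subset_L2[OF v]]
      proof eventually_elim
        case (elim x)
        then show ?case by (cases "x \<in> \<O>") (auto simp: shifted_def algebra_simps)
      qed
    qed measurable
    also have "\<dots> = L * inner u v + f 0 * inner one v - inner (comp_l2 shifted u) v"
      unfolding i1 i2 inner_l2_eq[of u v] using sq_integrable_mult[OF sq1 sq_integrable_rep_l2, of v] sq_integrable_mult[OF u(2) sq_integrable_rep_l2, of v]
      by simp
    finally have n: "nemytskii \<O> f u v = L * inner u v + f 0 * inner one v - inner (comp_l2 shifted u) v" .
    show ?thesis using u(3)[OF v] unfolding n dirichlet_laplacian_dirform bform_def by (simp add: inner_add_left algebra_simps)
  qed
  with u(1) show ?thesis unfolding solves_def by blast
qed

text \<open>Both equations are tested with the difference of the solutions.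
  \<open>solution_nem_integrable\<close> allows the two nonlinear integrals to be combined, after
  which the one-sided Lipschitz bound applies pointwise.\<close>

lemma solves_monotone:
  assumes s: "solves y u" "solves z v"
  shows "\<alpha> * (norm (u - v))\<^sup>2 \<le> inner (y - z) (u - v)"
proof -
  let ?w = "u - v"
  have uv: "u \<in> H10 \<O>" "v \<in> H10 \<O>" using s by (auto simp: solves_def)
  have w: "?w \<in> H10 \<O>" by (rule H10_diff(1)[OF open_dom uv])
  have i: "nem_integrable u ?w" "nem_integrable v ?w" using solution_nem_integrable[OF s(1) w] solution_nem_integrable[OF s(2) w] .
  have "nemytskii \<O> f u ?w - nemytskii \<O> f v ?w =
     (\<integral>x. indicator \<O> x * (f (rep_l2 u x) * rep_l2 ?w x) - indicator \<O> x * (f (rep_l2 v x) * rep_l2 ?w x) \<partial>lborel)"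
    unfolding nemytskii_eq using i by (simp add: nem_integrable_def)
  also have "\<dots> \<le> (\<integral>x. L * (rep_l2 ?w x * rep_l2 ?w x) \<partial>lborel)"
  proof (rule integral_mono_AE)
    show "AE x in lborel. indicator \<O> x * (f (rep_l2 u x) * rep_l2 ?w x) - indicator \<O> x * (f (rep_l2 v x) * rep_l2 ?w x) \<le> L * (rep_l2 ?w x * rep_l2 ?w x)"
      using rep_l2_diff[of u v] L2_rep_zero[OF H10_subset_L2[OF w]]
    proof eventually_elim
      case (elim x)
      show ?case
      proof (cases "x \<in> \<O>")
        case True
        then show ?thesis using one_sided[of "rep_l2 u x" "rep_l2 v x"] unfolding elim(1)
          by (simp add: power2_eq_square algebra_simps)
      qed (use elim(2) in simp)
    qed
  qed (use i in \<open>auto simp: nem_integrable_def\<close>)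
  also have "\<dots> = L * (norm ?w)\<^sup>2" unfolding norm_l2_sq by (simp add: power2_eq_square)
  finally have n: "nemytskii \<O> f u ?w - nemytskii \<O> f v ?w \<le> L * (norm ?w)\<^sup>2" .
  have "(norm ?w)\<^sup>2 = inner u ?w - inner v ?w" by (simp add: power2_norm_eq_inner inner_diff_left)
  also have "inner u ?w = inner y ?w + \<tau> * dirichlet_laplacian \<O> u ?w + \<tau> * nemytskii \<O> f u ?w"
    using s(1) w by (simp add: solves_def)
  also have "inner v ?w = inner z ?w + \<tau> * dirichlet_laplacian \<O> v ?w + \<tau> * nemytskii \<O> f v ?w"
    using s(2) w by (simp add: solves_def)
  finally have "(norm ?w)\<^sup>2 + \<tau> * dirform \<O> ?w ?w = inner (y - z) ?w + \<tau> * (nemytskii \<O> f u ?w - nemytskii \<O> f v ?w)"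
    unfolding dirichlet_laplacian_dirform dirform_diff_left[OF open_dom uv] inner_diff_left[of y z] by (simp add: algebra_simps)
  also have "\<dots> \<le> inner (y - z) ?w + \<tau> * (L * (norm ?w)\<^sup>2)" using n \<tau>_pos by simp
  finally show ?thesis using bform_lower[OF w] unfolding bform_def power2_norm_eq_inner by (simp add: algebra_simps)
qed

definition resolvent :: "'a l2 \<Rightarrow> 'a l2" where
  "resolvent y = (SOME u. solves y u)"

lemma resolvent_solves: "solves y (resolvent y)"
  unfolding resolvent_def by (rule someI_ex[OF solves_exists])

text \<open>With w the difference of the resolvents, 2 <y - z, w> \<le> |y - z|^2 + |w|^2 converts
  strong monotonicity into the constant 2 \<alpha> - 1 = 1 + 2 \<tau> (lam - L), the denominator of
  the contraction factor.\<close>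

lemma resolvent_contraction:
  "(1 + 2 * \<tau> * (lam - L)) * (norm (resolvent y - resolvent z))\<^sup>2 \<le> (norm (y - z))\<^sup>2"
proof -
  let ?w = "resolvent y - resolvent z"
  have "0 \<le> (norm ((y - z) - ?w))\<^sup>2" by simp
  also have "\<dots> = (norm (y - z))\<^sup>2 - 2 * inner (y - z) ?w + (norm ?w)\<^sup>2"
    unfolding power2_norm_eq_inner by (simp only: inner_diff_left inner_diff_right) (simp add: inner_commute algebra_simps)
  finally show ?thesis using solves_monotone[OF resolvent_solves resolvent_solves, of y z] unfolding \<alpha>_def by (simp add: algebra_simps)
qed

lemma resolvent_unique:
  assumes "solves y u"
  shows "u = resolvent y"
proof -
  have "\<alpha> * (norm (u - resolvent y))\<^sup>2 \<le> 0" using solves_monotone[OF assms resolvent_solves[of y]] by simp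
  then have "(norm (u - resolvent y))\<^sup>2 \<le> 0" using \<alpha>_pos by (simp add: mult_le_0_iff)
  then show ?thesis by simp
qed

lemma resolvent_H10: "resolvent y \<in> H10 \<O>"
  using resolvent_solves by (simp add: solves_def)

lemma resolvent_L2: "resolvent y \<in> L2 \<O>"
  by (rule H10_subset_L2[OF resolvent_H10])

lemma resolvent_nonexpansive: "norm (resolvent y - resolvent z) \<le> norm (y - z)"
proof -
  have "1 * (norm (resolvent y - resolvent z))\<^sup>2 \<le> (1 + 2 * \<tau> * (lam - L)) * (norm (resolvent y - resolvent z))\<^sup>2"
    using \<tau>_pos L_less by (intro mult_right_mono) auto
  also have "\<dots> \<le> (norm (y - z))\<^sup>2" by (rule resolvent_contraction)
  finally have "(norm (resolvent y - resolvent z))\<^sup>2 \<le> (norm (y - z))\<^sup>2" by (simp only: mult_1_left)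
  then show ?thesis by (rule power2_le_imp_le) simp
qed

end

section \<open>Random variables with values in a separable Hilbert space\<close>

locale onb_space =
  fixes H :: "'h::{real_inner, banach} set" and e :: "nat \<Rightarrow> 'h"
  assumes onb: "orthonormal_basis H e"
begin

abbreviation HB :: "'h measure" where "HB \<equiv> restrict_space borel H"

lemma e_in: "e k \<in> H" and e_orth: "inner (e j) (e k) = (if j = k then 1 else 0)"
  and H_closure: "H = closure (span (range e))"
  using onb by (auto simp: orthonormal_basis_def)

lemma norm_e: "norm (e k) = 1"
  using e_orth[of k k] by (simp add: norm_eq_1)

lemma subspace_H: "subspace H"
  unfolding subspace_def H_closure
proof (intro conjI allI ballI)
  show "0 \<in> closure (span (range e))" using closure_subset span_zero by blast
  fix x y :: 'h and c :: real
  assume x: "x \<in> closure (span (range e))"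
  obtain X where X: "\<And>n. X n \<in> span (range e)" "X \<longlonglongrightarrow> x" using x unfolding closure_sequential by blast
  show "c *\<^sub>R x \<in> closure (span (range e))"
    unfolding closure_sequential
    by (rule exI[of _ "\<lambda>n. c *\<^sub>R X n"]) (auto intro!: tendsto_intros X span_scale)
  assume "y \<in> closure (span (range e))"
  then obtain Y where Y: "\<And>n. Y n \<in> span (range e)" "Y \<longlonglongrightarrow> y" unfolding closure_sequential by blast
  show "x + y \<in> closure (span (range e))"
    unfolding closure_sequential
    by (rule exI[of _ "\<lambda>n. X n + Y n"]) (auto intro!: tendsto_intros X Y span_add)
qed

lemma closed_H: "closed H"
  by (subst H_closure) simp

lemmas H_zero = subspace_0[OF subspace_H] and H_add = subspace_add[OF subspace_H]
  and H_diff = subspace_diff[OF subspace_H] and H_scale = subspace_scale[OF subspace_H]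
  and H_sum = subspace_sum[OF subspace_H]

lemma H_limit: "(\<And>n. X n \<in> H) \<Longrightarrow> X \<longlonglongrightarrow> u \<Longrightarrow> u \<in> H"
  using closed_H closed_sequential_limits by blast

lemma space_HB [simp]: "space HB = H"
  by (simp add: space_restrict_space)

lemma inner_sum_e: "inner (\<Sum>k<n. c k *\<^sub>R e k) (e j) = (if j < n then c j else 0)"
proof -
  have "inner (\<Sum>k<n. c k *\<^sub>R e k) (e j) = (\<Sum>k<n. c k * (if k = j then 1 else 0))"
    by (simp add: inner_sum_left e_orth)
  also have "\<dots> = (\<Sum>k<n. if k = j then c k else 0)" by (rule sum.cong) auto
  also have "\<dots> = (if j < n then c j else 0)" by (simp add: sum.delta)
  finally show ?thesis .
qed

text \<open>The partial sums are orthogonal projections, hence at least as close to u as any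
  combination of the same basis vectors, and such combinations come arbitrarily close.\<close>

lemma expansion:
  assumes "u \<in> H"
  shows "(\<lambda>n. \<Sum>k<n. inner u (e k) *\<^sub>R e k) \<longlonglongrightarrow> u"
proof (rule LIMSEQ_I)
  fix \<epsilon> :: real assume "\<epsilon> > 0"
  then obtain w where w: "w \<in> span (range e)" "dist w u < \<epsilon>"
    using assms unfolding H_closure closure_approachable by blast
  have "\<exists>N. \<exists>c. w = (\<Sum>k<N. c k *\<^sub>R e k)"
    using w(1)
  proof (induction rule: span_induct_alt)
    case base
    show ?case by (rule exI[of _ 0]) simp
  next
    case (step a x y)
    then obtain j N c where j: "x = e j" and y: "y = (\<Sum>k<N. c k *\<^sub>R e k)" by auto
    define c' where "c' k = (if k < N then c k else 0) + (if k = j then a else 0)" for k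
    define M where "M = max N (Suc j)"
    have "(\<Sum>k<M. c' k *\<^sub>R e k) = (\<Sum>k<M. (if k < N then c k else 0) *\<^sub>R e k) + (\<Sum>k<M. (if k = j then a else 0) *\<^sub>R e k)"
      by (simp add: c'_def scaleR_left_distrib sum.distrib)
    also have "(\<Sum>k<M. (if k < N then c k else 0) *\<^sub>R e k) = (\<Sum>k<N. c k *\<^sub>R e k)"
      by (rule sum.mono_neutral_cong_right) (auto simp: M_def)
    also have "(\<Sum>k<M. (if k = j then a else 0) *\<^sub>R e k) = (\<Sum>k\<in>{j}. a *\<^sub>R e k)"
      by (rule sum.mono_neutral_cong_right) (auto simp: M_def)
    finally have "a *\<^sub>R x + y = (\<Sum>k<M. c' k *\<^sub>R e k)" by (simp add: j y)
    then show ?case by blast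
  qed
  then obtain N c where c: "w = (\<Sum>k<N. c k *\<^sub>R e k)" by blast
  have "norm ((\<Sum>k<n. inner u (e k) *\<^sub>R e k) - u) < \<epsilon>" if n: "n \<ge> N" for n
  proof -
    define S where "S = (\<Sum>k<n. inner u (e k) *\<^sub>R e k)"
    have w': "w = (\<Sum>k<n. (if k < N then c k else 0) *\<^sub>R e k)"
      unfolding c by (rule sum.mono_neutral_cong_left) (use n in auto)
    have orth: "inner (u - S) (e k) = 0" if "k < n" for k
      using that by (simp add: S_def inner_diff_left inner_sum_e)
    have "S - w = (\<Sum>k<n. (inner u (e k) - (if k < N then c k else 0)) *\<^sub>R e k)"
      unfolding S_def w' by (simp add: scaleR_left_diff_distrib sum_subtractf)
    then have o: "inner (u - S) (S - w) = 0" using orth by (simp add: inner_sum_right)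
    have "(norm (u - S))\<^sup>2 \<le> (norm (u - S))\<^sup>2 + (norm (S - w))\<^sup>2" by simp
    also have "\<dots> = (norm ((u - S) + (S - w)))\<^sup>2"
      using o by (simp only: power2_norm_eq_inner inner_add_left inner_add_right inner_commute[of "S - w" "u - S"] add_0_left add_0_right)
    finally have "(norm (u - S))\<^sup>2 \<le> (norm (u - w))\<^sup>2" by simp
    then have "norm (u - S) \<le> norm (u - w)" by (rule power2_le_imp_le) simp
    then show ?thesis using w(2) unfolding S_def[symmetric] by (simp add: dist_norm norm_minus_commute)
  qed
  then show "\<exists>N. \<forall>n\<ge>N. norm ((\<Sum>k<n. inner u (e k) *\<^sub>R e k) - u) < \<epsilon>" by blast
qed

section \<open>Measurable maps into H\<close>

lemma measurable_HB_iff: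
  "h \<in> M \<rightarrow>\<^sub>M HB \<longleftrightarrow> h \<in> space M \<rightarrow> H \<and> h \<in> borel_measurable M"
  by (auto simp: measurable_restrict_space2_iff)

lemma measurable_HB_imp: "h \<in> M \<rightarrow>\<^sub>M HB \<Longrightarrow> h \<in> borel_measurable M"
  by (simp add: measurable_HB_iff)

lemma measurable_HB_in: "h \<in> M \<rightarrow>\<^sub>M HB \<Longrightarrow> \<omega> \<in> space M \<Longrightarrow> h \<omega> \<in> H"
  by (auto simp: measurable_HB_iff)

text \<open>The ambient space need not be separable, and then sums of Borel maps may fail to be
  Borel. Inside H, the basis expansion reduces measurability to countably many real coordinates;
  sums and multiples below are treated in this way.\<close>

lemma measurable_HB_coords:
  assumes "\<And>\<omega>. \<omega> \<in> space M \<Longrightarrow> h \<omega> \<in> H" "\<And>k. (\<lambda>\<omega>. inner (h \<omega>) (e k)) \<in> borel_measurable M"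
  shows "h \<in> M \<rightarrow>\<^sub>M HB"
  unfolding measurable_HB_iff
proof
  show "h \<in> borel_measurable M"
  proof (rule borel_measurable_LIMSEQ_metric)
    fix \<omega> assume "\<omega> \<in> space M"
    then show "(\<lambda>n. \<Sum>k<n. inner (h \<omega>) (e k) *\<^sub>R e k) \<longlonglongrightarrow> h \<omega>" by (intro expansion assms(1))
  next
    fix n
    have c: "(\<lambda>\<omega> k. inner (h \<omega>) (e k)) \<in> borel_measurable M"
      by (rule measurable_coordinatewise_then_product) (rule assms(2))
    have "(\<lambda>c. \<Sum>k<n. c k *\<^sub>R e k) \<in> borel_measurable borel"
      by (intro borel_measurable_continuous_onI continuous_on_sum continuous_on_scaleR continuous_on_const
        continuous_on_product_coordinates)
    from measurable_compose[OF c this] show "(\<lambda>\<omega>. \<Sum>k<n. inner (h \<omega>) (e k) *\<^sub>R e k) \<in> borel_measurable M" .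
  qed
qed (use assms(1) in auto)

lemma measurable_HB_inner:
  assumes "h \<in> M \<rightarrow>\<^sub>M HB"
  shows "(\<lambda>\<omega>. inner (h \<omega>) v) \<in> borel_measurable M"
proof -
  have "(\<lambda>u. inner u v) \<in> borel_measurable borel"
    by (intro borel_measurable_continuous_onI continuous_intros)
  from measurable_compose[OF measurable_HB_imp[OF assms] this] show ?thesis .
qed

lemma measurable_HB_norm:
  assumes "h \<in> M \<rightarrow>\<^sub>M HB"
  shows "(\<lambda>\<omega>. norm (h \<omega>)) \<in> borel_measurable M"
proof -
  have "(norm :: 'h \<Rightarrow> real) \<in> borel_measurable borel"
    by (intro borel_measurable_continuous_onI continuous_intros)
  from measurable_compose[OF measurable_HB_imp[OF assms] this] show ?thesis .
qed

lemma measurable_HB_const: "v \<in> H \<Longrightarrow> (\<lambda>_. v) \<in> M \<rightarrow>\<^sub>M HB"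
  by (simp add: measurable_HB_iff)

lemma measurable_HB_add:
  assumes "h \<in> M \<rightarrow>\<^sub>M HB" "g \<in> M \<rightarrow>\<^sub>M HB"
  shows "(\<lambda>\<omega>. h \<omega> + g \<omega>) \<in> M \<rightarrow>\<^sub>M HB"
  by (rule measurable_HB_coords)
     (auto intro!: H_add measurable_HB_in[OF assms(1)] measurable_HB_in[OF assms(2)] borel_measurable_add
       measurable_HB_inner assms simp: inner_add_left)

lemma measurable_HB_scaleR:
  assumes "c \<in> borel_measurable M" "h \<in> M \<rightarrow>\<^sub>M HB"
  shows "(\<lambda>\<omega>. c \<omega> *\<^sub>R h \<omega>) \<in> M \<rightarrow>\<^sub>M HB"
  by (rule measurable_HB_coords)
     (auto intro!: H_scale measurable_HB_in[OF assms(2)] borel_measurable_times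
       measurable_HB_inner assms)

lemma measurable_HB_diff:
  assumes "h \<in> M \<rightarrow>\<^sub>M HB" "g \<in> M \<rightarrow>\<^sub>M HB"
  shows "(\<lambda>\<omega>. h \<omega> - g \<omega>) \<in> M \<rightarrow>\<^sub>M HB"
  using measurable_HB_add[OF assms(1) measurable_HB_scaleR[OF measurable_const assms(2), of "-1"]] by simp

lemma measurable_HB_sum:
  assumes "\<And>i. i \<in> I \<Longrightarrow> h i \<in> M \<rightarrow>\<^sub>M HB"
  shows "(\<lambda>\<omega>. \<Sum>i\<in>I. h i \<omega>) \<in> M \<rightarrow>\<^sub>M HB"
  using assms
  by (induction I rule: infinite_finite_induct) (auto intro: measurable_HB_const H_zero measurable_HB_add)

lemma measurable_HB_limit:
  assumes "\<And>n. h n \<in> M \<rightarrow>\<^sub>M HB" "\<And>\<omega>. \<omega> \<in> space M \<Longrightarrow> (\<lambda>n. h n \<omega>) \<longlonglongrightarrow> g \<omega>"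
  shows "g \<in> M \<rightarrow>\<^sub>M HB"
  unfolding measurable_HB_iff
proof
  show "g \<in> borel_measurable M"
    by (rule borel_measurable_LIMSEQ_metric[OF measurable_HB_imp[OF assms(1)] assms(2)])
  show "g \<in> space M \<rightarrow> H"
    by (auto intro!: H_limit[OF measurable_HB_in[OF assms(1)] assms(2)])
qed

lemma measurable_HB_continuous:
  assumes "h \<in> M \<rightarrow>\<^sub>M HB" "continuous_on H R" "\<And>u. u \<in> H \<Longrightarrow> R u \<in> H"
  shows "(\<lambda>\<omega>. R (h \<omega>)) \<in> M \<rightarrow>\<^sub>M HB"
proof -
  have "R \<in> HB \<rightarrow>\<^sub>M HB"
    unfolding measurable_HB_iff using assms(2,3) by (auto intro: borel_measurable_continuous_on_restrict)
  from measurable_compose[OF assms(1) this] show ?thesis .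
qed

text \<open>The set of convergence is measurable because the Cauchy property amounts to countably
  many conditions; cutting the sequence off outside it makes the limit exist everywhere.\<close>

lemma measurable_HB_lim:
  assumes h: "\<And>n. h n \<in> M \<rightarrow>\<^sub>M HB"
  shows "(\<lambda>\<omega>. if convergent (\<lambda>n. h n \<omega>) then lim (\<lambda>n. h n \<omega>) else 0) \<in> M \<rightarrow>\<^sub>M HB"
proof (rule measurable_HB_limit)
  define C where "C \<omega> \<longleftrightarrow> (\<forall>i. \<exists>N. \<forall>m\<ge>N. \<forall>n\<ge>N. norm (h m \<omega> - h n \<omega>) < inverse (real (Suc i)))" for \<omega>
  have C: "C \<omega> \<longleftrightarrow> convergent (\<lambda>n. h n \<omega>)" for \<omega>
  proof
    assume c: "C \<omega>"
    have "Cauchy (\<lambda>n. h n \<omega>)"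
    proof (rule CauchyI)
      fix \<epsilon> :: real assume "\<epsilon> > 0"
      then obtain i where i: "inverse (real (Suc i)) < \<epsilon>" using reals_Archimedean by blast
      obtain N where "\<forall>m\<ge>N. \<forall>n\<ge>N. norm (h m \<omega> - h n \<omega>) < inverse (real (Suc i))" using c unfolding C_def by blast
      then show "\<exists>M. \<forall>m\<ge>M. \<forall>n\<ge>M. norm (h m \<omega> - h n \<omega>) < \<epsilon>" using i less_trans by blast
    qed
    then show "convergent (\<lambda>n. h n \<omega>)" by (simp add: Cauchy_convergent_iff)
  next
    assume "convergent (\<lambda>n. h n \<omega>)"
    then have "Cauchy (\<lambda>n. h n \<omega>)" by (simp add: Cauchy_convergent_iff)
    then show "C \<omega>" unfolding C_def using CauchyD by fastforce
  qed
  have d [measurable]: "(\<lambda>\<omega>. norm (h m \<omega> - h n \<omega>)) \<in> borel_measurable M" for m n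
    by (intro measurable_HB_norm measurable_HB_diff h)
  have Cm: "{\<omega> \<in> space M. C \<omega>} \<in> sets M" unfolding C_def by measurable
  show "(\<lambda>\<omega>. (if C \<omega> then 1 else 0) *\<^sub>R h n \<omega>) \<in> M \<rightarrow>\<^sub>M HB" for n
    by (intro measurable_HB_scaleR h measurable_If Cm) auto
  fix \<omega> assume "\<omega> \<in> space M"
  show "(\<lambda>n. (if C \<omega> then 1 else 0) *\<^sub>R h n \<omega>) \<longlonglongrightarrow> (if convergent (\<lambda>n. h n \<omega>) then lim (\<lambda>n. h n \<omega>) else 0)"
    unfolding C by (auto simp: convergent_LIMSEQ_iff)
qed

end

text \<open>With q = sqrt r, the inequality d \<le> q^n + d^2 / q^n splits the geometric decay
  evenly: both terms have integral of order q^n, which is summable.\<close>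

lemma (in prob_space) AE_summable_if_L2_geometric:
  fixes d :: "nat \<Rightarrow> 'a \<Rightarrow> real"
  assumes [measurable]: "\<And>n. d n \<in> borel_measurable M" and nonneg: "\<And>n x. 0 \<le> d n x"
    and r: "0 < r" "r < 1" and C: "0 \<le> C"
    and bound: "\<And>n. (\<integral>\<^sup>+x. ennreal ((d n x)\<^sup>2) \<partial>M) \<le> ennreal (C * r ^ n)"
  shows "AE x in M. summable (\<lambda>n. d n x)"
proof -
  define q where "q = sqrt r"
  have q: "0 < q" "q < 1" "q * q = r" using r by (auto simp: q_def)
  have qn: "q ^ n > 0" for n using q by simp
  have le: "(\<integral>\<^sup>+x. ennreal (d n x) \<partial>M) \<le> ennreal ((1 + C) * q ^ n)" for n
  proof -
    have "(\<integral>\<^sup>+x. ennreal (d n x) \<partial>M) \<le> (\<integral>\<^sup>+x. ennreal (q ^ n) + ennreal (1 / q ^ n) * ennreal ((d n x)\<^sup>2) \<partial>M)"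
    proof (rule nn_integral_mono)
      fix x
      have "0 \<le> (q ^ n - d n x)\<^sup>2 + q ^ n * d n x" using nonneg[of n x] qn[of n] by simp
      then have "q ^ n * d n x \<le> q ^ n * q ^ n + (d n x)\<^sup>2" by (simp add: power2_eq_square algebra_simps)
      then have "(q ^ n * d n x) / q ^ n \<le> (q ^ n * q ^ n + (d n x)\<^sup>2) / q ^ n"
        using qn[of n] by (intro divide_right_mono) auto
      then have "d n x \<le> q ^ n + 1 / q ^ n * (d n x)\<^sup>2" using qn[of n] q(1) by (simp add: add_divide_distrib)
      then have "ennreal (d n x) \<le> ennreal (q ^ n + 1 / q ^ n * (d n x)\<^sup>2)" by (rule ennreal_leI)
      also have "\<dots> = ennreal (q ^ n) + ennreal (1 / q ^ n * (d n x)\<^sup>2)" using qn[of n] by (intro ennreal_plus) auto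
      also have "ennreal (1 / q ^ n * (d n x)\<^sup>2) = ennreal (1 / q ^ n) * ennreal ((d n x)\<^sup>2)" using qn[of n] by (intro ennreal_mult) auto
      finally show "ennreal (d n x) \<le> ennreal (q ^ n) + ennreal (1 / q ^ n) * ennreal ((d n x)\<^sup>2)" .
    qed
    also have "\<dots> = ennreal (q ^ n) + ennreal (1 / q ^ n) * (\<integral>\<^sup>+x. ennreal ((d n x)\<^sup>2) \<partial>M)"
      by (subst nn_integral_add) (auto simp: nn_integral_cmult emeasure_space_1)
    also have "\<dots> \<le> ennreal (q ^ n) + ennreal (1 / q ^ n) * ennreal (C * r ^ n)"
      by (intro add_left_mono mult_left_mono bound) simp
    also have "\<dots> = ennreal (q ^ n + 1 / q ^ n * (C * r ^ n))"
      using qn[of n] C r by (subst ennreal_mult[symmetric], simp, simp, subst ennreal_plus[symmetric]) auto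
    also have "1 / q ^ n * (C * r ^ n) = C * q ^ n"
      using qn[of n] unfolding q(3)[symmetric] power_mult_distrib by simp
    finally show ?thesis by (simp add: distrib_right)
  qed
  have "(\<integral>\<^sup>+x. (\<Sum>n. ennreal (d n x)) \<partial>M) = (\<Sum>n. \<integral>\<^sup>+x. ennreal (d n x) \<partial>M)"
    by (rule nn_integral_suminf) measurable
  also have "\<dots> \<le> (\<Sum>n. ennreal ((1 + C) * q ^ n))" by (intro suminf_le le) auto
  also have "\<dots> = ennreal (\<Sum>n. (1 + C) * q ^ n)"
    using q C by (intro suminf_ennreal2 summable_mult summable_geometric) auto
  also have "\<dots> < \<infinity>" by simp
  finally have "AE x in M. (\<Sum>n. ennreal (d n x)) \<noteq> \<infinity>" by (intro nn_integral_PInf_AE) auto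
  then show ?thesis by eventually_elim (use nonneg in \<open>auto intro: summable_suminf_not_top\<close>)
qed

lemma convergent_if_summable_norm_diff:
  fixes X :: "nat \<Rightarrow> 'h::banach"
  assumes "summable (\<lambda>n. norm (X (Suc n) - X n))"
  shows "convergent X"
proof -
  have "summable (\<lambda>n. X (Suc n) - X n)" by (rule summable_norm_cancel[OF assms])
  then have "convergent (\<lambda>n. \<Sum>i<n. X (Suc i) - X i)" by (simp add: summable_iff_convergent)
  then have "convergent (\<lambda>n. X n - X 0)" by (simp only: sum_lessThan_telescope[of X])
  from convergent_add[OF this convergent_const[of "X 0"]] show ?thesis by simp
qed

section \<open>Random maps contracting in mean square\<close>

lemma nn_integral_le_by_Fatou:
  assumes [measurable]: "\<And>n. f n \<in> borel_measurable M" and lim: "AE x in M. (\<lambda>n. f n x) \<longlonglongrightarrow> g x"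
    and le: "\<And>n. (\<integral>\<^sup>+x. f n x \<partial>M) \<le> (b n :: ennreal)" and b: "b \<longlonglongrightarrow> c"
  shows "(\<integral>\<^sup>+x. g x \<partial>M) \<le> c"
proof -
  have "(\<integral>\<^sup>+x. g x \<partial>M) = (\<integral>\<^sup>+x. liminf (\<lambda>n. f n x) \<partial>M)"
    by (rule nn_integral_cong_AE, use lim in eventually_elim) (simp add: lim_imp_Liminf)
  also have "\<dots> \<le> liminf (\<lambda>n. \<integral>\<^sup>+x. f n x \<partial>M)" by (rule nn_integral_liminf) measurable
  also have "\<dots> \<le> liminf b" by (intro Liminf_mono always_eventually allI le)
  also have "\<dots> = c" using b by (simp add: lim_imp_Liminf)
  finally show ?thesis .
qed

text \<open>Young's inequality with a free parameter: \<delta> = 1 serves for crude bounds, a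
  smaller \<delta> where the factor of the first term must stay close to 1.\<close>

lemma norm_add_sq_le:
  fixes a b :: "'h::real_inner"
  assumes "\<delta> > 0"
  shows "(norm (a + b))\<^sup>2 \<le> (1 + \<delta>) * (norm a)\<^sup>2 + (1 + 1 / \<delta>) * (norm b)\<^sup>2"
proof -
  obtain r where r: "r > 0" "\<delta> = r * r"
    using assms by (intro that[of "sqrt \<delta>"]) auto
  have "0 \<le> (norm (r *\<^sub>R a - (1 / r) *\<^sub>R b))\<^sup>2" by simp
  also have "\<dots> = \<delta> * (norm a)\<^sup>2 - 2 * inner a b + (1 / \<delta>) * (norm b)\<^sup>2"
    using r(1) unfolding power2_norm_eq_inner r(2) by (simp add: inner_diff_left inner_diff_right inner_commute[of b a] field_simps)
  finally have "2 * inner a b \<le> \<delta> * (norm a)\<^sup>2 + (1 / \<delta>) * (norm b)\<^sup>2" by linarith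
  moreover have "(norm (a + b))\<^sup>2 = (norm a)\<^sup>2 + 2 * inner a b + (norm b)\<^sup>2"
    unfolding power2_norm_eq_inner by (simp add: inner_add_left inner_add_right inner_commute[of b a])
  ultimately show ?thesis by (simp add: distrib_right)
qed

text \<open>The map contracts only on average, separately for each pair of starting points. The
  bound C0 at the single point 0 then controls second moments at all starting points.\<close>

locale contractive_map = onb_space H e + S: prob_space S
  for H :: "'h::{real_inner, banach} set" and e :: "nat \<Rightarrow> 'h" and S :: "'s measure" +
  fixes \<Phi> :: "'h \<Rightarrow> 's \<Rightarrow> 'h" and \<rho> C0 :: real
  assumes map_meas: "(\<lambda>(y, s). \<Phi> y s) \<in> HB \<Otimes>\<^sub>M S \<rightarrow>\<^sub>M HB"
    and contr: "\<And>x y. x \<in> H \<Longrightarrow> y \<in> H \<Longrightarrow>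
      (\<integral>\<^sup>+s. ennreal ((norm (\<Phi> x s - \<Phi> y s))\<^sup>2) \<partial>S) \<le> ennreal (\<rho> * (norm (x - y))\<^sup>2)"
    and \<rho>: "0 < \<rho>" "\<rho> < 1" and C0: "0 \<le> C0" "(\<integral>\<^sup>+s. ennreal ((norm (\<Phi> 0 s))\<^sup>2) \<partial>S) \<le> ennreal C0"
begin

section \<open>The transition operator of one step\<close>

lemma map_measurable:
  assumes "f \<in> M \<rightarrow>\<^sub>M HB" "g \<in> M \<rightarrow>\<^sub>M S"
  shows "(\<lambda>\<omega>. \<Phi> (f \<omega>) (g \<omega>)) \<in> M \<rightarrow>\<^sub>M HB"
  using measurable_compose[OF measurable_Pair[OF assms] map_meas] by simp

lemma map_measurable_snd: "y \<in> H \<Longrightarrow> \<Phi> y \<in> S \<rightarrow>\<^sub>M HB"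
  using map_measurable[OF measurable_HB_const measurable_ident_sets[OF refl], of y] by simp

lemma norm_map_diff_measurable:
  "x \<in> H \<Longrightarrow> y \<in> H \<Longrightarrow> (\<lambda>s. norm (\<Phi> x s - \<Phi> y s)) \<in> borel_measurable S"
  by (intro measurable_HB_norm measurable_HB_diff map_measurable_snd)

definition transition :: "('h \<Rightarrow> real) \<Rightarrow> 'h \<Rightarrow> real" where
  "transition \<phi> y = (\<integral>s. \<phi> (\<Phi> y s) \<partial>S)"

lemma transition_measurable:
  assumes "\<phi> \<in> borel_measurable HB"
  shows "transition \<phi> \<in> borel_measurable HB"
proof -
  have "(\<lambda>(y, s). \<phi> (\<Phi> y s)) \<in> borel_measurable (HB \<Otimes>\<^sub>M S)"
    using measurable_compose[OF map_meas assms] by (simp add: case_prod_beta)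
  from S.borel_measurable_lebesgue_integral[OF this] show ?thesis
    unfolding transition_def[abs_def] .
qed

lemma transition_integrable:
  fixes \<phi> :: "'h \<Rightarrow> real"
  assumes \<phi>: "\<phi> \<in> borel_measurable HB" "\<And>x. x \<in> H \<Longrightarrow> \<bar>\<phi> x\<bar> \<le> B" and y: "y \<in> H"
  shows "integrable S (\<lambda>s. \<phi> (\<Phi> y s))"
proof (rule S.integrable_const_bound[where B = B])
  show "(\<lambda>s. \<phi> (\<Phi> y s)) \<in> borel_measurable S" by (rule measurable_compose[OF map_measurable_snd[OF y] \<phi>(1)])
  show "AE s in S. norm (\<phi> (\<Phi> y s)) \<le> B"
    using \<phi>(2) measurable_HB_in[OF map_measurable_snd[OF y]] by (intro AE_I2) auto
qed

lemma transition_bounded: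
  fixes \<phi> :: "'h \<Rightarrow> real"
  assumes \<phi>: "\<phi> \<in> borel_measurable HB" "\<And>x. x \<in> H \<Longrightarrow> \<bar>\<phi> x\<bar> \<le> B" and y: "y \<in> H"
  shows "\<bar>transition \<phi> y\<bar> \<le> B"
proof -
  have "\<bar>transition \<phi> y\<bar> \<le> (\<integral>s. \<bar>\<phi> (\<Phi> y s)\<bar> \<partial>S)" unfolding transition_def by (rule integral_abs_bound)
  also have "\<dots> \<le> (\<integral>s. B \<partial>S)"
    using transition_integrable[OF \<phi> y] \<phi>(2) measurable_HB_in[OF map_measurable_snd[OF y]]
    by (intro integral_mono_AE AE_I2) auto
  also have "\<dots> = B" by (simp add: S.prob_space)
  finally show ?thesis .
qed

text \<open>Nonnegativity of the variance passes from the second to the first moment. Lipschitz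
  functions see the first moment of the distance, so this square root of \<rho> is the source of the
  factor 1/2 in the decay rate.\<close>

lemma map_contr_L1:
  assumes xy: "x \<in> H" "y \<in> H"
  shows "integrable S (\<lambda>s. norm (\<Phi> x s - \<Phi> y s))" "(\<integral>s. norm (\<Phi> x s - \<Phi> y s) \<partial>S) \<le> sqrt \<rho> * norm (x - y)"
proof -
  let ?d = "\<lambda>s. norm (\<Phi> x s - \<Phi> y s)"
  have m [measurable]: "?d \<in> borel_measurable S" by (rule norm_map_diff_measurable[OF xy])
  have i2: "integrable S (\<lambda>s. (?d s)\<^sup>2)"
    by (rule integrableI_bounded) (use le_less_trans[OF contr[OF xy]] in auto)
  show i: "integrable S ?d" by (rule S.square_integrable_imp_integrable[OF m i2])
  have "ennreal (\<integral>s. (?d s)\<^sup>2 \<partial>S) = (\<integral>\<^sup>+s. ennreal ((?d s)\<^sup>2) \<partial>S)"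
    by (rule nn_integral_eq_integral[symmetric, OF i2]) simp
  also have "\<dots> \<le> ennreal (\<rho> * (norm (x - y))\<^sup>2)" by (rule contr[OF xy])
  finally have "(\<integral>s. (?d s)\<^sup>2 \<partial>S) \<le> \<rho> * (norm (x - y))\<^sup>2" using \<rho> by (subst (asm) ennreal_le_iff) auto
  moreover have "(\<integral>s. ?d s \<partial>S)\<^sup>2 \<le> (\<integral>s. (?d s)\<^sup>2 \<partial>S)"
  proof -
    have "0 \<le> S.variance ?d" by (rule S.variance_positive)
    then show ?thesis using S.variance_eq[OF i i2] by simp
  qed
  ultimately have "(\<integral>s. ?d s \<partial>S)\<^sup>2 \<le> (sqrt \<rho> * norm (x - y))\<^sup>2" using \<rho> by (simp add: power_mult_distrib)
  then show "(\<integral>s. ?d s \<partial>S) \<le> sqrt \<rho> * norm (x - y)" by (rule power2_le_imp_le) (use \<rho> in simp)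
qed

lemma transition_lipschitz:
  fixes \<phi> :: "'h \<Rightarrow> real"
  assumes \<phi>: "\<phi> \<in> borel_measurable HB" "\<And>x. x \<in> H \<Longrightarrow> \<bar>\<phi> x\<bar> \<le> B" and K: "K \<ge> 0"
    and lip: "\<And>x y. x \<in> H \<Longrightarrow> y \<in> H \<Longrightarrow> \<bar>\<phi> x - \<phi> y\<bar> \<le> K * norm (x - y)"
    and xy: "x \<in> H" "y \<in> H"
  shows "\<bar>transition \<phi> x - transition \<phi> y\<bar> \<le> (K * sqrt \<rho>) * norm (x - y)"
proof -
  note i = transition_integrable[OF \<phi> xy(1)] transition_integrable[OF \<phi> xy(2)]
  have "\<bar>transition \<phi> x - transition \<phi> y\<bar> = \<bar>\<integral>s. \<phi> (\<Phi> x s) - \<phi> (\<Phi> y s) \<partial>S\<bar>"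
    unfolding transition_def using i by simp
  also have "\<dots> \<le> (\<integral>s. \<bar>\<phi> (\<Phi> x s) - \<phi> (\<Phi> y s)\<bar> \<partial>S)" by (rule integral_abs_bound)
  also have "\<dots> \<le> (\<integral>s. K * norm (\<Phi> x s - \<Phi> y s) \<partial>S)"
    using i map_contr_L1(1)[OF xy]
    by (intro integral_mono_AE AE_I2 lip measurable_HB_in[OF map_measurable_snd] xy) auto
  also have "\<dots> \<le> K * (sqrt \<rho> * norm (x - y))"
    using mult_left_mono[OF map_contr_L1(2)[OF xy] K] by simp
  finally show ?thesis by (simp add: mult.assoc)
qed

text \<open>The iterates are run backwards, \<open>Y\<^sub>m = \<Phi>\<^sub>0 \<circ> \<dots> \<circ> \<Phi>\<^sub>m\<^sub>-\<^sub>1 (0)\<close>, so that they converge almost surely;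
  the law of the limit is invariant.\<close>

primrec backward :: "nat \<Rightarrow> (nat \<Rightarrow> 's) \<Rightarrow> 'h" where
  "backward 0 \<omega> = 0"
| "backward (Suc m) \<omega> = \<Phi> (backward m (\<lambda>i. \<omega> (Suc i))) (\<omega> 0)"

abbreviation "N \<equiv> PiM (UNIV :: nat set) (\<lambda>_. S)"

lemma backward_measurable: "backward m \<in> N \<rightarrow>\<^sub>M HB"
proof (induction m)
  case 0
  then show ?case using measurable_HB_const[OF H_zero, of N] by (simp add: backward.simps(1)[abs_def])
next
  case (Suc m)
  have s: "(\<lambda>\<omega> i. \<omega> (Suc i)) \<in> N \<rightarrow>\<^sub>M N"
    by (rule measurable_PiM_single') (auto simp: space_PiM)
  have "(\<lambda>\<omega>. \<Phi> (backward m (\<lambda>i. \<omega> (Suc i))) (\<omega> 0)) \<in> N \<rightarrow>\<^sub>M HB"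
    by (rule map_measurable[OF measurable_compose[OF s Suc.IH]]) simp
  then show ?case by (simp add: backward.simps(2)[abs_def])
qed

section \<open>Sequences of independent noises and the shift\<close>

lemma seq_space: "sequence_space S"
  by (simp add: sequence_space_def product_prob_space_def product_prob_space_axioms_def product_sigma_finite_def
    S.prob_space_axioms S.sigma_finite_measure_axioms)

lemma N_prob: "prob_space N"
  by (rule prob_space_PiM) (rule S.prob_space_axioms)

lemma case_nat_measurable: "(\<lambda>(s, \<omega>). case_nat s \<omega>) \<in> S \<Otimes>\<^sub>M N \<rightarrow>\<^sub>M N"
  by measurable

lemma shift_distr: "distr (S \<Otimes>\<^sub>M N) N (\<lambda>(s, \<omega>). case_nat s \<omega>) = N"
  by (rule sequence_space.PiM_iter[OF seq_space])

lemma SN_pair: "pair_sigma_finite S N"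
  by (intro pair_sigma_finite.intro S.sigma_finite_measure_axioms prob_space_imp_sigma_finite N_prob)

lemma NS_pair: "pair_sigma_finite N S"
  by (intro pair_sigma_finite.intro S.sigma_finite_measure_axioms prob_space_imp_sigma_finite N_prob)

text \<open>Prepending an independent coordinate preserves the law of the sequence. By
  \<open>backward_case_nat\<close> that coordinate drives the outermost map, so it can be integrated
  out first.\<close>

lemma nn_integral_shift:
  assumes F: "F \<in> borel_measurable N"
  shows "(\<integral>\<^sup>+\<omega>. F \<omega> \<partial>N) = (\<integral>\<^sup>+\<omega>. (\<integral>\<^sup>+s. F (case_nat s \<omega>) \<partial>S) \<partial>N)"
proof -
  have "(\<integral>\<^sup>+\<omega>. F \<omega> \<partial>N) = (\<integral>\<^sup>+\<omega>. F \<omega> \<partial>distr (S \<Otimes>\<^sub>M N) N (\<lambda>(s, \<omega>). case_nat s \<omega>))" by (simp only: shift_distr)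
  also have "\<dots> = (\<integral>\<^sup>+p. F (case p of (s, \<omega>) \<Rightarrow> case_nat s \<omega>) \<partial>(S \<Otimes>\<^sub>M N))"
    by (rule nn_integral_distr[OF case_nat_measurable]) (simp add: F)
  also have "\<dots> = (\<integral>\<^sup>+\<omega>. (\<integral>\<^sup>+s. F (case_nat s \<omega>) \<partial>S) \<partial>N)"
    using pair_sigma_finite.nn_integral_snd[OF SN_pair measurable_compose[OF case_nat_measurable F]] by simp
  finally show ?thesis .
qed

lemma backward_in: "\<omega> \<in> space N \<Longrightarrow> backward m \<omega> \<in> H"
  by (rule measurable_HB_in[OF backward_measurable])

lemma backward_case_nat: "backward (Suc m) (case_nat s \<omega>) = \<Phi> (backward m \<omega>) s"
  by simp

lemma backward_diff_measurable [measurable]: "(\<lambda>\<omega>. norm (backward m \<omega> - backward n \<omega>)) \<in> borel_measurable N"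
  by (intro measurable_HB_norm measurable_HB_diff backward_measurable)

lemma backward_measurable_sq: "(\<lambda>\<omega>. ennreal ((norm (backward m \<omega> - backward n \<omega>))\<^sup>2)) \<in> borel_measurable N"
  "(\<lambda>\<omega>. ennreal ((norm (backward m \<omega>))\<^sup>2)) \<in> borel_measurable N"
  using measurable_compose[OF backward_diff_measurable[of m n], of "\<lambda>x. ennreal (x\<^sup>2)" borel]
    measurable_compose[OF measurable_HB_norm[OF backward_measurable[of m]], of "\<lambda>x. ennreal (x\<^sup>2)" borel] by auto

text \<open>Consecutive iterates share their outer maps and differ only in the innermost starting
  point; integrating out the outermost noise gains one factor \<rho>.\<close>

lemma backward_diff:
  "(\<integral>\<^sup>+\<omega>. ennreal ((norm (backward (Suc m) \<omega> - backward m \<omega>))\<^sup>2) \<partial>N) \<le> ennreal (C0 * \<rho> ^ m)"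
proof (induction m)
  case 0
  have "(\<integral>\<^sup>+\<omega>. ennreal ((norm (backward (Suc 0) \<omega> - backward 0 \<omega>))\<^sup>2) \<partial>N) = (\<integral>\<^sup>+\<omega>. (\<integral>\<^sup>+s. ennreal ((norm (\<Phi> 0 s))\<^sup>2) \<partial>S) \<partial>N)"
    by (subst nn_integral_shift[OF backward_measurable_sq(1)]) simp
  also have "\<dots> \<le> (\<integral>\<^sup>+\<omega>. ennreal C0 \<partial>N)" by (intro nn_integral_mono C0)
  also have "\<dots> = ennreal C0" by (simp add: prob_space.emeasure_space_1[OF N_prob])
  finally show ?case by simp
next
  case (Suc m)
  have "(\<integral>\<^sup>+\<omega>. ennreal ((norm (backward (Suc (Suc m)) \<omega> - backward (Suc m) \<omega>))\<^sup>2) \<partial>N)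
     = (\<integral>\<^sup>+\<omega>. (\<integral>\<^sup>+s. ennreal ((norm (\<Phi> (backward (Suc m) \<omega>) s - \<Phi> (backward m \<omega>) s))\<^sup>2) \<partial>S) \<partial>N)"
    by (subst nn_integral_shift[OF backward_measurable_sq(1)]) (simp only: backward_case_nat)
  also have "\<dots> \<le> (\<integral>\<^sup>+\<omega>. ennreal \<rho> * ennreal ((norm (backward (Suc m) \<omega> - backward m \<omega>))\<^sup>2) \<partial>N)"
    using \<rho> by (intro nn_integral_mono order_trans[OF contr] backward_in) (auto simp: ennreal_mult)
  also have "\<dots> = ennreal \<rho> * (\<integral>\<^sup>+\<omega>. ennreal ((norm (backward (Suc m) \<omega> - backward m \<omega>))\<^sup>2) \<partial>N)"
    by (rule nn_integral_cmult) (rule backward_measurable_sq(1))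
  also have "\<dots> \<le> ennreal \<rho> * ennreal (C0 * \<rho> ^ m)" by (intro mult_left_mono Suc.IH) simp
  also have "\<dots> = ennreal (C0 * \<rho> ^ Suc m)" using \<rho> C0 by (subst ennreal_mult[symmetric]) (auto simp: ac_simps)
  finally show ?case .
qed

lemma backward_convergent: "AE \<omega> in N. convergent (\<lambda>m. backward m \<omega>)"
proof -
  have "AE \<omega> in N. summable (\<lambda>m. norm (backward (Suc m) \<omega> - backward m \<omega>))"
    by (rule prob_space.AE_summable_if_L2_geometric[OF N_prob backward_diff_measurable norm_ge_zero \<rho> C0(1) backward_diff])
  then show ?thesis by eventually_elim (rule convergent_if_summable_norm_diff)
qed

definition limit_point :: "(nat \<Rightarrow> 's) \<Rightarrow> 'h" where
  "limit_point \<omega> = (if convergent (\<lambda>m. backward m \<omega>) then lim (\<lambda>m. backward m \<omega>) else 0)"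

lemma limit_point_measurable: "limit_point \<in> N \<rightarrow>\<^sub>M HB"
  unfolding limit_point_def[abs_def] by (rule measurable_HB_lim[OF backward_measurable])

lemma limit_point_lim: "AE \<omega> in N. (\<lambda>m. backward m \<omega>) \<longlonglongrightarrow> limit_point \<omega>"
  using backward_convergent by eventually_elim (simp add: limit_point_def convergent_LIMSEQ_iff)

lemma backward_second_moment:
  obtains K where "K \<ge> 0" "\<And>m. (\<integral>\<^sup>+\<omega>. ennreal ((norm (backward m \<omega>))\<^sup>2) \<partial>N) \<le> ennreal K"
proof -
  \<comment> \<open>This makes (1 + \<delta>) \<rho> the mean of \<rho> and 1, still below
    1.\<close>
  define \<delta> where "\<delta> = (1 - \<rho>) / (2 * \<rho>)"
  have \<delta>: "\<delta> > 0" "(1 + \<delta>) * \<rho> = (1 + \<rho>) / 2" using \<rho> by (auto simp: \<delta>_def field_simps)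
  define A B G where "A = 1 + \<delta>" and "B = 1 + 1 / \<delta>" and "G = (1 + \<rho>) / 2"
  have AB: "A \<ge> 0" "B \<ge> 0" "G \<ge> 0" "A * \<rho> = G" "1 - G > 0" using \<delta> \<rho> by (auto simp: A_def B_def G_def)
  \<comment> \<open>The fixed point of the affine recursion for the second moments.\<close>
  define K where "K = B * C0 / (1 - G)"
  have K: "K \<ge> 0" "G * K + B * C0 = K" using AB C0 by (auto simp: K_def field_simps)
  have "(\<integral>\<^sup>+\<omega>. ennreal ((norm (backward m \<omega>))\<^sup>2) \<partial>N) \<le> ennreal K" for m
  proof (induction m)
    case (Suc m)
    have nm [measurable]: "(\<lambda>\<omega>. norm (backward m \<omega>)) \<in> borel_measurable N" for m
      by (rule measurable_HB_norm[OF backward_measurable])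
    have "(\<integral>\<^sup>+\<omega>. ennreal ((norm (backward (Suc m) \<omega>))\<^sup>2) \<partial>N) = (\<integral>\<^sup>+\<omega>. (\<integral>\<^sup>+s. ennreal ((norm (\<Phi> (backward m \<omega>) s))\<^sup>2) \<partial>S) \<partial>N)"
      by (subst nn_integral_shift[OF backward_measurable_sq(2)]) (simp only: backward_case_nat)
    also have "\<dots> \<le> (\<integral>\<^sup>+\<omega>. ennreal (G) * ennreal ((norm (backward m \<omega>))\<^sup>2) + ennreal (B * C0) \<partial>N)"
    proof (rule nn_integral_mono)
      fix \<omega> assume \<omega>: "\<omega> \<in> space N"
      let ?y = "backward m \<omega>"
      have y: "?y \<in> H" by (rule backward_in[OF \<omega>])
      have [measurable]: "(\<lambda>s. norm (\<Phi> ?y s - \<Phi> 0 s)) \<in> borel_measurable S" "(\<lambda>s. norm (\<Phi> 0 s)) \<in> borel_measurable S"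
        by (intro norm_map_diff_measurable measurable_HB_norm map_measurable_snd y H_zero)+
      have "(\<integral>\<^sup>+s. ennreal ((norm (\<Phi> ?y s))\<^sup>2) \<partial>S) \<le> (\<integral>\<^sup>+s. ennreal A * ennreal ((norm (\<Phi> ?y s - \<Phi> 0 s))\<^sup>2) + ennreal B * ennreal ((norm (\<Phi> 0 s))\<^sup>2) \<partial>S)"
      proof (rule nn_integral_mono)
        fix s
        have "ennreal ((norm (\<Phi> ?y s))\<^sup>2) \<le> ennreal (A * (norm (\<Phi> ?y s - \<Phi> 0 s))\<^sup>2 + B * (norm (\<Phi> 0 s))\<^sup>2)"
          using norm_add_sq_le[OF \<delta>(1), of "\<Phi> ?y s - \<Phi> 0 s" "\<Phi> 0 s"] unfolding A_def B_def by (intro ennreal_leI) simp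
        also have "\<dots> = ennreal A * ennreal ((norm (\<Phi> ?y s - \<Phi> 0 s))\<^sup>2) + ennreal B * ennreal ((norm (\<Phi> 0 s))\<^sup>2)"
          using AB by (subst ennreal_plus) (auto simp: ennreal_mult)
        finally show "ennreal ((norm (\<Phi> ?y s))\<^sup>2) \<le> ennreal A * ennreal ((norm (\<Phi> ?y s - \<Phi> 0 s))\<^sup>2) + ennreal B * ennreal ((norm (\<Phi> 0 s))\<^sup>2)" .
      qed
      also have "\<dots> = ennreal A * (\<integral>\<^sup>+s. ennreal ((norm (\<Phi> ?y s - \<Phi> 0 s))\<^sup>2) \<partial>S) + ennreal B * (\<integral>\<^sup>+s. ennreal ((norm (\<Phi> 0 s))\<^sup>2) \<partial>S)"
        by (subst nn_integral_add) (auto simp: nn_integral_cmult)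
      also have "\<dots> \<le> ennreal A * ennreal (\<rho> * (norm (?y - 0))\<^sup>2) + ennreal B * ennreal C0"
        by (intro add_mono mult_left_mono contr y H_zero C0) auto
      also have "\<dots> = ennreal (G) * ennreal ((norm ?y)\<^sup>2) + ennreal (B * C0)"
        using AB \<rho> C0 by (simp add: ennreal_mult[symmetric] mult.assoc[symmetric])
      finally show "(\<integral>\<^sup>+s. ennreal ((norm (\<Phi> ?y s))\<^sup>2) \<partial>S) \<le> ennreal (G) * ennreal ((norm ?y)\<^sup>2) + ennreal (B * C0)" .
    qed
    also have "\<dots> = ennreal (G) * (\<integral>\<^sup>+\<omega>. ennreal ((norm (backward m \<omega>))\<^sup>2) \<partial>N) + ennreal (B * C0)"
      by (subst nn_integral_add) (auto simp: nn_integral_cmult prob_space.emeasure_space_1[OF N_prob])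
    also have "\<dots> \<le> ennreal (G) * ennreal K + ennreal (B * C0)"
      by (intro add_right_mono mult_left_mono Suc.IH) simp
    also have "\<dots> = ennreal (G * K + B * C0)"
      using AB C0 K(1) by (subst ennreal_plus) (auto simp: ennreal_mult)
    finally show ?case unfolding K(2) .
  qed (use K in simp)
  with K(1) show ?thesis by (rule that)
qed

text \<open>A realisation of the map need not be continuous in its first argument, so the limit
  cannot be taken inside it path by path. Instead, for fixed \<omega>, the mean-square contraction
  and Fatou's lemma show that the two sides have mean square distance 0 over s.\<close>

lemma limit_point_shift: "AE \<omega> in N. AE s in S. limit_point (case_nat s \<omega>) = \<Phi> (limit_point \<omega>) s"
proof -
  \<comment> \<open>Almost sure convergence is transported through the prepending map, and the
    factors are swapped to make the new noise s the inner variable.\<close>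
  have "AE \<omega> in distr (S \<Otimes>\<^sub>M N) N (\<lambda>(s, \<omega>). case_nat s \<omega>). (\<lambda>m. backward m \<omega>) \<longlonglongrightarrow> limit_point \<omega>"
    unfolding shift_distr by (rule limit_point_lim)
  then have "AE p in S \<Otimes>\<^sub>M N. (\<lambda>m. backward m (case p of (s, \<omega>) \<Rightarrow> case_nat s \<omega>)) \<longlonglongrightarrow> limit_point (case p of (s, \<omega>) \<Rightarrow> case_nat s \<omega>)"
    by (rule AE_distrD[OF case_nat_measurable])
  then have "AE p in distr (N \<Otimes>\<^sub>M S) (S \<Otimes>\<^sub>M N) (\<lambda>(x, y). (y, x)). (\<lambda>m. backward m (case p of (s, \<omega>) \<Rightarrow> case_nat s \<omega>)) \<longlonglongrightarrow> limit_point (case p of (s, \<omega>) \<Rightarrow> case_nat s \<omega>)"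
    by (simp only: pair_sigma_finite.distr_pair_swap[OF SN_pair, symmetric])
  then have "AE p in N \<Otimes>\<^sub>M S. (\<lambda>m. backward m (case (case p of (x, y) \<Rightarrow> (y, x)) of (s, \<omega>) \<Rightarrow> case_nat s \<omega>))
      \<longlonglongrightarrow> limit_point (case (case p of (x, y) \<Rightarrow> (y, x)) of (s, \<omega>) \<Rightarrow> case_nat s \<omega>)"
    by (rule AE_distrD[rotated]) (rule measurable_pair_swap')
  then have "AE \<omega> in N. AE s in S. (\<lambda>m. backward m (case_nat s \<omega>)) \<longlonglongrightarrow> limit_point (case_nat s \<omega>)"
    using pair_sigma_finite.AE_pair[OF NS_pair] by fastforce
  with limit_point_lim show ?thesis using AE_space[of N]
  proof eventually_elim
    case (elim \<omega>)
    let ?l = "limit_point \<omega>"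
    have \<omega>: "\<omega> \<in> space N" and l: "?l \<in> H" by (rule elim, rule measurable_HB_in[OF limit_point_measurable elim(3)])
    have sec: "(\<lambda>s. case_nat s \<omega>) \<in> S \<rightarrow>\<^sub>M N"
      using measurable_compose[OF measurable_Pair[OF measurable_ident_sets[OF refl] measurable_const[OF \<omega>]] case_nat_measurable] by simp
    have lc: "(\<lambda>s. limit_point (case_nat s \<omega>)) \<in> S \<rightarrow>\<^sub>M HB" by (rule measurable_compose[OF sec limit_point_measurable])
    have [measurable]: "(\<lambda>s. norm (\<Phi> (backward m \<omega>) s - \<Phi> ?l s)) \<in> borel_measurable S" for m
      by (rule norm_map_diff_measurable[OF backward_in[OF \<omega>] l])
    have nd [measurable]: "(\<lambda>s. norm (limit_point (case_nat s \<omega>) - \<Phi> ?l s)) \<in> borel_measurable S"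
      by (intro measurable_HB_norm measurable_HB_diff lc map_measurable_snd l)
    have "(\<integral>\<^sup>+s. ennreal ((norm (limit_point (case_nat s \<omega>) - \<Phi> ?l s))\<^sup>2) \<partial>S) \<le> ennreal (\<rho> * (norm (?l - ?l))\<^sup>2)"
    proof (rule nn_integral_le_by_Fatou)
      show "(\<lambda>s. ennreal ((norm (\<Phi> (backward m \<omega>) s - \<Phi> ?l s))\<^sup>2)) \<in> borel_measurable S" for m by measurable
      show "AE s in S. (\<lambda>m. ennreal ((norm (\<Phi> (backward m \<omega>) s - \<Phi> ?l s))\<^sup>2)) \<longlonglongrightarrow> ennreal ((norm (limit_point (case_nat s \<omega>) - \<Phi> ?l s))\<^sup>2)"
        using elim(2)
      proof eventually_elim
        case (elim s)
        have "(\<lambda>m. \<Phi> (backward m \<omega>) s) \<longlonglongrightarrow> limit_point (case_nat s \<omega>)"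
          using LIMSEQ_Suc[OF elim] by (simp only: backward_case_nat)
        then show ?case by (intro tendsto_ennrealI tendsto_intros)
      qed
      show "(\<integral>\<^sup>+s. ennreal ((norm (\<Phi> (backward m \<omega>) s - \<Phi> ?l s))\<^sup>2) \<partial>S) \<le> ennreal (\<rho> * (norm (backward m \<omega> - ?l))\<^sup>2)" for m
        by (rule contr[OF backward_in[OF \<omega>] l])
      show "(\<lambda>m. ennreal (\<rho> * (norm (backward m \<omega> - ?l))\<^sup>2)) \<longlonglongrightarrow> ennreal (\<rho> * (norm (?l - ?l))\<^sup>2)"
        by (intro tendsto_ennrealI tendsto_intros elim)
    qed
    then have "(\<integral>\<^sup>+s. ennreal ((norm (limit_point (case_nat s \<omega>) - \<Phi> ?l s))\<^sup>2) \<partial>S) = 0" by simp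
    then have "AE s in S. ennreal ((norm (limit_point (case_nat s \<omega>) - \<Phi> ?l s))\<^sup>2) = 0"
      by (subst (asm) nn_integral_0_iff_AE) auto
    then show "AE s in S. limit_point (case_nat s \<omega>) = \<Phi> ?l s" by eventually_elim simp
  qed
qed

theorem invariant_law:
  obtains \<pi> K where "prob_space \<pi>" "sets \<pi> = sets HB" "(\<integral>\<^sup>+y. ennreal ((norm y)\<^sup>2) \<partial>\<pi>) \<le> ennreal K"
    "\<And>\<phi> B. \<phi> \<in> borel_measurable HB \<Longrightarrow> (\<And>x. x \<in> H \<Longrightarrow> \<bar>\<phi> x\<bar> \<le> B) \<Longrightarrow> (\<integral>y. transition \<phi> y \<partial>\<pi>) = (\<integral>y. \<phi> y \<partial>\<pi>)"
proof -
  define \<pi> where "\<pi> = distr N HB limit_point"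
  interpret N: prob_space N by (rule N_prob)
  have p: "prob_space \<pi>" unfolding \<pi>_def by (rule N.prob_space_distr[OF limit_point_measurable])
  have s: "sets \<pi> = sets HB" by (simp add: \<pi>_def)
  obtain K where K: "K \<ge> 0" "\<And>m. (\<integral>\<^sup>+\<omega>. ennreal ((norm (backward m \<omega>))\<^sup>2) \<partial>N) \<le> ennreal K"
    by (rule backward_second_moment) blast
  have nm: "(\<lambda>y. ennreal ((norm y)\<^sup>2)) \<in> borel_measurable HB"
    using measurable_compose[OF measurable_HB_norm[OF measurable_ident_sets[OF refl]], of "\<lambda>x. ennreal (x\<^sup>2)" borel] by simp
  have "(\<integral>\<^sup>+y. ennreal ((norm y)\<^sup>2) \<partial>\<pi>) = (\<integral>\<^sup>+\<omega>. ennreal ((norm (limit_point \<omega>))\<^sup>2) \<partial>N)"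
    unfolding \<pi>_def by (rule nn_integral_distr[OF limit_point_measurable]) (simp add: nm)
  also have "\<dots> \<le> ennreal K"
  proof (rule nn_integral_le_by_Fatou[OF backward_measurable_sq(2) _ K(2) tendsto_const])
    show "AE \<omega> in N. (\<lambda>m. ennreal ((norm (backward m \<omega>))\<^sup>2)) \<longlonglongrightarrow> ennreal ((norm (limit_point \<omega>))\<^sup>2)"
      using limit_point_lim by eventually_elim (intro tendsto_ennrealI tendsto_intros)
  qed
  finally have m: "(\<integral>\<^sup>+y. ennreal ((norm y)\<^sup>2) \<partial>\<pi>) \<le> ennreal K" .
  have inv: "(\<integral>y. transition \<phi> y \<partial>\<pi>) = (\<integral>y. \<phi> y \<partial>\<pi>)"
    if \<phi>: "\<phi> \<in> borel_measurable HB" "\<And>x. x \<in> H \<Longrightarrow> \<bar>\<phi> x\<bar> \<le> B" for \<phi> :: "'h \<Rightarrow> real" and B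
  proof -
    interpret SN: pair_sigma_finite S N by (rule SN_pair)
    interpret P: pair_prob_space S N ..
    have \<phi>l: "(\<lambda>\<omega>. \<phi> (limit_point \<omega>)) \<in> borel_measurable N" by (rule measurable_compose[OF limit_point_measurable \<phi>(1)])
    have \<phi>c: "(\<lambda>p. \<phi> (limit_point (case p of (s, \<omega>) \<Rightarrow> case_nat s \<omega>))) \<in> borel_measurable (S \<Otimes>\<^sub>M N)"
      by (rule measurable_compose[OF case_nat_measurable \<phi>l])
    have int: "integrable (S \<Otimes>\<^sub>M N) (\<lambda>(s, \<omega>). \<phi> (limit_point (case_nat s \<omega>)))"
    proof (rule P.integrable_const_bound[where B = B])
      show "AE p in S \<Otimes>\<^sub>M N. norm (case p of (s, \<omega>) \<Rightarrow> \<phi> (limit_point (case_nat s \<omega>))) \<le> B"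
      proof (rule AE_I2)
        fix p assume "p \<in> space (S \<Otimes>\<^sub>M N)"
        then have "(case p of (s, \<omega>) \<Rightarrow> case_nat s \<omega>) \<in> space N" by (rule measurable_space[OF case_nat_measurable])
        from \<phi>(2)[OF measurable_HB_in[OF limit_point_measurable this]]
        show "norm (case p of (s, \<omega>) \<Rightarrow> \<phi> (limit_point (case_nat s \<omega>))) \<le> B" by (simp add: case_prod_beta)
      qed
    qed (use \<phi>c in \<open>simp add: case_prod_beta\<close>)
    have "(\<integral>y. \<phi> y \<partial>\<pi>) = (\<integral>\<omega>. \<phi> (limit_point \<omega>) \<partial>N)"
      unfolding \<pi>_def by (rule integral_distr[OF limit_point_measurable \<phi>(1)])
    also have "\<dots> = (\<integral>\<omega>. \<phi> (limit_point \<omega>) \<partial>distr (S \<Otimes>\<^sub>M N) N (\<lambda>(s, \<omega>). case_nat s \<omega>))" by (simp only: shift_distr)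
    also have "\<dots> = (\<integral>p. \<phi> (limit_point (case p of (s, \<omega>) \<Rightarrow> case_nat s \<omega>)) \<partial>(S \<Otimes>\<^sub>M N))"
      by (rule integral_distr[OF case_nat_measurable \<phi>l])
    also have "\<dots> = (\<integral>\<omega>. (\<integral>s. \<phi> (limit_point (case_nat s \<omega>)) \<partial>S) \<partial>N)"
      using SN.integral_snd[OF int] by (simp add: case_prod_unfold)
    \<comment> \<open>With the prepended noise as inner variable, \<open>limit_point_shift\<close>
      turns the inner integral into one transition from the limit.\<close>
    also have "\<dots> = (\<integral>\<omega>. transition \<phi> (limit_point \<omega>) \<partial>N)"
    proof (rule integral_cong_AE)
      show "(\<lambda>\<omega>. \<integral>s. \<phi> (limit_point (case_nat s \<omega>)) \<partial>S) \<in> borel_measurable N"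
        using SN.integrable_snd[OF int] by (rule borel_measurable_integrable)
      show "(\<lambda>\<omega>. transition \<phi> (limit_point \<omega>)) \<in> borel_measurable N"
        by (rule measurable_compose[OF limit_point_measurable transition_measurable[OF \<phi>(1)]])
      show "AE \<omega> in N. (\<integral>s. \<phi> (limit_point (case_nat s \<omega>)) \<partial>S) = transition \<phi> (limit_point \<omega>)"
        using limit_point_shift AE_space[of N]
      proof eventually_elim
        case (elim \<omega>)
        have sec: "(\<lambda>s. case_nat s \<omega>) \<in> S \<rightarrow>\<^sub>M N"
          using measurable_compose[OF measurable_Pair[OF measurable_ident_sets[OF refl] measurable_const[OF elim(2)]] case_nat_measurable] by simp
        show ?case unfolding transition_def
        proof (rule integral_cong_AE)
          show "(\<lambda>s. \<phi> (limit_point (case_nat s \<omega>))) \<in> borel_measurable S" by (rule measurable_compose[OF sec \<phi>l])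
          show "(\<lambda>s. \<phi> (\<Phi> (limit_point \<omega>) s)) \<in> borel_measurable S"
            by (rule measurable_compose[OF map_measurable_snd[OF measurable_HB_in[OF limit_point_measurable elim(2)]] \<phi>(1)])
          show "AE s in S. \<phi> (limit_point (case_nat s \<omega>)) = \<phi> (\<Phi> (limit_point \<omega>) s)"
            using elim(1) by eventually_elim simp
        qed
      qed
    qed
    also have "\<dots> = (\<integral>y. transition \<phi> y \<partial>\<pi>)"
      unfolding \<pi>_def by (rule integral_distr[symmetric, OF limit_point_measurable transition_measurable[OF \<phi>(1)]])
    finally show ?thesis by (rule sym)
  qed
  show ?thesis by (rule that[OF p s m inv])
qed

end

section \<open>The stochastic integral over one time step\<close>

context onb_space
begin

lemma sq_measurable:
  "h \<in> M \<rightarrow>\<^sub>M HB \<Longrightarrow> (\<lambda>s. ennreal ((norm (h s))\<^sup>2)) \<in> borel_measurable M"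
  using measurable_compose[OF measurable_HB_norm, of h M "\<lambda>x. ennreal (x\<^sup>2)" borel] by simp

lemma nn_integral_norm_add_sq_le:
  assumes a: "a \<in> M \<rightarrow>\<^sub>M HB" and b: "b \<in> M \<rightarrow>\<^sub>M HB" and \<delta>: "\<delta> > 0" and AB: "0 \<le> A" "0 \<le> B"
    and le: "(\<integral>\<^sup>+s. ennreal ((norm (a s))\<^sup>2) \<partial>M) \<le> ennreal A" "(\<integral>\<^sup>+s. ennreal ((norm (b s))\<^sup>2) \<partial>M) \<le> ennreal B"
  shows "(\<integral>\<^sup>+s. ennreal ((norm (a s + b s))\<^sup>2) \<partial>M) \<le> ennreal ((1 + \<delta>) * A + (1 + 1 / \<delta>) * B)"
proof -
  define p q where "p = 1 + \<delta>" and "q = 1 + 1 / \<delta>"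
  have pq: "0 \<le> p" "0 \<le> q" using \<delta> by (auto simp: p_def q_def)
  have [measurable]: "(\<lambda>s. ennreal ((norm (a s))\<^sup>2)) \<in> borel_measurable M" "(\<lambda>s. ennreal ((norm (b s))\<^sup>2)) \<in> borel_measurable M"
    by (intro sq_measurable a b)+
  have "(\<integral>\<^sup>+s. ennreal ((norm (a s + b s))\<^sup>2) \<partial>M) \<le> (\<integral>\<^sup>+s. ennreal p * ennreal ((norm (a s))\<^sup>2) + ennreal q * ennreal ((norm (b s))\<^sup>2) \<partial>M)"
  proof (rule nn_integral_mono)
    fix s
    have "ennreal ((norm (a s + b s))\<^sup>2) \<le> ennreal (p * (norm (a s))\<^sup>2 + q * (norm (b s))\<^sup>2)"
      unfolding p_def q_def by (intro ennreal_leI norm_add_sq_le \<delta>)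
    also have "\<dots> = ennreal p * ennreal ((norm (a s))\<^sup>2) + ennreal q * ennreal ((norm (b s))\<^sup>2)"
      using pq by (subst ennreal_plus) (auto simp: ennreal_mult)
    finally show "ennreal ((norm (a s + b s))\<^sup>2) \<le> ennreal p * ennreal ((norm (a s))\<^sup>2) + ennreal q * ennreal ((norm (b s))\<^sup>2)" .
  qed
  also have "\<dots> = (\<integral>\<^sup>+s. ennreal p * ennreal ((norm (a s))\<^sup>2) \<partial>M) + (\<integral>\<^sup>+s. ennreal q * ennreal ((norm (b s))\<^sup>2) \<partial>M)"
    by (rule nn_integral_add) measurable
  also have "\<dots> = ennreal p * (\<integral>\<^sup>+s. ennreal ((norm (a s))\<^sup>2) \<partial>M) + ennreal q * (\<integral>\<^sup>+s. ennreal ((norm (b s))\<^sup>2) \<partial>M)"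
    by (intro arg_cong2[where f = "(+)"] nn_integral_cmult) measurable
  also have "\<dots> \<le> ennreal p * ennreal A + ennreal q * ennreal B"
    by (intro add_mono mult_left_mono le) auto
  also have "\<dots> = ennreal (p * A + q * B)" using pq AB by (subst ennreal_plus) (auto simp: ennreal_mult)
  finally show ?thesis by (simp add: p_def q_def)
qed

end

text \<open>The coordinate s k stands for the increment of the k-th Brownian motion and g k x for
  G(x) Q^(1/2) e_k, so the formal sum of the s k g k x is G(x) \<delta>W.\<close>

locale noise_integral = onb_space H e + S: prob_space S
  for H :: "'h::{real_inner, banach} set" and e :: "nat \<Rightarrow> 'h" and S :: "(nat \<Rightarrow> real) measure" +
  fixes \<tau> :: real and g :: "nat \<Rightarrow> 'h \<Rightarrow> 'h"
  assumes \<tau>: "\<tau> > 0"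
    and coord [measurable]: "\<And>k. (\<lambda>s. s k) \<in> borel_measurable S"
    and mean: "\<And>k. integrable S (\<lambda>s. s k)" "\<And>k. (\<integral>s. s k \<partial>S) = 0"
    and cov: "\<And>j k. integrable S (\<lambda>s. s j * s k)" "\<And>j k. (\<integral>s. s j * s k \<partial>S) = (if j = k then \<tau> else 0)"
    and g_in: "\<And>k x. x \<in> H \<Longrightarrow> g k x \<in> H" and g_cont: "\<And>k. continuous_on H (g k)"
    and g_summable: "\<And>x. x \<in> H \<Longrightarrow> summable (\<lambda>k. (norm (g k x))\<^sup>2)"
begin

text \<open>Ito's isometry for finite sums: the mixed terms vanish because the coordinates are
  centred and uncorrelated. The deterministic z later carries the difference of two starting
  points.\<close>

lemma second_moment:
  fixes z :: 'h and h :: "nat \<Rightarrow> 'h"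
  assumes "finite K"
  shows "(\<integral>\<^sup>+s. ennreal ((norm (z + (\<Sum>k\<in>K. s k *\<^sub>R h k)))\<^sup>2) \<partial>S) = ennreal ((norm z)\<^sup>2 + \<tau> * (\<Sum>k\<in>K. (norm (h k))\<^sup>2))"
proof -
  have e: "(norm (z + (\<Sum>k\<in>K. s k *\<^sub>R h k)))\<^sup>2 = (norm z)\<^sup>2 + 2 * (\<Sum>k\<in>K. s k * inner z (h k)) + (\<Sum>j\<in>K. \<Sum>k\<in>K. (s j * s k) * inner (h j) (h k))" for s :: "nat \<Rightarrow> real"
  proof -
    define u where "u = (\<Sum>k\<in>K. s k *\<^sub>R h k)"
    have 1: "(norm (z + u))\<^sup>2 = (norm z)\<^sup>2 + 2 * inner z u + inner u u"
      by (simp add: power2_norm_eq_inner inner_add_left inner_add_right inner_commute)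
    have 2: "inner z u = (\<Sum>k\<in>K. s k * inner z (h k))" by (simp add: u_def inner_sum_right)
    have 3: "inner (h j) u = (\<Sum>k\<in>K. s k * inner (h j) (h k))" for j by (simp add: u_def inner_sum_right)
    have "inner u u = (\<Sum>j\<in>K. s j * inner (h j) u)" by (subst (1) u_def) (simp add: inner_sum_left)
    also have "\<dots> = (\<Sum>j\<in>K. \<Sum>k\<in>K. (s j * s k) * inner (h j) (h k))" by (simp only: 3 sum_distrib_left mult.assoc)
    finally show ?thesis unfolding u_def[symmetric] 1 by (simp only: 2)
  qed
  have i1: "integrable S (\<lambda>s. \<Sum>k\<in>K. s k * inner z (h k))"
    by (intro Bochner_Integration.integrable_sum integrable_mult_left mean)
  have i2: "integrable S (\<lambda>s. \<Sum>j\<in>K. \<Sum>k\<in>K. (s j * s k) * inner (h j) (h k))"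
    by (intro Bochner_Integration.integrable_sum integrable_mult_left cov)
  have int: "integrable S (\<lambda>s. (norm (z + (\<Sum>k\<in>K. s k *\<^sub>R h k)))\<^sup>2)"
    unfolding e by (intro Bochner_Integration.integrable_add integrable_mult_right S.integrable_const i1 i2)
  have "(\<integral>s. (\<Sum>j\<in>K. \<Sum>k\<in>K. (s j * s k) * inner (h j) (h k)) \<partial>S) = (\<Sum>j\<in>K. \<Sum>k\<in>K. (if j = k then \<tau> else 0) * inner (h j) (h k))"
  proof -
    have "(\<integral>s. (\<Sum>j\<in>K. \<Sum>k\<in>K. (s j * s k) * inner (h j) (h k)) \<partial>S) = (\<Sum>j\<in>K. \<integral>s. (\<Sum>k\<in>K. (s j * s k) * inner (h j) (h k)) \<partial>S)"
      by (intro Bochner_Integration.integral_sum Bochner_Integration.integrable_sum integrable_mult_left cov)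
    also have "\<dots> = (\<Sum>j\<in>K. \<Sum>k\<in>K. \<integral>s. (s j * s k) * inner (h j) (h k) \<partial>S)"
      by (intro sum.cong refl Bochner_Integration.integral_sum integrable_mult_left cov)
    also have "\<dots> = (\<Sum>j\<in>K. \<Sum>k\<in>K. (if j = k then \<tau> else 0) * inner (h j) (h k))"
      by (simp only: integral_mult_left_zero cov(2))
    finally show ?thesis .
  qed
  also have "\<dots> = (\<Sum>j\<in>K. \<Sum>k\<in>K. if k = j then \<tau> * inner (h j) (h k) else 0)"
    by (intro sum.cong) auto
  also have "\<dots> = \<tau> * (\<Sum>k\<in>K. (norm (h k))\<^sup>2)"
    using assms by (simp add: sum.delta sum_distrib_left power2_norm_eq_inner)
  finally have v2: "(\<integral>s. (\<Sum>j\<in>K. \<Sum>k\<in>K. (s j * s k) * inner (h j) (h k)) \<partial>S) = \<tau> * (\<Sum>k\<in>K. (norm (h k))\<^sup>2)" .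
  have v1: "(\<integral>s. (\<Sum>k\<in>K. s k * inner z (h k)) \<partial>S) = 0"
  proof -
    have "(\<integral>s. (\<Sum>k\<in>K. s k * inner z (h k)) \<partial>S) = (\<Sum>k\<in>K. \<integral>s. s k * inner z (h k) \<partial>S)"
      by (intro Bochner_Integration.integral_sum integrable_mult_left mean)
    also have "\<dots> = 0" by (simp only: integral_mult_left_zero mean(2)) simp
    finally show ?thesis .
  qed
  have "(\<integral>\<^sup>+s. ennreal ((norm (z + (\<Sum>k\<in>K. s k *\<^sub>R h k)))\<^sup>2) \<partial>S) = ennreal (\<integral>s. (norm (z + (\<Sum>k\<in>K. s k *\<^sub>R h k)))\<^sup>2 \<partial>S)"
    by (rule nn_integral_eq_integral[OF int]) simp
  also have "(\<integral>s. (norm (z + (\<Sum>k\<in>K. s k *\<^sub>R h k)))\<^sup>2 \<partial>S) = (norm z)\<^sup>2 + \<tau> * (\<Sum>k\<in>K. (norm (h k))\<^sup>2)"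
  proof -
    have "(\<integral>s. (norm z)\<^sup>2 + 2 * (\<Sum>k\<in>K. s k * inner z (h k)) + (\<Sum>j\<in>K. \<Sum>k\<in>K. (s j * s k) * inner (h j) (h k)) \<partial>S)
      = (\<integral>s. (norm z)\<^sup>2 + 2 * (\<Sum>k\<in>K. s k * inner z (h k)) \<partial>S) + (\<integral>s. (\<Sum>j\<in>K. \<Sum>k\<in>K. (s j * s k) * inner (h j) (h k)) \<partial>S)"
      by (intro Bochner_Integration.integral_add Bochner_Integration.integrable_add integrable_mult_right S.integrable_const i1 i2)
    also have "(\<integral>s. (norm z)\<^sup>2 + 2 * (\<Sum>k\<in>K. s k * inner z (h k)) \<partial>S) = (\<integral>s. (norm z)\<^sup>2 \<partial>S) + (\<integral>s. 2 * (\<Sum>k\<in>K. s k * inner z (h k)) \<partial>S)"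
      by (intro Bochner_Integration.integral_add integrable_mult_right S.integrable_const i1)
    also have "(\<integral>s. 2 * (\<Sum>k\<in>K. s k * inner z (h k)) \<partial>S) = 0"
      using v1 by (simp only: integral_mult_right_zero mult_zero_right)
    finally show ?thesis unfolding e v2 by (simp add: S.prob_space)
  qed
  finally show ?thesis .
qed

section \<open>The jointly measurable version of the noise\<close>

definition part :: "nat \<Rightarrow> 'h \<Rightarrow> (nat \<Rightarrow> real) \<Rightarrow> 'h" where
  "part n x s = (\<Sum>k<n. s k *\<^sub>R g k x)"

definition tail :: "'h \<Rightarrow> nat \<Rightarrow> real" where
  "tail x n = (\<Sum>k. (norm (g k x))\<^sup>2) - (\<Sum>k<n. (norm (g k x))\<^sup>2)"

lemma tail_nonneg: "x \<in> H \<Longrightarrow> 0 \<le> tail x n"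
  unfolding tail_def using sum_le_suminf[OF g_summable, of x "{..<n}"] by simp

lemma tail_tendsto: "x \<in> H \<Longrightarrow> tail x \<longlonglongrightarrow> 0"
proof -
  assume x: "x \<in> H"
  have "(\<lambda>n. (\<Sum>k. (norm (g k x))\<^sup>2) - (\<Sum>k<n. (norm (g k x))\<^sup>2)) \<longlonglongrightarrow> (\<Sum>k. (norm (g k x))\<^sup>2) - (\<Sum>k. (norm (g k x))\<^sup>2)"
    by (intro tendsto_diff tendsto_const summable_LIMSEQ[OF g_summable[OF x]])
  then show ?thesis by (simp add: tail_def[abs_def])
qed

lemma sum_le_tail: "x \<in> H \<Longrightarrow> (\<Sum>k\<in>{m..<n}. (norm (g k x))\<^sup>2) \<le> tail x m"
proof (cases "m \<le> n")
  case True
  assume x: "x \<in> H"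
  have "(\<Sum>k<n. (norm (g k x))\<^sup>2) = (\<Sum>k<m. (norm (g k x))\<^sup>2) + (\<Sum>k\<in>{m..<n}. (norm (g k x))\<^sup>2)"
    using True by (subst sum.union_disjoint[symmetric]) (auto intro: sum.cong simp: ivl_disj_un)
  moreover have "(\<Sum>k<n. (norm (g k x))\<^sup>2) \<le> (\<Sum>k. (norm (g k x))\<^sup>2)"
    by (rule sum_le_suminf[OF g_summable[OF x]]) auto
  ultimately show ?thesis by (simp add: tail_def)
qed (simp add: tail_nonneg)

lemma g_measurable: "g k \<in> HB \<rightarrow>\<^sub>M HB"
  using measurable_HB_continuous[OF measurable_ident_sets[OF refl] g_cont g_in] by simp

lemma part_measurable: "(\<lambda>(x, s). part n x s) \<in> HB \<Otimes>\<^sub>M S \<rightarrow>\<^sub>M HB"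
  unfolding part_def case_prod_beta
proof (intro measurable_HB_sum measurable_HB_scaleR)
  fix k
  show "(\<lambda>p. snd p k) \<in> borel_measurable (HB \<Otimes>\<^sub>M S)" by (rule measurable_compose[OF measurable_snd coord])
  show "(\<lambda>p. g k (fst p)) \<in> HB \<Otimes>\<^sub>M S \<rightarrow>\<^sub>M HB" by (rule measurable_compose[OF measurable_fst g_measurable])
qed

lemma part_measurable_snd: "x \<in> H \<Longrightarrow> part n x \<in> S \<rightarrow>\<^sub>M HB"
  unfolding part_def[abs_def] by (intro measurable_HB_sum measurable_HB_scaleR coord measurable_HB_const g_in)

lemma part_diff:
  assumes x: "x \<in> H"
  shows "(\<integral>\<^sup>+s. ennreal ((norm (part n x s - part m x s))\<^sup>2) \<partial>S) \<le> ennreal (\<tau> * (tail x n + tail x m))"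
proof -
  have main: "(\<integral>\<^sup>+s. ennreal ((norm (part n x s - part m x s))\<^sup>2) \<partial>S) \<le> ennreal (\<tau> * (tail x n + tail x m))" if mn: "m \<le> n" for m n
  proof -
    have "part n x s - part m x s = 0 + (\<Sum>k\<in>{m..<n}. s k *\<^sub>R g k x)" for s
    proof -
      have "part n x s = part m x s + (\<Sum>k\<in>{m..<n}. s k *\<^sub>R g k x)"
        unfolding part_def lessThan_atLeast0 by (rule sum.atLeastLessThan_concat[symmetric]) (use mn in auto)
      then show ?thesis by simp
    qed
    then have "(\<integral>\<^sup>+s. ennreal ((norm (part n x s - part m x s))\<^sup>2) \<partial>S) = (\<integral>\<^sup>+s. ennreal ((norm (0 + (\<Sum>k\<in>{m..<n}. s k *\<^sub>R g k x)))\<^sup>2) \<partial>S)"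
      by (intro nn_integral_cong) (simp only:)
    also have "\<dots> = ennreal ((norm (0::'h))\<^sup>2 + \<tau> * (\<Sum>k\<in>{m..<n}. (norm (g k x))\<^sup>2))"
      by (rule second_moment) simp
    also have "\<dots> \<le> ennreal (\<tau> * (tail x n + tail x m))"
      using \<tau> sum_le_tail[OF x, of m n] tail_nonneg[OF x, of n] by (intro ennreal_leI) (simp add: mult_left_mono)
    finally show ?thesis .
  qed
  show ?thesis
  proof (cases "m \<le> n")
    case True
    then show ?thesis by (rule main)
  next
    case False
    then have "(\<integral>\<^sup>+s. ennreal ((norm (part m x s - part n x s))\<^sup>2) \<partial>S) \<le> ennreal (\<tau> * (tail x m + tail x n))" by (intro main) auto
    then show ?thesis by (simp only: norm_minus_commute[of "part m x _"] add.commute[of "tail x m"])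
  qed
qed

text \<open>The partial sums converge in mean square for each \<open>x\<close>, but at a rate depending on \<open>x\<close>; along the
  indices \<open>idx x j\<close> they converge almost surely, and the limit is jointly measurable.\<close>

definition idx :: "'h \<Rightarrow> nat \<Rightarrow> nat" where
  "idx x j = (LEAST n. tail x n \<le> (1/4) ^ j)"

lemma tail_idx: "x \<in> H \<Longrightarrow> tail x (idx x j) \<le> (1/4) ^ j"
proof -
  assume x: "x \<in> H"
  have "\<forall>\<^sub>F n in sequentially. tail x n < (1/4) ^ j"
    using tail_tendsto[OF x] by (rule order_tendstoD) simp
  then obtain n where "tail x n \<le> (1/4) ^ j" by (auto simp: eventually_sequentially intro: less_imp_le)
  then show ?thesis unfolding idx_def by (rule LeastI)
qed

definition noise :: "'h \<Rightarrow> (nat \<Rightarrow> real) \<Rightarrow> 'h" where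
  "noise x s = (if convergent (\<lambda>j. part (idx x j) x s) then lim (\<lambda>j. part (idx x j) x s) else 0)"

lemma idx_measurable: "(\<lambda>x. idx x j) \<in> HB \<rightarrow>\<^sub>M count_space UNIV"
proof -
  have [measurable]: "(\<lambda>x. norm (g k x)) \<in> borel_measurable HB" for k
    by (rule measurable_HB_norm[OF g_measurable])
  have [measurable]: "(\<lambda>x. tail x n) \<in> borel_measurable HB" for n
    unfolding tail_def by measurable
  show ?thesis unfolding idx_def by measurable
qed

text \<open>The truncation index depends on x but takes only countably many values, so substituting
  it preserves joint measurability.\<close>

lemma noise_measurable: "(\<lambda>(x, s). noise x s) \<in> HB \<Otimes>\<^sub>M S \<rightarrow>\<^sub>M HB"
proof -
  have "(\<lambda>p. part (idx (fst p) j) (fst p) (snd p)) \<in> HB \<Otimes>\<^sub>M S \<rightarrow>\<^sub>M HB" for j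
  proof (rule measurable_compose_countable[where f = "\<lambda>n p. part n (fst p) (snd p)"])
    show "(\<lambda>p. part n (fst p) (snd p)) \<in> HB \<Otimes>\<^sub>M S \<rightarrow>\<^sub>M HB" for n
      using part_measurable[of n] by (simp add: case_prod_beta)
    show "(\<lambda>p. idx (fst p) j) \<in> HB \<Otimes>\<^sub>M S \<rightarrow>\<^sub>M count_space UNIV"
      by (rule measurable_compose[OF measurable_fst idx_measurable])
  qed
  from measurable_HB_lim[OF this] show ?thesis unfolding noise_def case_prod_beta .
qed

lemma noise_measurable_comp:
  assumes "f \<in> M \<rightarrow>\<^sub>M HB" "h \<in> M \<rightarrow>\<^sub>M S"
  shows "(\<lambda>\<omega>. noise (f \<omega>) (h \<omega>)) \<in> M \<rightarrow>\<^sub>M HB"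
  using measurable_compose[OF measurable_Pair[OF assms] noise_measurable] by simp

lemma noise_measurable_snd: "x \<in> H \<Longrightarrow> noise x \<in> S \<rightarrow>\<^sub>M HB"
  using noise_measurable_comp[OF measurable_HB_const measurable_ident_sets[OF refl], of x] by simp

lemma noise_lim:
  assumes x: "x \<in> H"
  shows "AE s in S. (\<lambda>j. part (idx x j) x s) \<longlonglongrightarrow> noise x s"
proof -
  have "AE s in S. summable (\<lambda>j. norm (part (idx x (Suc j)) x s - part (idx x j) x s))"
  proof (rule S.AE_summable_if_L2_geometric[where r = "1/4" and C = "2 * \<tau>"])
    show "(\<lambda>s. norm (part (idx x (Suc j)) x s - part (idx x j) x s)) \<in> borel_measurable S" for j
      by (intro measurable_HB_norm measurable_HB_diff part_measurable_snd x)
    fix j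
    have "(1/4::real) ^ Suc j \<le> (1/4) ^ j" by (rule power_decreasing) auto
    with tail_idx[OF x, of j] tail_idx[OF x, of "Suc j"]
    have "tail x (idx x (Suc j)) + tail x (idx x j) \<le> 2 * (1/4) ^ j" by linarith
    then have "\<tau> * (tail x (idx x (Suc j)) + tail x (idx x j)) \<le> 2 * \<tau> * (1/4) ^ j"
      using \<tau> mult_left_mono[of _ _ \<tau>] by fastforce
    then show "(\<integral>\<^sup>+s. ennreal ((norm (part (idx x (Suc j)) x s - part (idx x j) x s))\<^sup>2) \<partial>S) \<le> ennreal (2 * \<tau> * (1/4) ^ j)"
      by (intro order_trans[OF part_diff[OF x]] ennreal_leI)
  qed (use \<tau> in auto)
  then show ?thesis
  proof eventually_elim
    case (elim s)
    then have "convergent (\<lambda>j. part (idx x j) x s)" by (rule convergent_if_summable_norm_diff)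
    then show ?case by (simp add: noise_def convergent_LIMSEQ_iff)
  qed
qed

text \<open>Fatou's lemma in the Cauchy estimate. Although \<open>noise\<close> is defined along the
  special indices \<open>idx x j\<close>, this makes it the mean-square limit of the full sequence
  of partial sums.\<close>

lemma part_noise:
  assumes x: "x \<in> H"
  shows "(\<integral>\<^sup>+s. ennreal ((norm (part n x s - noise x s))\<^sup>2) \<partial>S) \<le> ennreal (\<tau> * tail x n)"
proof (rule nn_integral_le_by_Fatou)
  show "(\<lambda>s. ennreal ((norm (part n x s - part (idx x j) x s))\<^sup>2)) \<in> borel_measurable S" for j
    by (intro sq_measurable measurable_HB_diff part_measurable_snd x)
  show "AE s in S. (\<lambda>j. ennreal ((norm (part n x s - part (idx x j) x s))\<^sup>2)) \<longlonglongrightarrow> ennreal ((norm (part n x s - noise x s))\<^sup>2)"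
    using noise_lim[OF x] by eventually_elim (intro tendsto_ennrealI tendsto_intros)
  show "(\<integral>\<^sup>+s. ennreal ((norm (part n x s - part (idx x j) x s))\<^sup>2) \<partial>S) \<le> ennreal (\<tau> * (tail x n + tail x (idx x j)))" for j
    by (rule part_diff[OF x])
  have "(\<lambda>j. tail x (idx x j)) \<longlonglongrightarrow> 0"
  proof (rule tendsto_sandwich[OF _ _ tendsto_const])
    show "(\<lambda>j. (1/4::real) ^ j) \<longlonglongrightarrow> 0" by (rule LIMSEQ_realpow_zero) auto
  qed (auto intro!: always_eventually tail_nonneg[OF x] tail_idx[OF x])
  then have "(\<lambda>j. \<tau> * (tail x n + tail x (idx x j))) \<longlonglongrightarrow> \<tau> * (tail x n + 0)" by (intro tendsto_intros)
  then show "(\<lambda>j. ennreal (\<tau> * (tail x n + tail x (idx x j)))) \<longlonglongrightarrow> ennreal (\<tau> * tail x n)"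
    by (intro tendsto_ennrealI) simp
qed

text \<open>For the partial sums this is \<open>second_moment\<close>; the truncation errors are
  split off at the price of a factor 1 + \<delta>.\<close>

lemma noise_diff:
  assumes xy: "x \<in> H" "y \<in> H" and z: "z \<in> H" and D: "\<And>n. (\<Sum>k<n. (norm (g k x - g k y))\<^sup>2) \<le> D"
  shows "(\<integral>\<^sup>+s. ennreal ((norm (z + (noise x s - noise y s)))\<^sup>2) \<partial>S) \<le> ennreal ((norm z)\<^sup>2 + \<tau> * D)"
proof -
  let ?I = "\<integral>\<^sup>+s. ennreal ((norm (z + (noise x s - noise y s)))\<^sup>2) \<partial>S"
  define A where "A = (norm z)\<^sup>2 + \<tau> * D"
  have D0: "0 \<le> D" using D[of 0] by simp
  have A: "0 \<le> A" using D0 \<tau> by (simp add: A_def)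
  have ma: "(\<lambda>s. z + (part n x s - part n y s)) \<in> S \<rightarrow>\<^sub>M HB" for n
    by (intro measurable_HB_add measurable_HB_const measurable_HB_diff part_measurable_snd xy z)
  have md: "(\<lambda>s. noise w s - part n w s) \<in> S \<rightarrow>\<^sub>M HB" if "w \<in> H" for n w
    by (intro measurable_HB_diff part_measurable_snd noise_measurable_snd that)
  have m2: "(\<lambda>s. part n w s - noise w s) \<in> S \<rightarrow>\<^sub>M HB" if "w \<in> H" for n w
    by (intro measurable_HB_diff part_measurable_snd noise_measurable_snd that)
  have step: "?I \<le> ennreal ((1 + \<delta>) * A + (1 + 1 / \<delta>) * ((1 + 1) * (\<tau> * tail x n) + (1 + 1 / 1) * (\<tau> * tail y n)))" if \<delta>: "\<delta> > 0" for \<delta> n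
  proof -
    have 1: "(\<integral>\<^sup>+s. ennreal ((norm (z + (part n x s - part n y s)))\<^sup>2) \<partial>S) \<le> ennreal A"
    proof -
      have "part n x s - part n y s = (\<Sum>k<n. s k *\<^sub>R (g k x - g k y))" for s
        by (simp add: part_def scaleR_diff_right sum_subtractf)
      then have "(\<integral>\<^sup>+s. ennreal ((norm (z + (part n x s - part n y s)))\<^sup>2) \<partial>S) = (\<integral>\<^sup>+s. ennreal ((norm (z + (\<Sum>k<n. s k *\<^sub>R (g k x - g k y))))\<^sup>2) \<partial>S)"
        by (intro nn_integral_cong) (simp only:)
      also have "\<dots> = ennreal ((norm z)\<^sup>2 + \<tau> * (\<Sum>k<n. (norm (g k x - g k y))\<^sup>2))"
        by (rule second_moment) simp
      also have "\<dots> \<le> ennreal A" unfolding A_def using D[of n] \<tau> by (intro ennreal_leI add_left_mono mult_left_mono) auto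
      finally show ?thesis .
    qed
    have 2: "(\<integral>\<^sup>+s. ennreal ((norm ((noise x s - part n x s) + (part n y s - noise y s)))\<^sup>2) \<partial>S)
       \<le> ennreal ((1 + 1) * (\<tau> * tail x n) + (1 + 1 / 1) * (\<tau> * tail y n))"
    proof (rule nn_integral_norm_add_sq_le[OF md[OF xy(1)] m2[OF xy(2)]])
      show "(\<integral>\<^sup>+s. ennreal ((norm (noise x s - part n x s))\<^sup>2) \<partial>S) \<le> ennreal (\<tau> * tail x n)"
        using part_noise[OF xy(1), of n] by (simp only: norm_minus_commute[of "part n x _"])
      show "(\<integral>\<^sup>+s. ennreal ((norm (part n y s - noise y s))\<^sup>2) \<partial>S) \<le> ennreal (\<tau> * tail y n)"
        by (rule part_noise[OF xy(2)])
      show "0 \<le> \<tau> * tail x n" "0 \<le> \<tau> * tail y n"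
        using \<tau> tail_nonneg[OF xy(1), of n] tail_nonneg[OF xy(2), of n] by (auto intro: mult_nonneg_nonneg)
    qed simp
    have m3: "(\<lambda>s. (noise x s - part n x s) + (part n y s - noise y s)) \<in> S \<rightarrow>\<^sub>M HB"
      by (intro measurable_HB_add md m2 xy)
    have nn: "0 \<le> (1 + 1) * (\<tau> * tail x n) + (1 + 1 / 1) * (\<tau> * tail y n)"
      using \<tau> tail_nonneg[OF xy(1), of n] tail_nonneg[OF xy(2), of n] by simp
    have "z + (noise x s - noise y s) = (z + (part n x s - part n y s)) + ((noise x s - part n x s) + (part n y s - noise y s))" for s
      by simp
    then have "?I = (\<integral>\<^sup>+s. ennreal ((norm ((z + (part n x s - part n y s)) + ((noise x s - part n x s) + (part n y s - noise y s))))\<^sup>2) \<partial>S)"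
      by (intro nn_integral_cong) (simp add: algebra_simps)
    also have "\<dots> \<le> ennreal ((1 + \<delta>) * A + (1 + 1 / \<delta>) * ((1 + 1) * (\<tau> * tail x n) + (1 + 1 / 1) * (\<tau> * tail y n)))"
      by (rule nn_integral_norm_add_sq_le[OF ma m3 \<delta> A nn 1 2])
    finally show ?thesis .
  qed
  \<comment> \<open>For fixed \<delta> the truncation errors vanish as n grows; only afterwards
    \<delta> tends to 0, so the constant is not enlarged.\<close>
  have step2: "?I \<le> ennreal ((1 + \<delta>) * A)" if \<delta>: "\<delta> > 0" for \<delta>
  proof (rule LIMSEQ_le_const)
    have "(\<lambda>n. (1 + \<delta>) * A + (1 + 1 / \<delta>) * ((1 + 1) * (\<tau> * tail x n) + (1 + 1 / 1) * (\<tau> * tail y n)))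
      \<longlonglongrightarrow> (1 + \<delta>) * A + (1 + 1 / \<delta>) * ((1 + 1) * (\<tau> * 0) + (1 + 1 / 1) * (\<tau> * 0))"
      by (intro tendsto_add tendsto_mult tendsto_const tail_tendsto xy)
    then show "(\<lambda>n. ennreal ((1 + \<delta>) * A + (1 + 1 / \<delta>) * ((1 + 1) * (\<tau> * tail x n) + (1 + 1 / 1) * (\<tau> * tail y n)))) \<longlonglongrightarrow> ennreal ((1 + \<delta>) * A)"
      by (intro tendsto_ennrealI) simp
    show "\<exists>N. \<forall>n\<ge>N. ?I \<le> ennreal ((1 + \<delta>) * A + (1 + 1 / \<delta>) * ((1 + 1) * (\<tau> * tail x n) + (1 + 1 / 1) * (\<tau> * tail y n)))"
      by (intro exI[of _ 0] allI impI) (rule step[OF \<delta>])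
  qed
  have "?I \<le> ennreal A"
  proof (rule LIMSEQ_le_const)
    have "(\<lambda>n. (1 + inverse (real (Suc n))) * A) \<longlonglongrightarrow> (1 + 0) * A"
      by (intro tendsto_mult tendsto_add tendsto_const LIMSEQ_inverse_real_of_nat)
    then show "(\<lambda>n. ennreal ((1 + inverse (real (Suc n))) * A)) \<longlonglongrightarrow> ennreal A" by (intro tendsto_ennrealI) simp
    show "\<exists>N. \<forall>n\<ge>N. ?I \<le> ennreal ((1 + inverse (real (Suc n))) * A)"
      by (intro exI[of _ 0] allI impI, rule step2) simp
  qed
  then show ?thesis by (simp add: A_def)
qed

lemma noise_second_moment:
  assumes x: "x \<in> H"
  shows "(\<integral>\<^sup>+s. ennreal ((norm (noise x s))\<^sup>2) \<partial>S) \<le> ennreal (\<tau> * tail x 0)"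
  using part_noise[OF x, of 0] by (simp add: part_def norm_minus_commute[of 0])

end

section \<open>Invariant laws and mixing\<close>

text \<open>The indicator of a nonempty closed set is the limit of the Lipschitz functions max 0 (1
  - n dist), and the closed sets are an intersection-stable generator.\<close>

lemma measure_eqI_bounded_lipschitz:
  fixes M N :: "'a::metric_space measure"
  assumes "prob_space M" "prob_space N" and sets: "sets M = sets borel" "sets N = sets borel"
    and eq: "\<And>\<phi> K. K-lipschitz_on UNIV \<phi> \<Longrightarrow> (\<And>x. \<phi> x \<in> {0..1::real}) \<Longrightarrow> (\<integral>x. \<phi> x \<partial>M) = (\<integral>x. \<phi> x \<partial>N)"
  shows "M = N"
proof -
  interpret M: prob_space M by fact
  interpret N: prob_space N by fact
  have space: "space M = UNIV" "space N = UNIV" using sets_eq_imp_space_eq[OF sets(1)] sets_eq_imp_space_eq[OF sets(2)] by auto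
  have "emeasure M C = emeasure N C" if C: "closed C" for C
  proof (cases "C = {}")
    case False
    define \<phi> where "\<phi> n x = max 0 (1 - real n * infdist x C)" for n x
    have lip: "(real n)-lipschitz_on UNIV (\<phi> n)" for n
    proof (rule lipschitz_onI)
      fix x y
      have "\<bar>\<phi> n x - \<phi> n y\<bar> \<le> \<bar>real n * infdist x C - real n * infdist y C\<bar>" by (simp add: \<phi>_def max_def abs_minus_commute)
      also have "\<dots> = real n * \<bar>infdist x C - infdist y C\<bar>" by (simp add: abs_mult right_diff_distrib[symmetric])
      also have "\<dots> \<le> real n * dist x y" by (intro mult_left_mono infdist_triangle_abs) simp
      finally show "dist (\<phi> n x) (\<phi> n y) \<le> real n * dist x y" by (simp add: dist_real_def)
    qed simp
    have b: "\<phi> n x \<in> {0..1}" for n x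
      using mult_nonneg_nonneg[OF of_nat_0_le_iff[of n] infdist_nonneg[of x C]] by (simp add: \<phi>_def)
    have lim: "(\<lambda>n. \<phi> n x) \<longlonglongrightarrow> indicator C x" for x
    proof (cases "x \<in> C")
      case True
      then show ?thesis by (simp add: \<phi>_def)
    next
      case x: False
      then have p: "infdist x C > 0" using in_closed_iff_infdist_zero[OF C False] infdist_nonneg[of x C] by (simp add: less_le)
      then obtain n0 where n0: "real n0 * infdist x C > 1" using reals_Archimedean3 by blast
      have "\<phi> n x = 0" if "n \<ge> n0" for n
      proof -
        have "real n0 * infdist x C \<le> real n * infdist x C" using that p by (intro mult_right_mono) auto
        then show ?thesis using n0 by (simp add: \<phi>_def)
      qed
      then have "\<forall>\<^sub>F n in sequentially. \<phi> n x = 0" by (auto simp: eventually_sequentially)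
      then show ?thesis using x by (simp add: tendsto_eventually)
    qed
    have meas: "\<phi> n \<in> borel_measurable borel" for n
      using lipschitz_on_continuous_on[OF lip] by (rule borel_measurable_continuous_onI)
    have "(\<lambda>n. \<integral>x. \<phi> n x \<partial>L) \<longlonglongrightarrow> measure L C" if L: "prob_space L" "sets L = sets borel" for L
    proof -
      interpret L: prob_space L by (rule L(1))
      have "(\<lambda>n. \<integral>x. \<phi> n x \<partial>L) \<longlonglongrightarrow> (\<integral>x. indicator C x \<partial>L)"
      proof (rule integral_dominated_convergence[where w = "\<lambda>_. 1"])
        show "indicator C \<in> borel_measurable L" "\<And>n. \<phi> n \<in> borel_measurable L"
          using meas C by (simp_all add: measurable_cong_sets[OF L(2) refl])
        show "AE x in L. norm (\<phi> n x) \<le> 1" for n using b[of n] by (intro AE_I2) simp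
      qed (auto intro: lim)
      then show ?thesis using C L(2) sets_eq_imp_space_eq[OF L(2)] by simp
    qed
    then have "(\<lambda>n. \<integral>x. \<phi> n x \<partial>M) \<longlonglongrightarrow> measure M C" "(\<lambda>n. \<integral>x. \<phi> n x \<partial>N) \<longlonglongrightarrow> measure N C"
      using assms by blast+
    moreover have "(\<integral>x. \<phi> n x \<partial>M) = (\<integral>x. \<phi> n x \<partial>N)" for n by (rule eq[OF lip]) (rule b)
    ultimately have "measure M C = measure N C" using LIMSEQ_unique by simp
    then show ?thesis by (simp add: M.emeasure_eq_measure N.emeasure_eq_measure)
  qed simp
  then show ?thesis
    by (intro measure_eqI_generator_eq[where \<Omega> = UNIV and E = "Collect closed" and A = "\<lambda>_. UNIV"])
       (auto simp: Int_stable_def sets borel_eq_closed)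
qed

section \<open>Iterates of the transition operator\<close>

context contractive_map
begin

definition iter :: "nat \<Rightarrow> ('h \<Rightarrow> real) \<Rightarrow> 'h \<Rightarrow> real" where
  "iter m \<phi> = (transition ^^ m) \<phi>"

lemma iter_0 [simp]: "iter 0 \<phi> = \<phi>" and iter_Suc: "iter (Suc m) \<phi> = transition (iter m \<phi>)"
  and iter_Suc2: "iter (Suc m) \<phi> = iter m (transition \<phi>)"
  by (simp_all add: iter_def funpow_swap1)

lemma iter_measurable: "\<phi> \<in> borel_measurable HB \<Longrightarrow> iter m \<phi> \<in> borel_measurable HB"
  by (induction m) (auto simp: iter_Suc intro: transition_measurable)

lemma iter_bounded:
  fixes \<phi> :: "'h \<Rightarrow> real"
  assumes "\<phi> \<in> borel_measurable HB" "\<And>x. x \<in> H \<Longrightarrow> \<bar>\<phi> x\<bar> \<le> B"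
  shows "x \<in> H \<Longrightarrow> \<bar>iter m \<phi> x\<bar> \<le> B"
proof (induction m arbitrary: x)
  case (Suc m)
  show ?case unfolding iter_Suc by (rule transition_bounded[OF iter_measurable[OF assms(1)] Suc.IH Suc.prems])
qed (simp add: assms)

lemma iter_lipschitz:
  fixes \<phi> :: "'h \<Rightarrow> real"
  assumes "\<phi> \<in> borel_measurable HB" "\<And>x. x \<in> H \<Longrightarrow> \<bar>\<phi> x\<bar> \<le> B" "K \<ge> 0"
    and "\<And>x y. x \<in> H \<Longrightarrow> y \<in> H \<Longrightarrow> \<bar>\<phi> x - \<phi> y\<bar> \<le> K * norm (x - y)"
  shows "x \<in> H \<Longrightarrow> y \<in> H \<Longrightarrow> \<bar>iter m \<phi> x - iter m \<phi> y\<bar> \<le> (K * sqrt \<rho> ^ m) * norm (x - y)"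
proof (induction m arbitrary: x y)
  case (Suc m)
  have K: "0 \<le> K * sqrt \<rho> ^ m" using assms(3) \<rho> by simp
  have "\<bar>iter (Suc m) \<phi> x - iter (Suc m) \<phi> y\<bar> \<le> (K * sqrt \<rho> ^ m * sqrt \<rho>) * norm (x - y)"
    unfolding iter_Suc
    by (rule transition_lipschitz[OF iter_measurable[OF assms(1)] iter_bounded[OF assms(1,2)] K Suc.IH Suc.prems])
  then show ?case by (simp add: ac_simps)
qed (simp add: assms)

end

section \<open>Mixing towards the invariant law and its uniqueness\<close>

locale invariant_law = contractive_map H e S \<Phi> \<rho> C0 + \<pi>: prob_space \<pi>
  for H :: "'h::{real_inner, banach} set" and e S and \<Phi> :: "'h \<Rightarrow> 's \<Rightarrow> 'h" and \<rho> C0 and \<pi> :: "'h measure" +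
  fixes K2
  assumes sets_law: "sets \<pi> = sets HB" and law_moment: "(\<integral>\<^sup>+y. ennreal ((norm y)\<^sup>2) \<partial>\<pi>) \<le> ennreal K2"
    and law_transition: "\<And>\<phi> B. \<phi> \<in> borel_measurable HB \<Longrightarrow> (\<And>x. x \<in> H \<Longrightarrow> \<bar>\<phi> x\<bar> \<le> B) \<Longrightarrow>
      (\<integral>y. transition \<phi> y \<partial>\<pi>) = (\<integral>y. \<phi> y \<partial>\<pi>)"
begin

lemma space_law: "space \<pi> = H"
  using sets_eq_imp_space_eq[OF sets_law] by simp

lemma law_measurable: "borel_measurable \<pi> = borel_measurable HB"
  by (rule measurable_cong_sets[OF sets_law refl])

lemma law_integrable:
  fixes \<phi> :: "'h \<Rightarrow> real"
  assumes "\<phi> \<in> borel_measurable HB" "\<And>x. x \<in> H \<Longrightarrow> \<bar>\<phi> x\<bar> \<le> B"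
  shows "integrable \<pi> \<phi>"
  by (rule \<pi>.integrable_const_bound[of _ B]) (auto simp: law_measurable assms space_law intro!: AE_I2)

lemma law_iter:
  fixes \<phi> :: "'h \<Rightarrow> real"
  assumes "\<phi> \<in> borel_measurable HB" "\<And>x. x \<in> H \<Longrightarrow> \<bar>\<phi> x\<bar> \<le> B"
  shows "(\<integral>y. iter m \<phi> y \<partial>\<pi>) = (\<integral>y. \<phi> y \<partial>\<pi>)"
proof (induction m)
  case (Suc m)
  have "(\<integral>y. transition (iter m \<phi>) y \<partial>\<pi>) = (\<integral>y. iter m \<phi> y \<partial>\<pi>)"
    by (rule law_transition[OF iter_measurable[OF assms(1)] iter_bounded[OF assms]])
  then show ?case by (simp only: iter_Suc Suc.IH)
qed simp

lemma norm_measurable: "x \<in> H \<Longrightarrow> (\<lambda>y. norm (x - y)) \<in> borel_measurable \<pi>"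
  unfolding law_measurable
  by (intro measurable_HB_norm measurable_HB_diff measurable_HB_const measurable_ident_sets refl)

text \<open>The second moment of the law dominates the first. Without integrability the right-hand
  side of the mixing estimate would be the default value 0.\<close>

lemma law_norm_integrable:
  assumes x: "x \<in> H"
  shows "integrable \<pi> (\<lambda>y. norm (x - y))"
proof -
  have m [measurable]: "(\<lambda>y. norm y) \<in> borel_measurable \<pi>" using norm_measurable[OF H_zero] by simp
  have "integrable \<pi> (\<lambda>y. (norm y)\<^sup>2)"
  proof (rule integrableI_bounded)
    have "(\<integral>\<^sup>+y. ennreal (norm ((norm y)\<^sup>2)) \<partial>\<pi>) \<le> ennreal K2" using law_moment by simp
    then show "(\<integral>\<^sup>+y. ennreal (norm ((norm y)\<^sup>2)) \<partial>\<pi>) < \<infinity>" using ennreal_less_top le_less_trans by (metis infinity_ennreal_def)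
  qed measurable
  then have i: "integrable \<pi> (\<lambda>y. norm x + 1 + (norm y)\<^sup>2)"
    by (intro Bochner_Integration.integrable_add \<pi>.integrable_const)
  show ?thesis
  proof (rule Bochner_Integration.integrable_bound[OF i norm_measurable[OF x]], rule AE_I2)
    fix y :: 'h
    have "norm y \<le> 1 + (norm y)\<^sup>2"
      using power2_less_eq_zero_iff[of "norm y"] sum_power2_ge_zero[of "norm y - 1" 0] by (simp add: power2_eq_square algebra_simps) (smt (verit) mult_nonneg_nonneg norm_ge_zero)
    then have "norm (x - y) \<le> norm x + 1 + (norm y)\<^sup>2" using norm_triangle_ineq4[of x y] by linarith
    then show "norm (norm (x - y)) \<le> norm (norm x + 1 + (norm y)\<^sup>2)" by simp
  qed
qed

text \<open>By invariance the integral of \<phi> is that of \<open>iter m \<phi>\<close>, so the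
  left-hand side averages differences of a function with Lipschitz constant K sqrt \<rho>^m.\<close>

lemma mixing:
  fixes \<phi> :: "'h \<Rightarrow> real"
  assumes \<phi>: "\<phi> \<in> borel_measurable HB" "\<And>x. x \<in> H \<Longrightarrow> \<bar>\<phi> x\<bar> \<le> B" and K: "K \<ge> 0"
    and lip: "\<And>x y. x \<in> H \<Longrightarrow> y \<in> H \<Longrightarrow> \<bar>\<phi> x - \<phi> y\<bar> \<le> K * norm (x - y)" and x: "x \<in> H"
  shows "\<bar>iter m \<phi> x - (\<integral>y. \<phi> y \<partial>\<pi>)\<bar> \<le> K * sqrt \<rho> ^ m * (\<integral>y. norm (x - y) \<partial>\<pi>)"
proof -
  have i: "integrable \<pi> (iter m \<phi>)" by (rule law_integrable[OF iter_measurable[OF \<phi>(1)] iter_bounded[OF \<phi>]])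
  have "iter m \<phi> x - (\<integral>y. \<phi> y \<partial>\<pi>) = (\<integral>y. iter m \<phi> x - iter m \<phi> y \<partial>\<pi>)"
    using i law_iter[OF \<phi>, of m] by (subst Bochner_Integration.integral_diff) (auto simp: \<pi>.prob_space)
  also have "\<bar>\<dots>\<bar> \<le> (\<integral>y. \<bar>iter m \<phi> x - iter m \<phi> y\<bar> \<partial>\<pi>)"
    by (rule integral_abs_bound)
  also have "\<dots> \<le> (\<integral>y. (K * sqrt \<rho> ^ m) * norm (x - y) \<partial>\<pi>)"
    by (rule integral_mono) (auto intro!: i law_norm_integrable[OF x] iter_lipschitz[OF \<phi> K lip x] simp: space_law)
  finally show ?thesis by simp
qed

text \<open>A competing law may lack a first moment, so the mixing estimate is used pointwise:
  \<open>iter m \<phi>\<close> converges to a constant and is bounded by 1, and dominated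
  convergence identifies the integrals of \<phi> under both laws.\<close>

lemma law_unique:
  assumes \<mu>: "prob_space \<mu>" "sets \<mu> = sets HB"
    and inv: "\<And>\<phi> C m. C-lipschitz_on H \<phi> \<Longrightarrow> (\<And>x. x \<in> H \<Longrightarrow> \<phi> x \<in> {0..1::real}) \<Longrightarrow> (\<integral>y. iter m \<phi> y \<partial>\<mu>) = (\<integral>y. \<phi> y \<partial>\<mu>)"
  shows "\<mu> = \<pi>"
proof -
  interpret \<mu>: prob_space \<mu> by (rule \<mu>(1))
  have space: "space \<mu> = H" using sets_eq_imp_space_eq[OF \<mu>(2)] by simp
  have eq: "(\<integral>y. \<phi> y \<partial>\<mu>) = (\<integral>y. \<phi> y \<partial>\<pi>)" if lip: "C-lipschitz_on H \<phi>" and b: "\<And>x. x \<in> H \<Longrightarrow> \<phi> x \<in> {0..1}" for \<phi> :: "'h \<Rightarrow> real" and C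
  proof -
    have C: "C \<ge> 0" by (rule lipschitz_on_nonneg[OF lip])
    have m: "\<phi> \<in> borel_measurable HB"
      by (rule borel_measurable_continuous_on_restrict[OF lipschitz_on_continuous_on[OF lip]])
    have b': "\<bar>\<phi> x\<bar> \<le> 1" if "x \<in> H" for x using b[OF that] by simp
    have l: "\<bar>\<phi> x - \<phi> y\<bar> \<le> C * norm (x - y)" if "x \<in> H" "y \<in> H" for x y
      using lipschitz_onD[OF lip that] by (simp add: dist_norm)
    have "(\<lambda>m. \<integral>y. iter m \<phi> y \<partial>\<mu>) \<longlonglongrightarrow> (\<integral>y. (\<integral>y. \<phi> y \<partial>\<pi>) \<partial>\<mu>)"
    proof (rule integral_dominated_convergence[where w = "\<lambda>_. 1"])
      show "iter m \<phi> \<in> borel_measurable \<mu>" for m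
        using iter_measurable[OF m] by (simp add: measurable_cong_sets[OF \<mu>(2) refl])
      show "AE x in \<mu>. (\<lambda>m. iter m \<phi> x) \<longlonglongrightarrow> (\<integral>y. \<phi> y \<partial>\<pi>)"
      proof (rule AE_I2)
        fix x assume "x \<in> space \<mu>"
        then have x: "x \<in> H" by (simp add: space)
        have "(\<lambda>m. C * sqrt \<rho> ^ m * (\<integral>y. norm (x - y) \<partial>\<pi>)) \<longlonglongrightarrow> C * 0 * (\<integral>y. norm (x - y) \<partial>\<pi>)"
          using \<rho> by (intro tendsto_mult tendsto_const LIMSEQ_realpow_zero) auto
        then have "(\<lambda>m. C * sqrt \<rho> ^ m * (\<integral>y. norm (x - y) \<partial>\<pi>)) \<longlonglongrightarrow> 0" by simp
        then have "(\<lambda>m. iter m \<phi> x - (\<integral>y. \<phi> y \<partial>\<pi>)) \<longlonglongrightarrow> 0"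
          by (rule Lim_null_comparison[rotated]) (use mixing[OF m b' C l x] in simp)
        then show "(\<lambda>m. iter m \<phi> x) \<longlonglongrightarrow> (\<integral>y. \<phi> y \<partial>\<pi>)" by (rule LIM_zero_cancel)
      qed
      show "AE x in \<mu>. norm (iter m \<phi> x) \<le> 1" for m
        using iter_bounded[OF m b'] by (intro AE_I2) (simp add: space)
    qed auto
    then have "(\<lambda>m::nat. \<integral>y. \<phi> y \<partial>\<mu>) \<longlonglongrightarrow> (\<integral>y. \<phi> y \<partial>\<pi>)"
      using inv[OF lip b] by (simp add: \<mu>.prob_space)
    then show ?thesis by (simp add: LIMSEQ_const_iff)
  qed
  have id: "(\<lambda>x. x) \<in> \<nu> \<rightarrow>\<^sub>M borel" if "sets \<nu> = sets HB" for \<nu>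
    using measurable_HB_imp[OF measurable_ident_sets[OF refl]] by (simp add: measurable_cong_sets[OF that refl])
  \<comment> \<open>Both laws live on H; they are compared as Borel measures on the whole space and
    then brought back to H, which is closed.\<close>
  have "distr \<mu> borel (\<lambda>x. x) = distr \<pi> borel (\<lambda>x. x)"
  proof (rule measure_eqI_bounded_lipschitz)
    fix \<phi> :: "'h \<Rightarrow> real" and C assume l: "C-lipschitz_on UNIV \<phi>" and b: "\<And>x. \<phi> x \<in> {0..1}"
    have m: "\<phi> \<in> borel_measurable borel" by (rule borel_measurable_continuous_onI[OF lipschitz_on_continuous_on[OF l]])
    show "(\<integral>x. \<phi> x \<partial>distr \<mu> borel (\<lambda>x. x)) = (\<integral>x. \<phi> x \<partial>distr \<pi> borel (\<lambda>x. x))"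
      using eq[OF lipschitz_on_subset[OF l subset_UNIV] b]
      by (simp add: integral_distr[OF id[OF \<mu>(2)] m] integral_distr[OF id[OF sets_law] m])
  next
    show "prob_space (distr \<mu> borel (\<lambda>x. x))" by (rule \<mu>.prob_space_distr[OF id[OF \<mu>(2)]])
    show "prob_space (distr \<pi> borel (\<lambda>x. x))" by (rule \<pi>.prob_space_distr[OF id[OF sets_law]])
  qed simp_all
  then have d: "emeasure (distr \<mu> borel (\<lambda>x. x)) A = emeasure (distr \<pi> borel (\<lambda>x. x)) A" for A by simp
  show ?thesis
  proof (rule measure_eqI)
    show "sets \<mu> = sets \<pi>" using \<mu>(2) sets_law by simp
    fix A assume "A \<in> sets \<mu>"
    then have A: "A \<in> sets borel" "A \<subseteq> H"
      using closed_H by (auto simp: \<mu>(2) sets_restrict_space_iff borel_closed)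
    then show "emeasure \<mu> A = emeasure \<pi> A"
      using d[of A] by (simp add: emeasure_distr id[OF \<mu>(2)] id[OF sets_law] space space_law Int_absorb2)
  qed
qed

end

section \<open>Markov chains driven by independent noise\<close>

locale driven_chain = contractive_map H e S \<Phi> \<rho> C0 + P: prob_space P
  for H :: "'h::{real_inner, banach} set" and e and S :: "'s measure" and \<Phi> :: "'h \<Rightarrow> 's \<Rightarrow> 'h" and \<rho> C0
    and P :: "'w measure" +
  fixes F :: "nat \<Rightarrow> 'w measure" and s :: "nat \<Rightarrow> 'w \<Rightarrow> 's"
  assumes sub: "\<And>m. subalgebra P (F m)" and F_mono: "\<And>m. sets (F m) \<subseteq> sets (F (Suc m))"
    and s_adapted: "\<And>m. s m \<in> F (Suc m) \<rightarrow>\<^sub>M S" and s_law: "\<And>m. distr P S (s m) = S"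
    and s_indep: "\<And>m A B. A \<in> sets (F m) \<Longrightarrow> B \<in> sets S \<Longrightarrow>
      P.prob (A \<inter> (s m -` B \<inter> space P)) = P.prob A * P.prob (s m -` B \<inter> space P)"
begin

lemma space_F: "space (F m) = space P"
  using sub by (simp add: subalgebra_def)

lemma from_F: "h \<in> F m \<rightarrow>\<^sub>M L \<Longrightarrow> h \<in> P \<rightarrow>\<^sub>M L"
  using measurable_from_subalg[OF sub] .

lemma F_Suc: "h \<in> F m \<rightarrow>\<^sub>M L \<Longrightarrow> h \<in> F (Suc m) \<rightarrow>\<^sub>M L"
  using F_mono[of m] measurable_mono[of L L "F m" "F (Suc m)"] by (auto simp: space_F)

lemma s_measurable: "s m \<in> P \<rightarrow>\<^sub>M S"
  by (rule from_F[OF s_adapted])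

fun chain :: "'h \<Rightarrow> nat \<Rightarrow> 'w \<Rightarrow> 'h" where
  "chain x 0 \<omega> = x"
| "chain x (Suc m) \<omega> = \<Phi> (chain x m \<omega>) (s m \<omega>)"

lemma chain_adapted: "x \<in> H \<Longrightarrow> chain x m \<in> F m \<rightarrow>\<^sub>M HB"
proof (induction m)
  case (Suc m)
  have "(\<lambda>\<omega>. \<Phi> (chain x m \<omega>) (s m \<omega>)) \<in> F (Suc m) \<rightarrow>\<^sub>M HB"
    by (rule map_measurable[OF F_Suc[OF Suc.IH[OF Suc.prems]] s_adapted])
  then show ?case by (simp add: chain.simps(2)[abs_def])
next
  case 0
  then show ?case using measurable_HB_const by (simp add: chain.simps(1)[abs_def])
qed

text \<open>Rectangles suffice, and on them independence of the current noise from
  \<open>F m\<close> is the product formula. The noise can then be integrated out with the past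
  frozen.\<close>

lemma pair_law:
  assumes Y: "Y \<in> F m \<rightarrow>\<^sub>M L"
  shows "distr P (L \<Otimes>\<^sub>M S) (\<lambda>\<omega>. (Y \<omega>, s m \<omega>)) = distr P L Y \<Otimes>\<^sub>M S"
proof -
  let ?J = "distr P (L \<Otimes>\<^sub>M S) (\<lambda>\<omega>. (Y \<omega>, s m \<omega>))"
  interpret Y: prob_space "distr P L Y" by (rule P.prob_space_distr[OF from_F[OF Y]])
  have "distr P L Y \<Otimes>\<^sub>M S = ?J"
  proof (rule pair_measure_eqI)
    show "sigma_finite_measure (distr P L Y)" "sigma_finite_measure S" ..
    show "sets (distr P L Y \<Otimes>\<^sub>M S) = sets ?J"
      by (simp add: sets_pair_measure_cong[OF sets_distr refl])
    fix A B assume "A \<in> sets (distr P L Y)" and B: "B \<in> sets S"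
    then have A: "A \<in> sets L" by simp
    have "(\<lambda>\<omega>. (Y \<omega>, s m \<omega>)) -` (A \<times> B) \<inter> space P = (Y -` A \<inter> space P) \<inter> (s m -` B \<inter> space P)" by auto
    then have "emeasure ?J (A \<times> B) = P.prob ((Y -` A \<inter> space P) \<inter> (s m -` B \<inter> space P))"
      using A B by (subst emeasure_distr[OF measurable_Pair[OF from_F[OF Y] s_measurable]]) (auto simp: P.emeasure_eq_measure)
    also have "\<dots> = P.prob (Y -` A \<inter> space P) * P.prob (s m -` B \<inter> space P)"
      using measurable_sets[OF Y A] by (subst s_indep[OF _ B]) (simp_all add: space_F)
    also have "\<dots> = emeasure (distr P L Y) A * emeasure (distr P S (s m)) B"
      by (simp add: ennreal_mult emeasure_distr[OF from_F[OF Y] A] emeasure_distr[OF s_measurable B] P.emeasure_eq_measure)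
    finally show "emeasure (distr P L Y) A * emeasure S B = emeasure ?J (A \<times> B)" by (simp add: s_law)
  qed
  then show ?thesis by (rule sym)
qed

lemma nn_integral_pair:
  assumes Y: "Y \<in> F m \<rightarrow>\<^sub>M HB" and h: "(\<lambda>(y, z). h y z) \<in> borel_measurable (HB \<Otimes>\<^sub>M S)"
  shows "(\<integral>\<^sup>+\<omega>. h (Y \<omega>) (s m \<omega>) \<partial>P) = (\<integral>\<^sup>+\<omega>. (\<integral>\<^sup>+z. h (Y \<omega>) z \<partial>S) \<partial>P)"
proof -
  have "(\<integral>\<^sup>+\<omega>. h (Y \<omega>) (s m \<omega>) \<partial>P) = (\<integral>\<^sup>+p. h (fst p) (snd p) \<partial>distr P (HB \<Otimes>\<^sub>M S) (\<lambda>\<omega>. (Y \<omega>, s m \<omega>)))"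
    using h by (subst nn_integral_distr) (auto simp: case_prod_beta intro: measurable_Pair from_F[OF Y] s_measurable)
  also have "\<dots> = (\<integral>\<^sup>+y. (\<integral>\<^sup>+z. h y z \<partial>S) \<partial>distr P HB Y)"
    unfolding pair_law[OF Y]
    using S.nn_integral_fst[of "\<lambda>p. h (fst p) (snd p)" "distr P HB Y", symmetric] h
    by (simp add: case_prod_beta measurable_cong_sets[OF sets_pair_measure_cong[OF sets_distr refl] refl])
  also have "\<dots> = (\<integral>\<^sup>+\<omega>. (\<integral>\<^sup>+z. h (Y \<omega>) z \<partial>S) \<partial>P)"
    using S.borel_measurable_nn_integral[OF h] by (subst nn_integral_distr[OF from_F[OF Y]]) auto
  finally show ?thesis .
qed

lemma integral_step:
  fixes \<phi> :: "'h \<Rightarrow> real"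
  assumes Y: "Y \<in> F m \<rightarrow>\<^sub>M HB" and \<phi>: "\<phi> \<in> borel_measurable HB" "\<And>x. x \<in> H \<Longrightarrow> \<bar>\<phi> x\<bar> \<le> B"
  shows "(\<integral>\<omega>. \<phi> (\<Phi> (Y \<omega>) (s m \<omega>)) \<partial>P) = (\<integral>\<omega>. transition \<phi> (Y \<omega>) \<partial>P)"
proof -
  let ?D = "distr P HB Y"
  interpret D: prob_space ?D by (rule P.prob_space_distr[OF from_F[OF Y]])
  interpret DS: pair_prob_space ?D S ..
  have m: "(\<lambda>p. \<phi> (\<Phi> (fst p) (snd p))) \<in> borel_measurable (HB \<Otimes>\<^sub>M S)"
    using measurable_compose[OF map_meas \<phi>(1)] by (simp add: case_prod_beta)
  have m': "(\<lambda>p. \<phi> (\<Phi> (fst p) (snd p))) \<in> borel_measurable (?D \<Otimes>\<^sub>M S)"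
    using m by (simp add: measurable_cong_sets[OF sets_pair_measure_cong[OF sets_distr refl] refl])
  have i: "integrable (?D \<Otimes>\<^sub>M S) (\<lambda>p. \<phi> (\<Phi> (fst p) (snd p)))"
  proof (rule DS.integrable_const_bound[of _ B, OF AE_I2 m'])
    fix p assume "p \<in> space (?D \<Otimes>\<^sub>M S)"
    then have "(case p of (y, z) \<Rightarrow> \<Phi> y z) \<in> H"
      using measurable_space[OF map_meas, of p] by (simp add: space_pair_measure)
    from \<phi>(2)[OF this] show "norm (\<phi> (\<Phi> (fst p) (snd p))) \<le> B" by (simp add: case_prod_beta)
  qed
  have "(\<integral>\<omega>. \<phi> (\<Phi> (Y \<omega>) (s m \<omega>)) \<partial>P) = (\<integral>p. \<phi> (\<Phi> (fst p) (snd p)) \<partial>distr P (HB \<Otimes>\<^sub>M S) (\<lambda>\<omega>. (Y \<omega>, s m \<omega>)))"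
    by (subst integral_distr[OF measurable_Pair[OF from_F[OF Y] s_measurable] m]) simp
  also have "\<dots> = (\<integral>y. (\<integral>z. \<phi> (\<Phi> y z) \<partial>S) \<partial>?D)"
    unfolding pair_law[OF Y] using DS.integral_fst'[OF i] by simp
  also have "\<dots> = (\<integral>\<omega>. transition \<phi> (Y \<omega>) \<partial>P)"
    unfolding transition_def[symmetric] by (rule integral_distr[OF from_F[OF Y] transition_measurable[OF \<phi>(1)]])
  finally show ?thesis .
qed

text \<open>The last step is integrated out first, which replaces \<phi> by its transition; hence
  the induction over varying \<phi> and the use of \<open>iter_Suc2\<close>.\<close>

lemma integral_chain:
  fixes \<phi> :: "'h \<Rightarrow> real"
  assumes x: "x \<in> H"
  shows "\<phi> \<in> borel_measurable HB \<Longrightarrow> (\<And>x. x \<in> H \<Longrightarrow> \<bar>\<phi> x\<bar> \<le> B) \<Longrightarrow> (\<integral>\<omega>. \<phi> (chain x m \<omega>) \<partial>P) = iter m \<phi> x"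
proof (induction m arbitrary: \<phi>)
  case (Suc m)
  have "(\<integral>\<omega>. \<phi> (chain x (Suc m) \<omega>) \<partial>P) = (\<integral>\<omega>. transition \<phi> (chain x m \<omega>) \<partial>P)"
    using integral_step[OF chain_adapted[OF x] Suc.prems] by simp
  also have "\<dots> = iter m (transition \<phi>) x"
    by (rule Suc.IH[OF transition_measurable[OF Suc.prems(1)] transition_bounded[OF Suc.prems]])
  finally show ?case by (simp only: iter_Suc2)
qed (simp add: P.prob_space)

lemma map_second_moment:
  assumes y: "y \<in> H"
  shows "(\<integral>\<^sup>+z. ennreal ((norm (\<Phi> y z))\<^sup>2) \<partial>S) \<le> ennreal (2 * (norm y)\<^sup>2 + 2 * C0)"
proof -
  have "(\<integral>\<^sup>+z. ennreal ((norm (\<Phi> y z - \<Phi> 0 z))\<^sup>2) \<partial>S) \<le> ennreal ((norm y)\<^sup>2)"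
    using \<rho> by (intro order_trans[OF contr[OF y H_zero]] ennreal_leI) (simp add: mult_left_le_one_le)
  from nn_integral_norm_add_sq_le[OF measurable_HB_diff[OF map_measurable_snd[OF y] map_measurable_snd[OF H_zero]] map_measurable_snd[OF H_zero] zero_less_one _ C0(1) this C0(2)]
  show ?thesis by simp
qed

text \<open>Finite second moments are what makes the noise at the random point of the chain a limit
  in mean square over the probability space (\<open>part_step_noise\<close>).\<close>

lemma chain_second_moment:
  assumes x: "x \<in> H"
  shows "(\<integral>\<^sup>+\<omega>. ennreal ((norm (chain x m \<omega>))\<^sup>2) \<partial>P) < \<infinity>"
proof (induction m)
  case 0
  then show ?case by (simp add: P.emeasure_space_1)
next
  case (Suc m)
  have c: "chain x m \<in> F m \<rightarrow>\<^sub>M HB" by (rule chain_adapted[OF x])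
  have "(\<lambda>(y, z). ennreal ((norm (\<Phi> y z))\<^sup>2)) \<in> borel_measurable (HB \<Otimes>\<^sub>M S)"
    using sq_measurable[OF map_meas] by (simp add: case_prod_beta)
  from nn_integral_pair[OF c this]
  have "(\<integral>\<^sup>+\<omega>. ennreal ((norm (chain x (Suc m) \<omega>))\<^sup>2) \<partial>P) = (\<integral>\<^sup>+\<omega>. (\<integral>\<^sup>+z. ennreal ((norm (\<Phi> (chain x m \<omega>) z))\<^sup>2) \<partial>S) \<partial>P)" by simp
  also have "\<dots> \<le> (\<integral>\<^sup>+\<omega>. 2 * ennreal ((norm (chain x m \<omega>))\<^sup>2) + ennreal (2 * C0) \<partial>P)"
  proof (rule nn_integral_mono)
    fix \<omega> assume "\<omega> \<in> space P"
    then have "chain x m \<omega> \<in> H" by (rule measurable_HB_in[OF from_F[OF c]])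
    from map_second_moment[OF this] C0(1)
    show "(\<integral>\<^sup>+z. ennreal ((norm (\<Phi> (chain x m \<omega>) z))\<^sup>2) \<partial>S) \<le> 2 * ennreal ((norm (chain x m \<omega>))\<^sup>2) + ennreal (2 * C0)"
      by (simp add: ennreal_plus ennreal_mult)
  qed
  also have "\<dots> = (\<integral>\<^sup>+\<omega>. 2 * ennreal ((norm (chain x m \<omega>))\<^sup>2) \<partial>P) + (\<integral>\<^sup>+\<omega>. ennreal (2 * C0) \<partial>P)"
    using sq_measurable[OF from_F[OF c]] by (intro nn_integral_add borel_measurable_times) auto
  also have "\<dots> = 2 * (\<integral>\<^sup>+\<omega>. ennreal ((norm (chain x m \<omega>))\<^sup>2) \<partial>P) + ennreal (2 * C0)"
    using sq_measurable[OF from_F[OF c]] by (subst nn_integral_cmult) (auto simp: P.emeasure_space_1)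
  also have "\<dots> < \<infinity>" using Suc.IH by (simp add: ennreal_mult_less_top ennreal_add_less_top)
  finally show ?case .
qed

end

section \<open>The increments of a Wiener process\<close>

lemma (in prob_space) centered_normal_moments:
  assumes \<sigma>: "0 < \<sigma>" and D: "distributed M lborel X (\<lambda>r. ennreal (normal_density 0 \<sigma> r))"
  shows "integrable M X" "expectation X = 0" "integrable M (\<lambda>\<omega>. X \<omega> * X \<omega>)" "expectation (\<lambda>\<omega>. X \<omega> * X \<omega>) = \<sigma>\<^sup>2"
proof -
  show 1: "integrable M X"
    by (rule distributed_integrable_var[OF D normal_density_nonneg integrable_normal_moment_nz_1[OF \<sigma>]])
  show 2: "expectation X = 0" by (rule normal_distributed_expectation[OF \<sigma> D])
  show "integrable M (\<lambda>\<omega>. X \<omega> * X \<omega>)"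
    using distributed_integrable[OF D, of "\<lambda>x. x * x"] integrable_normal_moment[OF \<sigma>, of 0 2] by (simp add: power2_eq_square)
  show "expectation (\<lambda>\<omega>. X \<omega> * X \<omega>) = \<sigma>\<^sup>2"
    using normal_distributed_variance[OF \<sigma> D] 2 by (simp add: power2_eq_square)
qed

locale wiener_steps = onb_space H e + P: prob_space P
  for H :: "'h::{real_inner, banach} set" and e and P :: "'w measure" +
  fixes \<F> :: "real \<Rightarrow> 'w measure" and W :: "real \<Rightarrow> 'w \<Rightarrow> 'h" and \<kappa> :: "nat \<Rightarrow> real" and \<tau> :: real
  assumes filt: "filtered_prob_space P \<F>" and wiener: "Q_wiener_process P \<F> H e \<kappa> W"
    and \<kappa>_pos: "\<And>k. \<kappa> k > 0" and step_pos: "\<tau> > 0"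
begin

definition dW :: "nat \<Rightarrow> 'w \<Rightarrow> 'h" where
  "dW m \<omega> = W (real (Suc m) * \<tau>) \<omega> - W (real m * \<tau>) \<omega>"

definition F :: "nat \<Rightarrow> 'w measure" where "F m = \<F> (real m * \<tau>)"

text \<open>These are almost surely the increments of the Brownian motions. They are read off from W
  because the Brownian motions are merely some family given by existence, without a link to the
  filtration, while W is adapted.\<close>

definition s :: "nat \<Rightarrow> 'w \<Rightarrow> nat \<Rightarrow> real" where
  "s m \<omega> k = inner (dW m \<omega>) (e k) / sqrt (\<kappa> k)"

definition S :: "(nat \<Rightarrow> real) measure" where
  "S = (\<Pi>\<^sub>M k\<in>UNIV. density lborel (\<lambda>r. ennreal (normal_density 0 (sqrt \<tau>) r)))"

abbreviation seq_borel :: "(nat \<Rightarrow> real) measure" where "seq_borel \<equiv> \<Pi>\<^sub>M k\<in>UNIV. borel"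

lemma sets_S: "sets S = sets seq_borel"
  unfolding S_def by (rule sets_PiM_cong) auto

lemma coord_S: "(\<lambda>z. z k) \<in> borel_measurable S"
  unfolding measurable_cong_sets[OF sets_S refl] by (rule measurable_component_singleton) simp

lemma times: "0 \<le> real m * \<tau>" "real m * \<tau> < real (Suc m) * \<tau>" "real (Suc m) * \<tau> - real m * \<tau> = \<tau>"
  using step_pos by (auto simp: algebra_simps)

lemma F_sub: "subalgebra P (F m)"
  using filt times by (auto simp: F_def filtered_prob_space_def)

lemma F_incr: "sets (F m) \<subseteq> sets (F (Suc m))"
proof -
  have "\<And>s t. 0 \<le> s \<and> s \<le> t \<longrightarrow> sets (\<F> s) \<subseteq> sets (\<F> t)" using filt by (simp add: filtered_prob_space_def)
  then show ?thesis unfolding F_def using times(1,2)[of m] by (meson less_imp_le)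
qed

lemma W_adapted: "W (real m * \<tau>) \<in> F m \<rightarrow>\<^sub>M HB"
  using wiener times(1)[of m] unfolding Q_wiener_process_def F_def by blast

lemma dW_adapted: "dW m \<in> F (Suc m) \<rightarrow>\<^sub>M HB"
proof -
  have "space (F m) = space (F (Suc m))" using F_sub[of m] F_sub[of "Suc m"] by (simp add: subalgebra_def)
  then have "W (real m * \<tau>) \<in> F (Suc m) \<rightarrow>\<^sub>M HB"
    using W_adapted[of m] measurable_mono[OF order_refl refl F_incr[of m], of HB] by auto
  from measurable_HB_diff[OF W_adapted[of "Suc m"] this] show ?thesis by (simp add: dW_def[abs_def])
qed

text \<open>Writing \<open>s m\<close> as a fixed Borel function of the increment transfers
  adaptedness and independence of the past from W.\<close>

definition scaled_coords :: "'h \<Rightarrow> nat \<Rightarrow> real" where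
  "scaled_coords u k = inner u (e k) / sqrt (\<kappa> k)"

lemma scaled_coords_measurable: "scaled_coords \<in> borel \<rightarrow>\<^sub>M S"
proof -
  have "(\<lambda>u k. inner u (e k) / sqrt (\<kappa> k)) \<in> borel \<rightarrow>\<^sub>M seq_borel"
    by (rule measurable_PiM_single') (auto intro!: borel_measurable_continuous_onI continuous_intros simp: \<kappa>_pos less_imp_neq[THEN not_sym])
  then show ?thesis unfolding scaled_coords_def[abs_def] measurable_cong_sets[OF refl sets_S] .
qed

lemma s_eq: "s m \<omega> = scaled_coords (dW m \<omega>)"
  by (rule ext) (simp add: s_def scaled_coords_def)

lemma s_adapted: "s m \<in> F (Suc m) \<rightarrow>\<^sub>M S"
  using measurable_compose[OF measurable_HB_imp[OF dW_adapted] scaled_coords_measurable]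
  by (simp add: s_eq[abs_def])

lemma s_measurable: "s m \<in> P \<rightarrow>\<^sub>M S"
  by (rule measurable_from_subalg[OF F_sub s_adapted])

lemma s_indep:
  assumes A: "A \<in> sets (F m)" and B: "B \<in> sets S"
  shows "P.prob (A \<inter> (s m -` B \<inter> space P)) = P.prob A * P.prob (s m -` B \<inter> space P)"
proof (rule P.indep_setD[OF _ A])
  show "P.indep_set (sets (F m)) {(\<lambda>\<omega>. W (real (Suc m) * \<tau>) \<omega> - W (real m * \<tau>) \<omega>) -` B \<inter> space P | B. B \<in> sets borel}"
    using wiener times(1,2)[of m] unfolding Q_wiener_process_def F_def by (meson less_imp_le)
  have "scaled_coords -` B \<in> sets borel" using measurable_sets[OF scaled_coords_measurable B] by simp
  moreover have "s m -` B \<inter> space P = (\<lambda>\<omega>. W (real (Suc m) * \<tau>) \<omega> - W (real m * \<tau>) \<omega>) -` (scaled_coords -` B) \<inter> space P"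
    by (auto simp: s_eq dW_def)
  ultimately show "s m -` B \<inter> space P \<in> {(\<lambda>\<omega>. W (real (Suc m) * \<tau>) \<omega> - W (real m * \<tau>) \<omega>) -` B \<inter> space P | B. B \<in> sets borel}"
    by blast
qed

lemma coord_of_sums:
  assumes "(\<lambda>k. c k *\<^sub>R e k) sums w"
  shows "inner w (e k) = c k"
proof (rule LIMSEQ_unique)
  show "(\<lambda>n. inner (\<Sum>j<n. c j *\<^sub>R e j) (e k)) \<longlonglongrightarrow> inner w (e k)"
    using assms unfolding sums_def by (intro tendsto_intros)
  have "\<forall>\<^sub>F n in sequentially. inner (\<Sum>j<n. c j *\<^sub>R e j) (e k) = c k"
    using eventually_gt_at_top[of k] by eventually_elim (simp add: inner_sum_e)
  then show "(\<lambda>n. inner (\<Sum>j<n. c j *\<^sub>R e j) (e k)) \<longlonglongrightarrow> c k" by (rule tendsto_eventually)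
qed

text \<open>The expansion of W in Brownian motions holds almost surely at each fixed time; applied
  at both ends of the step it identifies the coordinates of the increment, whose law is then the
  product S of centred normal laws of variance \<tau>.\<close>

lemma increments:
  obtains inc :: "nat \<Rightarrow> 'w \<Rightarrow> real" where
    "AE \<omega> in P. s m \<omega> = (\<lambda>k. inc k \<omega>)" "P.indep_vars (\<lambda>_. borel) inc UNIV"
    "\<And>k. distributed P lborel (inc k) (\<lambda>r. ennreal (normal_density 0 (sqrt \<tau>) r))"
    "distr P S (s m) = S" "distr P S (\<lambda>\<omega> k. inc k \<omega>) = S" "(\<lambda>\<omega> k. inc k \<omega>) \<in> P \<rightarrow>\<^sub>M S"
proof -
  obtain \<beta> :: "nat \<Rightarrow> real \<Rightarrow> 'w \<Rightarrow> real" where \<beta>: "\<And>k. brownian_motion P (\<beta> k)"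
      "P.indep_vars (\<lambda>_. \<Pi>\<^sub>M t\<in>{0..}. borel) (\<lambda>k \<omega>. \<lambda>t\<in>{0..}. \<beta> k t \<omega>) UNIV"
      "\<And>t. t \<ge> 0 \<Longrightarrow> AE \<omega> in P. (\<lambda>k. (sqrt (\<kappa> k) * \<beta> k t \<omega>) *\<^sub>R e k) sums W t \<omega>"
    using wiener unfolding Q_wiener_process_def by blast
  let ?a = "real m * \<tau>" and ?b = "real (Suc m) * \<tau>"
  define inc where "inc k \<omega> = \<beta> k ?b \<omega> - \<beta> k ?a \<omega>" for k \<omega>
  have t: "0 \<le> ?a" "?a < ?b" "0 \<le> ?b" using times(1,2)[of m] by linarith+
  have ae: "AE \<omega> in P. s m \<omega> = (\<lambda>k. inc k \<omega>)"
    using \<beta>(3)[OF t(1)] \<beta>(3)[OF t(3)]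
  proof eventually_elim
    case (elim \<omega>)
    have "s m \<omega> k = inc k \<omega>" for k
      using coord_of_sums[OF elim(1), of k] coord_of_sums[OF elim(2), of k] \<kappa>_pos[of k]
      by (simp add: s_def dW_def inc_def inner_diff_left right_diff_distrib[symmetric])
    then show ?case by blast
  qed
  have ind: "P.indep_vars (\<lambda>_. borel) inc UNIV"
  proof -
    have "(\<lambda>p. p ?b - p ?a :: real) \<in> borel_measurable (\<Pi>\<^sub>M t\<in>{0..}. borel)"
      using t by (intro borel_measurable_diff measurable_component_singleton) auto
    from P.indep_vars_compose2[OF \<beta>(2), of "\<lambda>_ p. p ?b - p ?a" "\<lambda>_. borel", OF this]
    show ?thesis using t by (simp add: inc_def[abs_def])
  qed
  have dist: "distributed P lborel (inc k) (\<lambda>r. ennreal (normal_density 0 (sqrt \<tau>) r))" for k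
  proof -
    have "\<And>s t. 0 \<le> s \<and> s < t \<longrightarrow> distributed P lborel (\<lambda>\<omega>. \<beta> k t \<omega> - \<beta> k s \<omega>) (\<lambda>r. ennreal (normal_density 0 (sqrt (t - s)) r))"
      using \<beta>(1)[of k] unfolding brownian_motion_def by blast
    from this[of ?a ?b] t show ?thesis unfolding times(3) by (simp only: inc_def[abs_def] simp_thms)
  qed
  have meas: "inc k \<in> borel_measurable P" for k using distributed_measurable[OF dist[of k]] by simp
  have m: "(\<lambda>\<omega> k. inc k \<omega>) \<in> P \<rightarrow>\<^sub>M S"
    unfolding measurable_cong_sets[OF refl sets_S] by (rule measurable_PiM_single') (auto intro: meas)
  have "distr P borel (inc k) = density lborel (\<lambda>r. ennreal (normal_density 0 (sqrt \<tau>) r))" for k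
    using distributed_distr_eq_density[OF dist[of k]] by (simp cong: distr_cong)
  then have "distr P seq_borel (\<lambda>\<omega>. \<lambda>k\<in>UNIV. inc k \<omega>) = S"
    using P.indep_vars_iff_distr_eq_PiM[where I = UNIV and M' = "\<lambda>_. borel" and X = inc, OF _ meas] ind by (simp add: S_def)
  then have d: "distr P S (\<lambda>\<omega> k. inc k \<omega>) = S"
    using distr_cong[OF refl sets_S, of P "\<lambda>\<omega> k. inc k \<omega>" "\<lambda>\<omega> k. inc k \<omega>"] by (simp add: restrict_def)
  have d2: "distr P S (s m) = S"
    using distr_cong_AE[OF refl refl ae s_measurable m] d by simp
  show ?thesis by (rule that[OF ae ind dist d2 d m])
qed

lemma s_law: "distr P S (s m) = S"
  using increments .

lemma prob_space_S: "prob_space S"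
  using P.prob_space_distr[OF s_measurable[of 0]] by (simp add: s_law)

text \<open>The moments are computed on the probability space for the Brownian increments of the
  first step, whose joint law is S.\<close>

lemma S_moments:
  "integrable S (\<lambda>z. z k)" "(\<integral>z. z k \<partial>S) = 0"
  "integrable S (\<lambda>z. z j * z k)" "(\<integral>z. z j * z k \<partial>S) = (if j = k then \<tau> else 0)"
proof -
  obtain inc :: "nat \<Rightarrow> 'w \<Rightarrow> real" where inc: "P.indep_vars (\<lambda>_. borel) inc UNIV"
    "\<And>k. distributed P lborel (inc k) (\<lambda>r. ennreal (normal_density 0 (sqrt \<tau>) r))"
    "distr P S (\<lambda>\<omega> k. inc k \<omega>) = S" "(\<lambda>\<omega> k. inc k \<omega>) \<in> P \<rightarrow>\<^sub>M S"
    using increments[of 0] by blast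
  note mom = P.centered_normal_moments[OF real_sqrt_gt_zero[OF step_pos] inc(2)]
  have transfer: "integrable S h \<longleftrightarrow> integrable P (\<lambda>\<omega>. h (\<lambda>k. inc k \<omega>))" "(\<integral>z. h z \<partial>S) = (\<integral>\<omega>. h (\<lambda>k. inc k \<omega>) \<partial>P)"
    if "h \<in> borel_measurable S" for h :: "(nat \<Rightarrow> real) \<Rightarrow> real"
    using integrable_distr_eq[OF inc(4) that] integral_distr[OF inc(4) that] by (simp_all add: inc(3))
  have c2: "(\<lambda>z. z j * z k) \<in> borel_measurable S" by (intro borel_measurable_times coord_S)
  show "integrable S (\<lambda>z. z k)" "(\<integral>z. z k \<partial>S) = 0" using mom(1,2) by (simp_all add: transfer[OF coord_S])
  have "integrable P (\<lambda>\<omega>. inc j \<omega> * inc k \<omega>) \<and> (\<integral>\<omega>. inc j \<omega> * inc k \<omega> \<partial>P) = (if j = k then \<tau> else 0)"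
  proof (cases "j = k")
    case True
    then show ?thesis using mom(3,4)[of k] step_pos by simp
  next
    case False
    have "P.indep_vars (\<lambda>_. borel) inc {j, k}" by (rule P.indep_vars_subset[OF inc(1)]) simp
    from P.indep_vars_lebesgue_integral[OF _ this] P.indep_vars_integrable[OF _ this] show ?thesis
      using mom(1,2) False by simp
  qed
  then show "integrable S (\<lambda>z. z j * z k)" "(\<integral>z. z j * z k \<partial>S) = (if j = k then \<tau> else 0)"
    by (simp_all add: transfer[OF c2])
qed

end

section \<open>The Euler scheme as a Markov chain\<close>

locale euler_scheme =
  fixes \<O> :: "'a::euclidean_space set" and Q :: "'a l2 \<Rightarrow> 'a l2" and e :: "nat \<Rightarrow> 'a l2" and \<kappa> :: "nat \<Rightarrow> real"
    and P :: "'w measure" and \<F> :: "real \<Rightarrow> 'w measure" and W :: "real \<Rightarrow> 'w \<Rightarrow> 'a l2"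
    and f g :: "real \<Rightarrow> real" and G :: "'a l2 \<Rightarrow> 'a l2 \<Rightarrow> 'a l2" and L\<^sub>1 L\<^sub>6 L\<^sub>7 L\<^sub>8 \<tau> :: real
  assumes domain: "open \<O>" "bounded \<O>" "\<O> \<noteq> {}"
    and noise: "covariance_operator (L2 \<O>) Q e \<kappa>" "filtered_prob_space P \<F>" "Q_wiener_process P \<F> (L2 \<O>) e \<kappa> W"
    and drift: "continuous_on UNIV f" "\<And>s t. (f s - f t) * (s - t) \<le> L\<^sub>1 * (s - t)\<^sup>2"
    and diffusion: "diffusion_condition \<O> e \<kappa> g G L\<^sub>6 L\<^sub>7 L\<^sub>8"
    and dissipative: "L\<^sub>1 + L\<^sub>6 / 2 < first_eigenvalue \<O>"
    and step: "0 < \<tau>" "\<tau> < 1"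
begin

abbreviation H :: "'a l2 set" where "H \<equiv> L2 \<O>"

lemma onb: "orthonormal_basis H e"
  using noise(1) by (simp add: covariance_operator_def)

lemma L6_nonneg: "0 \<le> L\<^sub>6"
  using diffusion by (simp add: diffusion_condition_def)

lemma eigenvalue_pos: "\<kappa> k > 0"
proof -
  interpret onb_space H e by (unfold_locales) (rule onb)
  have "e k \<noteq> 0" using norm_e[of k] by auto
  moreover have "\<forall>u\<in>H. u \<noteq> 0 \<longrightarrow> inner (Q u) u > 0" "Q (e k) = \<kappa> k *\<^sub>R e k"
    using noise(1) unfolding covariance_operator_def by blast+
  ultimately have "0 < inner (Q (e k)) (e k)" using e_in[of k] by blast
  then have "0 < inner (\<kappa> k *\<^sub>R e k) (e k)" by (simp only: \<open>Q (e k) = \<kappa> k *\<^sub>R e k\<close>)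
  then show ?thesis by (simp add: e_orth)
qed

sublocale ds: drift_step \<O> f L\<^sub>1 \<tau>
proof
  show "L\<^sub>1 < first_eigenvalue \<O>" using dissipative L6_nonneg by linarith
qed (rule domain drift step)+

sublocale ws: wiener_steps H e P \<F> W \<kappa> \<tau>
proof -
  interpret P: prob_space P using noise(2) by (simp add: filtered_prob_space_def)
  show "wiener_steps H e P \<F> W \<kappa> \<tau>"
    by unfold_locales (rule onb noise eigenvalue_pos step)+
qed

section \<open>The diffusion coefficient on the basis of the noise\<close>

lemma sqrt_Q_sum: "sqrt_Q e \<kappa> (\<Sum>k<n. c k *\<^sub>R e k) = (\<Sum>k<n. (sqrt (\<kappa> k) * c k) *\<^sub>R e k)"
proof -
  have "sqrt_Q e \<kappa> (\<Sum>k<n. c k *\<^sub>R e k) = (\<Sum>k<n. (sqrt (\<kappa> k) * inner (\<Sum>k<n. c k *\<^sub>R e k) (e k)) *\<^sub>R e k)"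
    unfolding sqrt_Q_def by (rule suminf_finite) (auto simp: ws.inner_sum_e)
  also have "\<dots> = (\<Sum>k<n. (sqrt (\<kappa> k) * c k) *\<^sub>R e k)"
    by (rule sum.cong) (auto simp: ws.inner_sum_e)
  finally show ?thesis .
qed

text \<open>Linearity of \<open>G x\<close> is known on the range of Q^(1/2) only. Finite
  combinations of the basis lie there because all eigenvalues are positive.\<close>

lemma sum_in_H0: "(\<Sum>k<n. c k *\<^sub>R e k) \<in> H0 H e \<kappa>"
proof -
  have "(\<Sum>k<n. c k *\<^sub>R e k) = sqrt_Q e \<kappa> (\<Sum>k<n. (c k / sqrt (\<kappa> k)) *\<^sub>R e k)"
    unfolding sqrt_Q_sum using eigenvalue_pos by (intro sum.cong) (auto simp: less_imp_neq[THEN not_sym])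
  moreover have "(\<Sum>k<n. (c k / sqrt (\<kappa> k)) *\<^sub>R e k) \<in> H" by (intro ws.H_sum ws.H_scale ws.e_in)
  ultimately show ?thesis unfolding H0_def by blast
qed

lemma e_as_sum: "c *\<^sub>R e k = (\<Sum>j<Suc k. (if j = k then c else 0) *\<^sub>R e j)"
proof -
  have "(\<Sum>j<Suc k. (if j = k then c else 0) *\<^sub>R e j) = (\<Sum>j<Suc k. if j = k then c *\<^sub>R e j else 0)"
    by (rule sum.cong) auto
  also have "\<dots> = c *\<^sub>R e k" by simp
  finally show ?thesis by (rule sym)
qed

lemma e_in_H0: "c *\<^sub>R e k \<in> H0 H e \<kappa>"
  by (subst e_as_sum) (rule sum_in_H0)

lemma sqrt_Q_e: "sqrt_Q e \<kappa> (e k) = sqrt (\<kappa> k) *\<^sub>R e k"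
proof -
  have "sqrt_Q e \<kappa> (e k) = (\<Sum>j<Suc k. (sqrt (\<kappa> j) * (if j = k then 1 else 0)) *\<^sub>R e j)"
    using e_as_sum[of 1 k] sqrt_Q_sum[where n = "Suc k" and c = "\<lambda>j. if j = k then 1 else 0"] by simp
  also have "\<dots> = (\<Sum>j<Suc k. (if j = k then sqrt (\<kappa> k) else 0) *\<^sub>R e j)"
    by (rule sum.cong) auto
  also have "\<dots> = sqrt (\<kappa> k) *\<^sub>R e k" by (rule e_as_sum[symmetric])
  finally show ?thesis .
qed

lemma G_L20: "x \<in> H \<Longrightarrow> G x \<in> L20 H e \<kappa>"
  using diffusion by (simp add: diffusion_condition_def)

lemma G_linear: "x \<in> H \<Longrightarrow> linear_between (H0 H e \<kappa>) H (G x)"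
  using G_L20 by (simp add: L20_def)

lemma G_scale: "x \<in> H \<Longrightarrow> G x (c *\<^sub>R e k) = c *\<^sub>R G x (e k)"
  using G_linear[of x] e_in_H0[of 1 k] by (simp add: linear_between_def)

lemma G_sum:
  assumes x: "x \<in> H"
  shows "G x (\<Sum>k<n. c k *\<^sub>R e k) = (\<Sum>k<n. c k *\<^sub>R G x (e k))"
proof (induction n)
  case 0
  have "G x (0 *\<^sub>R e 0) = 0 *\<^sub>R G x (e 0)" by (rule G_scale[OF x])
  then show ?case by simp
next
  case (Suc n)
  have "G x ((\<Sum>k<n. c k *\<^sub>R e k) + c n *\<^sub>R e n) = G x (\<Sum>k<n. c k *\<^sub>R e k) + G x (c n *\<^sub>R e n)"
    using G_linear[OF x] sum_in_H0[of c n] e_in_H0[of "c n" n] unfolding linear_between_def by blast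
  then show ?case by (simp add: Suc.IH G_scale[OF x])
qed

text \<open>The values of \<open>G x\<close> on the orthonormal basis Q^(1/2) e_k of
  \<open>H0\<close> (\<open>gk_eq\<close>); their squared norms sum to the squared Hilbert-Schmidt
  norm.\<close>

definition gk :: "nat \<Rightarrow> 'a l2 \<Rightarrow> 'a l2" where
  "gk k x = sqrt (\<kappa> k) *\<^sub>R G x (e k)"

lemma gk_eq: "x \<in> H \<Longrightarrow> G x (sqrt_Q e \<kappa> (e k)) = gk k x"
  by (simp add: sqrt_Q_e G_scale gk_def)

lemma gk_in: "x \<in> H \<Longrightarrow> gk k x \<in> H"
  using G_linear[of x] e_in_H0[of 1 k] unfolding gk_def linear_between_def by (intro ws.H_scale) auto

lemma gk_summable: "x \<in> H \<Longrightarrow> summable (\<lambda>k. (norm (gk k x))\<^sup>2)"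
  using G_L20[of x] by (simp add: L20_def gk_eq)

lemma gk_growth: "x \<in> H \<Longrightarrow> (\<Sum>k. (norm (gk k x))\<^sup>2) \<le> L\<^sub>7 * (norm x)\<^sup>2 + L\<^sub>8"
proof -
  assume x: "x \<in> H"
  have "(L20_norm e \<kappa> (G x))\<^sup>2 = (\<Sum>k. (norm (gk k x))\<^sup>2)"
    unfolding L20_norm_def using suminf_nonneg[OF gk_summable[OF x]] by (simp add: gk_eq[OF x])
  moreover have "(L20_norm e \<kappa> (G x))\<^sup>2 \<le> L\<^sub>7 * (norm x)\<^sup>2 + L\<^sub>8"
    using diffusion x by (simp add: diffusion_condition_def)
  ultimately show ?thesis by simp
qed

lemma gk_lipschitz:
  assumes x: "x \<in> H" and y: "y \<in> H"
  shows "(\<Sum>k<n. (norm (gk k x - gk k y))\<^sup>2) \<le> L\<^sub>6 * (norm (x - y))\<^sup>2"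
proof -
  have s: "summable (\<lambda>k. (norm (gk k x - gk k y))\<^sup>2)"
  proof (rule summable_comparison_test)
    show "summable (\<lambda>k. 2 * (norm (gk k x))\<^sup>2 + 2 * (norm (gk k y))\<^sup>2)"
      by (intro summable_add summable_mult gk_summable x y)
    have "(norm (gk k x - gk k y))\<^sup>2 \<le> 2 * (norm (gk k x))\<^sup>2 + 2 * (norm (gk k y))\<^sup>2" for k
      using norm_add_sq_le[OF zero_less_one, of "gk k x" "- gk k y"] by simp
    then show "\<exists>N. \<forall>k\<ge>N. norm ((norm (gk k x - gk k y))\<^sup>2) \<le> 2 * (norm (gk k x))\<^sup>2 + 2 * (norm (gk k y))\<^sup>2" by simp
  qed
  have "(L20_norm e \<kappa> (\<lambda>u. G x u - G y u))\<^sup>2 = (\<Sum>k. (norm (gk k x - gk k y))\<^sup>2)"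
    unfolding L20_norm_def using suminf_nonneg[OF s] by (simp add: gk_eq x y)
  moreover have "(L20_norm e \<kappa> (\<lambda>u. G x u - G y u))\<^sup>2 \<le> L\<^sub>6 * (norm (x - y))\<^sup>2"
    using diffusion x y by (simp add: diffusion_condition_def)
  moreover have "(\<Sum>k<n. (norm (gk k x - gk k y))\<^sup>2) \<le> (\<Sum>k. (norm (gk k x - gk k y))\<^sup>2)"
    by (rule sum_le_suminf[OF s]) auto
  ultimately show ?thesis by simp
qed

text \<open>A single term of the Hilbert-Schmidt bound; continuity provides the measurability of the
  noise in its starting point.\<close>

lemma gk_continuous: "continuous_on H (gk k)"
proof (rule lipschitz_on_continuous_on, rule lipschitz_onI)
  fix x y assume xy: "x \<in> H" "y \<in> H"
  have "(norm (gk k x - gk k y))\<^sup>2 \<le> (\<Sum>k<Suc k. (norm (gk k x - gk k y))\<^sup>2)"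
    by (rule member_le_sum) auto
  also have "\<dots> \<le> L\<^sub>6 * (norm (x - y))\<^sup>2" by (rule gk_lipschitz[OF xy])
  also have "\<dots> = (sqrt L\<^sub>6 * norm (x - y))\<^sup>2" using L6_nonneg by (simp add: power_mult_distrib)
  finally have "norm (gk k x - gk k y) \<le> sqrt L\<^sub>6 * norm (x - y)"
    by (rule power2_le_imp_le) (use L6_nonneg in simp)
  then show "dist (gk k x) (gk k y) \<le> sqrt L\<^sub>6 * dist x y" by (simp add: dist_norm)
qed (use L6_nonneg in simp)

sublocale ni: noise_integral H e ws.S \<tau> gk
proof -
  interpret S: prob_space ws.S by (rule ws.prob_space_S)
  show "noise_integral H e ws.S \<tau> gk"
    by unfold_locales (rule step ws.S_moments ws.coord_S gk_continuous gk_in gk_summable; assumption?)+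
qed

section \<open>The random map of one Euler step\<close>

definition \<Phi> :: "'a l2 \<Rightarrow> (nat \<Rightarrow> real) \<Rightarrow> 'a l2" where
  "\<Phi> x z = ds.resolvent (x + ni.noise x z)"

definition \<rho> :: real where
  "\<rho> = (1 + \<tau> * L\<^sub>6) / (1 + 2 * \<tau> * (ds.lam - L\<^sub>1))"

lemma denominator_pos: "0 < 1 + 2 * \<tau> * (ds.lam - L\<^sub>1)"
  using step ds.L_less by (intro add_pos_nonneg mult_nonneg_nonneg) auto

lemma resolvent_measurable: "h \<in> M \<rightarrow>\<^sub>M ws.HB \<Longrightarrow> (\<lambda>\<omega>. ds.resolvent (h \<omega>)) \<in> M \<rightarrow>\<^sub>M ws.HB"
proof (erule ws.measurable_HB_continuous)
  have "1-lipschitz_on H ds.resolvent"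
    by (rule lipschitz_onI) (use ds.resolvent_nonexpansive in \<open>simp_all add: dist_norm\<close>)
  then show "continuous_on H ds.resolvent" by (rule lipschitz_on_continuous_on)
qed (rule ds.resolvent_L2)

lemma \<Phi>_measurable: "(\<lambda>(y, z). \<Phi> y z) \<in> ws.HB \<Otimes>\<^sub>M ws.S \<rightarrow>\<^sub>M ws.HB"
proof -
  have "(\<lambda>p. ds.resolvent (fst p + ni.noise (fst p) (snd p))) \<in> ws.HB \<Otimes>\<^sub>M ws.S \<rightarrow>\<^sub>M ws.HB"
    using ni.noise_measurable by (intro resolvent_measurable ws.measurable_HB_add measurable_fst) (simp add: case_prod_beta)
  then show ?thesis by (simp add: \<Phi>_def case_prod_beta)
qed

lemma \<Phi>_contraction:
  assumes x: "x \<in> H" and y: "y \<in> H"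
  shows "(\<integral>\<^sup>+z. ennreal ((norm (\<Phi> x z - \<Phi> y z))\<^sup>2) \<partial>ws.S) \<le> ennreal (\<rho> * (norm (x - y))\<^sup>2)"
proof -
  let ?c = "1 + 2 * \<tau> * (ds.lam - L\<^sub>1)"
  let ?d = "\<lambda>z. (x - y) + (ni.noise x z - ni.noise y z)"
  have c: "0 < ?c" by (rule denominator_pos)
  have m: "(\<lambda>z. ennreal ((norm (?d z))\<^sup>2)) \<in> borel_measurable ws.S"
    by (intro ws.sq_measurable ws.measurable_HB_add ws.measurable_HB_diff ws.measurable_HB_const ni.noise_measurable_snd x y)
  have "(\<integral>\<^sup>+z. ennreal ((norm (\<Phi> x z - \<Phi> y z))\<^sup>2) \<partial>ws.S) \<le> (\<integral>\<^sup>+z. ennreal (1 / ?c) * ennreal ((norm (?d z))\<^sup>2) \<partial>ws.S)"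
  proof (rule nn_integral_mono)
    fix z
    have "x + ni.noise x z - (y + ni.noise y z) = ?d z" by simp
    then have "?c * (norm (\<Phi> x z - \<Phi> y z))\<^sup>2 \<le> (norm (?d z))\<^sup>2"
      using ds.resolvent_contraction[of "x + ni.noise x z" "y + ni.noise y z"] unfolding \<Phi>_def by presburger
    then have "(norm (\<Phi> x z - \<Phi> y z))\<^sup>2 \<le> (norm (?d z))\<^sup>2 / ?c"
      using c by (simp only: pos_le_divide_eq mult.commute[of _ "?c"])
    then have "ennreal ((norm (\<Phi> x z - \<Phi> y z))\<^sup>2) \<le> ennreal (1 / ?c * (norm (?d z))\<^sup>2)" by (intro ennreal_leI) simp
    also have "\<dots> = ennreal (1 / ?c) * ennreal ((norm (?d z))\<^sup>2)" using c by (intro ennreal_mult) auto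
    finally show "ennreal ((norm (\<Phi> x z - \<Phi> y z))\<^sup>2) \<le> ennreal (1 / ?c) * ennreal ((norm (?d z))\<^sup>2)" .
  qed
  also have "\<dots> = ennreal (1 / ?c) * (\<integral>\<^sup>+z. ennreal ((norm (?d z))\<^sup>2) \<partial>ws.S)"
    by (rule nn_integral_cmult[OF m])
  also have "\<dots> \<le> ennreal (1 / ?c) * ennreal ((norm (x - y))\<^sup>2 + \<tau> * (L\<^sub>6 * (norm (x - y))\<^sup>2))"
    by (intro mult_left_mono ni.noise_diff[OF x y ws.H_diff[OF x y]] gk_lipschitz x y) simp
  also have "\<dots> = ennreal (1 / ?c * ((norm (x - y))\<^sup>2 + \<tau> * (L\<^sub>6 * (norm (x - y))\<^sup>2)))"
    using c step L6_nonneg by (intro ennreal_mult[symmetric]) auto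
  also have "1 / ?c * ((norm (x - y))\<^sup>2 + \<tau> * (L\<^sub>6 * (norm (x - y))\<^sup>2)) = \<rho> * (norm (x - y))\<^sup>2"
    by (simp add: \<rho>_def distrib_right)
  finally show ?thesis .
qed

lemma \<rho>_bounds: "0 < \<rho>" "\<rho> < 1"
proof -
  show "0 < \<rho>" unfolding \<rho>_def using step L6_nonneg by (intro divide_pos_pos denominator_pos add_pos_nonneg) auto
  have "\<tau> * L\<^sub>6 < \<tau> * (2 * (ds.lam - L\<^sub>1))" using step dissipative by (intro mult_strict_left_mono) auto
  then have "1 + \<tau> * L\<^sub>6 < 1 + 2 * \<tau> * (ds.lam - L\<^sub>1)" by (simp add: algebra_simps)
  then show "\<rho> < 1" unfolding \<rho>_def using denominator_pos by (simp only: divide_less_eq_1_pos)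
qed

text \<open>Young's inequality with \<delta> = 1 for the sum of the resolvent at 0 and the deviation
  caused by the noise.\<close>

definition C0 :: real where
  "C0 = 2 * (norm (ds.resolvent 0))\<^sup>2 + 2 * (\<tau> * ni.tail 0 0)"

lemma C0_bounds: "0 \<le> C0" "(\<integral>\<^sup>+z. ennreal ((norm (\<Phi> 0 z))\<^sup>2) \<partial>ws.S) \<le> ennreal C0"
proof -
  have t: "0 \<le> \<tau> * ni.tail 0 0" using step ni.tail_nonneg[OF ws.H_zero, of 0] by simp
  then show "0 \<le> C0" by (simp add: C0_def)
  have m0: "\<Phi> 0 \<in> ws.S \<rightarrow>\<^sub>M ws.HB" unfolding \<Phi>_def[abs_def]
    by (intro resolvent_measurable ws.measurable_HB_add ws.measurable_HB_const ws.H_zero ni.noise_measurable_snd)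
  have mr: "(\<lambda>_. ds.resolvent 0) \<in> ws.S \<rightarrow>\<^sub>M ws.HB" by (rule ws.measurable_HB_const[OF ds.resolvent_L2])
  have "(\<integral>\<^sup>+z. ennreal ((norm (\<Phi> 0 z - ds.resolvent 0))\<^sup>2) \<partial>ws.S) \<le> (\<integral>\<^sup>+z. ennreal ((norm (ni.noise 0 z))\<^sup>2) \<partial>ws.S)"
    using ds.resolvent_nonexpansive[of _ 0]
    by (intro nn_integral_mono ennreal_leI power_mono) (simp_all add: \<Phi>_def)
  also have "\<dots> \<le> ennreal (\<tau> * ni.tail 0 0)" by (rule ni.noise_second_moment[OF ws.H_zero])
  finally have 2: "(\<integral>\<^sup>+z. ennreal ((norm (\<Phi> 0 z - ds.resolvent 0))\<^sup>2) \<partial>ws.S) \<le> ennreal (\<tau> * ni.tail 0 0)" .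
  have 1: "(\<integral>\<^sup>+z. ennreal ((norm (ds.resolvent 0))\<^sup>2) \<partial>ws.S) \<le> ennreal ((norm (ds.resolvent 0))\<^sup>2)"
    by (simp add: prob_space.emeasure_space_1[OF ws.prob_space_S])
  show "(\<integral>\<^sup>+z. ennreal ((norm (\<Phi> 0 z))\<^sup>2) \<partial>ws.S) \<le> ennreal C0"
    using ws.nn_integral_norm_add_sq_le[OF mr ws.measurable_HB_diff[OF m0 mr] zero_less_one _ t 1 2] by (simp add: C0_def)
qed

sublocale dc: driven_chain H e ws.S \<Phi> \<rho> C0 P ws.F ws.s
  by unfold_locales
    (rule \<Phi>_measurable \<Phi>_contraction \<rho>_bounds C0_bounds ws.F_sub ws.F_incr ws.s_adapted ws.s_law ws.s_indep; assumption?)+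


text \<open>The square root of the eigenvalue is divided out in \<open>ws.s\<close> and multiplied
  back in \<open>gk\<close>.\<close>

lemma part_eq: "y \<in> H \<Longrightarrow> G y (\<Sum>k<n. inner (ws.dW m \<omega>) (e k) *\<^sub>R e k) = ni.part n y (ws.s m \<omega>)"
  using eigenvalue_pos by (simp add: G_sum ni.part_def ws.s_def gk_def less_imp_neq[THEN not_sym])

definition step_noise :: "nat \<Rightarrow> ('w \<Rightarrow> 'a l2) \<Rightarrow> 'w \<Rightarrow> 'a l2" where
  "step_noise m Y \<omega> = ni.noise (Y \<omega>) (ws.s m \<omega>)"

lemma step_noise_measurable: "Y \<in> P \<rightarrow>\<^sub>M ws.HB \<Longrightarrow> step_noise m Y \<in> P \<rightarrow>\<^sub>M ws.HB"
  unfolding step_noise_def[abs_def] by (rule ni.noise_measurable_comp[OF _ ws.s_measurable])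

lemma part_measurable_comp: "Y \<in> P \<rightarrow>\<^sub>M ws.HB \<Longrightarrow> (\<lambda>\<omega>. ni.part n (Y \<omega>) (ws.s m \<omega>)) \<in> P \<rightarrow>\<^sub>M ws.HB"
  using measurable_compose[OF measurable_Pair[OF _ ws.s_measurable] ni.part_measurable] by simp

text \<open>At a frozen point the error is at most \<tau> times the tail
  (\<open>part_noise\<close>); independence allows the point to be random, and dominated convergence
  integrates the tails.\<close>

lemma part_step_noise:
  assumes Y: "Y \<in> ws.F m \<rightarrow>\<^sub>M ws.HB" and fin: "(\<integral>\<^sup>+\<omega>. ennreal ((norm (Y \<omega>))\<^sup>2) \<partial>P) < \<infinity>"
  shows "(\<lambda>n. \<integral>\<^sup>+\<omega>. ennreal ((norm (ni.part n (Y \<omega>) (ws.s m \<omega>) - step_noise m Y \<omega>))\<^sup>2) \<partial>P) \<longlonglongrightarrow> 0"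
proof -
  have YP: "Y \<in> P \<rightarrow>\<^sub>M ws.HB" by (rule dc.from_F[OF Y])
  have le: "(\<integral>\<^sup>+\<omega>. ennreal ((norm (ni.part n (Y \<omega>) (ws.s m \<omega>) - step_noise m Y \<omega>))\<^sup>2) \<partial>P) \<le> (\<integral>\<^sup>+\<omega>. ennreal (\<tau> * ni.tail (Y \<omega>) n) \<partial>P)" for n
  proof -
    have "(\<lambda>p. ni.part n (fst p) (snd p) - ni.noise (fst p) (snd p)) \<in> ws.HB \<Otimes>\<^sub>M ws.S \<rightarrow>\<^sub>M ws.HB"
      using ws.measurable_HB_diff[OF ni.part_measurable[of n] ni.noise_measurable] by (simp add: case_prod_beta)
    from ws.sq_measurable[OF this]
    have "(\<lambda>(y, z). ennreal ((norm (ni.part n y z - ni.noise y z))\<^sup>2)) \<in> borel_measurable (ws.HB \<Otimes>\<^sub>M ws.S)"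
      by (simp add: case_prod_beta)
    from dc.nn_integral_pair[OF Y this]
    have "(\<integral>\<^sup>+\<omega>. ennreal ((norm (ni.part n (Y \<omega>) (ws.s m \<omega>) - step_noise m Y \<omega>))\<^sup>2) \<partial>P)
      = (\<integral>\<^sup>+\<omega>. (\<integral>\<^sup>+z. ennreal ((norm (ni.part n (Y \<omega>) z - ni.noise (Y \<omega>) z))\<^sup>2) \<partial>ws.S) \<partial>P)"
      by (simp only: step_noise_def)
    also have "\<dots> \<le> (\<integral>\<^sup>+\<omega>. ennreal (\<tau> * ni.tail (Y \<omega>) n) \<partial>P)"
      by (intro nn_integral_mono ni.part_noise ws.measurable_HB_in[OF YP])
    finally show ?thesis .
  qed
  have [measurable]: "(\<lambda>\<omega>. norm (gk k (Y \<omega>))) \<in> borel_measurable P" for k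
    by (rule ws.measurable_HB_norm[OF measurable_compose[OF YP ni.g_measurable]])
  have [measurable]: "(\<lambda>\<omega>. ni.tail (Y \<omega>) n) \<in> borel_measurable P" for n unfolding ni.tail_def by measurable
  have [measurable]: "(\<lambda>\<omega>. norm (Y \<omega>)) \<in> borel_measurable P" by (rule ws.measurable_HB_norm[OF YP])
  have L78: "0 \<le> L\<^sub>7" "0 \<le> L\<^sub>8" using diffusion by (auto simp: diffusion_condition_def)
  have "(\<lambda>n. \<integral>\<^sup>+\<omega>. ennreal (\<tau> * ni.tail (Y \<omega>) n) \<partial>P) \<longlonglongrightarrow> (\<integral>\<^sup>+\<omega>. 0 \<partial>P)"
  proof (rule nn_integral_dominated_convergence[where w = "\<lambda>\<omega>. ennreal (\<tau> * L\<^sub>7) * ennreal ((norm (Y \<omega>))\<^sup>2) + ennreal (\<tau> * L\<^sub>8)"])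
    \<comment> \<open>The majorant comes from the growth condition (G2); it is integrable because Y
      has a finite second moment.\<close>
    show "AE \<omega> in P. ennreal (\<tau> * ni.tail (Y \<omega>) n) \<le> ennreal (\<tau> * L\<^sub>7) * ennreal ((norm (Y \<omega>))\<^sup>2) + ennreal (\<tau> * L\<^sub>8)" for n
    proof (rule AE_I2)
      fix \<omega> assume "\<omega> \<in> space P"
      then have y: "Y \<omega> \<in> H" by (rule ws.measurable_HB_in[OF YP])
      have "ni.tail (Y \<omega>) n \<le> (\<Sum>k. (norm (gk k (Y \<omega>)))\<^sup>2)" unfolding ni.tail_def by (simp add: sum_nonneg)
      also have "\<dots> \<le> L\<^sub>7 * (norm (Y \<omega>))\<^sup>2 + L\<^sub>8" by (rule gk_growth[OF y])
      finally have "\<tau> * ni.tail (Y \<omega>) n \<le> \<tau> * (L\<^sub>7 * (norm (Y \<omega>))\<^sup>2 + L\<^sub>8)" using step by (intro mult_left_mono) auto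
      then have "ennreal (\<tau> * ni.tail (Y \<omega>) n) \<le> ennreal (\<tau> * L\<^sub>7 * (norm (Y \<omega>))\<^sup>2 + \<tau> * L\<^sub>8)" by (intro ennreal_leI) (simp add: algebra_simps)
      also have "\<dots> = ennreal (\<tau> * L\<^sub>7) * ennreal ((norm (Y \<omega>))\<^sup>2) + ennreal (\<tau> * L\<^sub>8)"
        using L78 step by (subst ennreal_plus) (auto simp: ennreal_mult)
      finally show "ennreal (\<tau> * ni.tail (Y \<omega>) n) \<le> ennreal (\<tau> * L\<^sub>7) * ennreal ((norm (Y \<omega>))\<^sup>2) + ennreal (\<tau> * L\<^sub>8)" .
    qed
    have "(\<integral>\<^sup>+\<omega>. ennreal (\<tau> * L\<^sub>7) * ennreal ((norm (Y \<omega>))\<^sup>2) + ennreal (\<tau> * L\<^sub>8) \<partial>P) = (\<integral>\<^sup>+\<omega>. ennreal (\<tau> * L\<^sub>7) * ennreal ((norm (Y \<omega>))\<^sup>2) \<partial>P) + (\<integral>\<^sup>+\<omega>. ennreal (\<tau> * L\<^sub>8) \<partial>P)"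
      by (rule nn_integral_add) measurable
    also have "(\<integral>\<^sup>+\<omega>. ennreal (\<tau> * L\<^sub>7) * ennreal ((norm (Y \<omega>))\<^sup>2) \<partial>P) = ennreal (\<tau> * L\<^sub>7) * (\<integral>\<^sup>+\<omega>. ennreal ((norm (Y \<omega>))\<^sup>2) \<partial>P)"
      by (rule nn_integral_cmult) measurable
    also have "\<dots> + (\<integral>\<^sup>+\<omega>. ennreal (\<tau> * L\<^sub>8) \<partial>P) < \<infinity>"
      using fin by (simp add: ws.P.emeasure_space_1 ennreal_mult_less_top)
    finally show "(\<integral>\<^sup>+\<omega>. ennreal (\<tau> * L\<^sub>7) * ennreal ((norm (Y \<omega>))\<^sup>2) + ennreal (\<tau> * L\<^sub>8) \<partial>P) < \<infinity>" .
    show "AE \<omega> in P. (\<lambda>n. ennreal (\<tau> * ni.tail (Y \<omega>) n)) \<longlonglongrightarrow> 0"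
    proof (rule AE_I2)
      fix \<omega> assume "\<omega> \<in> space P"
      then have y: "Y \<omega> \<in> H" by (rule ws.measurable_HB_in[OF YP])
      have "(\<lambda>n. \<tau> * ni.tail (Y \<omega>) n) \<longlonglongrightarrow> \<tau> * 0" by (intro tendsto_mult tendsto_const ni.tail_tendsto y)
      then have "(\<lambda>n. ennreal (\<tau> * ni.tail (Y \<omega>) n)) \<longlonglongrightarrow> ennreal (\<tau> * 0)" by (rule tendsto_ennrealI)
      then show "(\<lambda>n. ennreal (\<tau> * ni.tail (Y \<omega>) n)) \<longlonglongrightarrow> 0" by simp
    qed
  qed measurable
  then have lim: "(\<lambda>n. \<integral>\<^sup>+\<omega>. ennreal (\<tau> * ni.tail (Y \<omega>) n) \<partial>P) \<longlonglongrightarrow> 0" by simp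
  show ?thesis
    by (rule tendsto_sandwich[OF _ _ tendsto_const lim]) (auto intro: le always_eventually)
qed

section \<open>Identification of the scheme with the driven chain\<close>

lemma solves_iff:
  "ds.solves (y + i) u \<longleftrightarrow> u \<in> H10 \<O> \<and> (\<forall>v\<in>H10 \<O>. inner u v =
     inner y v + \<tau> * dirichlet_laplacian \<O> u v + \<tau> * nemytskii \<O> f u v + inner i v)"
  unfolding ds.solves_def inner_add_left by (simp only: ac_simps)

text \<open>The constructed noise is the required mean-square limit at the current value, and the
  equation holds along every path by construction of the resolvent.\<close>

lemma chain_solution:
  assumes x: "x \<in> H"
  shows "euler_solution \<O> f G e P \<F> W \<tau> x (dc.chain x)"
  unfolding euler_solution_def
proof (intro conjI allI ballI)
  fix m
  show "dc.chain x m \<in> \<F> (real m * \<tau>) \<rightarrow>\<^sub>M ws.HB"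
    using dc.chain_adapted[OF x, of m] by (simp only: ws.F_def)
  have c: "dc.chain x m \<in> P \<rightarrow>\<^sub>M ws.HB" by (rule dc.from_F[OF dc.chain_adapted[OF x]])
  let ?I = "step_noise m (dc.chain x m)"
  have "(\<integral>\<^sup>+\<omega>. ennreal ((norm (G (dc.chain x m \<omega>) (\<Sum>k<n. inner (ws.dW m \<omega>) (e k) *\<^sub>R e k) - ?I \<omega>))\<^sup>2) \<partial>P)
    = (\<integral>\<^sup>+\<omega>. ennreal ((norm (ni.part n (dc.chain x m \<omega>) (ws.s m \<omega>) - ?I \<omega>))\<^sup>2) \<partial>P)" for n
    by (rule nn_integral_cong) (simp only: part_eq[OF ws.measurable_HB_in[OF c]])
  then have "applied_noise P H G e (ws.dW m) (dc.chain x m) ?I"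
    unfolding applied_noise_def
    using step_noise_measurable[OF c] part_step_noise[OF dc.chain_adapted[OF x] dc.chain_second_moment[OF x]] by simp
  moreover have "AE \<omega> in P. dc.chain x (Suc m) \<omega> \<in> H10 \<O> \<and> (\<forall>v\<in>H10 \<O>. inner (dc.chain x (Suc m) \<omega>) v =
     inner (dc.chain x m \<omega>) v + \<tau> * dirichlet_laplacian \<O> (dc.chain x (Suc m) \<omega>) v
     + \<tau> * nemytskii \<O> f (dc.chain x (Suc m) \<omega>) v + inner (?I \<omega>) v)"
  proof (rule AE_I2)
    fix \<omega>
    have "ds.solves (dc.chain x m \<omega> + ?I \<omega>) (dc.chain x (Suc m) \<omega>)"
      using ds.resolvent_solves by (simp only: dc.chain.simps \<Phi>_def step_noise_def)
    then show "dc.chain x (Suc m) \<omega> \<in> H10 \<O> \<and> (\<forall>v\<in>H10 \<O>. inner (dc.chain x (Suc m) \<omega>) v =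
     inner (dc.chain x m \<omega>) v + \<tau> * dirichlet_laplacian \<O> (dc.chain x (Suc m) \<omega>) v
     + \<tau> * nemytskii \<O> f (dc.chain x (Suc m) \<omega>) v + inner (?I \<omega>) v)" by (rule solves_iff[THEN iffD1])
  qed
  ultimately show "\<exists>I. applied_noise P H G e (\<lambda>\<omega>. W (real (Suc m) * \<tau>) \<omega> - W (real m * \<tau>) \<omega>) (dc.chain x m) I \<and>
        (AE \<omega> in P. dc.chain x (Suc m) \<omega> \<in> H10 \<O> \<and> (\<forall>v\<in>H10 \<O>. inner (dc.chain x (Suc m) \<omega>) v =
     inner (dc.chain x m \<omega>) v + \<tau> * dirichlet_laplacian \<O> (dc.chain x (Suc m) \<omega>) v
     + \<tau> * nemytskii \<O> f (dc.chain x (Suc m) \<omega>) v + inner (I \<omega>) v))"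
    unfolding ws.dW_def[abs_def] by blast
qed simp

text \<open>Limits in mean square are unique: once Y is replaced by the chain, I and the constructed
  noise are limits of the same partial sums.\<close>

lemma applied_noise_AE_eq:
  assumes x: "x \<in> H" and Y: "Y \<in> P \<rightarrow>\<^sub>M ws.HB" and eq: "AE \<omega> in P. Y \<omega> = dc.chain x m \<omega>"
    and I: "applied_noise P H G e (ws.dW m) Y I"
  shows "AE \<omega> in P. I \<omega> = step_noise m (dc.chain x m) \<omega>"
proof -
  let ?c = "dc.chain x m" let ?J = "step_noise m ?c"
  have c: "?c \<in> P \<rightarrow>\<^sub>M ws.HB" by (rule dc.from_F[OF dc.chain_adapted[OF x]])
  have Im: "I \<in> P \<rightarrow>\<^sub>M ws.HB" using I by (simp add: applied_noise_def)
  let ?a = "\<lambda>n \<omega>. ni.part n (?c \<omega>) (ws.s m \<omega>) - I \<omega>" and ?b = "\<lambda>n \<omega>. ni.part n (?c \<omega>) (ws.s m \<omega>) - ?J \<omega>"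
  have ma: "(\<lambda>\<omega>. ennreal ((norm (?a n \<omega>))\<^sup>2)) \<in> borel_measurable P" and mb: "(\<lambda>\<omega>. ennreal ((norm (?b n \<omega>))\<^sup>2)) \<in> borel_measurable P" for n
    by (intro ws.sq_measurable ws.measurable_HB_diff part_measurable_comp c Im step_noise_measurable)+
  have 1: "(\<lambda>n. \<integral>\<^sup>+\<omega>. ennreal ((norm (?a n \<omega>))\<^sup>2) \<partial>P) \<longlonglongrightarrow> 0"
  proof -
    have "(\<integral>\<^sup>+\<omega>. ennreal ((norm (G (Y \<omega>) (\<Sum>k<n. inner (ws.dW m \<omega>) (e k) *\<^sub>R e k) - I \<omega>))\<^sup>2) \<partial>P) = (\<integral>\<^sup>+\<omega>. ennreal ((norm (?a n \<omega>))\<^sup>2) \<partial>P)" for n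
    proof (rule nn_integral_cong_AE)
      show "AE \<omega> in P. ennreal ((norm (G (Y \<omega>) (\<Sum>k<n. inner (ws.dW m \<omega>) (e k) *\<^sub>R e k) - I \<omega>))\<^sup>2) = ennreal ((norm (?a n \<omega>))\<^sup>2)"
        using eq AE_space[of P]
      proof eventually_elim
        case (elim \<omega>)
        show ?case unfolding elim(1) by (simp only: part_eq[OF ws.measurable_HB_in[OF c elim(2)]])
      qed
    qed
    then show ?thesis using I by (simp add: applied_noise_def)
  qed
  have 2: "(\<lambda>n. \<integral>\<^sup>+\<omega>. ennreal ((norm (?b n \<omega>))\<^sup>2) \<partial>P) \<longlonglongrightarrow> 0"
    by (rule part_step_noise[OF dc.chain_adapted[OF x] dc.chain_second_moment[OF x]])
  let ?K = "\<integral>\<^sup>+\<omega>. ennreal ((norm (I \<omega> - ?J \<omega>))\<^sup>2) \<partial>P"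
  have le: "?K \<le> 2 * (\<integral>\<^sup>+\<omega>. ennreal ((norm (?a n \<omega>))\<^sup>2) \<partial>P) + 2 * (\<integral>\<^sup>+\<omega>. ennreal ((norm (?b n \<omega>))\<^sup>2) \<partial>P)" for n
  proof -
    have "?K \<le> (\<integral>\<^sup>+\<omega>. 2 * ennreal ((norm (?a n \<omega>))\<^sup>2) + 2 * ennreal ((norm (?b n \<omega>))\<^sup>2) \<partial>P)"
    proof (rule nn_integral_mono)
      fix \<omega>
      have "norm (I \<omega> - ?J \<omega>) = norm (?b n \<omega> + - ?a n \<omega>)" by simp
      then have "(norm (I \<omega> - ?J \<omega>))\<^sup>2 \<le> 2 * (norm (?a n \<omega>))\<^sup>2 + 2 * (norm (?b n \<omega>))\<^sup>2"
        using norm_add_sq_le[OF zero_less_one, of "?b n \<omega>" "- ?a n \<omega>"] by (simp only: norm_minus_cancel) simp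
      then have "ennreal ((norm (I \<omega> - ?J \<omega>))\<^sup>2) \<le> ennreal (2 * (norm (?a n \<omega>))\<^sup>2 + 2 * (norm (?b n \<omega>))\<^sup>2)" by (rule ennreal_leI)
      then show "ennreal ((norm (I \<omega> - ?J \<omega>))\<^sup>2) \<le> 2 * ennreal ((norm (?a n \<omega>))\<^sup>2) + 2 * ennreal ((norm (?b n \<omega>))\<^sup>2)"
        by (simp add: ennreal_plus ennreal_mult)
    qed
    also have "\<dots> = (\<integral>\<^sup>+\<omega>. 2 * ennreal ((norm (?a n \<omega>))\<^sup>2) \<partial>P) + (\<integral>\<^sup>+\<omega>. 2 * ennreal ((norm (?b n \<omega>))\<^sup>2) \<partial>P)"
      by (intro nn_integral_add borel_measurable_times_ennreal ma mb borel_measurable_const)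
    finally show ?thesis by (simp only: nn_integral_cmult[OF ma] nn_integral_cmult[OF mb])
  qed
  have "(\<lambda>n. 2 * (\<integral>\<^sup>+\<omega>. ennreal ((norm (?a n \<omega>))\<^sup>2) \<partial>P) + 2 * (\<integral>\<^sup>+\<omega>. ennreal ((norm (?b n \<omega>))\<^sup>2) \<partial>P)) \<longlonglongrightarrow> 2 * 0 + 2 * 0"
    by (intro tendsto_add ennreal_tendsto_cmult 1 2) simp_all
  then have "?K \<le> 2 * 0 + 2 * 0" by (rule LIMSEQ_le_const) (use le in blast)
  then have "?K = 0" by simp
  then have "AE \<omega> in P. ennreal ((norm (I \<omega> - ?J \<omega>))\<^sup>2) = 0"
    by (subst (asm) nn_integral_0_iff_AE) (intro ws.sq_measurable ws.measurable_HB_diff Im step_noise_measurable c)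
  then show ?thesis by eventually_elim simp
qed

text \<open>Induction on m: equal values give equal noises almost surely, and the solution of the
  implicit step is unique. Any process picked by the choice operator is therefore almost surely the
  chain.\<close>

lemma solution_AE_eq_chain:
  assumes x: "x \<in> H" and X: "euler_solution \<O> f G e P \<F> W \<tau> x X"
  shows "AE \<omega> in P. X m \<omega> = dc.chain x m \<omega>"
proof (induction m)
  case 0
  show ?case using X by (intro AE_I2) (simp add: euler_solution_def)
next
  case (Suc m)
  have "X m \<in> ws.F m \<rightarrow>\<^sub>M ws.HB" using X by (simp only: euler_solution_def ws.F_def)
  then have Xm: "X m \<in> P \<rightarrow>\<^sub>M ws.HB" by (rule dc.from_F)
  obtain I where I: "applied_noise P H G e (ws.dW m) (X m) I" and
    ae: "AE \<omega> in P. X (Suc m) \<omega> \<in> H10 \<O> \<and> (\<forall>v\<in>H10 \<O>. inner (X (Suc m) \<omega>) v =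
              inner (X m \<omega>) v + \<tau> * dirichlet_laplacian \<O> (X (Suc m) \<omega>) v
              + \<tau> * nemytskii \<O> f (X (Suc m) \<omega>) v + inner (I \<omega>) v)"
    using X unfolding euler_solution_def ws.dW_def[abs_def] by blast
  from ae applied_noise_AE_eq[OF x Xm Suc.IH I] Suc.IH show ?case
  proof eventually_elim
    case (elim \<omega>)
    have "ds.solves (X m \<omega> + I \<omega>) (X (Suc m) \<omega>)" unfolding solves_iff by (rule elim(1))
    then have "X (Suc m) \<omega> = ds.resolvent (X m \<omega> + I \<omega>)" by (rule ds.resolvent_unique)
    also have "\<dots> = \<Phi> (dc.chain x m \<omega>) (ws.s m \<omega>)" unfolding elim(2,3) step_noise_def by (rule \<Phi>_def[symmetric])
    finally show ?case by (simp only: dc.chain.simps)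
  qed
qed

lemma semigroup_eq_iter:
  assumes x: "x \<in> H" and \<phi>: "\<phi> \<in> borel_measurable ws.HB" "\<And>x. x \<in> H \<Longrightarrow> \<bar>\<phi> x\<bar> \<le> B"
  shows "euler_semigroup \<O> f G e P \<F> W \<tau> m \<phi> x = dc.iter m \<phi> x"
proof -
  let ?X = "euler_process \<O> f G e P \<F> W \<tau> x"
  \<comment> \<open>\<open>chain_solution\<close> provides a witness, so the chosen process is a
    solution.\<close>
  have X: "euler_solution \<O> f G e P \<F> W \<tau> x ?X"
    unfolding euler_process_def by (rule someI[of _ "dc.chain x"]) (rule chain_solution[OF x])
  then have "?X m \<in> ws.F m \<rightarrow>\<^sub>M ws.HB" by (simp only: euler_solution_def ws.F_def)
  then have Xm: "?X m \<in> P \<rightarrow>\<^sub>M ws.HB" by (rule dc.from_F)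
  have c: "dc.chain x m \<in> P \<rightarrow>\<^sub>M ws.HB" by (rule dc.from_F[OF dc.chain_adapted[OF x]])
  have "(\<integral>\<omega>. \<phi> (?X m \<omega>) \<partial>P) = (\<integral>\<omega>. \<phi> (dc.chain x m \<omega>) \<partial>P)"
  proof (rule integral_cong_AE)
    show "AE \<omega> in P. \<phi> (?X m \<omega>) = \<phi> (dc.chain x m \<omega>)"
      using solution_AE_eq_chain[OF x X, of m] by eventually_elim simp
  qed (use measurable_compose[OF Xm \<phi>(1)] measurable_compose[OF c \<phi>(1)] in auto)
  also have "\<dots> = dc.iter m \<phi> x" by (rule dc.integral_chain[OF x \<phi>])
  finally show ?thesis by (simp add: euler_semigroup_def)
qed

section \<open>The decay rate and the mixing estimate\<close>

abbreviation \<gamma> :: real where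
  "\<gamma> \<equiv> (2 * (ds.lam - L\<^sub>1) - L\<^sub>6) / (2 * (ds.lam - L\<^sub>1) + 1)"

text \<open>With a = 2 (lam - L1), 1 - \<rho> = \<tau> (a - L6) / (1 + \<tau> a). As \<tau> < 1, the
  denominator is at most a + 1, so 1 - \<rho> is at least \<gamma> \<tau>, and 1 - \<gamma> \<tau>
  is at most exp(- \<gamma> \<tau>).\<close>

lemma sqrt_\<rho>_power: "sqrt \<rho> ^ m \<le> exp (- \<gamma> * (real m * \<tau>) / 2)"
proof -
  let ?a = "2 * (ds.lam - L\<^sub>1)"
  have half: "c = 2 * (c / 2)" for c :: real by simp
  have a: "0 < ?a" "0 < ?a - L\<^sub>6" using ds.L_less dissipative by auto
  have "\<tau> * (?a - L\<^sub>6) / (?a + 1) \<le> \<tau> * (?a - L\<^sub>6) / (1 + \<tau> * ?a)"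
    using a step by (intro divide_left_mono mult_pos_pos add_pos_pos) (auto simp: mult_left_le_one_le)
  moreover have "1 - \<rho> = \<tau> * (?a - L\<^sub>6) / (1 + \<tau> * ?a)"
    using denominator_pos unfolding \<rho>_def by (simp add: field_simps)
  ultimately have "\<rho> \<le> 1 + - \<gamma> * \<tau>" by (simp add: mult.commute)
  also have "\<dots> \<le> exp (- \<gamma> * \<tau>)" by (rule exp_ge_add_one_self)
  also have "\<dots> = exp (2 * (- \<gamma> * \<tau> / 2))" by (rule arg_cong[where f = exp]) (rule half)
  also have "\<dots> = (exp (- \<gamma> * \<tau> / 2))\<^sup>2" by (rule exp_double)
  finally have "sqrt \<rho> \<le> exp (- \<gamma> * \<tau> / 2)" by (intro real_le_lsqrt) auto
  then have "sqrt \<rho> ^ m \<le> exp (- \<gamma> * \<tau> / 2) ^ m" using \<rho>_bounds by (intro power_mono) auto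
  also have "\<dots> = exp (real m * (- \<gamma> * \<tau> / 2))" by (rule exp_of_nat_mult[symmetric])
  finally show ?thesis by (simp add: ac_simps)
qed

lemma Lip_seminorm_bound:
  assumes \<phi>: "\<phi> \<in> Lipb H" and xy: "x \<in> H" "y \<in> H"
  shows "\<bar>\<phi> x - \<phi> y\<bar> \<le> Lip_seminorm H \<phi> * norm (x - y)" "0 \<le> Lip_seminorm H \<phi>"
proof -
  let ?A = "{(x, y). x \<in> H \<and> y \<in> H \<and> x \<noteq> y}" and ?h = "\<lambda>(x, y). \<bar>\<phi> x - \<phi> y\<bar> / norm (x - y)"
  obtain C where C: "C-lipschitz_on H \<phi>" using \<phi> by (auto simp: Lipb_def)
  \<comment> \<open>A real supremum is meaningful only for sets bounded above; any Lipschitz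
    constant is a bound.\<close>
  have bdd: "bdd_above (?h ` ?A)"
  proof (rule bdd_aboveI2[where M = C])
    fix p assume "p \<in> ?A"
    then obtain x y where p: "p = (x, y)" "x \<in> H" "y \<in> H" "x \<noteq> y" by auto
    then have "\<bar>\<phi> x - \<phi> y\<bar> \<le> C * norm (x - y)" using lipschitz_onD[OF C, of x y] by (simp add: dist_norm)
    then show "?h p \<le> C" using p by (simp add: divide_le_eq)
  qed
  have le: "\<bar>\<phi> x - \<phi> y\<bar> / norm (x - y) \<le> Lip_seminorm H \<phi>" if "x \<in> H" "y \<in> H" "x \<noteq> y" for x y
    unfolding Lip_seminorm_def using cSUP_upper[OF _ bdd, of "(x, y)"] that by simp
  show "\<bar>\<phi> x - \<phi> y\<bar> \<le> Lip_seminorm H \<phi> * norm (x - y)"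
  proof (cases "x = y")
    case False
    then show ?thesis using le[OF xy] by (simp add: divide_le_eq)
  qed simp
  \<comment> \<open>The distinct points e 0 and 0 of H show that the supremum dominates some
    nonnegative quotient.\<close>
  have "e 0 \<noteq> 0" using ws.norm_e[of 0] by auto
  then have "\<bar>\<phi> (e 0) - \<phi> 0\<bar> / norm (e 0 - 0) \<le> Lip_seminorm H \<phi>" by (intro le ws.e_in ws.H_zero)
  moreover have "0 \<le> \<bar>\<phi> (e 0) - \<phi> 0\<bar> / norm (e 0 - 0)" by simp
  ultimately show "0 \<le> Lip_seminorm H \<phi>" by linarith
qed

lemma Cb_measurable: "\<phi> \<in> Cb H \<Longrightarrow> \<phi> \<in> borel_measurable ws.HB"
  by (auto simp: Cb_def intro: borel_measurable_continuous_on_restrict)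

lemma Cb_bound:
  assumes "\<phi> \<in> Cb H"
  obtains B where "\<And>x. x \<in> H \<Longrightarrow> \<bar>\<phi> x\<bar> \<le> B"
  using assms by (auto simp: Cb_def bounded_iff)

lemma Lipb_Cb: "\<phi> \<in> Lipb H \<Longrightarrow> \<phi> \<in> Cb H"
  by (auto simp: Cb_def Lipb_def intro: lipschitz_on_continuous_on)

theorem exponentially_mixing:
  fixes Pm defines "Pm \<equiv> euler_semigroup \<O> f G e P \<F> W \<tau>"
  shows "\<exists>\<pi>. invariant_measure H Pm \<pi> \<and> (\<forall>\<mu>. invariant_measure H Pm \<mu> \<longrightarrow> \<mu> = \<pi>) \<and>
    (\<forall>m. \<forall>x\<in>H. \<forall>\<phi>\<in>Lipb H. \<bar>Pm m \<phi> x - (\<integral>y. \<phi> y \<partial>\<pi>)\<bar>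
      \<le> exp (- \<gamma> * (real m * \<tau>) / 2) * Lip_seminorm H \<phi> * (\<integral>y. norm (x - y) \<partial>\<pi>))"
proof -
  obtain \<pi> K2 where \<pi>: "prob_space \<pi>" "sets \<pi> = sets ws.HB" "(\<integral>\<^sup>+y. ennreal ((norm y)\<^sup>2) \<partial>\<pi>) \<le> ennreal K2"
    "\<And>\<phi> B. \<phi> \<in> borel_measurable ws.HB \<Longrightarrow> (\<And>x. x \<in> H \<Longrightarrow> \<bar>\<phi> x\<bar> \<le> B) \<Longrightarrow> (\<integral>y. dc.transition \<phi> y \<partial>\<pi>) = (\<integral>y. \<phi> y \<partial>\<pi>)"
    by (rule dc.invariant_law) blast
  interpret \<pi>: prob_space \<pi> by (rule \<pi>(1))
  interpret il: invariant_law H e ws.S \<Phi> \<rho> C0 \<pi> K2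
    by unfold_locales (rule \<pi>; assumption)+
  \<comment> \<open>Only starting points in H matter, since the laws are carried by H; there the
    chosen solution can be replaced by the chain.\<close>
  have semi: "Pm m \<phi> x = dc.iter m \<phi> x" if \<phi>: "\<phi> \<in> Cb H" and x: "x \<in> H" for \<phi> x m
  proof -
    obtain B where "\<And>x. x \<in> H \<Longrightarrow> \<bar>\<phi> x\<bar> \<le> B" by (rule Cb_bound[OF \<phi>]) blast
    then show ?thesis unfolding Pm_def by (rule semigroup_eq_iter[OF x Cb_measurable[OF \<phi>]])
  qed
  have int: "(\<integral>x. Pm m \<phi> x \<partial>\<mu>) = (\<integral>x. dc.iter m \<phi> x \<partial>\<mu>)" if "\<phi> \<in> Cb H" "sets \<mu> = sets ws.HB" for \<phi> m \<mu>
  proof (rule Bochner_Integration.integral_cong[OF refl])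
    fix x assume "x \<in> space \<mu>"
    then have "x \<in> H" using sets_eq_imp_space_eq[OF that(2)] by simp
    then show "Pm m \<phi> x = dc.iter m \<phi> x" by (rule semi[OF that(1)])
  qed
  have inv: "invariant_measure H Pm \<pi>"
    unfolding invariant_measure_def
  proof (intro conjI ballI allI \<pi>(1,2))
    fix \<phi> m assume \<phi>: "\<phi> \<in> Cb H"
    obtain B where B: "\<And>x. x \<in> H \<Longrightarrow> \<bar>\<phi> x\<bar> \<le> B" by (rule Cb_bound[OF \<phi>]) blast
    show "(\<integral>x. Pm m \<phi> x \<partial>\<pi>) = (\<integral>x. \<phi> x \<partial>\<pi>)"
      unfolding int[OF \<phi> \<pi>(2)] by (rule il.law_iter[OF Cb_measurable[OF \<phi>] B])
  qed
  have unique: "\<mu> = \<pi>" if \<mu>: "invariant_measure H Pm \<mu>" for \<mu>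
  proof (rule il.law_unique)
    show "prob_space \<mu>" and sets: "sets \<mu> = sets ws.HB" using \<mu> by (auto simp: invariant_measure_def)
    fix \<phi> :: "'a l2 \<Rightarrow> real" and C m
    assume "C-lipschitz_on H \<phi>" and b: "\<And>x. x \<in> H \<Longrightarrow> \<phi> x \<in> {0..1}"
    moreover have "bounded (\<phi> ` H)" unfolding bounded_iff by (rule exI[of _ 1]) (use b in auto)
    ultimately have "\<phi> \<in> Lipb H" by (auto simp: Lipb_def)
    then have \<phi>: "\<phi> \<in> Cb H" by (rule Lipb_Cb)
    show "(\<integral>y. dc.iter m \<phi> y \<partial>\<mu>) = (\<integral>y. \<phi> y \<partial>\<mu>)"
      using \<mu> \<phi> int[OF \<phi> sets, of m] by (simp add: invariant_measure_def)
  qed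
  have mix: "\<bar>Pm m \<phi> x - (\<integral>y. \<phi> y \<partial>\<pi>)\<bar> \<le> exp (- \<gamma> * (real m * \<tau>) / 2) * Lip_seminorm H \<phi> * (\<integral>y. norm (x - y) \<partial>\<pi>)"
    if x: "x \<in> H" and \<phi>: "\<phi> \<in> Lipb H" for m x \<phi>
  proof -
    obtain B where B: "\<And>x. x \<in> H \<Longrightarrow> \<bar>\<phi> x\<bar> \<le> B" by (rule Cb_bound[OF Lipb_Cb[OF \<phi>]]) blast
    have "\<bar>Pm m \<phi> x - (\<integral>y. \<phi> y \<partial>\<pi>)\<bar> \<le> Lip_seminorm H \<phi> * sqrt \<rho> ^ m * (\<integral>y. norm (x - y) \<partial>\<pi>)"
      unfolding semi[OF Lipb_Cb[OF \<phi>] x]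
      by (rule il.mixing[OF Cb_measurable[OF Lipb_Cb[OF \<phi>]] B Lip_seminorm_bound(2)[OF \<phi> x x] Lip_seminorm_bound(1)[OF \<phi>] x])
    also have "\<dots> \<le> Lip_seminorm H \<phi> * exp (- \<gamma> * (real m * \<tau>) / 2) * (\<integral>y. norm (x - y) \<partial>\<pi>)"
      by (intro mult_right_mono mult_left_mono sqrt_\<rho>_power Lip_seminorm_bound(2)[OF \<phi> x x] integral_nonneg_AE) simp
    finally show ?thesis by (simp only: ac_simps)
  qed
  show ?thesis using inv unique mix by blast
qed

end

theorem theorem3p1:
  fixes \<O> :: "(real ^ 'n) set"
    and Q :: "(real ^ 'n) l2 \<Rightarrow> (real ^ 'n) l2"
    and e :: "nat \<Rightarrow> (real ^ 'n) l2"
    and \<kappa> :: "nat \<Rightarrow> real"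
    and P :: "'w measure"
    and \<F> :: "real \<Rightarrow> 'w measure"
    and W :: "real \<Rightarrow> 'w \<Rightarrow> (real ^ 'n) l2"
    and f g :: "real \<Rightarrow> real"
    and G :: "(real ^ 'n) l2 \<Rightarrow> (real ^ 'n) l2 \<Rightarrow> (real ^ 'n) l2"
    and q L\<^sub>1 L\<^sub>2 L\<^sub>3 L\<^sub>4 L\<^sub>5 L\<^sub>6 L\<^sub>7 L\<^sub>8 \<tau> :: real
  defines "H \<equiv> L2 \<O>"
    and "lam\<^sub>1 \<equiv> first_eigenvalue \<O>"
    and "Pm \<equiv> euler_semigroup \<O> f G e P \<F> W \<tau>"
    and "\<gamma>\<^sub>6 \<equiv> (2 * (first_eigenvalue \<O> - L\<^sub>1) - L\<^sub>6) / (2 * (first_eigenvalue \<O> - L\<^sub>1) + 1)"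
  assumes dim: "CARD('n) \<in> {1, 2, 3}"
    and domain: "open \<O>" "bounded \<O>" "\<O> \<noteq> {}" "smooth_boundary \<O>"
    and noise: "covariance_operator H Q e \<kappa>" "filtered_prob_space P \<F>"
      "Q_wiener_process P \<F> H e \<kappa> W"
    and drift: "q \<ge> 1" "CARD('n) = 3 \<Longrightarrow> q \<le> 3" "drift_condition f q L\<^sub>1 L\<^sub>2 L\<^sub>3 L\<^sub>4 L\<^sub>5"
    and diffusion: "diffusion_condition \<O> e \<kappa> g G L\<^sub>6 L\<^sub>7 L\<^sub>8"
    and dissipative: "max (L\<^sub>1 + L\<^sub>6 / 2) (L\<^sub>2 + L\<^sub>7 / 2) < lam\<^sub>1"
    and step: "0 < \<tau>" "\<tau> < 1" "(L\<^sub>1 - lam\<^sub>1 / (lam\<^sub>1 + 1)) * \<tau> < 1"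
  shows "\<gamma>\<^sub>6 > 0 \<and>
    (\<exists>\<pi>. invariant_measure H Pm \<pi> \<and> (\<forall>\<mu>. invariant_measure H Pm \<mu> \<longrightarrow> \<mu> = \<pi>) \<and>
      (\<forall>m. \<forall>x\<in>H. \<forall>\<phi>\<in>Lipb H.
         \<bar>Pm m \<phi> x - (\<integral>y. \<phi> y \<partial>\<pi>)\<bar>
           \<le> exp (- \<gamma>\<^sub>6 * (real m * \<tau>) / 2) * Lip_seminorm H \<phi> * (\<integral>y. norm (x - y) \<partial>\<pi>)))"
proof
  note defs = H_def lam\<^sub>1_def Pm_def \<gamma>\<^sub>6_def
  have L6: "0 \<le> L\<^sub>6" using diffusion by (simp add: diffusion_condition_def)
  have d: "L\<^sub>1 + L\<^sub>6 / 2 < first_eigenvalue \<O>" using dissipative by (simp add: defs)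
  \<comment> \<open>Since L6 is nonnegative, the hypothesis also puts L1 below the eigenvalue, so
    the denominator exceeds 1.\<close>
  show "\<gamma>\<^sub>6 > 0" unfolding defs using d L6 by (intro divide_pos_pos) auto
  have f: "f field_differentiable at \<xi>" "(f \<xi> - f \<eta>) * (\<xi> - \<eta>) \<le> L\<^sub>1 * (\<xi> - \<eta>)\<^sup>2" for \<xi> \<eta>
    using drift(3) by (simp_all add: drift_condition_def)
  have cont: "continuous_on UNIV f"
    by (intro continuous_at_imp_continuous_on ballI field_differentiable_imp_continuous_at f(1))
  interpret euler_scheme \<O> Q e \<kappa> P \<F> W f g G L\<^sub>1 L\<^sub>6 L\<^sub>7 L\<^sub>8 \<tau>
    by unfold_locales (rule domain noise[unfolded H_def] cont f(2) diffusion d step)+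
  show "\<exists>\<pi>. invariant_measure H Pm \<pi> \<and> (\<forall>\<mu>. invariant_measure H Pm \<mu> \<longrightarrow> \<mu> = \<pi>) \<and>
      (\<forall>m. \<forall>x\<in>H. \<forall>\<phi>\<in>Lipb H. \<bar>Pm m \<phi> x - (\<integral>y. \<phi> y \<partial>\<pi>)\<bar>
        \<le> exp (- \<gamma>\<^sub>6 * (real m * \<tau>) / 2) * Lip_seminorm H \<phi> * (\<integral>y. norm (x - y) \<partial>\<pi>))"
    unfolding defs by (rule exponentially_mixing)
qed

end
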